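(* Let $\rho\in L^2(\mathbb{T})$ be real-valued with weak derivative $\nabla\rho\in L^2(\mathbb{T})$, $\int_{\mathbb{T}}\rho=N$, and $\rho(x)>0$ for all $x\in\mathbb{T}$ (for the continuous representative of $\rho$). Then there exists an equivalence class $[v]\in\mathscr{X}^*$, with corresponding external potential $V=\sum_{j=1}^N v(x_j)$ acting on wave functions (as a quadratic form), such that $\rho$ is the density of an (ensemble) ground state of the self-adjoint Hamiltonian $H=H_0+V=-\frac12\Delta+W+V$.
   Context: $\mathbb{T}$ is the one-dimensional torus $[0,1]$ with $0$ and $1$ identified; $N\ge1$ is a fixed integer. The $N$-particle Hilbert space is $\mathcal{H}=(L^2(\mathbb{T})\otimes\mathbb{C}^2)^{\wedge N}$ (antisymmetric spin-$\tfrac12$ wave functions), and $\mathscr{W}=\{\Psi\in(H^1(\mathbb{T})\otimes\mathbb{C}^2)^{\wedge N}:\|\Psi\|_{\mathcal H}=1\}$. For $\Psi\in\mathscr W$ the kinetic energy is $T(\Psi)=\frac12\sum_{j=1}^N\|\nabla_j\Psi\|_{\mathcal H}^2$ and the density is $\rho_\Psi(x)=N\sum_{\sigma_1,\dots,\sigma_N}\int|\Psi(x\sigma_1,x_2\sigma_2,\dots,x_N\sigma_N)|^2\,dx_2\cdots dx_N$. A symmetric quadratic form $B$ on $(H^1(\mathbb{T})\otimes\mathbb{C}^2)^{\wedge N}$ is called kinetically bounded if there are $a,b\ge0$ with $|B(\Psi,\Psi)|\le aT(\Psi)+b$ for all $\Psi\in\mathscr W$; the infimum of such $a$ is its relative kinetic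 bound. The interaction $W$ is a positive symmetric quadratic form on $(H^1(\mathbb{T})\otimes\mathbb{C}^2)^{\wedge N}$ that is kinetically bounded with relative kinetic bound $<1$; $H_0=-\frac12\Delta+W$ denotes the self-adjoint operator associated with the form $\frac12\sum_j\langle\nabla_j\Phi,\nabla_j\Psi\rangle+W(\Phi,\Psi)$. $\mathscr{X}^*=\{[v]=\{v+c\mid c\in\mathbb{R}\}\mid v=f+\nabla g,\ f,g\in L^2(\mathbb{T})\}$, i.e. $H^{-1}(\mathbb{T})$ modulo constants, where $v=f+\nabla g$ acts on $\varphi\in H^1(\mathbb{T})$ by $\langle v,\varphi\rangle=\int f\varphi-\int g\nabla\varphi$. The potential form is $V(\Psi,\Psi)=\langle v,\rho_\Psi\rangle$ (extended by polarization), and $H=H_0+V$ is the associated self-adjoint operator with form domain $(H^1(\mathbb{T})\otimes\mathbb{C}^2)^{\wedge N}$. "$\rho$ is the density of an (ensemble) ground state" means: with $E_0=\inf\sigma(H)$, there are orthonormal $\Psi_k\in\mathscr W$ and weights $\lambda_k\ge0$, $\sum_k\lambda_k=1$, such that each $\Psi_k$ with $\lambda_k>0$ satisfies $\langle\Psi_k,H\Psi_k\rangle=E_0$ and $H\Psi_k=E_0\Psi_k$ (in the distributional sense), and $\rho=\sum_k\lambda_k\rho_{\Psi_k}$. *)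

theory Defs
  imports "HOL-Analysis.Analysis"
begin

text \<open>N-particle wave functions: a configuration is given by positions x :: nat => real
  (coordinates 0..N-1 in [0,1], the torus) and spins sigma :: nat => bool.
  Wave functions are represented by (a.e.-determined) representatives.\<close>

type_synonym wf = "(nat \<Rightarrow> real) \<Rightarrow> (nat \<Rightarrow> bool) \<Rightarrow> complex"

definition spins :: "nat \<Rightarrow> (nat \<Rightarrow> bool) set" where
  "spins N = PiE {..<N} (\<lambda>_. UNIV)"

definition cubeM :: "nat \<Rightarrow> (nat \<Rightarrow> real) measure" where
  "cubeM N = PiM {..<N} (\<lambda>_. lebesgue_on {0..1})"

definition L2wf :: "nat \<Rightarrow> wf \<Rightarrow> bool" where
  "L2wf N \<Psi> \<longleftrightarrow> (\<forall>\<sigma>\<in>spins N. (\<lambda>x. \<Psi> x \<sigma>) \<in> borel_measurable (cubeM N) \<and>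
      integrable (cubeM N) (\<lambda>x. (cmod (\<Psi> x \<sigma>))\<^sup>2))"

definition inner_wf :: "nat \<Rightarrow> wf \<Rightarrow> wf \<Rightarrow> complex" where
  "inner_wf N \<Phi> \<Psi> = (\<Sum>\<sigma>\<in>spins N. \<integral>x. cnj (\<Phi> x \<sigma>) * \<Psi> x \<sigma> \<partial>cubeM N)"

definition nrm2 :: "nat \<Rightarrow> wf \<Rightarrow> real" where
  "nrm2 N \<Psi> = (\<Sum>\<sigma>\<in>spins N. \<integral>x. (cmod (\<Psi> x \<sigma>))\<^sup>2 \<partial>cubeM N)"

definition ptest :: "(real \<Rightarrow> real) \<Rightarrow> bool" where
  "ptest f \<longleftrightarrow> (\<forall>t. f (t + 1) = f t) \<and>
     (\<exists>f'. continuous_on UNIV f' \<and> (\<forall>t. (f has_real_derivative f' t) (at t)))"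

definition wderiv_wf :: "nat \<Rightarrow> nat \<Rightarrow> wf \<Rightarrow> wf \<Rightarrow> bool" where
  "wderiv_wf N j \<Psi> D \<longleftrightarrow> (\<forall>\<sigma>\<in>spins N. \<forall>fs. (\<forall>i<N. ptest (fs i)) \<longrightarrow>
     (\<integral>x. \<Psi> x \<sigma> * complex_of_real (deriv (fs j) (x j) * (\<Prod>i\<in>{..<N}-{j}. fs i (x i))) \<partial>cubeM N)
     = - (\<integral>x. D x \<sigma> * complex_of_real (\<Prod>i<N. fs i (x i)) \<partial>cubeM N))"

definition tsw :: "nat \<Rightarrow> nat \<Rightarrow> nat \<Rightarrow> nat" where
  "tsw j k i = (if i = j then k else if i = k then j else i)"

definition antisym_wf :: "nat \<Rightarrow> wf \<Rightarrow> bool" where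
  "antisym_wf N \<Psi> \<longleftrightarrow> (\<forall>j<N. \<forall>k<N. j \<noteq> k \<longrightarrow> (\<forall>\<sigma>\<in>spins N.
     AE x in cubeM N. \<Psi> (x \<circ> tsw j k) (\<sigma> \<circ> tsw j k) = - \<Psi> x \<sigma>))"

text \<open>Form domain (H^1(T) \<otimes> C^2)^{\<wedge>N}.\<close>
definition fdom :: "nat \<Rightarrow> wf \<Rightarrow> bool" where
  "fdom N \<Psi> \<longleftrightarrow> L2wf N \<Psi> \<and> antisym_wf N \<Psi> \<and> (\<forall>j<N. \<exists>D. L2wf N D \<and> wderiv_wf N j \<Psi> D)"

definition Wset :: "nat \<Rightarrow> wf set" where
  "Wset N = {\<Psi>. fdom N \<Psi> \<and> nrm2 N \<Psi> = 1}"

definition grad :: "nat \<Rightarrow> nat \<Rightarrow> wf \<Rightarrow> wf" where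
  "grad N j \<Psi> = (SOME D. L2wf N D \<and> wderiv_wf N j \<Psi> D)"

definition Tkin :: "nat \<Rightarrow> wf \<Rightarrow> real" where
  "Tkin N \<Psi> = (1/2) * (\<Sum>j<N. nrm2 N (grad N j \<Psi>))"

definition L2T :: "(real \<Rightarrow> real) \<Rightarrow> bool" where
  "L2T f \<longleftrightarrow> f \<in> borel_measurable (lebesgue_on {0..1}) \<and>
     integrable (lebesgue_on {0..1}) (\<lambda>t. (f t)\<^sup>2)"

definition wderivT :: "(real \<Rightarrow> real) \<Rightarrow> (real \<Rightarrow> real) \<Rightarrow> bool" where
  "wderivT f r \<longleftrightarrow> (\<forall>\<phi>. ptest \<phi> \<longrightarrow>
     (\<integral>t. f t * deriv \<phi> t \<partial>lebesgue_on {0..1}) = - (\<integral>t. r t * \<phi> t \<partial>lebesgue_on {0..1}))"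

definition H1T :: "(real \<Rightarrow> real) \<Rightarrow> bool" where
  "H1T f \<longleftrightarrow> L2T f \<and> (\<exists>r. L2T r \<and> wderivT f r)"

definition gradT :: "(real \<Rightarrow> real) \<Rightarrow> real \<Rightarrow> real" where
  "gradT f = (SOME r. L2T r \<and> wderivT f r)"

text \<open>Density rho_Psi(t) = N sum_sigma int |Psi(t sigma_1, x_2 sigma_2, ...)|^2 dx_2...dx_N
  (particle 1 is index 0).\<close>
definition dens :: "nat \<Rightarrow> wf \<Rightarrow> real \<Rightarrow> real" where
  "dens N \<Psi> t = real N * (\<Sum>\<sigma>\<in>spins N.
     \<integral>y. (cmod (\<Psi> (y(0 := t)) \<sigma>))\<^sup>2 \<partial>PiM {1..<N} (\<lambda>_. lebesgue_on {0..1}))"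

text \<open>Pairing of v = f + nabla g (f, g in L^2(T)) with phi in H^1(T).\<close>
definition pot :: "(real \<Rightarrow> real) \<Rightarrow> (real \<Rightarrow> real) \<Rightarrow> (real \<Rightarrow> real) \<Rightarrow> real" where
  "pot f g \<phi> = (\<integral>t. f t * \<phi> t \<partial>lebesgue_on {0..1}) - (\<integral>t. g t * gradT \<phi> t \<partial>lebesgue_on {0..1})"

definition hq :: "nat \<Rightarrow> (wf \<Rightarrow> wf \<Rightarrow> complex) \<Rightarrow> (real \<Rightarrow> real) \<Rightarrow> (real \<Rightarrow> real) \<Rightarrow> wf \<Rightarrow> real" where
  "hq N W f g \<Psi> = Tkin N \<Psi> + Re (W \<Psi> \<Psi>) + pot f g (dens N \<Psi>)"

text \<open>Sesquilinear form (antilinear in the first argument) obtained by polarization.\<close>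
definition hform :: "nat \<Rightarrow> (wf \<Rightarrow> wf \<Rightarrow> complex) \<Rightarrow> (real \<Rightarrow> real) \<Rightarrow> (real \<Rightarrow> real) \<Rightarrow> wf \<Rightarrow> wf \<Rightarrow> complex" where
  "hform N W f g \<Phi> \<Psi> = (1/4) * (\<Sum>k<4::nat. \<i> ^ k *
      complex_of_real (hq N W f g (\<lambda>x \<sigma>. \<Psi> x \<sigma> + \<i> ^ k * \<Phi> x \<sigma>)))"

text \<open>Ground state energy E_0 = inf sigma(H), via the variational characterization.\<close>
definition E0 :: "nat \<Rightarrow> (wf \<Rightarrow> wf \<Rightarrow> complex) \<Rightarrow> (real \<Rightarrow> real) \<Rightarrow> (real \<Rightarrow> real) \<Rightarrow> real" where
  "E0 N W f g = Inf (hq N W f g ` Wset N)"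

definition interaction :: "nat \<Rightarrow> (wf \<Rightarrow> wf \<Rightarrow> complex) \<Rightarrow> bool" where
  "interaction N W \<longleftrightarrow>
     (\<forall>\<Phi> \<Psi>. fdom N \<Phi> \<longrightarrow> fdom N \<Psi> \<longrightarrow> W \<Phi> \<Psi> = cnj (W \<Psi> \<Phi>)) \<and>
     (\<forall>\<Phi> \<Psi>1 \<Psi>2 a. fdom N \<Phi> \<longrightarrow> fdom N \<Psi>1 \<longrightarrow> fdom N \<Psi>2 \<longrightarrow>
        W \<Phi> (\<lambda>x \<sigma>. a * \<Psi>1 x \<sigma> + \<Psi>2 x \<sigma>) = a * W \<Phi> \<Psi>1 + W \<Phi> \<Psi>2) \<and>
     (\<forall>\<Phi> \<Psi>1 \<Psi>2. fdom N \<Phi> \<longrightarrow> fdom N \<Psi>1 \<longrightarrow> fdom N \<Psi>2 \<longrightarrow>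
        (\<forall>\<sigma>\<in>spins N. AE x in cubeM N. \<Psi>1 x \<sigma> = \<Psi>2 x \<sigma>) \<longrightarrow> W \<Phi> \<Psi>1 = W \<Phi> \<Psi>2) \<and>
     (\<forall>\<Psi>. fdom N \<Psi> \<longrightarrow> Re (W \<Psi> \<Psi>) \<ge> 0) \<and>
     (\<exists>a b. 0 \<le> a \<and> a < 1 \<and> 0 \<le> b \<and> (\<forall>\<Psi>\<in>Wset N. cmod (W \<Psi> \<Psi>) \<le> a * Tkin N \<Psi> + b))"

definition gs_density :: "nat \<Rightarrow> (wf \<Rightarrow> wf \<Rightarrow> complex) \<Rightarrow> (real \<Rightarrow> real) \<Rightarrow> (real \<Rightarrow> real) \<Rightarrow> (real \<Rightarrow> real) \<Rightarrow> bool" where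
  "gs_density N W f g \<rho> \<longleftrightarrow> (\<exists>\<Psi>s :: nat \<Rightarrow> wf. \<exists>wts :: nat \<Rightarrow> real.
     (\<forall>k. \<Psi>s k \<in> Wset N) \<and>
     (\<forall>k l. k \<noteq> l \<longrightarrow> inner_wf N (\<Psi>s k) (\<Psi>s l) = 0) \<and>
     (\<forall>k. 0 \<le> wts k) \<and> wts sums 1 \<and>
     (\<forall>k. 0 < wts k \<longrightarrow>
        hq N W f g (\<Psi>s k) = E0 N W f g \<and>
        (\<forall>\<Phi>. fdom N \<Phi> \<longrightarrow>
           hform N W f g \<Phi> (\<Psi>s k) = complex_of_real (E0 N W f g) * inner_wf N \<Phi> (\<Psi>s k))) \<and>
     (AE t in lebesgue_on {0..1}. (\<lambda>k. wts k * dens N (\<Psi>s k) t) sums \<rho> t))"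

end

theory Submission
  imports Defs "HOL-Complex_Analysis.Great_Picard"
begin

text \<open>
  One may take f = 0, and by adding a constant g has mean zero. Writing r for the derivative of \<rho>
  and E(g) for the ground state energy with potential nabla g, the potential is sought as a maximiser of the
  concave dual function D(g) = E(g) + \<integral>g r over square integrable g of mean zero. Since \<rho> is bounded below by a positive
  constant, \<rho> can be perturbed by a small multiple of the primitive of g and remains the density
  of a Slater determinant of Harriman orbitals with controlled kinetic energy; testing with it gives
  D(g) \<le> C - \<epsilon>\<parallel>g\<parallel>, so a maximiser exists.

  By the Rellich theorem the ground states of the maximising g form a finite-dimensional space, and perturbing g shows that for every
  direction w some ground state \<Psi>, with density derivative J(\<Psi>), has \<integral>w (J(\<Psi>) - r) \<ge> 0. Take the ensemble of
  ground states whose density derivative is closest to r. If it were not equal to r, the difference would be such a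
  direction w in which the ensemble can be improved by mixing in a ground state. Hence the ensemble has density \<rho>. Potentials enter only
  through \<integral>g J(\<Psi>), so everything is phrased in terms of density derivatives.
\<close>

section \<open>Square integrable functions\<close>

text \<open>The obstacle is that v is a distribution: it pairs with a density only because densities
  of form-domain functions have square integrable derivatives, which rests on a one-dimensional
  Sobolev bound for marginals. The same bound makes the potential form-bounded with relative bound
  1/2, uniformly on L2 balls, so energies stay bounded below while g varies. Slater trial states
  need differentiable orbitals whereas the prescribed density is only H1; its perturbed derivative
  is therefore smoothed to a trigonometric polynomial. This fixes the constants: with minimum 3e, a
  shift of the derivative by e and a smoothing error e/2 leave a density of at least 3e/2 and a gain
  of e/2 per unit norm of g. Mixing in a ground state could lengthen the ensemble; ensembles are
  therefore tuples longer than any orthonormal family of ground states, so that an orthogonal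
  minimiser has an empty slot. Weak derivatives on the cube, their product rule and Rellich's
  theorem are handled by Fourier coefficients in a real basis.\<close>

definition sqint :: "'a measure \<Rightarrow> ('a \<Rightarrow> 'b::euclidean_space) \<Rightarrow> bool" where
  "sqint M f \<longleftrightarrow> f \<in> borel_measurable M \<and> integrable M (\<lambda>x. (norm (f x))\<^sup>2)"

definition l2 :: "'a measure \<Rightarrow> ('a \<Rightarrow> 'b::euclidean_space) \<Rightarrow> real" where
  "l2 M f = (\<integral>x. (norm (f x))\<^sup>2 \<partial>M)"

lemma sqint_measurable [measurable_dest]: "sqint M f \<Longrightarrow> f \<in> borel_measurable M"
  by (simp add: sqint_def)

lemma sqint_integrable: "sqint M f \<Longrightarrow> integrable M (\<lambda>x. (norm (f x))\<^sup>2)"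
  by (simp add: sqint_def)

lemma l2_nonneg [simp]: "0 \<le> l2 M f"
  by (simp add: l2_def)

lemma sqint_0 [simp]: "sqint M (\<lambda>_. 0)"
  by (simp add: sqint_def)

lemma sqint_le:
  assumes "f \<in> borel_measurable M" "sqint M g" "\<And>x. x \<in> space M \<Longrightarrow> norm (f x) \<le> C * norm (g x)"
  shows "sqint M f" "l2 M f \<le> C\<^sup>2 * l2 M g"
proof -
  have le: "(norm (f x))\<^sup>2 \<le> C\<^sup>2 * (norm (g x))\<^sup>2" if "x \<in> space M" for x
    using assms(3)[OF that] by (metis norm_ge_zero power_mono power_mult_distrib)
  have ig: "integrable M (\<lambda>x. C\<^sup>2 * (norm (g x))\<^sup>2)"
    using assms(2) by (simp add: sqint_def)
  have i: "integrable M (\<lambda>x. (norm (f x))\<^sup>2)"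
    by (rule Bochner_Integration.integrable_bound[OF ig]) (use assms(1) le in \<open>auto intro!: AE_I2\<close>)
  then show "sqint M f" using assms(1) by (simp add: sqint_def)
  show "l2 M f \<le> C\<^sup>2 * l2 M g"
    unfolding l2_def integral_mult_right_zero[symmetric]
    by (rule integral_mono[OF i ig le])
qed

lemma norm_add_sq_le: "(norm (a + b))\<^sup>2 \<le> 2 * (norm a)\<^sup>2 + 2 * (norm (b::'b::real_normed_vector))\<^sup>2"
proof -
  have "(norm (a + b))\<^sup>2 \<le> (norm a + norm b)\<^sup>2" by (intro power_mono norm_triangle_ineq) auto
  also have "\<dots> \<le> 2 * (norm a)\<^sup>2 + 2 * (norm b)\<^sup>2"
    using sum_squares_bound[of "norm a" "norm b"] by (simp add: power2_sum)
  finally show ?thesis .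
qed

lemma sqint_add:
  assumes "sqint M f" "sqint M g" shows "sqint M (\<lambda>x. f x + g x)"
    and l2_add: "l2 M (\<lambda>x. f x + g x) \<le> 2 * l2 M f + 2 * l2 M g"
proof -
  note [measurable] = sqint_measurable[OF assms(1)] sqint_measurable[OF assms(2)]
  have ig: "integrable M (\<lambda>x. 2 * (norm (f x))\<^sup>2 + 2 * (norm (g x))\<^sup>2)"
    using assms by (simp add: sqint_def)
  have i: "integrable M (\<lambda>x. (norm (f x + g x))\<^sup>2)"
    by (rule Bochner_Integration.integrable_bound[OF ig]) (use norm_add_sq_le in auto)
  then show "sqint M (\<lambda>x. f x + g x)" by (simp add: sqint_def)
  have "l2 M (\<lambda>x. f x + g x) \<le> (\<integral>x. 2 * (norm (f x))\<^sup>2 + 2 * (norm (g x))\<^sup>2 \<partial>M)"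
    unfolding l2_def by (rule integral_mono[OF i ig norm_add_sq_le])
  also have "\<dots> = 2 * l2 M f + 2 * l2 M g"
    using assms by (simp add: sqint_def l2_def)
  finally show "l2 M (\<lambda>x. f x + g x) \<le> 2 * l2 M f + 2 * l2 M g" .
qed

lemma sqint_scaleR: "sqint M f \<Longrightarrow> sqint M (\<lambda>x. c *\<^sub>R f x)"
  by (rule sqint_le(1)[where g=f and C="\<bar>c\<bar>"]) auto

lemma sqint_mult_left:
  fixes f :: "'a \<Rightarrow> 'b::{euclidean_space,real_normed_field}"
  shows "sqint M f \<Longrightarrow> sqint M (\<lambda>x. c * f x)"
  by (rule sqint_le(1)[where g=f and C="norm c"]) (auto simp: norm_mult)

lemma l2_mult_left:
  fixes f :: "'a \<Rightarrow> 'b::{euclidean_space,real_normed_field}"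
  shows "l2 M (\<lambda>x. c * f x) = (norm c)\<^sup>2 * l2 M f"
  by (simp add: l2_def power_mult_distrib norm_mult)

lemma sqint_minus: "sqint M f \<Longrightarrow> sqint M (\<lambda>x. - f x)"
  using sqint_scaleR[of M f "-1"] by simp

lemma l2_minus: "l2 M (\<lambda>x. - f x) = l2 M f"
  by (simp add: l2_def)

lemma l2_minus_commute: "l2 M (\<lambda>x. f x - g x) = l2 M (\<lambda>x. g x - f x)"
  by (simp add: l2_def norm_minus_commute)

lemma sqint_diff: "sqint M f \<Longrightarrow> sqint M g \<Longrightarrow> sqint M (\<lambda>x. f x - g x)"
  using sqint_add(1)[OF _ sqint_minus, of M f g] by simp

lemma sqint_sum: "(\<And>i. i \<in> A \<Longrightarrow> sqint M (f i)) \<Longrightarrow> sqint M (\<lambda>x. \<Sum>i\<in>A. f i x)"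
  by (induction A rule: infinite_finite_induct) (auto intro: sqint_add(1))

lemma sqint_bounded_scaleR:
  assumes "sqint M f" "h \<in> borel_measurable M" "\<And>x. x \<in> space M \<Longrightarrow> \<bar>h x\<bar> \<le> C"
  shows "sqint M (\<lambda>x. h x *\<^sub>R f x)" "l2 M (\<lambda>x. h x *\<^sub>R f x) \<le> C\<^sup>2 * l2 M f"
  using sqint_le[of "\<lambda>x. h x *\<^sub>R f x" M f C] assms by (auto simp: mult_right_mono)

lemma (in finite_measure) sqint_bounded:
  assumes "f \<in> borel_measurable M" "\<And>x. x \<in> space M \<Longrightarrow> norm (f x) \<le> C"
  shows "sqint M f"
proof -
  have "integrable M (\<lambda>x. (norm (f x))\<^sup>2)"
    by (rule integrable_const_bound[of _ "C\<^sup>2"]) (use assms in \<open>auto intro!: AE_I2 power_mono\<close>)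
  then show ?thesis using assms(1) by (simp add: sqint_def)
qed

lemma l2_cong_AE:
  assumes "AE x in M. f x = g x" "f \<in> borel_measurable M" "g \<in> borel_measurable M"
  shows "l2 M f = l2 M g"
  unfolding l2_def by (rule integral_cong_AE) (use assms in \<open>auto elim: eventually_mono\<close>)

lemma l2_eq_0_iff: "sqint M f \<Longrightarrow> l2 M f = 0 \<longleftrightarrow> (AE x in M. f x = 0)"
  unfolding l2_def by (subst integral_nonneg_eq_0_iff_AE) (auto simp: sqint_def)

lemma integrable_norm_prod:
  assumes "sqint M f" "sqint M g"
  shows "integrable M (\<lambda>x. norm (f x) * norm (g x))"
proof -
  note [measurable] = sqint_measurable[OF assms(1)] sqint_measurable[OF assms(2)]
  have ig: "integrable M (\<lambda>x. (norm (f x))\<^sup>2 + (norm (g x))\<^sup>2)"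
    using assms by (simp add: sqint_def)
  have "norm (norm a * norm b) \<le> norm ((norm a)\<^sup>2 + (norm b)\<^sup>2)" for a :: 'b and b :: 'c
  proof -
    have "norm a * norm b \<le> (norm a)\<^sup>2 + (norm b)\<^sup>2"
      using sum_squares_bound[of "norm a" "norm b"] mult_nonneg_nonneg[OF norm_ge_zero[of a] norm_ge_zero[of b]]
      unfolding mult.assoc by linarith
    then show ?thesis by simp
  qed
  then show ?thesis
    by (intro Bochner_Integration.integrable_bound[OF ig]) auto
qed

text \<open>Discriminant argument for the quadratic polynomial obtained by integrating the square of
  \<open>norm (f x) - t * norm (g x)\<close>. The optimal t divides by \<open>l2 M g\<close>, so a
  vanishing second norm is a separate case.\<close>

lemma cauchy_schwarz_norm:
  assumes f: "sqint M f" and g: "sqint M g"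
  shows "(\<integral>x. norm (f x) * norm (g x) \<partial>M) \<le> sqrt (l2 M f) * sqrt (l2 M g)"
proof -
  note i = integrable_norm_prod[OF f g]
  let ?p = "\<integral>x. norm (f x) * norm (g x) \<partial>M"
  have p0: "0 \<le> ?p" by simp
  have quad: "0 \<le> l2 M f - 2 * t * ?p + t\<^sup>2 * l2 M g" for t
  proof -
    have "0 \<le> (\<integral>x. (norm (f x) - t * norm (g x))\<^sup>2 \<partial>M)" by simp
    also have "\<dots> = (\<integral>x. (norm (f x))\<^sup>2 - 2 * t * (norm (f x) * norm (g x)) + t\<^sup>2 * (norm (g x))\<^sup>2 \<partial>M)"
      by (rule Bochner_Integration.integral_cong) (auto simp: power2_eq_square algebra_simps)
    also have "\<dots> = l2 M f - 2 * t * ?p + t\<^sup>2 * l2 M g"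
      using i f g by (simp add: sqint_def l2_def)
    finally show ?thesis .
  qed
  have "?p\<^sup>2 \<le> l2 M f * l2 M g"
  proof (cases "l2 M g = 0")
    case True
    have "?p = 0"
    proof (rule ccontr)
      assume "?p \<noteq> 0"
      then have "?p > 0" using p0 by linarith
      \<comment> \<open>Without a quadratic term the polynomial is affine in t; at this t it equals
        -1.\<close>
      with quad[of "(l2 M f + 1) / (2 * ?p)"] True show False by simp
    qed
    then show ?thesis by simp
  next
    case False
    then have pos: "l2 M g > 0" using l2_nonneg[of M g] by linarith
    have "0 \<le> (l2 M f - 2 * (?p / l2 M g) * ?p + (?p / l2 M g)\<^sup>2 * l2 M g) * l2 M g"
      by (rule mult_nonneg_nonneg[OF quad]) (use pos in simp)
    also have "\<dots> = l2 M f * l2 M g - ?p\<^sup>2"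
      using pos by (simp add: field_simps power2_eq_square)
    finally show ?thesis by simp
  qed
  then have "sqrt (?p\<^sup>2) \<le> sqrt (l2 M f * l2 M g)" by (rule real_sqrt_le_mono)
  then show ?thesis using p0 by (simp add: real_sqrt_mult)
qed

text \<open>The integrand is arbitrary and merely dominated by the product of the norms, so real and
  complex products, inner products and scalar multiples all inherit integrability and Cauchy-Schwarz
  from this one statement.\<close>

lemma cs_integrable:
  fixes h :: "'a \<Rightarrow> 'd::{banach,second_countable_topology}"
  assumes f: "sqint M f" and g: "sqint M g" and h: "h \<in> borel_measurable M"
    and le: "\<And>x. norm (h x) \<le> K * (norm (f x) * norm (g x))"
  shows "integrable M h"
    and cs_bound: "0 \<le> K \<Longrightarrow> norm (\<integral>x. h x \<partial>M) \<le> K * (sqrt (l2 M f) * sqrt (l2 M g))"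
proof -
  note i = integrable_norm_prod[OF f g]
  have iK: "integrable M (\<lambda>x. K * (norm (f x) * norm (g x)))" using i by simp
  have le': "norm (h x) \<le> norm (K * (norm (f x) * norm (g x)))" for x
    using le[of x] by (simp add: order_trans[OF _ abs_ge_self])
  show ih: "integrable M h"
    by (rule Bochner_Integration.integrable_bound[OF iK h]) (use le' in auto)
  show "norm (\<integral>x. h x \<partial>M) \<le> K * (sqrt (l2 M f) * sqrt (l2 M g))" if "0 \<le> K"
  proof -
    have "norm (\<integral>x. h x \<partial>M) \<le> (\<integral>x. norm (h x) \<partial>M)" by (rule integral_norm_bound)
    also have "\<dots> \<le> (\<integral>x. K * (norm (f x) * norm (g x)) \<partial>M)"
      by (rule integral_mono) (use ih iK le in auto)
    also have "\<dots> = K * (\<integral>x. norm (f x) * norm (g x) \<partial>M)" by simp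
    also have "\<dots> \<le> K * (sqrt (l2 M f) * sqrt (l2 M g))"
      by (intro mult_left_mono cauchy_schwarz_norm f g that)
    finally show ?thesis .
  qed
qed

lemma integrable_mult_sqint:
  fixes f g :: "'a \<Rightarrow> 'b::{euclidean_space,real_normed_field}"
  assumes "sqint M f" "sqint M g" shows "integrable M (\<lambda>x. f x * g x)"
    and norm_integral_mult_sqint: "norm (\<integral>x. f x * g x \<partial>M) \<le> sqrt (l2 M f) * sqrt (l2 M g)"
  using cs_integrable(1)[OF assms, of "\<lambda>x. f x * g x" 1] cs_integrable(2)[OF assms, of "\<lambda>x. f x * g x" 1] assms
  by (simp_all add: norm_mult sqint_measurable)

lemma integrable_inner_sqint:
  assumes "sqint M f" "sqint M g" shows "integrable M (\<lambda>x. f x \<bullet> g x)"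
    and abs_integral_inner_sqint: "\<bar>\<integral>x. f x \<bullet> g x \<partial>M\<bar> \<le> sqrt (l2 M f) * sqrt (l2 M g)"
proof -
  note m = sqint_measurable[OF assms(1)] sqint_measurable[OF assms(2)]
  have 1: "(\<lambda>x. f x \<bullet> g x) \<in> borel_measurable M" using m by simp
  have 2: "norm (f x \<bullet> g x) \<le> 1 * (norm (f x) * norm (g x))" for x
    using Cauchy_Schwarz_ineq2 by auto
  show "integrable M (\<lambda>x. f x \<bullet> g x)" "\<bar>\<integral>x. f x \<bullet> g x \<partial>M\<bar> \<le> sqrt (l2 M f) * sqrt (l2 M g)"
    using cs_integrable(1)[OF assms 1 2] cs_integrable(2)[OF assms 1 2] by simp_all
qed

lemma l2_add_eq:
  assumes "sqint M f" "sqint M g"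
  shows "l2 M (\<lambda>x. f x + g x) = l2 M f + 2 * (\<integral>x. f x \<bullet> g x \<partial>M) + l2 M g"
proof -
  have "l2 M (\<lambda>x. f x + g x) = (\<integral>x. (norm (f x))\<^sup>2 + 2 * (f x \<bullet> g x) + (norm (g x))\<^sup>2 \<partial>M)"
    unfolding l2_def
    by (rule Bochner_Integration.integral_cong) (auto simp: power2_norm_eq_inner inner_add inner_commute)
  then show ?thesis
    using assms integrable_inner_sqint[OF assms] by (simp add: sqint_def l2_def)
qed

lemma l2_triangle:
  assumes "sqint M f" "sqint M g"
  shows "sqrt (l2 M (\<lambda>x. f x + g x)) \<le> sqrt (l2 M f) + sqrt (l2 M g)"
proof (rule real_le_lsqrt)
  show "l2 M (\<lambda>x. f x + g x) \<le> (sqrt (l2 M f) + sqrt (l2 M g))\<^sup>2"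
    using abs_integral_inner_sqint[OF assms] by (simp add: l2_add_eq[OF assms] power2_sum)
qed auto

section \<open>Convergence and completeness in L2\<close>

lemma tendsto_sqrt_l2_iff: "(\<lambda>n. sqrt (l2 M (f n))) \<longlonglongrightarrow> 0 \<longleftrightarrow> (\<lambda>n. l2 M (f n)) \<longlonglongrightarrow> 0"
proof
  assume "(\<lambda>n. sqrt (l2 M (f n))) \<longlonglongrightarrow> 0"
  from tendsto_power[OF this, of 2] show "(\<lambda>n. l2 M (f n)) \<longlonglongrightarrow> 0" by simp
next
  assume "(\<lambda>n. l2 M (f n)) \<longlonglongrightarrow> 0"
  from tendsto_real_sqrt[OF this] show "(\<lambda>n. sqrt (l2 M (f n))) \<longlonglongrightarrow> 0" by simp
qed

text \<open>The difference of the two integrals splits into three terms, each with at least one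
  small factor, and Cauchy-Schwarz bounds them. The product is abstract because it is needed for
  scalar multiplication, for real multiplication and for \<open>a * cnj b\<close>.\<close>

lemma l2_tendsto_bilinear:
  fixes f :: "'a \<Rightarrow> 'b::euclidean_space" and g :: "'a \<Rightarrow> 'c::euclidean_space"
    and prod :: "'b \<Rightarrow> 'c \<Rightarrow> 'd::euclidean_space"
  assumes bil: "bounded_bilinear prod"
    and f: "sqint M f" "\<And>n. sqint M (fs n)" and g: "sqint M g" "\<And>n. sqint M (gs n)"
    and lf: "(\<lambda>n. l2 M (\<lambda>x. fs n x - f x)) \<longlonglongrightarrow> 0" and lg: "(\<lambda>n. l2 M (\<lambda>x. gs n x - g x)) \<longlonglongrightarrow> 0"
  shows "(\<lambda>n. \<integral>x. prod (fs n x) (gs n x) \<partial>M) \<longlonglongrightarrow> (\<integral>x. prod (f x) (g x) \<partial>M)"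
proof -
  interpret bounded_bilinear prod by fact
  obtain K where K: "K > 0" "\<And>a b. norm (prod a b) \<le> norm a * norm b * K"
    using pos_bounded by blast
  have meas: "(\<lambda>x. prod (u x) (v x)) \<in> borel_measurable M"
    if "sqint M u" "sqint M v" for u v
  proof -
    have "continuous_on UNIV (\<lambda>p. prod (fst p) (snd p))"
      by (intro continuous_on continuous_on_fst continuous_on_snd continuous_on_id)
    from borel_measurable_continuous_onI[OF this]
    have "(\<lambda>p. prod (fst p) (snd p)) \<in> borel_measurable (borel \<Otimes>\<^sub>M borel)"
      by (simp add: borel_prod)
    from measurable_compose[OF measurable_Pair this, of u M v] that
    show ?thesis by (simp add: sqint_measurable)
  qed
  have int: "integrable M (\<lambda>x. prod (u x) (v x))"
    and bnd: "norm (\<integral>x. prod (u x) (v x) \<partial>M) \<le> K * (sqrt (l2 M u) * sqrt (l2 M v))"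
    if "sqint M u" "sqint M v" for u v
    using cs_integrable(1)[OF that meas[OF that], of K] cs_integrable(2)[OF that meas[OF that], of K] K
    by (auto simp: ac_simps)
  have df: "sqint M (\<lambda>x. fs n x - f x)" and dg: "sqint M (\<lambda>x. gs n x - g x)" for n
    using f g by (auto intro: sqint_diff)
  let ?a = "\<lambda>n. sqrt (l2 M (\<lambda>x. fs n x - f x))" and ?b = "\<lambda>n. sqrt (l2 M (\<lambda>x. gs n x - g x))"
  have bound: "norm ((\<integral>x. prod (fs n x) (gs n x) \<partial>M) - (\<integral>x. prod (f x) (g x) \<partial>M))
     \<le> K * (?a n * ?b n) + K * (?a n * sqrt (l2 M g)) + K * (sqrt (l2 M f) * ?b n)" for n
  proof -
    have "(\<integral>x. prod (fs n x) (gs n x) \<partial>M) =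
      (\<integral>x. prod (fs n x - f x) (gs n x - g x) + prod (fs n x - f x) (g x) + prod (f x) (gs n x - g x)
          + prod (f x) (g x) \<partial>M)"
      by (rule Bochner_Integration.integral_cong) (auto simp: diff_left diff_right)
    also have "\<dots> = (\<integral>x. prod (fs n x - f x) (gs n x - g x) \<partial>M) + (\<integral>x. prod (fs n x - f x) (g x) \<partial>M)
        + (\<integral>x. prod (f x) (gs n x - g x) \<partial>M) + (\<integral>x. prod (f x) (g x) \<partial>M)"
      using int f g df dg by simp
    finally have eq: "(\<integral>x. prod (fs n x) (gs n x) \<partial>M) - (\<integral>x. prod (f x) (g x) \<partial>M) =
      (\<integral>x. prod (fs n x - f x) (gs n x - g x) \<partial>M) + (\<integral>x. prod (fs n x - f x) (g x) \<partial>M)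
        + (\<integral>x. prod (f x) (gs n x - g x) \<partial>M)" by simp
    show ?thesis unfolding eq
      by (intro norm_triangle_le[OF add_mono] norm_triangle_le[OF add_mono] bnd df dg f g)
  qed
  have "(\<lambda>n. K * (?a n * ?b n) + K * (?a n * sqrt (l2 M g)) + K * (sqrt (l2 M f) * ?b n))
     \<longlonglongrightarrow> K * (0 * 0) + K * (0 * sqrt (l2 M g)) + K * (sqrt (l2 M f) * 0)"
    by (intro tendsto_intros) (simp_all add: tendsto_sqrt_l2_iff lf lg)
  then have "(\<lambda>n. K * (?a n * ?b n) + K * (?a n * sqrt (l2 M g)) + K * (sqrt (l2 M f) * ?b n)) \<longlonglongrightarrow> 0"
    by simp
  from tendsto_0_le[OF this, of "\<lambda>n. (\<integral>x. prod (fs n x) (gs n x) \<partial>M) - (\<integral>x. prod (f x) (g x) \<partial>M)" 1]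
  show ?thesis using bound
    by (subst Lim_null) (auto intro!: eventuallyI order_trans[OF _ abs_ge_self])
qed

text \<open>Riesz-Fischer. On a finite measure space an L2-Cauchy sequence is L1-Cauchy, hence
  converges almost everywhere along a subsequence; Fatou's lemma along that subsequence turns
  pointwise convergence back into L2 convergence of the whole sequence.\<close>

lemma (in finite_measure) l2_complete:
  fixes fs :: "nat \<Rightarrow> 'a \<Rightarrow> 'b::euclidean_space"
  assumes fs: "\<And>n. sqint M (fs n)"
    and cauchy: "\<And>e. e > 0 \<Longrightarrow> \<exists>N. \<forall>m\<ge>N. \<forall>n\<ge>N. l2 M (\<lambda>x. fs m x - fs n x) < e"
  obtains f where "sqint M f" "(\<lambda>n. l2 M (\<lambda>x. fs n x - f x)) \<longlonglongrightarrow> 0"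
proof -
  note [measurable] = sqint_measurable[OF fs]
  have one: "sqint M (\<lambda>_. 1::real)" by (rule sqint_bounded[of _ 1]) auto
  have d: "sqint M (\<lambda>x. fs m x - fs n x)" for m n using fs by (intro sqint_diff)
  have L1: "(\<integral>x. norm (fs m x - fs n x) \<partial>M) \<le> sqrt (l2 M (\<lambda>_. 1::real)) * sqrt (l2 M (\<lambda>x. fs m x - fs n x))" for m n
    using cauchy_schwarz_norm[OF one d] by simp
  have int: "integrable M (fs n)" for n
    using cs_integrable(1)[OF one fs[of n], of "fs n" 1] by simp
  \<comment> \<open>The summand 1 keeps \<open>c\<close> positive even for the zero measure.\<close>
  define c where "c = sqrt (l2 M (\<lambda>_. 1::real)) + 1"
  have c: "c > 0" unfolding c_def by (simp add: add_nonneg_pos)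
  have "\<exists>N. \<forall>i\<ge>N. \<forall>j\<ge>N. (\<integral>x. norm (fs i x - fs j x) \<partial>M) < e" if "e > 0" for e :: real
  proof -
    have "(e / c)\<^sup>2 > 0" using that c by simp
    from cauchy[OF this] obtain N where N: "\<forall>m\<ge>N. \<forall>n\<ge>N. l2 M (\<lambda>x. fs m x - fs n x) < (e / c)\<^sup>2"
      by blast
    have "(\<integral>x. norm (fs i x - fs j x) \<partial>M) < e" if ij: "i \<ge> N" "j \<ge> N" for i j
    proof -
      have s: "sqrt (l2 M (\<lambda>x. fs i x - fs j x)) < e / c"
        by (rule real_less_lsqrt) (use N ij \<open>e > 0\<close> c in auto)
      have "(\<integral>x. norm (fs i x - fs j x) \<partial>M) \<le> c * sqrt (l2 M (\<lambda>x. fs i x - fs j x))"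
        using L1[of i j] by (rule order_trans) (auto simp: c_def intro!: mult_right_mono)
      also have "\<dots> < c * (e / c)" using s c by (intro mult_strict_left_mono)
      finally show ?thesis using c by simp
    qed
    then show ?thesis by blast
  qed
  from cauchy_L1_AE_cauchy_subseq[OF int this] obtain r where r: "strict_mono r"
    and AEC: "AE x in M. Cauchy (\<lambda>i. fs (r i) x)" by blast
  define f where "f x = lim (\<lambda>i. fs (r i) x)" for x
  have fm [measurable]: "f \<in> borel_measurable M"
    unfolding f_def by measurable
  have lim: "AE x in M. (\<lambda>i. fs (r i) x) \<longlonglongrightarrow> f x"
    using AEC by eventually_elim (simp add: f_def Cauchy_convergent_iff convergent_LIMSEQ_iff)
  \<comment> \<open>Fatou with n fixed and the subsequence index running to infinity; membership of
    the limit in L2 and the convergence rate come out of the same estimate.\<close>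
  have key: "integrable M (\<lambda>x. (norm (fs n x - f x))\<^sup>2) \<and> l2 M (\<lambda>x. fs n x - f x) \<le> e"
    if e: "e > 0" and n: "n \<ge> N" and N: "\<forall>m\<ge>N. \<forall>n\<ge>N. l2 M (\<lambda>x. fs m x - fs n x) < e" for e n N
  proof -
    have "(\<integral>\<^sup>+ x. ennreal ((norm (fs n x - f x))\<^sup>2) \<partial>M)
        = (\<integral>\<^sup>+ x. liminf (\<lambda>i. ennreal ((norm (fs n x - fs (r i) x))\<^sup>2)) \<partial>M)"
    proof (rule nn_integral_cong_AE)
      show "AE x in M. ennreal ((norm (fs n x - f x))\<^sup>2) = liminf (\<lambda>i. ennreal ((norm (fs n x - fs (r i) x))\<^sup>2))"
        using lim
      proof eventually_elim
        case (elim x)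
        have "(\<lambda>i. ennreal ((norm (fs n x - fs (r i) x))\<^sup>2)) \<longlonglongrightarrow> ennreal ((norm (fs n x - f x))\<^sup>2)"
          by (intro tendsto_ennrealI tendsto_intros elim)
        from lim_imp_Liminf[OF _ this] show ?case by simp
      qed
    qed
    also have "\<dots> \<le> liminf (\<lambda>i. \<integral>\<^sup>+ x. ennreal ((norm (fs n x - fs (r i) x))\<^sup>2) \<partial>M)"
      by (rule nn_integral_liminf) measurable
    also have "\<dots> \<le> ennreal e"
    proof (rule Liminf_le)
      show "\<forall>\<^sub>F i in sequentially. (\<integral>\<^sup>+ x. ennreal ((norm (fs n x - fs (r i) x))\<^sup>2) \<partial>M) \<le> ennreal e"
        using eventually_ge_at_top[of N]
      proof eventually_elim
        case (elim i)
        have "r i \<ge> N" using elim seq_suble[OF r, of i] by linarith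
        then have "l2 M (\<lambda>x. fs n x - fs (r i) x) < e" using N n by blast
        moreover have "(\<integral>\<^sup>+ x. ennreal ((norm (fs n x - fs (r i) x))\<^sup>2) \<partial>M) = ennreal (l2 M (\<lambda>x. fs n x - fs (r i) x))"
          unfolding l2_def by (rule nn_integral_eq_integral) (use d[of n "r i"] in \<open>auto simp: sqint_def\<close>)
        ultimately show ?case by (simp add: ennreal_leI)
      qed
    qed simp
    finally have le: "(\<integral>\<^sup>+ x. ennreal ((norm (fs n x - f x))\<^sup>2) \<partial>M) \<le> ennreal e" .
    have i: "integrable M (\<lambda>x. (norm (fs n x - f x))\<^sup>2)"
      by (rule integrableI_bounded) (use le in \<open>auto intro: le_less_trans\<close>)
    have "ennreal (l2 M (\<lambda>x. fs n x - f x)) \<le> ennreal e"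
      using le unfolding l2_def by (subst (asm) nn_integral_eq_integral[OF i]) auto
    then have "l2 M (\<lambda>x. fs n x - f x) \<le> e" using e by (simp add: ennreal_le_iff)
    with i show ?thesis by blast
  qed
  obtain N1 where "\<forall>m\<ge>N1. \<forall>n\<ge>N1. l2 M (\<lambda>x. fs m x - fs n x) < 1" using cauchy[of 1] by auto
  from key[OF _ order_refl this] have "sqint M (\<lambda>x. fs N1 x - f x)"
    by (simp add: sqint_def)
  from sqint_diff[OF fs this, of N1] have "sqint M f" by simp
  moreover have "(\<lambda>n. l2 M (\<lambda>x. fs n x - f x)) \<longlonglongrightarrow> 0"
  proof (rule LIMSEQ_I)
    fix e :: real assume "e > 0"
    then obtain N where "\<forall>m\<ge>N. \<forall>n\<ge>N. l2 M (\<lambda>x. fs m x - fs n x) < e / 2"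
      using cauchy[of "e / 2"] by auto
    from key[OF _ _ this] \<open>e > 0\<close> have "l2 M (\<lambda>x. fs n x - f x) \<le> e / 2" if "n \<ge> N" for n
      using that by auto
    then show "\<exists>N. \<forall>n\<ge>N. norm (l2 M (\<lambda>x. fs n x - f x) - 0) < e"
      using \<open>e > 0\<close> by (intro exI[of _ N]) fastforce
  qed
  ultimately show ?thesis by (rule that)
qed

section \<open>Orthonormal systems\<close>

text \<open>The functions \<open>e i\<close> are real while the expanded functions take values in
  any Euclidean space, so one theory serves real functions on the interval and complex amplitudes on
  the cube. Boundedness of each \<open>e i\<close> gives coefficients to functions that are only
  integrable.\<close>

locale orthonormal_system = finite_measure M for M :: "'a measure" +
  fixes e :: "'i \<Rightarrow> 'a \<Rightarrow> real" and I :: "'i set" and bd :: "'i \<Rightarrow> real"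
  assumes e_measurable [measurable]: "\<And>i. e i \<in> borel_measurable M"
    and e_bounded: "\<And>i x. \<bar>e i x\<bar> \<le> bd i"
    and e_ortho: "\<And>i j. i \<in> I \<Longrightarrow> j \<in> I \<Longrightarrow> (\<integral>x. e i x * e j x \<partial>M) = (if i = j then 1 else 0)"
begin

definition coef :: "('a \<Rightarrow> 'b::euclidean_space) \<Rightarrow> 'i \<Rightarrow> 'b" where
  "coef u i = (\<integral>x. e i x *\<^sub>R u x \<partial>M)"

definition proj :: "'i set \<Rightarrow> ('a \<Rightarrow> 'b::euclidean_space) \<Rightarrow> 'a \<Rightarrow> 'b" where
  "proj A u x = (\<Sum>i\<in>A. e i x *\<^sub>R coef u i)"

lemma sqint_e: "sqint M (e i)"
  by (rule sqint_bounded[where C="bd i"]) (auto simp: e_bounded)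

lemma sqint_e_const: "sqint M (\<lambda>x. e i x *\<^sub>R (c::'b::euclidean_space))"
  by (rule sqint_bounded[where C="bd i * norm c"]) (auto simp: e_bounded mult_right_mono)

lemma sqint_proj: "sqint M (proj A u)"
  unfolding proj_def by (intro sqint_sum sqint_e_const)

lemma integrable_e_scaleR:
  assumes "sqint M (u :: 'a \<Rightarrow> 'b::euclidean_space)" shows "integrable M (\<lambda>x. e i x *\<^sub>R u x)"
  by (rule cs_integrable(1)[OF sqint_e[of i] assms, of _ 1]) (use assms in \<open>auto simp: sqint_measurable\<close>)

lemma coef_diff:
  assumes "sqint M u" "sqint M v"
  shows "coef (\<lambda>x. u x - v x) i = coef u i - coef v i"
  unfolding coef_def using assms by (simp add: scaleR_diff_right integrable_e_scaleR)

lemma coef_norm_le: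
  assumes "sqint M (u :: 'a \<Rightarrow> 'b::euclidean_space)" "i \<in> I"
  shows "norm (coef u i) \<le> sqrt (l2 M u)"
proof -
  have "norm (coef u i) \<le> 1 * (sqrt (l2 M (e i)) * sqrt (l2 M u))"
    unfolding coef_def
    by (rule cs_integrable(2)[OF sqint_e[of i] assms(1)]) (use assms in \<open>auto simp: sqint_measurable\<close>)
  moreover have "l2 M (e i) = 1"
    using e_ortho[OF assms(2) assms(2)] by (simp add: l2_def power2_eq_square)
  ultimately show ?thesis by simp
qed

lemma integral_inner_e:
  assumes "sqint M (u :: 'a \<Rightarrow> 'b::euclidean_space)"
  shows "(\<integral>x. u x \<bullet> (e i x *\<^sub>R c) \<partial>M) = coef u i \<bullet> c"
proof -
  have "(\<integral>x. u x \<bullet> (e i x *\<^sub>R c) \<partial>M) = (\<integral>x. (e i x *\<^sub>R u x) \<bullet> c \<partial>M)" by simp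
  also have "\<dots> = coef u i \<bullet> c"
    unfolding coef_def by (rule integral_inner_left) (use integrable_e_scaleR[OF assms] in auto)
  finally show ?thesis .
qed

lemma integral_inner_comb:
  assumes "sqint M (u :: 'a \<Rightarrow> 'b::euclidean_space)"
  shows "(\<integral>x. u x \<bullet> (\<Sum>i\<in>A. e i x *\<^sub>R c i) \<partial>M) = (\<Sum>i\<in>A. coef u i \<bullet> c i)"
proof -
  have "(\<integral>x. u x \<bullet> (\<Sum>i\<in>A. e i x *\<^sub>R c i) \<partial>M) = (\<Sum>i\<in>A. \<integral>x. u x \<bullet> (e i x *\<^sub>R c i) \<partial>M)"
    unfolding inner_sum_right
    by (rule Bochner_Integration.integral_sum) (rule integrable_inner_sqint[OF assms sqint_e_const])
  then show ?thesis unfolding integral_inner_e[OF assms] .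
qed

lemma coef_comb:
  assumes "finite A" "A \<subseteq> I" "i \<in> I"
  shows "coef (\<lambda>x. \<Sum>j\<in>A. e j x *\<^sub>R c j) i = (if i \<in> A then c i else (0::'b::euclidean_space))"
proof -
  have "coef (\<lambda>x. \<Sum>j\<in>A. e j x *\<^sub>R c j) i = (\<Sum>j\<in>A. \<integral>x. e i x *\<^sub>R (e j x *\<^sub>R c j) \<partial>M)"
    unfolding coef_def scaleR_sum_right
    by (rule Bochner_Integration.integral_sum) (rule integrable_e_scaleR[OF sqint_e_const])
  also have "\<dots> = (\<Sum>j\<in>A. (\<integral>x. e i x * e j x \<partial>M) *\<^sub>R c j)"
    by (intro sum.cong refl)
      (simp, subst integral_scaleR_left, auto intro!: integrable_mult_sqint sqint_e)
  also have "\<dots> = (\<Sum>j\<in>A. if i = j then c j else 0)"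
    using assms by (intro sum.cong refl) (auto simp: e_ortho subset_iff)
  also have "\<dots> = (if i \<in> A then c i else 0)"
    using assms(1) by simp
  finally show ?thesis .
qed

lemma l2_comb:
  assumes "finite A" "A \<subseteq> I"
  shows "l2 M (\<lambda>x. \<Sum>j\<in>A. e j x *\<^sub>R (c j :: 'b::euclidean_space)) = (\<Sum>j\<in>A. (norm (c j))\<^sup>2)"
proof -
  let ?u = "\<lambda>x. \<Sum>j\<in>A. e j x *\<^sub>R c j"
  have u: "sqint M ?u" by (intro sqint_sum sqint_e_const)
  have "l2 M ?u = (\<integral>x. ?u x \<bullet> ?u x \<partial>M)" by (simp add: l2_def power2_norm_eq_inner)
  also have "\<dots> = (\<Sum>i\<in>A. coef ?u i \<bullet> c i)" by (rule integral_inner_comb[OF u])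
  also have "\<dots> = (\<Sum>j\<in>A. (norm (c j))\<^sup>2)"
    using assms by (intro sum.cong refl) (simp add: coef_comb subset_iff power2_norm_eq_inner)
  finally show ?thesis .
qed

lemma l2_diff_comb:
  assumes "finite A" "A \<subseteq> I" "sqint M (u :: 'a \<Rightarrow> 'b::euclidean_space)"
  shows "l2 M (\<lambda>x. u x - (\<Sum>j\<in>A. e j x *\<^sub>R c j))
    = l2 M u - 2 * (\<Sum>j\<in>A. coef u j \<bullet> c j) + (\<Sum>j\<in>A. (norm (c j))\<^sup>2)"
proof -
  let ?v = "\<lambda>x. - (\<Sum>j\<in>A. e j x *\<^sub>R c j)"
  have v: "sqint M ?v" by (intro sqint_minus sqint_sum sqint_e_const)
  show ?thesis
    using l2_add_eq[OF assms(3) v] integral_inner_comb[OF assms(3), where A=A and c=c] l2_comb[OF assms(1,2), where c=c]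
    by (simp add: l2_minus)
qed

lemma l2_diff_proj:
  assumes "finite A" "A \<subseteq> I" "sqint M u"
  shows "l2 M (\<lambda>x. u x - proj A u x) = l2 M u - (\<Sum>j\<in>A. (norm (coef u j))\<^sup>2)"
  using l2_diff_comb[OF assms, where c="coef u"] by (simp add: proj_def power2_norm_eq_inner)

lemma bessel:
  assumes "finite A" "A \<subseteq> I" "sqint M u"
  shows "(\<Sum>j\<in>A. (norm (coef u j))\<^sup>2) \<le> l2 M u"
  using l2_diff_proj[OF assms] l2_nonneg[of M "\<lambda>x. u x - proj A u x"] by linarith

end

text \<open>The finite sets \<open>F K\<close> exhaust the index set, so that expansions are
  ordinary limits in K. Totality is required for real integrable functions, the form in which the
  approximation arguments below deliver it.\<close>

locale orthonormal_basis = orthonormal_system +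
  fixes F :: "nat \<Rightarrow> 'b set"
  assumes F_finite: "\<And>K. finite (F K)" and F_mono: "mono F" and F_Union: "(\<Union>K. F K) = I"
    and total: "\<And>u. integrable M u \<Longrightarrow> (\<And>i. i \<in> I \<Longrightarrow> (\<integral>x. e i x * u x \<partial>M) = 0) \<Longrightarrow> AE x in M. u x = 0"
begin

lemma F_subset: "F K \<subseteq> I"
  using F_Union by blast

lemma total_euclidean:
  fixes u :: "'a \<Rightarrow> 'c::euclidean_space"
  assumes u: "integrable M u" and 0: "\<And>i. i \<in> I \<Longrightarrow> (\<integral>x. e i x *\<^sub>R u x \<partial>M) = 0"
  shows "AE x in M. u x = 0"
proof -
  have "AE x in M. u x \<bullet> b = 0" if "b \<in> Basis" for b
  proof (rule total)
    show "integrable M (\<lambda>x. u x \<bullet> b)" using u by simp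
    fix i assume i: "i \<in> I"
    have ii: "integrable M (\<lambda>x. e i x *\<^sub>R u x)"
    proof (rule Bochner_Integration.integrable_bound)
      show "integrable M (\<lambda>x. bd i * norm (u x))" using u by simp
      show "AE x in M. norm (e i x *\<^sub>R u x) \<le> norm (bd i * norm (u x))"
        by (intro AE_I2) (auto simp: abs_mult intro!: mult_right_mono order_trans[OF e_bounded])
    qed (use u in simp)
    have "(\<integral>x. e i x * (u x \<bullet> b) \<partial>M) = (\<integral>x. (e i x *\<^sub>R u x) \<bullet> b \<partial>M)" by simp
    also have "\<dots> = (\<integral>x. e i x *\<^sub>R u x \<partial>M) \<bullet> b"
      by (rule integral_inner_left) (use ii in auto)
    finally show "(\<integral>x. e i x * (u x \<bullet> b) \<partial>M) = 0" using 0[OF i] by simp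
  qed
  then have "AE x in M. \<forall>b\<in>Basis. u x \<bullet> b = 0"
    by (intro AE_finite_allI) auto
  then show ?thesis by eventually_elim (simp add: euclidean_all_zero_iff)
qed

text \<open>Bessel bounds the increasing partial sums, so the projections form a Cauchy sequence.
  Their limit has the same coefficients as \<open>u\<close>, and totality identifies the
  two.\<close>

theorem parseval:
  assumes u: "sqint M (u :: 'a \<Rightarrow> 'c::euclidean_space)"
  shows "(\<lambda>K. l2 M (\<lambda>x. u x - proj (F K) u x)) \<longlonglongrightarrow> 0"
    and "(\<lambda>K. \<Sum>j\<in>F K. (norm (coef u j))\<^sup>2) \<longlonglongrightarrow> l2 M u"
proof -
  let ?s = "\<lambda>K. \<Sum>j\<in>F K. (norm (coef u j))\<^sup>2"
  have mono: "mono ?s"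
    by (intro monoI sum_mono2 F_finite) (auto intro: monoD[OF F_mono, THEN subsetD])
  have bdd: "bdd_above (range ?s)"
    by (rule bdd_aboveI2[where M="l2 M u"]) (rule bessel[OF F_finite F_subset u])
  have conv: "?s \<longlonglongrightarrow> (SUP K. ?s K)"
    by (rule LIMSEQ_incseq_SUP[OF bdd mono])
  have diff: "l2 M (\<lambda>x. proj (F m) u x - proj (F n) u x) = ?s m - ?s n" if "n \<le> m" for m n
  proof -
    have sub: "F n \<subseteq> F m" using F_mono that by (rule monoD)
    have "(\<lambda>x. proj (F m) u x - proj (F n) u x) = (\<lambda>x. \<Sum>i\<in>F m - F n. e i x *\<^sub>R coef u i)"
      by (auto simp: proj_def sum_diff[OF F_finite sub])
    then have "l2 M (\<lambda>x. proj (F m) u x - proj (F n) u x) = l2 M (\<lambda>x. \<Sum>i\<in>F m - F n. e i x *\<^sub>R coef u i)"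
      by simp
    also have "\<dots> = (\<Sum>i\<in>F m - F n. (norm (coef u i))\<^sup>2)"
      using F_finite F_subset by (intro l2_comb) auto
    also have "\<dots> = ?s m - ?s n" by (rule sum_diff[OF F_finite sub])
    finally show ?thesis .
  qed
  have cauchy: "\<exists>N. \<forall>m\<ge>N. \<forall>n\<ge>N. l2 M (\<lambda>x. proj (F m) u x - proj (F n) u x) < e'" if "e' > 0" for e' :: real
  proof -
    from LIMSEQ_imp_Cauchy[OF conv] that obtain N where N: "\<forall>m\<ge>N. \<forall>n\<ge>N. \<bar>?s m - ?s n\<bar> < e'"
      unfolding Cauchy_def dist_real_def by blast
    have "l2 M (\<lambda>x. proj (F m) u x - proj (F n) u x) < e'" if "m \<ge> N" "n \<ge> N" for m n
    proof (cases "n \<le> m")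
      case True
      have "\<bar>?s m - ?s n\<bar> < e'" using N that by blast
      then show ?thesis using diff[OF True] by linarith
    next
      case False
      then have "m \<le> n" by simp
      have "\<bar>?s m - ?s n\<bar> < e'" using N that by blast
      then show ?thesis using diff[OF \<open>m \<le> n\<close>] l2_minus_commute[of M "proj (F m) u" "proj (F n) u"] by linarith
    qed
    then show ?thesis by blast
  qed
  obtain v where v: "sqint M v" "(\<lambda>n. l2 M (\<lambda>x. proj (F n) u x - v x)) \<longlonglongrightarrow> 0"
    using l2_complete[OF sqint_proj cauchy] by blast
  have coef_v: "coef v i = coef u i" if i: "i \<in> I" for i
  proof -
    have "(\<lambda>n. coef (proj (F n) u) i) \<longlonglongrightarrow> coef v i"
      unfolding coef_def
      by (rule l2_tendsto_bilinear[OF bounded_bilinear_scaleR sqint_e sqint_e v(1) sqint_proj _ v(2)]) (simp add: l2_def)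
    \<comment> \<open>By orthonormality the i-th coefficient of a projection is already exact once i
      belongs to \<open>F n\<close>.\<close>
    moreover have "eventually (\<lambda>n. coef (proj (F n) u) i = coef u i) sequentially"
    proof -
      obtain K where "i \<in> F K" using i F_Union by blast
      then have "\<forall>n\<ge>K. i \<in> F n" using F_mono by (meson monoD subsetD)
      then show ?thesis
        by (auto simp: eventually_sequentially proj_def[abs_def] coef_comb[OF F_finite F_subset i] intro!: exI[of _ K])
    qed
    ultimately show ?thesis
      by (rule LIMSEQ_unique[OF _ tendsto_eventually])
  qed
  have duv: "sqint M (\<lambda>x. u x - v x)" using u v by (intro sqint_diff)
  have "AE x in M. u x - v x = 0"
  proof (rule total_euclidean)
    show "integrable M (\<lambda>x. u x - v x)"
      by (rule cs_integrable(1)[OF _ duv, of "\<lambda>_. 1::real" _ 1])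
        (use duv in \<open>auto simp: sqint_measurable intro!: sqint_bounded[of _ 1]\<close>)
    show "(\<integral>x. e i x *\<^sub>R (u x - v x) \<partial>M) = 0" if "i \<in> I" for i
      using coef_diff[OF u v(1), of i] coef_v[OF that] by (simp add: coef_def)
  qed
  then have ae: "AE x in M. u x = v x" by eventually_elim simp
  have "l2 M (\<lambda>x. u x - proj (F K) u x) = l2 M (\<lambda>x. proj (F K) u x - v x)" for K
    unfolding l2_minus_commute[of M u]
    by (rule l2_cong_AE) (use ae u v sqint_proj[of "F K" u] in \<open>auto simp: sqint_measurable\<close>)
  with v(2) show lim: "(\<lambda>K. l2 M (\<lambda>x. u x - proj (F K) u x)) \<longlonglongrightarrow> 0" by simp
  have "(\<lambda>K. l2 M u - l2 M (\<lambda>x. u x - proj (F K) u x)) \<longlonglongrightarrow> l2 M u - 0"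
    by (intro tendsto_intros lim)
  then show "?s \<longlonglongrightarrow> l2 M u"
    by (simp add: l2_diff_proj[OF F_finite F_subset u])
qed

end

section \<open>The unit interval\<close>

abbreviation "L01 \<equiv> lebesgue_on {0..1::real}"

lemma space_L01 [simp]: "space L01 = {0..1}" by simp

lemma finite_measure_L01: "finite_measure L01"
  by (rule finite_measureI) (simp add: emeasure_restrict_space)

lemma emeasure_L01_space: "emeasure L01 {0..1} = 1"
  by (simp add: emeasure_restrict_space)

interpretation L01: finite_measure L01 by (rule finite_measure_L01)

lemma measure_L01_space [simp]: "measure L01 {0..1} = 1"
  by (simp add: measure_def emeasure_L01_space)

interpretation L01P: product_sigma_finite "\<lambda>_::nat. L01"
  by (simp add: product_sigma_finite_def L01.sigma_finite_measure_axioms)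

lemma integral_L01_FTC:
  fixes F f :: "real \<Rightarrow> 'b::euclidean_space"
  assumes "\<And>t. t \<in> {0..1} \<Longrightarrow> (F has_vector_derivative f t) (at t)" "continuous_on {0..1} f"
  shows "(\<integral>t. f t \<partial>L01) = F 1 - F 0"
proof -
  have "(f has_integral F 1 - F 0) {0..1}"
    by (rule fundamental_theorem_of_calculus) (simp_all add: has_vector_derivative_at_within assms(1))
  moreover have "(\<integral>t. f t \<partial>L01) = integral {0..1} f"
    by (rule lebesgue_integral_eq_integral) (auto intro: continuous_imp_integrable_real assms(2))
  ultimately show ?thesis by (simp add: integral_unique)
qed

text \<open>Hartley functions: a real orthonormal basis indexed by the integers, on which differentiation acts as m to -m.\<close>

definition cas :: "int \<Rightarrow> real \<Rightarrow> real" where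
  "cas m t = cos (2 * pi * of_int m * t) + sin (2 * pi * of_int m * t)"

lemma cas_0 [simp]: "cas 0 = (\<lambda>_. 1)"
  by (simp add: cas_def fun_eq_iff)

lemma abs_cas_le: "\<bar>cas m t\<bar> \<le> 2"
  unfolding cas_def using abs_cos_le_one[of "2 * pi * of_int m * t"] abs_sin_le_one[of "2 * pi * of_int m * t"]
  by linarith

lemma cas_deriv: "(cas m has_real_derivative 2 * pi * of_int m * cas (- m) t) (at t)"
  unfolding cas_def by (auto intro!: derivative_eq_intros simp: algebra_simps)

lemma continuous_cas [continuous_intros]: "continuous_on A (cas m)"
  unfolding cas_def by (intro continuous_intros)

lemma cas_measurable [measurable]: "cas m \<in> borel_measurable borel"
  by (rule borel_measurable_continuous_onI[OF continuous_cas])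

lemma cas_periodic: "cas m (t + 1) = cas m t"
proof -
  have "2 * pi * of_int m * (t + 1) = 2 * pi * of_int m * t + 2 * pi * of_int m" by (simp add: algebra_simps)
  moreover have "sin (x + 2 * pi * of_int m) = sin x" "cos (x + 2 * pi * of_int m) = cos x" for x
    by (simp_all add: sin_add cos_add sin_int_2pin cos_int_2pin)
  ultimately show ?thesis by (simp add: cas_def)
qed

lemma cos_cas: "cos (2 * pi * of_int m * t) = (1/2) * cas m t + (1/2) * cas (- m) t"
  and sin_cas: "sin (2 * pi * of_int m * t) = (1/2) * cas m t + (-1/2) * cas (- m) t"
  by (simp_all add: cas_def field_simps)

text \<open>The product equals cos of the difference plus sin of the sum, each rewritten as a
  half-sum of two Hartley functions. The minus sign sits in the coefficient -1/2 because
  \<open>trigp\<close> has rules for sums and multiples only.\<close>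

lemma cas_mult: "cas m t * cas n t = (1/2) * cas (m - n) t + ((1/2) * cas (n - m) t
    + ((1/2) * cas (m + n) t + (-1/2) * cas (- (m + n)) t))"
proof -
  have "cas m t * cas n t = cos (2 * pi * of_int (m - n) * t) + sin (2 * pi * of_int (m + n) * t)"
    unfolding cas_def by (simp add: algebra_simps cos_diff sin_add)
  also have "\<dots> = (1/2) * cas (m - n) t + (1/2) * cas (n - m) t
    + ((1/2) * cas (m + n) t + (-1/2) * cas (- (m + n)) t)"
    unfolding cos_cas sin_cas by simp
  finally show ?thesis by simp
qed

lemma integral_cas: "(\<integral>t. cas m t \<partial>L01) = (if m = 0 then 1 else 0)"
proof (cases "m = 0")
  case False
  have "((\<lambda>t. - cas (- m) t / (2 * pi * of_int m)) has_vector_derivative cas m t) (at t)" for t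
    unfolding has_real_derivative_iff_has_vector_derivative[symmetric]
    using False by (auto intro!: derivative_eq_intros cas_deriv)
  from integral_L01_FTC[OF this continuous_cas] show ?thesis
    using cas_periodic[of "- m" 0] False by simp
qed simp

lemma integrable_cas: "integrable L01 (cas m)"
  by (intro continuous_imp_integrable_real continuous_cas)

lemma cas_ortho: "(\<integral>t. cas m t * cas n t \<partial>L01) = (if m = n then 1 else 0)"
  unfolding cas_mult
  by (simp add: integrable_cas integral_cas)

section \<open>Real trigonometric polynomials as the span of the Hartley functions: algebra, uniform
  density, approximation almost everywhere\<close>

inductive trigp :: "(real \<Rightarrow> real) \<Rightarrow> bool" where
  cas: "trigp (cas m)"
| add: "trigp p \<Longrightarrow> trigp q \<Longrightarrow> trigp (\<lambda>t. p t + q t)"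
| scale: "trigp p \<Longrightarrow> trigp (\<lambda>t. c * p t)"

lemma trigp_const: "trigp (\<lambda>_. c)"
  using trigp.scale[OF trigp.cas[of 0], of c] by simp

lemma trigp_cas_mult: "trigp q \<Longrightarrow> trigp (\<lambda>t. cas m t * q t)"
proof (induction rule: trigp.induct)
  case (cas n)
  show ?case unfolding cas_mult by (intro trigp.intros)
next
  case (add p q)
  from trigp.add[OF add.IH] show ?case by (simp add: distrib_left)
next
  case (scale p c)
  from trigp.scale[OF scale.IH, of c] show ?case by (simp add: mult.left_commute)
qed

lemma trigp_mult: "trigp p \<Longrightarrow> trigp q \<Longrightarrow> trigp (\<lambda>t. p t * q t)"
proof (induction rule: trigp.induct)
  case (cas m)
  then show ?case by (rule trigp_cas_mult)
next
  case (add p p')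
  from trigp.add[OF add.IH(1)[OF add.prems] add.IH(2)[OF add.prems]] show ?case by (simp add: distrib_right)
next
  case (scale p c)
  from trigp.scale[OF scale.IH[OF scale.prems], of c] show ?case by (simp add: mult.assoc)
qed

lemma trigp_continuous: "trigp p \<Longrightarrow> continuous_on A p"
  by (induction rule: trigp.induct) (auto intro!: continuous_intros)

lemma trigp_measurable_L01: "trigp p \<Longrightarrow> p \<in> borel_measurable L01"
  by (rule continuous_imp_measurable_on_sets_lebesgue[OF trigp_continuous]) auto

lemma trigp_bounded: "trigp p \<Longrightarrow> \<exists>B. \<forall>t. \<bar>p t\<bar> \<le> B"
proof (induction rule: trigp.induct)
  case (add p q)
  then obtain B C where "\<forall>t. \<bar>p t\<bar> \<le> B" "\<forall>t. \<bar>q t\<bar> \<le> C" by blast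
  then have "\<bar>p t + q t\<bar> \<le> B + C" for t
    by (meson abs_triangle_ineq add_mono order_trans)
  then show ?case by blast
next
  case (scale p c)
  then obtain B where "\<forall>t. \<bar>p t\<bar> \<le> B" by blast
  then have "\<bar>c * p t\<bar> \<le> \<bar>c\<bar> * B" for t by (simp add: abs_mult mult_left_mono)
  then show ?case by blast
qed (use abs_cas_le in blast)

lemma ptest_cas: "ptest (cas m)"
  unfolding ptest_def using cas_periodic cas_deriv
  by (auto intro!: exI[of _ "\<lambda>t. 2 * pi * of_int m * cas (- m) t"] continuous_intros)

lemma deriv_cas: "deriv (cas m) t = 2 * pi * of_int m * cas (- m) t"
  by (rule DERIV_imp_deriv[OF cas_deriv])

text \<open>On the unit circle a real linear functional is a combination of cos and sin, and
  trigonometric polynomials are closed under sums and products. This links the Stone-Weierstrass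
  theorem on the circle to \<open>trigp\<close>.\<close>

lemma trigp_polynomial:
  assumes "real_polynomial_function (g :: complex \<Rightarrow> real)"
  shows "trigp (\<lambda>t. g (cis (2 * pi * t)))"
  using assms
proof (induction rule: real_polynomial_function.induct)
  case (linear f)
  then interpret bounded_linear f .
  have "f (cis (2 * pi * t)) = f 1 * cos (2 * pi * t) + f \<i> * sin (2 * pi * t)" for t
  proof -
    have "cis (2 * pi * t) = cos (2 * pi * t) *\<^sub>R 1 + sin (2 * pi * t) *\<^sub>R \<i>"
      by (simp add: complex_eq_iff)
    then show ?thesis by (simp add: add scaleR)
  qed
  also have "f 1 * cos (2 * pi * t) + f \<i> * sin (2 * pi * t) =
      f 1 * ((1/2) * cas 1 t + (1/2) * cas (- 1) t) + f \<i> * ((1/2) * cas 1 t + (-1/2) * cas (- 1) t)" for t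
    by (simp add: cas_def field_simps)
  finally have "(\<lambda>t. f (cis (2 * pi * t))) = (\<lambda>t. f 1 * ((1/2) * cas 1 t + (1/2) * cas (- 1) t)
      + f \<i> * ((1/2) * cas 1 t + (-1/2) * cas (- 1) t))" by blast
  moreover have "trigp \<dots>" by (intro trigp.intros)
  ultimately show ?case by simp
qed (auto intro: trigp_const trigp.intros trigp_mult)

lemma trigp_dense:
  assumes f: "continuous_on {0..1} f" "f 0 = f 1" and e: "e > 0"
  obtains p where "trigp p" "\<And>t. t \<in> {0..1} \<Longrightarrow> \<bar>f t - p t\<bar> < e"
proof -
  \<comment> \<open>The constant homotopy of the loop is used only for its by-product: the induced
    function on the circle is continuous. This is not a plain composition, since
    \<open>Arg2pi\<close> jumps at 1.\<close>
  have "path (f :: real \<Rightarrow> real)" using f by (simp add: path_def)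
  then have "homotopic_loops UNIV f f"
    using f by (simp add: homotopic_loops_refl pathstart_def pathfinish_def)
  from homotopic_with_imp_continuous[OF homotopic_loops_imp_homotopic_circlemaps[OF this]]
  have c: "continuous_on (sphere 0 1) (f \<circ> (\<lambda>z. Arg2pi z / (2 * pi)))" by simp
  obtain g where g: "real_polynomial_function g"
     "\<And>z. z \<in> sphere 0 1 \<Longrightarrow> \<bar>(f \<circ> (\<lambda>z. Arg2pi z / (2 * pi))) z - g z\<bar> < e"
    using Stone_Weierstrass_real_polynomial_function[OF compact_sphere c e] by blast
  show ?thesis
  proof (rule that[OF trigp_polynomial[OF g(1)]])
    fix t :: real assume t: "t \<in> {0..1}"
    show "\<bar>f t - g (cis (2 * pi * t))\<bar> < e"
    proof (cases "t = 1")
      \<comment> \<open>The endpoint is special because \<open>Arg2pi\<close> sends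
        \<open>cis (2 * pi)\<close> to 0 instead of 2 pi; here the equal endpoint values of
        \<open>f\<close> enter.\<close>
      case True
      moreover have "Arg2pi 1 = 0" by (rule Arg2pi_unique[of 1]) auto
      ultimately show ?thesis using g(2)[of 1] f(2) by (simp add: cis_2pi)
    next
      case False
      have "Arg2pi (cis (2 * pi * t)) = 2 * pi * t"
        using t False by (intro Arg2pi_unique[of 1]) (auto simp: cis_conv_exp)
      then show ?thesis using g(2)[of "cis (2 * pi * t)"] by simp
    qed
  qed
qed

text \<open>Measurability supplies continuous functions converging almost everywhere; they are
  clipped to [0,1], made periodic and approximated uniformly within 1/(n+1). The lower bound
  -1/(n+1) is recorded so that a constant can later restore nonnegativity.\<close>

lemma trigp_AE_approx:
  assumes f: "f \<in> borel_measurable L01" and b: "\<And>t. t \<in> {0..1} \<Longrightarrow> 0 \<le> f t \<and> f t \<le> 1"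
  obtains p where "\<And>n. trigp (p n)" "\<And>n t. t \<in> {0..1} \<Longrightarrow> - (1 / real (Suc n)) \<le> p n t"
    "\<And>n t. t \<in> {0..1} \<Longrightarrow> p n t \<le> 2" "AE t in L01. (\<lambda>n. p n t) \<longlonglongrightarrow> f t"
proof -
  have "f measurable_on {0..1}"
    using f by (subst measurable_on_iff_borel_measurable) auto
  then obtain Z g where Z: "negligible Z" and g: "\<And>n. continuous_on UNIV (g n)"
    and gl: "\<And>t. t \<notin> Z \<Longrightarrow> (\<lambda>n. g n t) \<longlonglongrightarrow> (if t \<in> {0..1} then f t else 0)"
    unfolding measurable_on_def by blast
  \<comment> \<open>The second factor vanishes at 0 and 1, which forces equal endpoint values, and
    it equals 1 at every interior point once n is large.\<close>
  define h where "h n t = max 0 (min 1 (g n t)) * min 1 (real n * (t * (1 - t)))" for n :: nat and t :: real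
  have hc: "continuous_on {0..1} (h n)" for n
    unfolding h_def by (intro continuous_intros continuous_on_subset[OF g]) auto
  have h01: "h n 0 = h n 1" for n by (simp add: h_def)
  have hb: "0 \<le> h n t \<and> h n t \<le> 1" if "t \<in> {0..1}" for n t
    using that unfolding h_def by (auto intro!: mult_nonneg_nonneg mult_le_one)
  have "\<exists>q. trigp q \<and> (\<forall>t\<in>{0..1}. \<bar>h n t - q t\<bar> < 1 / real (Suc n))" for n
    using trigp_dense[OF hc h01, of "1 / real (Suc n)" n] by (metis of_nat_0_less_iff zero_less_Suc zero_less_divide_1_iff)
  then obtain p where p: "\<And>n. trigp (p n)" "\<And>n t. t \<in> {0..1} \<Longrightarrow> \<bar>h n t - p n t\<bar> < 1 / real (Suc n)"
    by metis
  have le1: "1 / real (Suc n) \<le> 1" for n by simp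
  show ?thesis
  proof (rule that[OF p(1)])
    show "- (1 / real (Suc n)) \<le> p n t" "p n t \<le> 2" if "t \<in> {0..1}" for n t
      using p(2)[OF that, of n] hb[OF that, of n] le1[of n] by linarith+
    have "AE t in lebesgue. t \<in> {0..1} \<longrightarrow> (\<lambda>n. p n t) \<longlonglongrightarrow> f t"
    proof (rule AE_I')
      show "Z \<union> {0, 1} \<in> null_sets lebesgue"
        using Z negligible_iff_null_sets negligible_Un negligible_finite by blast
      have "(\<lambda>n. p n t) \<longlonglongrightarrow> f t" if t: "t \<in> {0..1}" "t \<notin> Z \<union> {0, 1}" for t
      proof -
        have gt: "(\<lambda>n. g n t) \<longlonglongrightarrow> f t" using gl[of t] t by auto
        have "t * (1 - t) > 0" using t by auto
        then obtain N where N: "1 / (t * (1 - t)) < real N" using reals_Archimedean2 by blast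
        have "min 1 (real n * (t * (1 - t))) = 1" if "n \<ge> N" for n
        proof -
          have "1 / (t * (1 - t)) \<le> real n" using N that by linarith
          then show ?thesis using \<open>t * (1 - t) > 0\<close> by (simp add: field_simps)
        qed
        then have "eventually (\<lambda>n. min 1 (real n * (t * (1 - t))) = 1) sequentially"
          by (auto simp: eventually_sequentially)
        then have "(\<lambda>n. h n t) \<longlonglongrightarrow> max 0 (min 1 (f t)) * 1"
          unfolding h_def by (intro tendsto_intros gt tendsto_eventually)
        then have hl: "(\<lambda>n. h n t) \<longlonglongrightarrow> f t" using b[OF t(1)] by simp
        have "(\<lambda>n. 1 / real (Suc n)) \<longlonglongrightarrow> 0" using LIMSEQ_inverse_real_of_nat by (simp add: inverse_eq_divide)
        then have "(\<lambda>n. h n t - p n t) \<longlonglongrightarrow> 0"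
          by (rule tendsto_0_le[of _ _ _ 1]) (use p(2)[OF t(1)] in \<open>auto intro!: always_eventually less_imp_le\<close>)
        from tendsto_diff[OF hl this] show ?thesis by simp
      qed
      then show "{t \<in> space lebesgue. \<not> (t \<in> {0..1} \<longrightarrow> (\<lambda>n. p n t) \<longlonglongrightarrow> f t)} \<subseteq> Z \<union> {0, 1}" by blast
    qed
    then show "AE t in L01. (\<lambda>n. p n t) \<longlonglongrightarrow> f t"
      by (subst AE_restrict_space_iff) auto
  qed
qed

lemma integral_cas_eq_0_imp_trigp:
  assumes "trigp p" "integrable L01 u" "\<And>m. (\<integral>t. cas m t * u t \<partial>L01) = 0"
  shows "integrable L01 (\<lambda>t. p t * u t) \<and> (\<integral>t. p t * u t \<partial>L01) = (0::real)"
  using assms(1)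
proof (induction rule: trigp.induct)
  case (cas m)
  have "integrable L01 (\<lambda>t. cas m t * u t)"
  proof (rule Bochner_Integration.integrable_bound)
    show "integrable L01 (\<lambda>t. 2 * norm (u t))" using assms(2) by simp
    show "(\<lambda>t. cas m t * u t) \<in> borel_measurable L01"
      using assms(2) trigp_measurable_L01[OF trigp.cas] by auto
    show "AE t in L01. norm (cas m t * u t) \<le> norm (2 * norm (u t))"
      by (intro AE_I2) (auto simp: abs_mult intro!: mult_right_mono abs_cas_le)
  qed
  then show ?case using assms(3) by simp
next
  case (add p q)
  then show ?case by (simp add: distrib_right)
next
  case (scale p c)
  then show ?case by (simp add: mult.assoc)
qed

text \<open>Vanishing coefficients mean vanishing integrals against trigonometric polynomials, and
  by dominated convergence against indicators of measurable sets; a function with zero integral over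
  every measurable set is null.\<close>

lemma L01_total:
  fixes u :: "real \<Rightarrow> real"
  assumes u: "integrable L01 u" and 0: "\<And>m. (\<integral>t. cas m t * u t \<partial>L01) = 0"
  shows "AE t in L01. u t = 0"
proof (rule L01.density_zero[OF u])
  fix A assume A: "A \<in> sets L01"
  obtain p where p: "\<And>n. trigp (p n)" "\<And>n t. t \<in> {0..1} \<Longrightarrow> - (1 / real (Suc n)) \<le> p n t"
    "\<And>n t. t \<in> {0..1} \<Longrightarrow> p n t \<le> 2" "AE t in L01. (\<lambda>n. p n t) \<longlonglongrightarrow> indicator A t"
    using trigp_AE_approx[of "indicator A"] A by (auto simp: indicator_def)
  have pb: "\<bar>p n t\<bar> \<le> 2" if "t \<in> {0..1}" for n t
  proof -
    have "1 / real (Suc n) \<le> 1" by simp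
    then show ?thesis using p(2,3)[OF that, of n] by linarith
  qed
  have "(\<lambda>n. \<integral>t. p n t * u t \<partial>L01) \<longlonglongrightarrow> (\<integral>t. indicator A t * u t \<partial>L01)"
  proof (rule integral_dominated_convergence[where w="\<lambda>t. 2 * \<bar>u t\<bar>"])
    show "AE t in L01. (\<lambda>n. p n t * u t) \<longlonglongrightarrow> indicator A t * u t"
      using p(4) by eventually_elim (intro tendsto_intros)
    show "AE t in L01. norm (p n t * u t) \<le> 2 * \<bar>u t\<bar>" for n
      by (intro AE_I2) (auto simp: abs_mult intro!: mult_right_mono pb)
  qed (use u A trigp_measurable_L01[OF p(1)] in auto)
  moreover have "(\<integral>t. p n t * u t \<partial>L01) = 0" for n
    using integral_cas_eq_0_imp_trigp[OF p(1) u 0] by simp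
  ultimately have "(\<integral>t. indicator A t * u t \<partial>L01) = 0"
    by (simp add: LIMSEQ_const_iff)
  then show "set_lebesgue_integral L01 A u = 0" by (simp add: set_lebesgue_integral_def)
qed

interpretation L01: orthonormal_basis L01 cas UNIV "\<lambda>_. 2" "\<lambda>K. {- int K..int K}"
proof
  show "cas i \<in> borel_measurable L01" for i by (rule trigp_measurable_L01[OF trigp.cas])
  show "(\<integral>x. cas i x * cas j x \<partial>L01) = (if i = j then 1 else 0)" for i j by (rule cas_ortho)
  show "mono (\<lambda>K. {- int K..int K})" by (auto intro!: monoI)
  show "(\<Union>K. {- int K..int K}) = UNIV"
  proof (intro set_eqI iffI UN_I)
    fix i :: int show "i \<in> {- int (nat \<bar>i\<bar>)..int (nat \<bar>i\<bar>)}" by auto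
  qed auto
qed (use abs_cas_le L01_total in auto)

section \<open>The cube\<close>

lemma emeasure_PiM_L01_space: "finite J \<Longrightarrow> emeasure (PiM J (\<lambda>_::nat. L01)) (space (PiM J (\<lambda>_. L01))) = 1"
  by (simp add: space_PiM L01P.emeasure_PiM emeasure_L01_space)

lemma finite_measure_PiM_L01: "finite J \<Longrightarrow> finite_measure (PiM J (\<lambda>_::nat. L01))"
  by (rule finite_measureI) (simp only: emeasure_PiM_L01_space, simp)

interpretation cube: finite_measure "cubeM N" for N
  unfolding cubeM_def by (rule finite_measure_PiM_L01) simp

lemma space_cubeM: "space (cubeM N) = PiE {..<N} (\<lambda>_. {0..1})"
  by (simp add: cubeM_def space_PiM)

lemma measurable_cubeM_component [measurable]: "j < N \<Longrightarrow> (\<lambda>x. x j) \<in> measurable (cubeM N) L01"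
  unfolding cubeM_def by (rule measurable_component_singleton) simp

lemma measurable_cubeM_comp:
  "j < N \<Longrightarrow> f \<in> borel_measurable L01 \<Longrightarrow> (\<lambda>x. f (x j)) \<in> borel_measurable (cubeM N)"
  by (rule measurable_compose[OF measurable_cubeM_component])

lemma AE_cubeM_component:
  assumes j: "j < N" and P: "AE t in L01. P t"
  shows "AE x in cubeM N. P (x j)"
proof -
  obtain Z where Z: "{t \<in> space L01. \<not> P t} \<subseteq> Z" "emeasure L01 Z = 0" "Z \<in> sets L01"
    using P by (rule AE_E)
  let ?E = "\<lambda>i. if i = j then Z else space L01"
  have "emeasure (cubeM N) (PiE {..<N} ?E) = (\<Prod>i<N. emeasure L01 (?E i))"
    unfolding cubeM_def using Z by (subst L01P.emeasure_PiM) auto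
  also have "\<dots> = 0" using j Z by (intro prod_zero) auto
  finally have 0: "emeasure (cubeM N) (PiE {..<N} ?E) = 0" .
  have s: "PiE {..<N} ?E \<in> sets (cubeM N)"
    unfolding cubeM_def using Z by (intro sets_PiM_I_finite) auto
  show ?thesis
  proof (rule AE_I)
    show "{x \<in> space (cubeM N). \<not> P (x j)} \<subseteq> PiE {..<N} ?E"
      using Z(1) j by (auto simp: space_cubeM PiE_iff extensional_def)
  qed (use 0 s in auto)
qed

lemma integral_cubeM_prod:
  fixes f :: "nat \<Rightarrow> real \<Rightarrow> 'b::{real_normed_field,banach,second_countable_topology}"
  assumes "\<And>i. i < N \<Longrightarrow> integrable L01 (f i)"
  shows "integrable (cubeM N) (\<lambda>x. \<Prod>i<N. f i (x i))"
    and "(\<integral>x. (\<Prod>i<N. f i (x i)) \<partial>cubeM N) = (\<Prod>i<N. \<integral>t. f i t \<partial>L01)"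
  unfolding cubeM_def using assms
  by (auto intro!: L01P.product_integrable_prod L01P.product_integral_prod)

section \<open>The product basis of the cube and its totality\<close>

definition bas :: "nat \<Rightarrow> (nat \<Rightarrow> int) \<Rightarrow> (nat \<Rightarrow> real) \<Rightarrow> real" where
  "bas N k x = (\<Prod>j<N. cas (k j) (x j))"

text \<open>Multi-indices are extensional, so two different ones differ at some coordinate below N,
  as orthogonality requires.\<close>

definition idx :: "nat \<Rightarrow> (nat \<Rightarrow> int) set" where
  "idx N = PiE {..<N} (\<lambda>_. UNIV)"

definition ibox :: "nat \<Rightarrow> nat \<Rightarrow> (nat \<Rightarrow> int) set" where
  "ibox N K = PiE {..<N} (\<lambda>_. {- int K..int K})"

lemma prod_trigp_bounded:
  assumes "\<And>j. j < N \<Longrightarrow> trigp (p j)"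
  shows "\<exists>B. \<forall>x. \<bar>\<Prod>j<N. p j (x j)\<bar> \<le> B"
proof -
  have "\<forall>j. \<exists>B. j < N \<longrightarrow> (\<forall>t. \<bar>p j t\<bar> \<le> B)" using trigp_bounded[OF assms] by blast
  then obtain B where B: "\<And>j t. j < N \<Longrightarrow> \<bar>p j t\<bar> \<le> B j" by metis
  have "\<bar>\<Prod>j<N. p j (x j)\<bar> \<le> (\<Prod>j<N. B j)" for x
    unfolding abs_prod by (intro prod_mono) (auto intro: B)
  then show ?thesis by blast
qed

lemma prod_measurable_cubeM:
  fixes p :: "nat \<Rightarrow> real \<Rightarrow> 'b::{real_normed_field,second_countable_topology}"
  assumes "\<And>j. j < N \<Longrightarrow> p j \<in> borel_measurable L01"
  shows "(\<lambda>x. \<Prod>j<N. p j (x j)) \<in> borel_measurable (cubeM N)"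
  by (intro borel_measurable_prod measurable_cubeM_comp assms) auto

lemma integrable_prod_trigp_mult:
  assumes p: "\<And>j. j < N \<Longrightarrow> trigp (p j)" and u: "integrable (cubeM N) (u :: _ \<Rightarrow> real)"
  shows "integrable (cubeM N) (\<lambda>x. (\<Prod>j<N. p j (x j)) * u x)"
proof -
  obtain B where B: "\<And>x. \<bar>\<Prod>j<N. p j (x j)\<bar> \<le> B" using prod_trigp_bounded[of N p] p by blast
  show ?thesis
  proof (rule Bochner_Integration.integrable_bound)
    show "integrable (cubeM N) (\<lambda>x. B * \<bar>u x\<bar>)" using u by simp
    show "(\<lambda>x. (\<Prod>j<N. p j (x j)) * u x) \<in> borel_measurable (cubeM N)"
      using u p by (intro borel_measurable_times prod_measurable_cubeM trigp_measurable_L01) auto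
    have "0 \<le> B" using B[of undefined] by linarith
    then show "AE x in cubeM N. norm ((\<Prod>j<N. p j (x j)) * u x) \<le> norm (B * \<bar>u x\<bar>)"
      by (intro AE_I2) (auto simp: abs_mult intro!: mult_right_mono B)
  qed
qed

lemma prod_fun_upd:
  fixes p :: "nat \<Rightarrow> 'a \<Rightarrow> 'b::comm_monoid_mult"
  assumes "n < N"
  shows "(\<Prod>j<N. (p(n := r)) j (x j)) = r (x n) * (\<Prod>j\<in>{..<N}-{n}. p j (x j))"
proof -
  have "(\<Prod>j<N. (p(n := r)) j (x j)) = (p(n := r)) n (x n) * (\<Prod>j\<in>{..<N}-{n}. (p(n := r)) j (x j))"
    using assms by (subst prod.remove[of _ n]) auto
  also have "(\<Prod>j\<in>{..<N}-{n}. (p(n := r)) j (x j)) = (\<Prod>j\<in>{..<N}-{n}. p j (x j))"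
    by (intro prod.cong) auto
  finally show ?thesis by simp
qed

text \<open>Hartley factors are replaced by arbitrary trigonometric polynomials one coordinate at a
  time. The outer induction counts the coordinates already released; the inner one runs over the
  polynomial at the next coordinate and uses linearity of the integral in it.\<close>

lemma bas_0_imp_prod_trigp_0:
  assumes u: "integrable (cubeM N) (u :: _ \<Rightarrow> real)"
    and 0: "\<And>k. k \<in> idx N \<Longrightarrow> (\<integral>x. bas N k x * u x \<partial>cubeM N) = 0"
    and "n \<le> N" "\<And>j. j < n \<Longrightarrow> trigp (p j)" "\<And>j. n \<le> j \<Longrightarrow> j < N \<Longrightarrow> \<exists>m. p j = cas m"
  shows "(\<integral>x. (\<Prod>j<N. p j (x j)) * u x \<partial>cubeM N) = 0"
  using assms(3-5)
proof (induction n arbitrary: p)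
  case 0
  then have "\<forall>j. \<exists>m. j < N \<longrightarrow> p j = cas m" by blast
  then obtain k where k: "\<And>j. j < N \<Longrightarrow> p j = cas (k j)" by metis
  have "(\<Prod>j<N. p j (x j)) = bas N (restrict k {..<N}) x" for x
    unfolding bas_def by (rule prod.cong) (auto simp: k)
  moreover have "restrict k {..<N} \<in> idx N" by (auto simp: idx_def)
  ultimately show ?case using assms(2) by simp
next
  case (Suc n)
  have tp: "trigp (p j)" if "j < N" for j
    using Suc.prems(2,3)[of j] that trigp.cas by (cases "j < Suc n") auto
  have "(\<integral>x. (\<Prod>j<N. (p(n := r)) j (x j)) * u x \<partial>cubeM N) = 0" if "trigp r" for r
    using that
  proof (induction rule: trigp.induct)
    case (cas m)
    show ?case
    proof (rule Suc.IH)
      fix j assume "j < n" then show "trigp ((p(n := cas m)) j)" using Suc.prems(2)[of j] by simp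
    next
      fix j assume "n \<le> j" "j < N" then show "\<exists>ma. (p(n := cas m)) j = cas ma"
        using Suc.prems(3)[of j] by (cases "j = n") auto
    qed (use Suc.prems in simp)
  next
    case (add r s)
    have n: "n < N" using Suc.prems by simp
    have i: "integrable (cubeM N) (\<lambda>x. (\<Prod>j<N. (p(n := q)) j (x j)) * u x)" if "trigp q" for q
      by (rule integrable_prod_trigp_mult[OF _ u]) (use tp that in auto)
    have "(\<integral>x. (\<Prod>j<N. (p(n := \<lambda>t. r t + s t)) j (x j)) * u x \<partial>cubeM N) =
      (\<integral>x. (\<Prod>j<N. (p(n := r)) j (x j)) * u x + (\<Prod>j<N. (p(n := s)) j (x j)) * u x \<partial>cubeM N)"
      unfolding prod_fun_upd[OF n] by (simp add: algebra_simps)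
    then show ?case using i add by simp
  next
    case (scale r c)
    have n: "n < N" using Suc.prems by simp
    have "(\<integral>x. (\<Prod>j<N. (p(n := \<lambda>t. c * r t)) j (x j)) * u x \<partial>cubeM N) =
      (\<integral>x. c * ((\<Prod>j<N. (p(n := r)) j (x j)) * u x) \<partial>cubeM N)"
      unfolding prod_fun_upd[OF n] by (simp add: algebra_simps)
    then show ?case using scale by simp
  qed
  from this[OF tp, of n] Suc.prems(1) show ?case by simp
qed

text \<open>As in one dimension, except that products of polynomials approximate only indicators of
  boxes. Boxes are closed under intersection and generate the product sigma-algebra, so a Dynkin
  argument reaches all measurable sets.\<close>

lemma cubeM_total:
  fixes u :: "(nat \<Rightarrow> real) \<Rightarrow> real"
  assumes u: "integrable (cubeM N) u"
    and 0: "\<And>k. k \<in> idx N \<Longrightarrow> (\<integral>x. bas N k x * u x \<partial>cubeM N) = 0"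
  shows "AE x in cubeM N. u x = 0"
proof (rule cube.density_zero[OF u])
  fix A assume A: "A \<in> sets (cubeM N)"
  let ?G = "{PiE {..<N} E | E. E \<in> ({..<N} \<rightarrow> sets L01)}"
  have rect: "(\<integral>x. indicator (PiE {..<N} E) x * u x \<partial>cubeM N) = 0" if E: "E \<in> {..<N} \<rightarrow> sets L01" for E
  proof -
    have "\<exists>p. (\<forall>n. trigp (p n)) \<and> (\<forall>n. \<forall>t\<in>{0..1}. \<bar>p n t\<bar> \<le> 2) \<and> (AE t in L01. (\<lambda>n. p n t) \<longlonglongrightarrow> indicator (E j) t)"
      if "j < N" for j
    proof -
      have "E j \<in> sets L01" using E that by auto
      then obtain p where p: "\<And>n. trigp (p n)" "\<And>n t. t \<in> {0..1} \<Longrightarrow> - (1 / real (Suc n)) \<le> p n t"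
        "\<And>n t. t \<in> {0..1} \<Longrightarrow> p n t \<le> 2" "AE t in L01. (\<lambda>n. p n t) \<longlonglongrightarrow> indicator (E j) t"
        using trigp_AE_approx[of "indicator (E j)"] by (auto simp: indicator_def)
      have pb: "\<bar>p n t\<bar> \<le> 2" if "t \<in> {0..1}" for n t
      proof -
        have "1 / real (Suc n) \<le> 1" by simp
        then show ?thesis using p(2,3)[OF that, of n] by linarith
      qed
      then show ?thesis using p by blast
    qed
    then have "\<forall>j. \<exists>p. j < N \<longrightarrow> ((\<forall>n. trigp (p n)) \<and> (\<forall>n. \<forall>t\<in>{0..1}. \<bar>p n t\<bar> \<le> 2) \<and> (AE t in L01. (\<lambda>n. p n t) \<longlonglongrightarrow> indicator (E j) t))"
      by blast
    from choice[OF this] obtain p where p: "\<And>j n. j < N \<Longrightarrow> trigp (p j n)"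
      "\<And>j n t. j < N \<Longrightarrow> t \<in> {0..1} \<Longrightarrow> \<bar>p j n t\<bar> \<le> 2"
      "\<And>j. j < N \<Longrightarrow> AE t in L01. (\<lambda>n. p j n t) \<longlonglongrightarrow> indicator (E j) t"
      by blast
    have "(\<lambda>n. \<integral>x. (\<Prod>j<N. p j n (x j)) * u x \<partial>cubeM N) \<longlonglongrightarrow> (\<integral>x. indicator (PiE {..<N} E) x * u x \<partial>cubeM N)"
    proof (rule integral_dominated_convergence[where w="\<lambda>x. 2 ^ N * \<bar>u x\<bar>"])
      have "AE x in cubeM N. \<forall>j\<in>{..<N}. (\<lambda>n. p j n (x j)) \<longlonglongrightarrow> indicator (E j) (x j)"
        by (intro AE_finite_allI) (auto intro!: AE_cubeM_component p(3))
      then show "AE x in cubeM N. (\<lambda>n. (\<Prod>j<N. p j n (x j)) * u x) \<longlonglongrightarrow> indicator (PiE {..<N} E) x * u x"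
        using AE_space
      proof eventually_elim
        case (elim x)
        have "(\<lambda>n. \<Prod>j<N. p j n (x j)) \<longlonglongrightarrow> (\<Prod>j<N. indicator (E j) (x j))"
          by (intro tendsto_prod) (use elim in auto)
        moreover have "(\<Prod>j<N. indicator (E j) (x j)) = (indicator (PiE {..<N} E) x :: real)"
        proof (cases "x \<in> PiE {..<N} E")
          case True
          then show ?thesis by (auto simp: PiE_iff intro!: prod.neutral)
        next
          case False
          then obtain j where "j < N" "x j \<notin> E j" using elim(2) by (auto simp: space_cubeM PiE_iff)
          then show ?thesis using False by (auto intro!: prod_zero bexI[of _ j])
        qed
        ultimately show ?case by (auto intro: tendsto_mult_right)
      qed
      show "AE x in cubeM N. norm ((\<Prod>j<N. p j n (x j)) * u x) \<le> 2 ^ N * \<bar>u x\<bar>" for n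
      proof (rule AE_I2)
        fix x assume x: "x \<in> space (cubeM N)"
        have "\<bar>\<Prod>j<N. p j n (x j)\<bar> \<le> (\<Prod>j<N. 2)"
          unfolding abs_prod using x by (intro prod_mono) (auto intro!: p(2) simp: space_cubeM PiE_iff)
        then show "norm ((\<Prod>j<N. p j n (x j)) * u x) \<le> 2 ^ N * \<bar>u x\<bar>"
          by (simp add: abs_mult mult_right_mono)
      qed
      show "(\<lambda>x. (\<Prod>j<N. p j n (x j)) * u x) \<in> borel_measurable (cubeM N)" for n
        using u p(1) by (intro borel_measurable_times prod_measurable_cubeM trigp_measurable_L01) auto
      have "PiE {..<N} E \<in> sets (cubeM N)"
        unfolding cubeM_def using E by (intro sets_PiM_I_finite) auto
      then show "(\<lambda>x. indicator (PiE {..<N} E) x * u x) \<in> borel_measurable (cubeM N)"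
        using u by measurable
    qed (use u in auto)
    moreover have "(\<integral>x. (\<Prod>j<N. p j n (x j)) * u x \<partial>cubeM N) = 0" for n
      by (rule bas_0_imp_prod_trigp_0[OF u 0 order_refl]) (use p(1) in auto)
    ultimately show ?thesis by (simp add: LIMSEQ_const_iff)
  qed
  have pa: "prod_algebra {..<N} (\<lambda>_. L01) = ?G"
    by (subst prod_algebra_eq_finite) auto
  have sets_eq: "sets (cubeM N) = sigma_sets (PiE {..<N} (\<lambda>_. space L01)) ?G"
    unfolding cubeM_def sets_PiM pa[symmetric] by simp
  have stable: "Int_stable ?G" unfolding pa[symmetric] by (rule Int_stable_prod_algebra)
  have closed: "?G \<subseteq> Pow (PiE {..<N} (\<lambda>_. space L01))"
    unfolding pa[symmetric] by (rule prod_algebra_sets_into_space)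
  have int: "integrable (cubeM N) (\<lambda>x. indicator B x * u x)" if "B \<in> sets (cubeM N)" for B
    using integrable_mult_indicator[OF that u] by simp
  \<comment> \<open>The cube is itself a box; the complement step of the Dynkin argument subtracts
    from it.\<close>
  have whole: "(\<integral>x. u x \<partial>cubeM N) = 0"
  proof -
    have "(\<integral>x. indicator (PiE {..<N} (\<lambda>_. {0..1})) x * u x \<partial>cubeM N) = (\<integral>x. u x \<partial>cubeM N)"
      by (rule Bochner_Integration.integral_cong) (auto simp: space_cubeM)
    with rect[of "\<lambda>_. {0..1}"] show ?thesis by (simp add: sets_restrict_space_iff)
  qed
  from A have A': "A \<in> sigma_sets (PiE {..<N} (\<lambda>_. space L01)) ?G" by (simp add: sets_eq)
  have "(\<integral>x. indicator A x * u x \<partial>cubeM N) = 0"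
    using stable closed A'
  proof (induction rule: sigma_sets_induct_disjoint)
    case (basic B)
    then show ?case using rect by auto
  next
    case empty
    then show ?case by simp
  next
    case (compl B)
    then have B: "B \<in> sets (cubeM N)" by (simp add: sets_eq)
    have "(\<integral>x. indicator (PiE {..<N} (\<lambda>_. space L01) - B) x * u x \<partial>cubeM N) = (\<integral>x. u x - indicator B x * u x \<partial>cubeM N)"
      by (rule Bochner_Integration.integral_cong) (auto simp: space_cubeM indicator_def)
    also have "\<dots> = 0" using u int[OF B] whole compl by simp
    finally show ?case .
  next
    case (union B)
    then have B: "B i \<in> sets (cubeM N)" for i by (auto simp: sets_eq)
    have "set_lebesgue_integral (cubeM N) (\<Union>i. B i) u = (\<Sum>i. set_lebesgue_integral (cubeM N) (B i) u)"
    proof (rule lebesgue_integral_countable_add)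
      show "set_integrable (cubeM N) (\<Union>i. B i) u"
        unfolding set_integrable_def using B u by (intro integrable_mult_indicator) auto
      show "B i \<inter> B j = {}" if "i \<noteq> j" for i j
        using union(1) that by (auto simp: disjoint_family_on_def)
    qed (rule B)
    then show ?case using union by (simp add: set_lebesgue_integral_def)
  qed
  then show "set_lebesgue_integral (cubeM N) A u = 0" by (simp add: set_lebesgue_integral_def)
qed

lemma bas_bounded: "\<bar>bas N k x\<bar> \<le> 2 ^ N"
proof -
  have "\<bar>\<Prod>j<N. cas (k j) (x j)\<bar> \<le> (\<Prod>j<N. 2)"
    unfolding abs_prod by (intro prod_mono) (auto simp: abs_cas_le)
  then show ?thesis by (simp add: bas_def)
qed

lemma bas_measurable [measurable]: "bas N k \<in> borel_measurable (cubeM N)"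
  unfolding bas_def by (intro prod_measurable_cubeM trigp_measurable_L01 trigp.cas)

lemma bas_ortho:
  assumes "k \<in> idx N" "l \<in> idx N"
  shows "(\<integral>x. bas N k x * bas N l x \<partial>cubeM N) = (if k = l then 1 else 0)"
proof -
  have "(\<integral>x. bas N k x * bas N l x \<partial>cubeM N) = (\<integral>x. (\<Prod>j<N. cas (k j) (x j) * cas (l j) (x j)) \<partial>cubeM N)"
    by (simp add: bas_def prod.distrib)
  also have "\<dots> = (\<Prod>j<N. \<integral>t. cas (k j) t * cas (l j) t \<partial>L01)"
    by (rule integral_cubeM_prod) (auto intro!: integrable_mult_sqint L01.sqint_e)
  also have "\<dots> = (\<Prod>j<N. if k j = l j then 1 else 0)" by (simp add: cas_ortho)
  also have "\<dots> = (if k = l then 1 else 0)"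
  proof (cases "k = l")
    case False
    then obtain j where "j < N" "k j \<noteq> l j"
      using assms unfolding idx_def by (metis PiE_ext lessThan_iff)
    then show ?thesis using False by (auto intro!: prod_zero bexI[of _ j])
  qed simp
  finally show ?thesis .
qed

interpretation cube: orthonormal_basis "cubeM N" "bas N" "idx N" "\<lambda>_. 2 ^ N" "ibox N" for N
proof
  show "mono (ibox N)" unfolding ibox_def by (intro monoI PiE_mono) auto
  show "(\<Union>K. ibox N K) = idx N"
  proof (intro set_eqI iffI)
    fix k assume k: "k \<in> idx N"
    define S where "S = (\<Sum>i<N. nat \<bar>k i\<bar>)"
    have S: "nat \<bar>k j\<bar> \<le> S" if "j < N" for j
      unfolding S_def using that by (intro member_le_sum) auto
    have "k j \<in> {- int S..int S}" if "j < N" for j using S[OF that] by auto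
    then have "k \<in> ibox N S" using k unfolding ibox_def idx_def by (auto simp: PiE_iff)
    then show "k \<in> (\<Union>K. ibox N K)" by blast
  qed (auto simp: ibox_def idx_def PiE_iff)
qed (auto simp: bas_bounded bas_ortho cubeM_total ibox_def finite_PiE)

section \<open>Splitting off coordinate 0: Fubini for marginals\<close>

text \<open>Coordinate 0 is kept, so y only carries the coordinates 1, ..., N - 1.\<close>

definition marg :: "nat \<Rightarrow> ((nat \<Rightarrow> real) \<Rightarrow> 'b::euclidean_space) \<Rightarrow> real \<Rightarrow> 'b" where
  "marg N F t = (\<integral>y. F (y(0 := t)) \<partial>PiM {1..<N} (\<lambda>_. L01))"

lemma lessThan_eq_insert_0: "N \<ge> 1 \<Longrightarrow> {..<N} = insert 0 {1..<N::nat}"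
  by auto

text \<open>A product measure is determined by its values on boxes, and the preimage of a box is its
  side in coordinate 0 times the box of the remaining sides. All Fubini statements about marginals
  reduce to this change of variables.\<close>

lemma distr_pair_cubeM:
  assumes N: "N \<ge> 1"
  shows "distr (L01 \<Otimes>\<^sub>M PiM {1..<N} (\<lambda>_. L01)) (cubeM N) (\<lambda>(t, y). y(0 := t)) = cubeM N"
proof -
  let ?R = "PiM {1..<N} (\<lambda>_::nat. L01)"
  interpret R: finite_measure ?R by (rule finite_measure_PiM_L01) simp
  have m: "(\<lambda>(t, y). y(0 := t)) \<in> measurable (L01 \<Otimes>\<^sub>M ?R) (PiM {..<N} (\<lambda>_. L01))"
    using measurable_compose[OF measurable_pair_swap' measurable_add_dim[of 0 "{1..<N}" "\<lambda>_. L01"]]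
    unfolding lessThan_eq_insert_0[OF N] by (simp add: split_beta')
  show ?thesis unfolding cubeM_def
  proof (rule L01P.PiM_eqI)
    fix A :: "nat \<Rightarrow> real set" assume A: "\<And>i. i \<in> {..<N} \<Longrightarrow> A i \<in> sets L01"
    have "(\<lambda>(t, y). y(0 := t)) -` PiE {..<N} A \<inter> space (L01 \<Otimes>\<^sub>M ?R) = A 0 \<times> PiE {1..<N} A"
    proof (intro set_eqI iffI)
      fix p assume p: "p \<in> A 0 \<times> PiE {1..<N} A"
      obtain t y where ty: "p = (t, y)" by (cases p)
      have t: "t \<in> A 0" and y: "y \<in> PiE {1..<N} A" using p by (auto simp: ty)
      have sub: "A i \<subseteq> {0..1}" if "i < N" for i
        using A[of i, THEN sets.sets_into_space] that by simp
      have "y(0 := t) \<in> PiE (insert 0 {1..<N}) A"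
        using t y by (intro PiE_fun_upd) auto
      moreover have "t \<in> {0..1}" using sub[of 0] t N by auto
      moreover have "y \<in> PiE {1..<N} (\<lambda>_. {0..1})"
        using y sub PiE_mono[of "{1..<N}" A "\<lambda>_. {0..1}"] by auto
      ultimately show "p \<in> (\<lambda>(t, y). y(0 := t)) -` PiE {..<N} A \<inter> space (L01 \<Otimes>\<^sub>M ?R)"
        unfolding lessThan_eq_insert_0[OF N, symmetric] by (simp add: ty space_pair_measure space_PiM)
    next
      fix p assume p: "p \<in> (\<lambda>(t, y). y(0 := t)) -` PiE {..<N} A \<inter> space (L01 \<Otimes>\<^sub>M ?R)"
      obtain t y where ty: "p = (t, y)" by (cases p)
      have 1: "y(0 := t) \<in> PiE {..<N} A" and y: "y \<in> PiE {1..<N} (\<lambda>_. {0..1})"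
        using p by (auto simp: ty space_pair_measure space_PiM)
      have "t \<in> A 0" using PiE_mem[OF 1, of 0] N by simp
      moreover have "y i \<in> A i" if "i \<in> {1..<N}" for i using PiE_mem[OF 1, of i] that by simp
      ultimately show "p \<in> A 0 \<times> PiE {1..<N} A" using y by (auto simp: ty PiE_iff)
    qed
    then have "emeasure (distr (L01 \<Otimes>\<^sub>M ?R) (PiM {..<N} (\<lambda>_. L01)) (\<lambda>(t, y). y(0 := t))) (PiE {..<N} A)
        = emeasure (L01 \<Otimes>\<^sub>M ?R) (A 0 \<times> PiE {1..<N} A)"
      using A by (subst emeasure_distr[OF m]) (auto intro!: sets_PiM_I_finite)
    also have "\<dots> = emeasure L01 (A 0) * emeasure ?R (PiE {1..<N} A)"
      using A N by (intro R.emeasure_pair_measure_Times sets_PiM_I_finite) auto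
    also have "\<dots> = emeasure L01 (A 0) * (\<Prod>i\<in>{1..<N}. emeasure L01 (A i))"
      using A by (subst L01P.emeasure_PiM) auto
    also have "\<dots> = (\<Prod>i<N. emeasure L01 (A i))"
      unfolding lessThan_eq_insert_0[OF N] by simp
    finally show "emeasure (distr (L01 \<Otimes>\<^sub>M ?R) (PiM {..<N} (\<lambda>_. L01)) (\<lambda>(t, y). y(0 := t))) (PiE {..<N} A)
      = (\<Prod>i<N. emeasure L01 (A i))" .
  qed simp_all
qed

lemma measurable_pair_cubeM:
  assumes N: "N \<ge> 1"
  shows "(\<lambda>(t, y). y(0 := t)) \<in> measurable (L01 \<Otimes>\<^sub>M PiM {1..<N} (\<lambda>_. L01)) (cubeM N)"
  using measurable_compose[OF measurable_pair_swap' measurable_add_dim[of 0 "{1..<N}" "\<lambda>_. L01"]]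
  unfolding cubeM_def lessThan_eq_insert_0[OF N] by (simp add: split_beta')

lemma marg_integral:
  assumes N: "N \<ge> 1" and F: "integrable (cubeM N) (F :: _ \<Rightarrow> 'b::euclidean_space)"
  shows "AE t in L01. integrable (PiM {1..<N} (\<lambda>_. L01)) (\<lambda>y. F (y(0 := t)))"
    and "integrable L01 (marg N F)" and "(\<integral>t. marg N F t \<partial>L01) = (\<integral>x. F x \<partial>cubeM N)"
proof -
  let ?R = "PiM {1..<N} (\<lambda>_::nat. L01)"
  interpret R: finite_measure ?R by (rule finite_measure_PiM_L01) simp
  interpret P: pair_sigma_finite L01 ?R ..
  note m = measurable_pair_cubeM[OF N]
  have Fm: "F \<in> borel_measurable (cubeM N)" using F by simp
  have i: "integrable (L01 \<Otimes>\<^sub>M ?R) (\<lambda>(t, y). F (y(0 := t)))"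
  proof -
    have "integrable (L01 \<Otimes>\<^sub>M ?R) (\<lambda>p. F ((\<lambda>(t, y). y(0 := t)) p))"
      using F unfolding integrable_distr_eq[OF m Fm, symmetric] distr_pair_cubeM[OF N] .
    then show ?thesis by (simp add: split_beta')
  qed
  show "AE t in L01. integrable ?R (\<lambda>y. F (y(0 := t)))"
    using P.AE_integrable_fst'[OF i] by simp
  show "integrable L01 (marg N F)"
    using P.integrable_fst'[OF i] by (simp add: marg_def[abs_def])
  have "(\<integral>x. F x \<partial>cubeM N) = (\<integral>p. F ((\<lambda>(t, y). y(0 := t)) p) \<partial>(L01 \<Otimes>\<^sub>M ?R))"
    using integral_distr[OF m Fm] unfolding distr_pair_cubeM[OF N] .
  also have "\<dots> = (\<integral>t. marg N F t \<partial>L01)"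
    using P.integral_fst'[OF i] by (simp add: marg_def split_beta')
  finally show "(\<integral>t. marg N F t \<partial>L01) = (\<integral>x. F x \<partial>cubeM N)" by simp
qed

lemma marg_mult:
  assumes N: "N \<ge> 1"
  shows "marg N (\<lambda>x. \<phi> (x 0) *\<^sub>R F x) t = \<phi> t *\<^sub>R marg N F t"
  by (simp add: marg_def)

section \<open>Weak derivatives on the torus\<close>

lemma ptestI:
  assumes "\<And>t. f (t + 1) = f t" "\<And>t. (f has_real_derivative f' t) (at t)" "continuous_on UNIV f'"
  shows "ptest f"
  using assms unfolding ptest_def by blast

lemma ptestD:
  assumes "ptest f"
  shows "f (t + 1) = f t" "(f has_real_derivative deriv f t) (at t)" "continuous_on A f" "continuous_on A (deriv f)"
proof -
  obtain f' where f': "continuous_on UNIV f'" "\<And>t. (f has_real_derivative f' t) (at t)"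
    using assms unfolding ptest_def by blast
  have d: "deriv f = f'" using f'(2) by (auto intro: DERIV_imp_deriv)
  show "f (t + 1) = f t" using assms by (simp add: ptest_def)
  show "(f has_real_derivative deriv f t) (at t)" using f'(2) by (simp add: d)
  show "continuous_on A f" using f'(2) by (meson DERIV_continuous_on has_field_derivative_at_within)
  show "continuous_on A (deriv f)" using f'(1) unfolding d by (rule continuous_on_subset) simp
qed

lemma ptest_bounded:
  assumes "ptest f"
  obtains B where "B \<ge> 0" "\<And>t. t \<in> {0..1} \<Longrightarrow> \<bar>f t\<bar> \<le> B" "\<And>t. t \<in> {0..1} \<Longrightarrow> \<bar>deriv f t\<bar> \<le> B"
proof -
  have "bounded (f ` {0..1})" "bounded (deriv f ` {0..1})"
    using assms by (auto intro!: compact_imp_bounded compact_continuous_image ptestD)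
  then obtain B C where "\<forall>t\<in>{0..1}. \<bar>f t\<bar> \<le> B" "\<forall>t\<in>{0..1}. \<bar>deriv f t\<bar> \<le> C"
    unfolding bounded_iff by auto
  then show ?thesis by (intro that[of "max 0 (max B C)"]) force+
qed

lemma continuous_measurable_L01: "continuous_on {0..1} f \<Longrightarrow> f \<in> borel_measurable L01"
  by (rule continuous_imp_measurable_on_sets_lebesgue) auto

lemma ptest_measurable: "ptest f \<Longrightarrow> f \<in> borel_measurable L01" "ptest f \<Longrightarrow> deriv f \<in> borel_measurable L01"
  by (intro continuous_measurable_L01 ptestD; assumption)+

lemma ptest_mult:
  assumes "ptest f" "ptest g"
  shows "ptest (\<lambda>t. f t * g t)" "deriv (\<lambda>t. f t * g t) t = deriv f t * g t + f t * deriv g t"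
proof -
  have d: "((\<lambda>t. f t * g t) has_real_derivative deriv f t * g t + f t * deriv g t) (at t)" for t
    by (auto intro!: derivative_eq_intros ptestD(2) assms)
  show "ptest (\<lambda>t. f t * g t)"
    by (rule ptestI[OF _ d]) (simp add: ptestD(1)[OF assms(1)] ptestD(1)[OF assms(2)],
      intro continuous_intros ptestD(3,4) assms)
  show "deriv (\<lambda>t. f t * g t) t = deriv f t * g t + f t * deriv g t"
    by (rule DERIV_imp_deriv[OF d])
qed

text \<open>Only a function of mean zero has a periodic primitive, hence the subtracted mean. For a
  nonconstant Hartley function the primitive is explicit, with the constant chosen to make it vanish
  at 0.\<close>

lemma trigp_primitive:
  assumes "trigp p"
  shows "\<exists>\<phi>. trigp \<phi> \<and> (\<forall>t. \<phi> (t + 1) = \<phi> t) \<and> \<phi> 0 = 0 \<and>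
    (\<forall>t. (\<phi> has_real_derivative p t - (\<integral>t. p t \<partial>L01)) (at t))"
  using assms
proof (induction rule: trigp.induct)
  case (cas m)
  show ?case
  proof (cases "m = 0")
    case True
    then show ?thesis by (intro exI[of _ "\<lambda>_. 0"]) (simp add: integral_cas trigp_const)
  next
    case False
    have "trigp (\<lambda>t. 1 / (2 * pi * of_int m) + (- (1 / (2 * pi * of_int m))) * cas (- m) t)"
      by (intro trigp.add trigp_const trigp.scale trigp.cas)
    then have "trigp (\<lambda>t. (1 - cas (- m) t) / (2 * pi * of_int m))"
      by (simp add: diff_divide_distrib)
    then show ?thesis
      by (intro exI[of _ "\<lambda>t. (1 - cas (- m) t) / (2 * pi * of_int m)"])
        (use False in \<open>auto intro!: derivative_eq_intros cas_deriv simp: cas_periodic integral_cas; simp add: cas_def\<close>)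
  qed
next
  case (add p q)
  then obtain \<phi> \<psi> where
    "trigp \<phi>" "\<forall>t. \<phi> (t + 1) = \<phi> t" "\<phi> 0 = 0" "\<forall>t. (\<phi> has_real_derivative p t - (\<integral>t. p t \<partial>L01)) (at t)"
    "trigp \<psi>" "\<forall>t. \<psi> (t + 1) = \<psi> t" "\<psi> 0 = 0" "\<forall>t. (\<psi> has_real_derivative q t - (\<integral>t. q t \<partial>L01)) (at t)"
    by blast
  moreover have "integrable L01 p" "integrable L01 q"
    using add by (auto intro!: continuous_imp_integrable_real trigp_continuous)
  ultimately show ?case
    by (intro exI[of _ "\<lambda>t. \<phi> t + \<psi> t"]) (auto intro!: derivative_eq_intros trigp.add)
next
  case (scale p c)
  then obtain \<phi> where
    "trigp \<phi>" "\<forall>t. \<phi> (t + 1) = \<phi> t" "\<phi> 0 = 0" "\<forall>t. (\<phi> has_real_derivative p t - (\<integral>t. p t \<partial>L01)) (at t)"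
    by blast
  then show ?case
    by (intro exI[of _ "\<lambda>t. c * \<phi> t"]) (auto intro!: derivative_eq_intros trigp.scale simp: algebra_simps)
qed

section \<open>Sup bounds and uniqueness for weak derivatives on the torus\<close>

lemma trigp_integrable_mult:
  assumes "trigp p" "integrable L01 (u :: real \<Rightarrow> real)" shows "integrable L01 (\<lambda>t. p t * u t)"
proof -
  obtain B where B: "\<And>t. \<bar>p t\<bar> \<le> B" using trigp_bounded[OF assms(1)] by blast
  have B0: "B \<ge> 0" using B[of 0] by linarith
  show ?thesis
  proof (rule Bochner_Integration.integrable_bound)
    show "integrable L01 (\<lambda>t. B * \<bar>u t\<bar>)" using assms(2) by simp
    show "AE t in L01. norm (p t * u t) \<le> norm (B * \<bar>u t\<bar>)"
      using B B0 by (intro AE_I2) (auto simp: abs_mult intro!: mult_right_mono)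
  qed (use assms trigp_measurable_L01 in auto)
qed

text \<open>Nonnegative polynomials approximating the indicator of the set where \<open>A\<close>
  exceeds C turn the tested inequality into a nonpositive integral of a nonnegative function over
  that set.\<close>

lemma AE_le_of_trigp:
  assumes A: "integrable L01 (A :: real \<Rightarrow> real)"
    and le: "\<And>p. trigp p \<Longrightarrow> (\<And>t. t \<in> {0..1} \<Longrightarrow> 0 \<le> p t) \<Longrightarrow> (\<integral>t. p t * A t \<partial>L01) \<le> C * (\<integral>t. p t \<partial>L01)"
  shows "AE t in L01. A t \<le> C"
proof -
  let ?S = "{t \<in> space L01. A t > C}"
  have Am: "A \<in> borel_measurable L01" using A by simp
  have S: "?S \<in> sets L01"
    by (rule borel_measurable_less) (use Am in auto)
  obtain p where p: "\<And>n. trigp (p n)" "\<And>n t. t \<in> {0..1} \<Longrightarrow> - (1 / real (Suc n)) \<le> p n t"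
    "\<And>n t. t \<in> {0..1} \<Longrightarrow> p n t \<le> 2" "AE t in L01. (\<lambda>n. p n t) \<longlonglongrightarrow> indicator ?S t"
    using trigp_AE_approx[of "indicator ?S"] S by (auto simp: indicator_def)
  \<comment> \<open>The added 1/(n+1) makes the approximants nonnegative, hence admissible in the
    hypothesis, without changing their limit.\<close>
  define q where "q n t = p n t + 1 / real (Suc n)" for n t
  have q: "trigp (q n)" for n unfolding q_def by (intro trigp.add p trigp_const)
  have q0: "0 \<le> q n t" if "t \<in> {0..1}" for n t using p(2)[OF that, of n] by (simp add: q_def)
  have le1: "1 / real (Suc n) \<le> 1" for n by simp
  have q3: "q n t \<le> 3" if "t \<in> {0..1}" for n t using p(3)[OF that, of n] le1[of n] unfolding q_def by linarith
  have ql: "AE t in L01. (\<lambda>n. q n t) \<longlonglongrightarrow> indicator ?S t"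
    using p(4)
  proof eventually_elim
    case (elim t)
    have "(\<lambda>n. 1 / real (Suc n)) \<longlonglongrightarrow> 0" using LIMSEQ_inverse_real_of_nat by (simp add: inverse_eq_divide)
    from tendsto_add[OF elim this] show ?case by (simp add: q_def)
  qed
  have lim: "(\<lambda>n. \<integral>t. q n t * w t \<partial>L01) \<longlonglongrightarrow> (\<integral>t. indicator ?S t * w t \<partial>L01)"
    if w: "integrable L01 w" for w :: "real \<Rightarrow> real"
  proof (rule integral_dominated_convergence[where w="\<lambda>t. 3 * \<bar>w t\<bar>"])
    show "AE t in L01. (\<lambda>n. q n t * w t) \<longlonglongrightarrow> indicator ?S t * w t"
      using ql by eventually_elim (intro tendsto_intros)
    show "AE t in L01. norm (q n t * w t) \<le> 3 * \<bar>w t\<bar>" for n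
      using q0 q3 by (intro AE_I2) (auto simp: abs_mult intro!: mult_right_mono)
    show "(\<lambda>t. indicator ?S t * w t) \<in> borel_measurable L01"
      using w S by (intro borel_measurable_times borel_measurable_indicator) auto
    show "integrable L01 (\<lambda>t. 3 * \<bar>w t\<bar>)" using w by simp
    show "(\<lambda>t. q n t * w t) \<in> borel_measurable L01" for n
      using w trigp_measurable_L01[OF q] by auto
  qed
  have i1: "integrable L01 (\<lambda>_. 1::real)" by simp
  have "(\<integral>t. indicator ?S t * A t \<partial>L01) \<le> (\<integral>t. indicator ?S t * C \<partial>L01)"
  proof (rule LIMSEQ_le[OF lim[OF A]])
    show "(\<lambda>n. \<integral>t. q n t * C \<partial>L01) \<longlonglongrightarrow> (\<integral>t. indicator ?S t * C \<partial>L01)"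
      by (rule lim) simp
    show "\<exists>n0. \<forall>n\<ge>n0. (\<integral>t. q n t * A t \<partial>L01) \<le> (\<integral>t. q n t * C \<partial>L01)"
      using le[OF q q0] by (simp add: mult.commute)
  qed
  moreover have i: "integrable L01 (\<lambda>t. indicator ?S t * A t)" "integrable L01 (\<lambda>t. indicator ?S t * C)"
    using integrable_mult_indicator[OF S A] integrable_mult_indicator[OF S, of "\<lambda>_. C"] by simp_all
  ultimately have le0: "(\<integral>t. indicator ?S t * (A t - C) \<partial>L01) \<le> 0"
    by (simp add: right_diff_distrib)
  have nn: "AE t in L01. 0 \<le> indicator ?S t * (A t - C)" by (intro AE_I2) (auto simp: indicator_def)
  have ii: "integrable L01 (\<lambda>t. indicator ?S t * (A t - C))" using i by (simp add: right_diff_distrib)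
  have "(\<integral>t. indicator ?S t * (A t - C) \<partial>L01) = 0"
    using le0 integral_nonneg_AE[OF nn] by linarith
  with integral_nonneg_eq_0_iff_AE[OF ii nn] have "AE t in L01. indicator ?S t * (A t - C) = 0" by simp
  then show ?thesis using AE_space
    by eventually_elim (auto simp: indicator_def split: if_splits)
qed

text \<open>One-dimensional Sobolev embedding by duality. The periodic primitive of p minus its mean
  is a test function and is bounded by the mean of p, so testing with it bounds the average of
  \<open>A\<close> against any p at least 0 by mean plus L1 norm of the derivative.\<close>

lemma wderivT_sup:
  assumes A: "integrable L01 A" and r: "integrable L01 r" and w: "wderivT A r"
  shows "AE t in L01. A t \<le> (\<integral>t. A t \<partial>L01) + (\<integral>t. \<bar>r t\<bar> \<partial>L01)"
proof (rule AE_le_of_trigp[OF A])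
  fix p assume p: "trigp p" "\<And>t. t \<in> {0..1} \<Longrightarrow> 0 \<le> p t"
  define m where "m = (\<integral>t. p t \<partial>L01)"
  obtain \<phi> where \<phi>: "\<forall>t. \<phi> (t + 1) = \<phi> t" "\<phi> 0 = 0" "\<forall>t. (\<phi> has_real_derivative p t - m) (at t)"
    using trigp_primitive[OF p(1)] unfolding m_def by blast
  have pt: "ptest \<phi>"
    by (rule ptestI[where f'="\<lambda>t. p t - m"]) (simp_all add: \<phi> continuous_on_diff trigp_continuous[OF p(1)])
  have d: "deriv \<phi> t = p t - m" for t using \<phi>(3) by (auto intro: DERIV_imp_deriv)
  have m0: "m \<ge> 0" unfolding m_def by (intro integral_nonneg_AE AE_I2) (use p in auto)
  \<comment> \<open>Since p is nonnegative, \<phi> t + m * t increases from 0 to m on the interval,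
    so \<phi> lies between -m * t and m - m * t.\<close>
  have b: "\<bar>\<phi> t\<bar> \<le> m" if t: "t \<in> {0..1}" for t
  proof -
    have dd: "((\<lambda>t. \<phi> t + m * t) has_real_derivative p t) (at t)" for t
      using \<phi>(3) by (auto intro!: derivative_eq_intros)
    have "\<phi> 0 + m * 0 \<le> \<phi> t + m * t"
      by (rule DERIV_nonneg_imp_nondecreasing) (use t p dd in \<open>auto intro!: exI[of _ "p _"]\<close>)
    moreover have "\<phi> t + m * t \<le> \<phi> 1 + m * 1"
      by (rule DERIV_nonneg_imp_nondecreasing) (use t p dd in \<open>auto intro!: exI[of _ "p _"]\<close>)
    moreover have "\<phi> 1 = 0" using \<phi>(1)[rule_format, of 0] \<phi>(2) by simp
    moreover have "0 \<le> m * t" "m * t \<le> m * 1" using m0 t by (auto intro!: mult_left_mono simp del: mult_1_right)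
    ultimately show ?thesis using \<phi>(2) by (simp add: abs_le_iff)
  qed
  have pA: "integrable L01 (\<lambda>t. p t * A t)" by (rule trigp_integrable_mult[OF p(1) A])
  have "(\<integral>t. A t * (p t - m) \<partial>L01) = - (\<integral>t. r t * \<phi> t \<partial>L01)"
    using w pt unfolding wderivT_def by (auto simp: d)
  moreover have "(\<integral>t. A t * (p t - m) \<partial>L01) = (\<integral>t. p t * A t \<partial>L01) - m * (\<integral>t. A t \<partial>L01)"
  proof -
    have "(\<integral>t. A t * (p t - m) \<partial>L01) = (\<integral>t. p t * A t - m * A t \<partial>L01)"
      by (rule Bochner_Integration.integral_cong) (auto simp: algebra_simps)
    then show ?thesis using pA A by simp
  qed
  moreover have "- (\<integral>t. r t * \<phi> t \<partial>L01) \<le> m * (\<integral>t. \<bar>r t\<bar> \<partial>L01)"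
  proof -
    have le: "norm (r t * \<phi> t) \<le> m * \<bar>r t\<bar>" if "t \<in> {0..1}" for t
      using mult_left_mono[OF b[OF that], of "\<bar>r t\<bar>"] by (simp add: abs_mult mult.commute)
    have ir: "integrable L01 (\<lambda>t. r t * \<phi> t)"
    proof (rule Bochner_Integration.integrable_bound)
      show "integrable L01 (\<lambda>t. m * \<bar>r t\<bar>)" using r by simp
      show "AE t in L01. norm (r t * \<phi> t) \<le> norm (m * \<bar>r t\<bar>)"
        using le by (intro AE_I2) (auto intro: order_trans[OF _ abs_ge_self])
    qed (use r ptest_measurable(1)[OF pt] in auto)
    have "- (\<integral>t. r t * \<phi> t \<partial>L01) = (\<integral>t. - (r t * \<phi> t) \<partial>L01)" by simp
    also have "\<dots> \<le> (\<integral>t. m * \<bar>r t\<bar> \<partial>L01)"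
      by (rule integral_mono) (use ir r le in \<open>auto simp: abs_le_iff\<close>)
    finally show ?thesis by simp
  qed
  ultimately show "(\<integral>t. p t * A t \<partial>L01) \<le> ((\<integral>t. A t \<partial>L01) + (\<integral>t. \<bar>r t\<bar> \<partial>L01)) * (\<integral>t. p t \<partial>L01)"
    by (simp add: m_def[symmetric] algebra_simps)
qed

lemma wderivT_linear:
  assumes "integrable L01 f" "integrable L01 g" "integrable L01 r" "integrable L01 s" "wderivT f r" "wderivT g s"
  shows "wderivT (\<lambda>t. a * f t + b * g t) (\<lambda>t. a * r t + b * s t)"
  unfolding wderivT_def
proof (intro allI impI)
  fix \<phi> assume \<phi>: "ptest \<phi>"
  obtain B where B: "B \<ge> 0" "\<And>t. t \<in> {0..1} \<Longrightarrow> \<bar>\<phi> t\<bar> \<le> B" "\<And>t. t \<in> {0..1} \<Longrightarrow> \<bar>deriv \<phi> t\<bar> \<le> B"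
    using ptest_bounded[OF \<phi>] by blast
  have i: "integrable L01 (\<lambda>t. f t * h t)" if f: "integrable L01 f" and h: "h \<in> borel_measurable L01" "\<And>t. t \<in> {0..1} \<Longrightarrow> \<bar>h t\<bar> \<le> B" for f h :: "real \<Rightarrow> real"
  proof (rule Bochner_Integration.integrable_bound)
    show "integrable L01 (\<lambda>t. B * \<bar>f t\<bar>)" using f by simp
    show "AE t in L01. norm (f t * h t) \<le> norm (B * \<bar>f t\<bar>)"
      using h(2) B(1) by (intro AE_I2) (auto simp: abs_mult mult.commute[of B] intro!: mult_left_mono)
  qed (use f h in auto)
  note m = ptest_measurable[OF \<phi>]
  have "(\<integral>t. (a * f t + b * g t) * deriv \<phi> t \<partial>L01) = (\<integral>t. a * (f t * deriv \<phi> t) + b * (g t * deriv \<phi> t) \<partial>L01)"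
    by (rule Bochner_Integration.integral_cong) (auto simp: algebra_simps)
  also have "\<dots> = a * (\<integral>t. f t * deriv \<phi> t \<partial>L01) + b * (\<integral>t. g t * deriv \<phi> t \<partial>L01)"
    using i[OF assms(1) m(2) B(3)] i[OF assms(2) m(2) B(3)] by simp
  also have "\<dots> = - (a * (\<integral>t. r t * \<phi> t \<partial>L01) + b * (\<integral>t. s t * \<phi> t \<partial>L01))"
    using assms(5,6) \<phi> by (simp add: wderivT_def)
  also have "\<dots> = - (\<integral>t. a * (r t * \<phi> t) + b * (s t * \<phi> t) \<partial>L01)"
    using i[OF assms(3) m(1) B(2)] i[OF assms(4) m(1) B(2)] by simp
  also have "(\<integral>t. a * (r t * \<phi> t) + b * (s t * \<phi> t) \<partial>L01) = (\<integral>t. (a * r t + b * s t) * \<phi> t \<partial>L01)"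
    by (rule Bochner_Integration.integral_cong) (auto simp: algebra_simps)
  finally show "(\<integral>t. (a * f t + b * g t) * deriv \<phi> t \<partial>L01) = - (\<integral>t. (a * r t + b * s t) * \<phi> t \<partial>L01)" .
qed

lemma wderivT_abs_le:
  assumes f: "integrable L01 f" and r: "integrable L01 r" and w: "wderivT f r" and 0: "(\<integral>t. f t \<partial>L01) = 0"
  shows "AE t in L01. \<bar>f t\<bar> \<le> (\<integral>t. \<bar>r t\<bar> \<partial>L01)"
proof -
  have "wderivT (\<lambda>t. - f t) (\<lambda>t. - r t)"
    using wderivT_linear[OF f f r r w w, of "-1" 0] by simp
  from wderivT_sup[OF _ _ this] wderivT_sup[OF f r w] f r 0
  have "AE t in L01. - f t \<le> (\<integral>t. \<bar>r t\<bar> \<partial>L01)" "AE t in L01. f t \<le> (\<integral>t. \<bar>r t\<bar> \<partial>L01)" by simp_all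
  then show ?thesis by eventually_elim (simp add: abs_le_iff)
qed

text \<open>Hartley functions are admissible test functions, so all coefficients of the difference
  vanish.\<close>

lemma wderivT_unique:
  assumes r: "integrable L01 r" and s: "integrable L01 s" and w: "wderivT f r" "wderivT f s"
  shows "AE t in L01. r t = s t"
proof -
  have "AE t in L01. r t - s t = 0"
  proof (rule L01_total)
    fix m
    have "(\<integral>t. cas m t * (r t - s t) \<partial>L01) = (\<integral>t. cas m t * r t - cas m t * s t \<partial>L01)"
      by (simp add: algebra_simps)
    also have "\<dots> = (\<integral>t. r t * cas m t \<partial>L01) - (\<integral>t. s t * cas m t \<partial>L01)"
      using trigp_integrable_mult[OF trigp.cas r] trigp_integrable_mult[OF trigp.cas s] by (simp add: mult.commute)
    also have "\<dots> = 0"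
      using w[unfolded wderivT_def, rule_format, OF ptest_cas[of m]] by simp
    finally show "(\<integral>t. cas m t * (r t - s t) \<partial>L01) = 0" .
  qed (use r s in simp)
  then show ?thesis by eventually_elim simp
qed

lemma integral_wderivT_0:
  assumes "wderivT f r" shows "(\<integral>t. r t \<partial>L01) = 0"
  using assms[unfolded wderivT_def, rule_format, OF ptest_cas[of 0]] by simp

lemma L2T_iff: "L2T f \<longleftrightarrow> sqint L01 f"
  by (simp add: L2T_def sqint_def)

lemma sqint_L01_integrable: "sqint L01 (f :: real \<Rightarrow> 'b::euclidean_space) \<Longrightarrow> integrable L01 f"
  by (rule cs_integrable(1)[OF L01.sqint_bounded[of "\<lambda>_. 1::real" 1], of f f 1]) (auto intro: sqint_measurable)

lemma sqint_cubeM_integrable: "sqint (cubeM N) (f :: _ \<Rightarrow> 'b::euclidean_space) \<Longrightarrow> integrable (cubeM N) f"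
  by (rule cs_integrable(1)[OF cube.sqint_bounded[of "\<lambda>_. 1::real" N 1], of f f 1]) (auto intro: sqint_measurable)

lemma gradT_AE:
  assumes "L2T r" "wderivT f r"
  shows "L2T (gradT f)" "wderivT f (gradT f)" "AE t in L01. gradT f t = r t"
proof -
  have "L2T (gradT f) \<and> wderivT f (gradT f)"
    unfolding gradT_def by (rule someI[of _ r]) (use assms in auto)
  then show "L2T (gradT f)" "wderivT f (gradT f)" by auto
  then show "AE t in L01. gradT f t = r t"
    using assms by (intro wderivT_unique sqint_L01_integrable) (auto simp: L2T_iff)
qed

section \<open>Weak partial derivatives on the cube\<close>

definition tst :: "nat \<Rightarrow> (nat \<Rightarrow> real \<Rightarrow> real) \<Rightarrow> (nat \<Rightarrow> real) \<Rightarrow> real" where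
  "tst N fs x = (\<Prod>i<N. fs i (x i))"

definition dtst :: "nat \<Rightarrow> nat \<Rightarrow> (nat \<Rightarrow> real \<Rightarrow> real) \<Rightarrow> (nat \<Rightarrow> real) \<Rightarrow> real" where
  "dtst N j fs x = deriv (fs j) (x j) * (\<Prod>i\<in>{..<N}-{j}. fs i (x i))"

text \<open>This is \<open>wderiv_wf\<close> for a single spin component, with the real test
  function acting as a scalar so that the vector-valued Fourier coefficients apply directly.\<close>

definition wd :: "nat \<Rightarrow> nat \<Rightarrow> ((nat \<Rightarrow> real) \<Rightarrow> complex) \<Rightarrow> ((nat \<Rightarrow> real) \<Rightarrow> complex) \<Rightarrow> bool" where
  "wd N j u D \<longleftrightarrow> (\<forall>fs. (\<forall>i<N. ptest (fs i)) \<longrightarrow>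
     (\<integral>x. dtst N j fs x *\<^sub>R u x \<partial>cubeM N) = - (\<integral>x. tst N fs x *\<^sub>R D x \<partial>cubeM N))"

lemma wderiv_wf_iff: "wderiv_wf N j \<Psi> D \<longleftrightarrow> (\<forall>\<sigma>\<in>spins N. wd N j (\<lambda>x. \<Psi> x \<sigma>) (\<lambda>x. D x \<sigma>))"
  unfolding wderiv_wf_def wd_def tst_def dtst_def by (simp add: scaleR_conv_of_real mult.commute)

lemma prod_bounded_cubeM:
  fixes h :: "nat \<Rightarrow> real \<Rightarrow> real"
  assumes "\<And>i. i < N \<Longrightarrow> \<exists>B. \<forall>t\<in>{0..1}. \<bar>h i t\<bar> \<le> B"
  shows "\<exists>B. \<forall>x\<in>space (cubeM N). \<bar>\<Prod>i<N. h i (x i)\<bar> \<le> B"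
proof -
  have "\<forall>i. \<exists>B. i < N \<longrightarrow> (\<forall>t\<in>{0..1}. \<bar>h i t\<bar> \<le> B)" using assms by blast
  then obtain B where B: "\<And>i t. i < N \<Longrightarrow> t \<in> {0..1} \<Longrightarrow> \<bar>h i t\<bar> \<le> B i" by metis
  have "\<bar>\<Prod>i<N. h i (x i)\<bar> \<le> (\<Prod>i<N. B i)" if "x \<in> space (cubeM N)" for x
    unfolding abs_prod using that by (intro prod_mono) (auto intro!: B simp: space_cubeM PiE_iff)
  then show ?thesis by blast
qed

lemma dtst_eq: "j < N \<Longrightarrow> dtst N j fs = (\<lambda>x. \<Prod>i<N. (fs(j := deriv (fs j))) i (x i))"
  unfolding dtst_def by (subst prod_fun_upd) auto

lemma ptest_bounded_ex: "ptest f \<Longrightarrow> \<exists>B. \<forall>t\<in>{0..1}. \<bar>f t\<bar> \<le> B \<and> \<bar>deriv f t\<bar> \<le> B"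
  by (erule ptest_bounded) blast

lemma tst_props:
  assumes "\<forall>i<N. ptest (fs i)" "j < N"
  shows "tst N fs \<in> borel_measurable (cubeM N)" "dtst N j fs \<in> borel_measurable (cubeM N)"
    "\<exists>B. \<forall>x\<in>space (cubeM N). \<bar>tst N fs x\<bar> \<le> B \<and> \<bar>dtst N j fs x\<bar> \<le> B"
proof -
  show "tst N fs \<in> borel_measurable (cubeM N)"
    unfolding tst_def[abs_def] by (intro prod_measurable_cubeM ptest_measurable assms(1)[rule_format])
  show "dtst N j fs \<in> borel_measurable (cubeM N)"
    unfolding dtst_eq[OF assms(2)] by (intro prod_measurable_cubeM) (auto intro: ptest_measurable assms(1)[rule_format])
  have "\<exists>B. \<forall>x\<in>space (cubeM N). \<bar>tst N fs x\<bar> \<le> B"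
    unfolding tst_def
  proof (rule prod_bounded_cubeM)
    fix i assume i: "i < N"
    obtain B where "\<forall>t\<in>{0..1}. \<bar>fs i t\<bar> \<le> B \<and> \<bar>deriv (fs i) t\<bar> \<le> B"
      using ptest_bounded_ex[OF assms(1)[rule_format, OF i]] by blast
    then show "\<exists>B. \<forall>t\<in>{0..1}. \<bar>fs i t\<bar> \<le> B" by blast
  qed
  moreover have "\<exists>B. \<forall>x\<in>space (cubeM N). \<bar>dtst N j fs x\<bar> \<le> B"
    unfolding dtst_eq[OF assms(2)]
  proof (rule prod_bounded_cubeM)
    fix i assume i: "i < N"
    obtain B where "\<forall>t\<in>{0..1}. \<bar>fs i t\<bar> \<le> B \<and> \<bar>deriv (fs i) t\<bar> \<le> B"
      using ptest_bounded_ex[OF assms(1)[rule_format, OF i]] by blast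
    then show "\<exists>B. \<forall>t\<in>{0..1}. \<bar>(fs(j := deriv (fs j))) i t\<bar> \<le> B"
      by (intro exI[of _ B]) auto
  qed
  ultimately obtain B C where "\<forall>x\<in>space (cubeM N). \<bar>tst N fs x\<bar> \<le> B" "\<forall>x\<in>space (cubeM N). \<bar>dtst N j fs x\<bar> \<le> C" by blast
  then show "\<exists>B. \<forall>x\<in>space (cubeM N). \<bar>tst N fs x\<bar> \<le> B \<and> \<bar>dtst N j fs x\<bar> \<le> B"
    by (intro exI[of _ "max B C"]) (auto simp: le_max_iff_disj)
qed

lemma integrable_tst_scaleR:
  assumes "\<forall>i<N. ptest (fs i)" "j < N" "sqint (cubeM N) (u :: _ \<Rightarrow> 'b::euclidean_space)"
  shows "integrable (cubeM N) (\<lambda>x. tst N fs x *\<^sub>R u x)" "integrable (cubeM N) (\<lambda>x. dtst N j fs x *\<^sub>R u x)"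
    "sqint (cubeM N) (tst N fs)" "sqint (cubeM N) (dtst N j fs)"
proof -
  obtain B where B: "\<forall>x\<in>space (cubeM N). \<bar>tst N fs x\<bar> \<le> B \<and> \<bar>dtst N j fs x\<bar> \<le> B"
    using tst_props(3)[OF assms(1,2)] by blast
  show "integrable (cubeM N) (\<lambda>x. tst N fs x *\<^sub>R u x)"
    by (intro sqint_cubeM_integrable sqint_bounded_scaleR(1)[where C=B] assms(3) tst_props(1)[OF assms(1,2)]) (use B in auto)
  show "integrable (cubeM N) (\<lambda>x. dtst N j fs x *\<^sub>R u x)"
    by (intro sqint_cubeM_integrable sqint_bounded_scaleR(1)[where C=B] assms(3) tst_props(2)[OF assms(1,2)]) (use B in auto)
  show "sqint (cubeM N) (tst N fs)" "sqint (cubeM N) (dtst N j fs)"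
    using tst_props(1,2)[OF assms(1,2)] B by (auto intro!: cube.sqint_bounded[where C=B])
qed

lemma wd_linear:
  assumes j: "j < N" and s: "sqint (cubeM N) u" "sqint (cubeM N) v" "sqint (cubeM N) D" "sqint (cubeM N) E"
    and w: "wd N j u D" "wd N j v E"
  shows "wd N j (\<lambda>x. a * u x + v x) (\<lambda>x. a * D x + E x)"
  unfolding wd_def
proof (intro allI impI)
  fix fs :: "nat \<Rightarrow> real \<Rightarrow> real" assume fs: "\<forall>i<N. ptest (fs i)"
  note i = integrable_tst_scaleR[OF fs j]
  have "(\<integral>x. dtst N j fs x *\<^sub>R (a * u x + v x) \<partial>cubeM N) =
     (\<integral>x. a * (dtst N j fs x *\<^sub>R u x) + dtst N j fs x *\<^sub>R v x \<partial>cubeM N)"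
    by (simp add: scaleR_add_right)
  also have "\<dots> = a * (\<integral>x. dtst N j fs x *\<^sub>R u x \<partial>cubeM N) + (\<integral>x. dtst N j fs x *\<^sub>R v x \<partial>cubeM N)"
    using i(2)[OF s(1)] i(2)[OF s(2)] by (simp del: mult_scaleR_right)
  also have "\<dots> = - (a * (\<integral>x. tst N fs x *\<^sub>R D x \<partial>cubeM N) + (\<integral>x. tst N fs x *\<^sub>R E x \<partial>cubeM N))"
    using w fs by (simp add: wd_def)
  also have "a * (\<integral>x. tst N fs x *\<^sub>R D x \<partial>cubeM N) + (\<integral>x. tst N fs x *\<^sub>R E x \<partial>cubeM N)
      = (\<integral>x. a * (tst N fs x *\<^sub>R D x) + tst N fs x *\<^sub>R E x \<partial>cubeM N)"
    using i(1)[OF s(3)] i(1)[OF s(4)] by (simp del: mult_scaleR_right)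
  also have "\<dots> = (\<integral>x. tst N fs x *\<^sub>R (a * D x + E x) \<partial>cubeM N)"
    by (simp add: scaleR_add_right)
  finally show "(\<integral>x. dtst N j fs x *\<^sub>R (a * u x + v x) \<partial>cubeM N) = - (\<integral>x. tst N fs x *\<^sub>R (a * D x + E x) \<partial>cubeM N)" .
qed

text \<open>Both sides of the defining identity are continuous under L2 convergence because test
  functions are bounded. This closedness is what makes the form domain complete.\<close>

lemma wd_limit:
  assumes j: "j < N" and s: "sqint (cubeM N) u" "sqint (cubeM N) D" "\<And>n. sqint (cubeM N) (us n)" "\<And>n. sqint (cubeM N) (Ds n)"
    and lim: "(\<lambda>n. l2 (cubeM N) (\<lambda>x. us n x - u x)) \<longlonglongrightarrow> 0" "(\<lambda>n. l2 (cubeM N) (\<lambda>x. Ds n x - D x)) \<longlonglongrightarrow> 0"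
    and w: "\<And>n. wd N j (us n) (Ds n)"
  shows "wd N j u D"
  unfolding wd_def
proof (intro allI impI)
  fix fs :: "nat \<Rightarrow> real \<Rightarrow> real" assume fs: "\<forall>i<N. ptest (fs i)"
  note i = integrable_tst_scaleR[OF fs j]
  have z: "(\<lambda>n::nat. l2 (cubeM N) (\<lambda>x. h x - h x)) \<longlonglongrightarrow> 0" for h :: "_ \<Rightarrow> real" by (simp add: l2_def)
  have 1: "(\<lambda>n. \<integral>x. dtst N j fs x *\<^sub>R us n x \<partial>cubeM N) \<longlonglongrightarrow> (\<integral>x. dtst N j fs x *\<^sub>R u x \<partial>cubeM N)"
    by (rule l2_tendsto_bilinear[OF bounded_bilinear_scaleR i(4)[OF s(1)] i(4)[OF s(1)] s(1) s(3) z lim(1)])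
  have 2: "(\<lambda>n. \<integral>x. tst N fs x *\<^sub>R Ds n x \<partial>cubeM N) \<longlonglongrightarrow> (\<integral>x. tst N fs x *\<^sub>R D x \<partial>cubeM N)"
    by (rule l2_tendsto_bilinear[OF bounded_bilinear_scaleR i(3)[OF s(1)] i(3)[OF s(1)] s(2) s(4) z lim(2)])
  have "(\<integral>x. dtst N j fs x *\<^sub>R us n x \<partial>cubeM N) = - (\<integral>x. tst N fs x *\<^sub>R Ds n x \<partial>cubeM N)" for n
    using w[of n] fs by (simp add: wd_def)
  with 1 tendsto_minus[OF 2] show "(\<integral>x. dtst N j fs x *\<^sub>R u x \<partial>cubeM N) = - (\<integral>x. tst N fs x *\<^sub>R D x \<partial>cubeM N)"
    using LIMSEQ_unique by simp
qed

section \<open>Weak partial derivatives in terms of Fourier coefficients\<close>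

text \<open>Differentiation in coordinate j sends the mode k to a multiple of the mode flip j k.\<close>

definition flip :: "nat \<Rightarrow> (nat \<Rightarrow> int) \<Rightarrow> nat \<Rightarrow> int" where
  "flip j k = k(j := - k j)"

lemma flip_flip [simp]: "flip j (flip j k) = k" and flip_at [simp]: "flip j k j = - k j"
  by (simp_all add: flip_def)

lemma flip_ibox:
  assumes "j < N" "k \<in> ibox N K" shows "flip j k \<in> ibox N K"
proof -
  have "k j \<in> {- int K..int K}" 
    using assms PiE_mem[of k "{..<N}" "\<lambda>_. {- int K..int K}" j] by (simp add: ibox_def)
  then have "- k j \<in> {- int K..int K}" by simp
  then have "k(j := - k j) \<in> PiE (insert j {..<N}) (\<lambda>_. {- int K..int K})"
    using assms(2) unfolding ibox_def by (intro PiE_fun_upd)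
  then show ?thesis using assms(1) by (simp add: flip_def ibox_def insert_absorb)
qed

lemma bas_split: "j < N \<Longrightarrow> bas N k x = cas (k j) (x j) * (\<Prod>i\<in>{..<N}-{j}. cas (k i) (x i))"
  unfolding bas_def by (subst prod.remove[of _ j]) auto

lemma bas_flip: "j < N \<Longrightarrow> bas N (flip j k) x = cas (- k j) (x j) * (\<Prod>i\<in>{..<N}-{j}. cas (k i) (x i))"
  unfolding bas_split[of j] by (auto simp: flip_def intro!: prod.cong)

text \<open>The test function is a basis function with an extra factor \<phi> in coordinate j, and
  the Leibniz rule splits its derivative. With \<phi> = 1 this yields the coefficients of the
  derivative; with general \<phi> it feeds the product rule.\<close>

lemma wd_bas_mult:
  assumes j: "j < N" and w: "wd N j u D" and \<phi>: "ptest \<phi>"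
  shows "(\<integral>x. (2 * pi * of_int (k j) * bas N (flip j k) x * \<phi> (x j) + bas N k x * deriv \<phi> (x j)) *\<^sub>R u x \<partial>cubeM N)
    = - (\<integral>x. (bas N k x * \<phi> (x j)) *\<^sub>R D x \<partial>cubeM N)"
proof -
  let ?fs = "(\<lambda>i. cas (k i))(j := \<lambda>t. cas (k j) t * \<phi> t)"
  have p: "\<forall>i<N. ptest (?fs i)" using ptest_cas ptest_mult(1)[OF ptest_cas \<phi>] by auto
  have "tst N ?fs x = bas N k x * \<phi> (x j)" for x
    unfolding tst_def prod_fun_upd[OF j] bas_split[OF j] by simp
  moreover have "dtst N j ?fs x = 2 * pi * of_int (k j) * bas N (flip j k) x * \<phi> (x j) + bas N k x * deriv \<phi> (x j)" for x
  proof -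
    have "(\<Prod>i\<in>{..<N}-{j}. ?fs i (x i)) = (\<Prod>i\<in>{..<N}-{j}. cas (k i) (x i))" by (rule prod.cong) auto
    moreover have "deriv (?fs j) t = 2 * pi * of_int (k j) * cas (- k j) t * \<phi> t + cas (k j) t * deriv \<phi> t" for t
      by (simp add: ptest_mult(2)[OF ptest_cas \<phi>] deriv_cas)
    ultimately show ?thesis
      unfolding dtst_def bas_split[OF j, of k] bas_flip[OF j]
      by (simp only:) (simp add: algebra_simps)
  qed
  ultimately show ?thesis using w[unfolded wd_def, rule_format, of ?fs] p by simp
qed

text \<open>The derivative of a basis function in coordinate j is a multiple of its flipped partner,
  and weak differentiation moves it over with a minus sign. Uniqueness and the mode estimate below
  both rest on this formula.\<close>

lemma wd_coef:
  assumes j: "j < N" and w: "wd N j u D"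
  shows "cube.coef N D k = - ((2 * pi * of_int (k j)) *\<^sub>R cube.coef N u (flip j k))"
proof -
  have "ptest (\<lambda>_. 1)" using ptest_cas[of 0] by simp
  from wd_bas_mult[OF j w this, of k] show ?thesis
    by (simp add: cube.coef_def scaleR_scaleR[symmetric] del: scaleR_scaleR)
qed

lemma cubeM_coef_eq_imp_AE:
  assumes "sqint (cubeM N) (u :: _ \<Rightarrow> 'b::euclidean_space)" "sqint (cubeM N) v"
    "\<And>k. k \<in> idx N \<Longrightarrow> cube.coef N u k = cube.coef N v k"
  shows "AE x in cubeM N. u x = v x"
proof -
  have "AE x in cubeM N. u x - v x = 0"
  proof (rule cube.total_euclidean)
    show "integrable (cubeM N) (\<lambda>x. u x - v x)"
      by (intro sqint_cubeM_integrable sqint_diff assms)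
    show "(\<integral>x. bas N k x *\<^sub>R (u x - v x) \<partial>cubeM N) = 0" if "k \<in> idx N" for k
      using cube.coef_diff[OF assms(1,2), of k] assms(3)[OF that] by (simp add: cube.coef_def)
  qed
  then show ?thesis by eventually_elim simp
qed

lemma wd_unique:
  assumes "j < N" "wd N j u D" "wd N j u E" "sqint (cubeM N) D" "sqint (cubeM N) E"
  shows "AE x in cubeM N. D x = E x"
  by (rule cubeM_coef_eq_imp_AE) (use assms in \<open>auto simp: wd_coef[OF assms(1,2)] wd_coef[OF assms(1,3)]\<close>)

text \<open>A mode outside the box has some frequency of absolute value at least K + 1, so its
  weight is at most the corresponding weight in the derivatives divided by the square of K + 1.
  Together with Parseval this is the quantitative core of the Rellich theorem.\<close>

lemma l2_le_low_modes:
  assumes s: "sqint (cubeM N) u" "\<And>j. j < N \<Longrightarrow> sqint (cubeM N) (D j)" and w: "\<And>j. j < N \<Longrightarrow> wd N j u (D j)"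
  shows "l2 (cubeM N) u \<le> (\<Sum>k\<in>ibox N K. (norm (cube.coef N u k))\<^sup>2) + (\<Sum>j<N. l2 (cubeM N) (D j)) / (real (Suc K))\<^sup>2"
proof (rule LIMSEQ_le_const2)
  let ?c = "\<lambda>k. (norm (cube.coef N u k))\<^sup>2"
  show "(\<lambda>L. \<Sum>k\<in>ibox N L. ?c k) \<longlonglongrightarrow> l2 (cubeM N) u" by (rule cube.parseval(2)[OF s(1)])
  have "(\<Sum>k\<in>ibox N L. ?c k) \<le> (\<Sum>k\<in>ibox N K. ?c k) + (\<Sum>j<N. l2 (cubeM N) (D j)) / (real (Suc K))\<^sup>2" if "L \<ge> K" for L
  proof -
    have sub: "ibox N K \<subseteq> ibox N L" using monoD[OF cube.F_mono that] .
    have t: "?c k \<le> (\<Sum>j<N. (of_int (k j))\<^sup>2 * ?c k) / (real (Suc K))\<^sup>2" if k: "k \<in> ibox N L - ibox N K" for k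
    proof -
      obtain j where j: "j < N" "\<not> (- int K \<le> k j \<and> k j \<le> int K)"
        using k by (auto simp: ibox_def PiE_iff)
      then have "int (Suc K) \<le> \<bar>k j\<bar>" by auto
      then have "real (Suc K) \<le> \<bar>of_int (k j)\<bar>" by (metis of_int_abs of_int_le_iff of_int_of_nat_eq)
      then have "(real (Suc K))\<^sup>2 \<le> (of_int (k j))\<^sup>2" by (rule abs_le_square_iff[THEN iffD1, OF order_trans[rotated]]) simp
      then have "(real (Suc K))\<^sup>2 * ?c k \<le> (of_int (k j))\<^sup>2 * ?c k" by (intro mult_right_mono) auto
      also have "\<dots> \<le> (\<Sum>j<N. (of_int (k j))\<^sup>2 * ?c k)"
        using j(1) by (intro member_le_sum) auto
      finally show ?thesis by (simp add: field_simps)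
    qed
    have b: "(\<Sum>k\<in>ibox N L. (of_int (k j))\<^sup>2 * ?c k) \<le> l2 (cubeM N) (D j)" if j: "j < N" for j
    proof -
      have "(\<Sum>k\<in>ibox N L. (of_int (k j))\<^sup>2 * ?c k) \<le> (\<Sum>k\<in>ibox N L. (norm (cube.coef N (D j) (flip j k)))\<^sup>2)"
      proof (rule sum_mono)
        fix k
        \<comment> \<open>The factor 4 pi squared coming from the derivative is at least 1 and is
          simply discarded.\<close>
        have "1 \<le> 2 * pi" using pi_ge_two by linarith
        then have "1 \<le> (2 * pi)\<^sup>2" by (rule one_le_power)
        then have "1 * ((of_int (k j))\<^sup>2 * ?c k) \<le> (2 * pi)\<^sup>2 * ((of_int (k j))\<^sup>2 * ?c k)"
          by (intro mult_right_mono) auto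
        then show "(of_int (k j))\<^sup>2 * ?c k \<le> (norm (cube.coef N (D j) (flip j k)))\<^sup>2"
          unfolding wd_coef[OF j w[OF j]] by (simp add: power_mult_distrib mult.assoc)
      qed
      also have "\<dots> = (\<Sum>k\<in>ibox N L. (norm (cube.coef N (D j) k))\<^sup>2)"
        by (rule sum.reindex_bij_witness[of _ "flip j" "flip j"]) (auto intro: flip_ibox j)
      also have "\<dots> \<le> l2 (cubeM N) (D j)"
        by (rule cube.bessel[OF cube.F_finite cube.F_subset s(2)[OF j]])
      finally show ?thesis .
    qed
    have "(\<Sum>k\<in>ibox N L. ?c k) = (\<Sum>k\<in>ibox N L - ibox N K. ?c k) + (\<Sum>k\<in>ibox N K. ?c k)"
      by (rule sum.subset_diff[OF sub cube.F_finite])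
    moreover have "(\<Sum>k\<in>ibox N L - ibox N K. ?c k) \<le> (\<Sum>k\<in>ibox N L - ibox N K. (\<Sum>j<N. (of_int (k j))\<^sup>2 * ?c k) / (real (Suc K))\<^sup>2)"
      by (rule sum_mono[OF t])
    moreover have "\<dots> \<le> (\<Sum>k\<in>ibox N L. (\<Sum>j<N. (of_int (k j))\<^sup>2 * ?c k) / (real (Suc K))\<^sup>2)"
      by (rule sum_mono2[OF cube.F_finite]) (auto intro!: divide_nonneg_nonneg sum_nonneg)
    moreover have "\<dots> = (\<Sum>j<N. \<Sum>k\<in>ibox N L. (of_int (k j))\<^sup>2 * ?c k) / (real (Suc K))\<^sup>2"
      unfolding sum_divide_distrib[symmetric] by (subst sum.swap) simp
    moreover have "\<dots> \<le> (\<Sum>j<N. l2 (cubeM N) (D j)) / (real (Suc K))\<^sup>2"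
      by (intro divide_right_mono sum_mono b) auto
    ultimately show ?thesis by linarith
  qed
  then show "\<exists>n. \<forall>L\<ge>n. (\<Sum>k\<in>ibox N L. ?c k) \<le> (\<Sum>k\<in>ibox N K. ?c k) + (\<Sum>j<N. l2 (cubeM N) (D j)) / (real (Suc K))\<^sup>2"
    by blast
qed

lemma bounded_bilinear_mult_cnj: "bounded_bilinear (\<lambda>a b. a * cnj b)"
  by (rule bounded_bilinear.comp[OF bounded_bilinear_mult bounded_linear_ident bounded_linear_cnj])

lemma integral_mult_cnj_proj:
  assumes U: "sqint (cubeM N) U"
  shows "(\<integral>x. U x * cnj (cube.proj N A v x) \<partial>cubeM N) = (\<Sum>k\<in>A. cube.coef N U k * cnj (cube.coef N v k))"
proof -
  have i: "integrable (cubeM N) (\<lambda>x. bas N k x *\<^sub>R U x)" for k by (rule cube.integrable_e_scaleR[OF U])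
  have "(\<integral>x. U x * cnj (cube.proj N A v x) \<partial>cubeM N) = (\<integral>x. (\<Sum>k\<in>A. (bas N k x *\<^sub>R U x) * cnj (cube.coef N v k)) \<partial>cubeM N)"
    by (rule Bochner_Integration.integral_cong) (auto simp: cube.proj_def sum_distrib_left scaleR_conv_of_real mult_ac)
  also have "\<dots> = (\<Sum>k\<in>A. \<integral>x. (bas N k x *\<^sub>R U x) * cnj (cube.coef N v k) \<partial>cubeM N)"
    by (rule Bochner_Integration.integral_sum) (use i in \<open>auto simp del: mult_scaleR_left\<close>)
  also have "\<dots> = (\<Sum>k\<in>A. cube.coef N U k * cnj (cube.coef N v k))"
    using i by (simp add: cube.coef_def del: mult_scaleR_left)
  finally show ?thesis .
qed

lemma sqint_ptest_comp:
  assumes "j < N" "ptest \<phi>" "sqint (cubeM N) u"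
  shows "sqint (cubeM N) (\<lambda>x. \<phi> (x j) *\<^sub>R u x)" "sqint (cubeM N) (\<lambda>x. deriv \<phi> (x j) *\<^sub>R u x)"
proof -
  obtain B where B: "B \<ge> 0" "\<And>t. t \<in> {0..1} \<Longrightarrow> \<bar>\<phi> t\<bar> \<le> B" "\<And>t. t \<in> {0..1} \<Longrightarrow> \<bar>deriv \<phi> t\<bar> \<le> B"
    using ptest_bounded[OF assms(2)] by blast
  show "sqint (cubeM N) (\<lambda>x. \<phi> (x j) *\<^sub>R u x)" "sqint (cubeM N) (\<lambda>x. deriv \<phi> (x j) *\<^sub>R u x)"
    by (rule sqint_bounded_scaleR(1)[OF assms(3) measurable_cubeM_comp[OF assms(1)], where C=B];
        use B assms ptest_measurable in \<open>auto simp: space_cubeM PiE_iff\<close>)+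
qed

text \<open>Neither factor need be smooth, so the definition of \<open>wd\<close> does not apply
  directly. The second factor is replaced by its Fourier projections, for which the rule is a finite
  identity between coefficients, and L2 limits remove the truncation.\<close>

lemma wd_product:
  assumes j: "j < N" and s: "sqint (cubeM N) u" "sqint (cubeM N) Du" "sqint (cubeM N) v" "sqint (cubeM N) Dv"
    and w: "wd N j u Du" "wd N j v Dv" and \<phi>: "ptest \<phi>"
  shows "(\<integral>x. (deriv \<phi> (x j) *\<^sub>R u x) * cnj (v x) \<partial>cubeM N)
    = - (\<integral>x. (\<phi> (x j) *\<^sub>R Du x) * cnj (v x) \<partial>cubeM N) - (\<integral>x. (\<phi> (x j) *\<^sub>R u x) * cnj (Dv x) \<partial>cubeM N)"
proof -
  let ?U = "\<lambda>x. \<phi> (x j) *\<^sub>R u x" and ?U' = "\<lambda>x. deriv \<phi> (x j) *\<^sub>R u x" and ?DU = "\<lambda>x. \<phi> (x j) *\<^sub>R Du x"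
  have sU: "sqint (cubeM N) ?U" "sqint (cubeM N) ?U'" "sqint (cubeM N) ?DU"
    using sqint_ptest_comp[OF j \<phi>] s by auto
  have step: "cube.coef N ?U' k = - cube.coef N ?DU k - (2 * pi * of_int (k j)) *\<^sub>R cube.coef N ?U (flip j k)" for k
  proof -
    note i = cube.integrable_e_scaleR[OF sU(1)] cube.integrable_e_scaleR[OF sU(2)]
    have "- cube.coef N ?DU k = - (\<integral>x. (bas N k x * \<phi> (x j)) *\<^sub>R Du x \<partial>cubeM N)" by (simp add: cube.coef_def)
    also have "\<dots> = (\<integral>x. (2 * pi * of_int (k j)) *\<^sub>R (bas N (flip j k) x *\<^sub>R ?U x) + bas N k x *\<^sub>R ?U' x \<partial>cubeM N)"
      unfolding wd_bas_mult[OF j w(1) \<phi>, symmetric] by (simp add: scaleR_add_left mult.assoc)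
    also have "\<dots> = (2 * pi * of_int (k j)) *\<^sub>R cube.coef N ?U (flip j k) + cube.coef N ?U' k"
      unfolding cube.coef_def using i[of "flip j k"] i[of k] by (simp del: scaleR_scaleR)
    finally show ?thesis by simp
  qed
  \<comment> \<open>The box of frequencies is invariant under \<open>flip j\<close>, so moving the
    derivative onto \<open>v\<close> is an exact reindexing for each K, without boundary
    terms.\<close>
  have eq: "(\<integral>x. ?U' x * cnj (cube.proj N (ibox N K) v x) \<partial>cubeM N)
     = - (\<integral>x. ?DU x * cnj (cube.proj N (ibox N K) v x) \<partial>cubeM N) - (\<integral>x. ?U x * cnj (cube.proj N (ibox N K) Dv x) \<partial>cubeM N)" for K
  proof -
    have "(\<Sum>k\<in>ibox N K. cube.coef N ?U k * cnj (cube.coef N Dv k))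
       = (\<Sum>k\<in>ibox N K. ((2 * pi * of_int (k j)) *\<^sub>R cube.coef N ?U (flip j k)) * cnj (cube.coef N v k))"
      by (rule sum.reindex_bij_witness[of _ "flip j" "flip j"])
        (auto intro: flip_ibox j simp: wd_coef[OF j w(2)] scaleR_conv_of_real)
    then show ?thesis
      unfolding integral_mult_cnj_proj[OF sU(1)] integral_mult_cnj_proj[OF sU(2)] integral_mult_cnj_proj[OF sU(3)] step
      by (simp add: left_diff_distrib sum_subtractf sum_negf)
  qed
  have z: "(\<lambda>n::nat. l2 (cubeM N) (\<lambda>x. h x - h x)) \<longlonglongrightarrow> 0" for h :: "_ \<Rightarrow> complex" by (simp add: l2_def)
  have lim: "(\<lambda>K. \<integral>x. h x * cnj (cube.proj N (ibox N K) f x) \<partial>cubeM N) \<longlonglongrightarrow> (\<integral>x. h x * cnj (f x) \<partial>cubeM N)"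
    if h: "sqint (cubeM N) h" and f: "sqint (cubeM N) f" for h f
    using cube.parseval(1)[OF f]
    by (intro l2_tendsto_bilinear[OF bounded_bilinear_mult_cnj h h f cube.sqint_proj z]) (simp add: l2_minus_commute)
  show ?thesis
    by (rule LIMSEQ_unique[OF lim[OF sU(2) s(3)]])
      (unfold eq, intro tendsto_intros lim s sU)
qed

section \<open>Marginal densities\<close>

lemma measurable_slice:
  assumes N: "N \<ge> 1" and t: "t \<in> {0..1}" and F: "F \<in> borel_measurable (cubeM N)"
  shows "(\<lambda>y. F (y(0 := t))) \<in> borel_measurable (PiM {1..<N} (\<lambda>_. L01))"
proof -
  have "(\<lambda>p. F ((\<lambda>(t, y). y(0 := t)) p)) \<in> borel_measurable (L01 \<Otimes>\<^sub>M PiM {1..<N} (\<lambda>_. L01))"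
    by (rule measurable_compose[OF measurable_pair_cubeM[OF N] F])
  from measurable_compose[OF measurable_Pair1' this, of t] t show ?thesis by simp
qed

lemma marg_nn_integral:
  assumes N: "N \<ge> 1" and F: "F \<in> borel_measurable (cubeM N)"
  shows "(\<integral>\<^sup>+x. F x \<partial>cubeM N) = (\<integral>\<^sup>+t. \<integral>\<^sup>+y. F (y(0 := t)) \<partial>PiM {1..<N} (\<lambda>_. L01) \<partial>L01)"
proof -
  let ?R = "PiM {1..<N} (\<lambda>_::nat. L01)"
  interpret R: finite_measure ?R by (rule finite_measure_PiM_L01) simp
  note m = measurable_pair_cubeM[OF N]
  have "(\<integral>\<^sup>+x. F x \<partial>cubeM N) = (\<integral>\<^sup>+x. F x \<partial>distr (L01 \<Otimes>\<^sub>M ?R) (cubeM N) (\<lambda>(t, y). y(0 := t)))"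
    unfolding distr_pair_cubeM[OF N] ..
  also have "\<dots> = (\<integral>\<^sup>+p. F ((\<lambda>(t, y). y(0 := t)) p) \<partial>(L01 \<Otimes>\<^sub>M ?R))"
    by (rule nn_integral_distr[OF m]) (simp add: F)
  also have "\<dots> = (\<integral>\<^sup>+t. \<integral>\<^sup>+y. F ((\<lambda>(t, y). y(0 := t)) (t, y)) \<partial>?R \<partial>L01)"
    by (rule R.nn_integral_fst[symmetric]) (rule measurable_compose[OF m F])
  finally show ?thesis by simp
qed

text \<open>The derivative of the marginal density msq N u when D is the derivative of u in coordinate 0.\<close>

definition jd :: "nat \<Rightarrow> ((nat \<Rightarrow> real) \<Rightarrow> complex) \<Rightarrow> ((nat \<Rightarrow> real) \<Rightarrow> complex) \<Rightarrow> real \<Rightarrow> real" where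
  "jd N u D t = 2 * Re (marg N (\<lambda>x. cnj (u x) * D x) t)"

definition msq :: "nat \<Rightarrow> ((nat \<Rightarrow> real) \<Rightarrow> complex) \<Rightarrow> real \<Rightarrow> real" where
  "msq N u = marg N (\<lambda>x. (cmod (u x))\<^sup>2)"

lemma sqint_cnj:
  assumes "sqint M u" shows "sqint M (\<lambda>x. cnj (u x))"
proof (rule sqint_le(1)[of _ _ u 1])
  have "cnj \<in> borel_measurable borel" by (intro borel_measurable_continuous_onI continuous_intros)
  then show "(\<lambda>x. cnj (u x)) \<in> borel_measurable M"
    by (rule measurable_compose[OF sqint_measurable[OF assms]])
qed (use assms in auto)

lemma integrable_cnj_mult: "sqint M u \<Longrightarrow> sqint M v \<Longrightarrow> integrable M (\<lambda>x. cnj (u x) * v x)"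
  by (rule integrable_mult_sqint(1)[OF sqint_cnj])

lemma msq_integral:
  assumes "N \<ge> 1" "sqint (cubeM N) u"
  shows "integrable L01 (msq N u)" "(\<integral>t. msq N u t \<partial>L01) = l2 (cubeM N) u"
  unfolding msq_def l2_def
  by (rule marg_integral(2,3)[OF assms(1) sqint_integrable[OF assms(2)]])+

lemma jd_integral:
  assumes N: "N \<ge> 1" and s: "sqint (cubeM N) u" "sqint (cubeM N) D"
  shows "integrable L01 (jd N u D)" "(\<integral>t. \<bar>jd N u D t\<bar> \<partial>L01) \<le> 2 * (sqrt (l2 (cubeM N) u) * sqrt (l2 (cubeM N) D))"
proof -
  have i: "integrable L01 (marg N (\<lambda>x. cnj (u x) * D x))"
    by (rule marg_integral(2)[OF N integrable_cnj_mult[OF s]])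
  show j: "integrable L01 (jd N u D)" unfolding jd_def[abs_def] using i by simp
  have i2: "integrable (cubeM N) (\<lambda>x. norm (u x) * norm (D x))" by (rule integrable_norm_prod[OF s])
  have "(\<integral>t. \<bar>jd N u D t\<bar> \<partial>L01) \<le> (\<integral>t. 2 * marg N (\<lambda>x. norm (u x) * norm (D x)) t \<partial>L01)"
  proof (rule integral_mono)
    fix t
    have "\<bar>Re (marg N (\<lambda>x. cnj (u x) * D x) t)\<bar> \<le> norm (marg N (\<lambda>x. cnj (u x) * D x) t)" by (rule abs_Re_le_cmod)
    also have "\<dots> \<le> marg N (\<lambda>x. norm (cnj (u x) * D x)) t"
      unfolding marg_def by (rule integral_norm_bound)
    finally show "\<bar>jd N u D t\<bar> \<le> 2 * marg N (\<lambda>x. norm (u x) * norm (D x)) t"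
      by (simp add: jd_def norm_mult abs_mult)
  qed (use j marg_integral(2)[OF N i2] in auto)
  also have "\<dots> = 2 * (\<integral>x. norm (u x) * norm (D x) \<partial>cubeM N)"
    using marg_integral(3)[OF N i2] by simp
  also have "\<dots> \<le> 2 * (sqrt (l2 (cubeM N) u) * sqrt (l2 (cubeM N) D))"
    using cauchy_schwarz_norm[OF s] by simp
  finally show "(\<integral>t. \<bar>jd N u D t\<bar> \<partial>L01) \<le> 2 * (sqrt (l2 (cubeM N) u) * sqrt (l2 (cubeM N) D))" .
qed

text \<open>In the product rule with both factors equal to \<open>u\<close>, the two terms on the
  right are complex conjugates of each other; their sum is twice a real part, which explains the
  factor in \<open>jd\<close>.\<close>

lemma wderivT_msq:
  assumes N: "N \<ge> 1" and s: "sqint (cubeM N) u" "sqint (cubeM N) D" and w: "wd N 0 u D"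
  shows "wderivT (msq N u) (jd N u D)"
  unfolding wderivT_def
proof (intro allI impI)
  fix \<phi> assume \<phi>: "ptest \<phi>"
  have j: "0 < N" using N by simp
  note su = sqint_ptest_comp[OF j \<phi> s(1)] sqint_ptest_comp[OF j \<phi> s(2)]
  have i1: "integrable (cubeM N) (\<lambda>x. deriv \<phi> (x 0) *\<^sub>R (cmod (u x))\<^sup>2)"
    using integrable_inner_sqint(1)[OF su(2) s(1)] by (simp add: power2_norm_eq_inner)
  have i2: "integrable (cubeM N) (\<lambda>x. \<phi> (x 0) *\<^sub>R (cnj (u x) * D x))"
    using integrable_cnj_mult[OF s(1) su(3)] by simp
  have A: "(\<integral>t. msq N u t * deriv \<phi> t \<partial>L01) = (\<integral>x. deriv \<phi> (x 0) *\<^sub>R (cmod (u x))\<^sup>2 \<partial>cubeM N)"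
  proof -
    have "marg N (\<lambda>x. deriv \<phi> (x 0) *\<^sub>R (cmod (u x))\<^sup>2) t = deriv \<phi> t *\<^sub>R msq N u t" for t
      unfolding msq_def by (rule marg_mult[OF N])
    then have "marg N (\<lambda>x. deriv \<phi> (x 0) *\<^sub>R (cmod (u x))\<^sup>2) = (\<lambda>t. msq N u t * deriv \<phi> t)"
      by (simp only: fun_eq_iff real_scaleR_def mult.commute simp_thms)
    then show ?thesis unfolding marg_integral(3)[OF N i1, symmetric] by (simp only:)
  qed
  have "(\<integral>x. (deriv \<phi> (x 0) *\<^sub>R u x) * cnj (u x) \<partial>cubeM N) = of_real (\<integral>x. deriv \<phi> (x 0) *\<^sub>R (cmod (u x))\<^sup>2 \<partial>cubeM N)"
    unfolding integral_complex_of_real[symmetric]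
    by (rule Bochner_Integration.integral_cong) (simp_all add: complex_norm_square[symmetric] scaleR_conv_of_real mult.assoc)
  then have B: "Re (\<integral>x. (deriv \<phi> (x 0) *\<^sub>R u x) * cnj (u x) \<partial>cubeM N) = (\<integral>t. msq N u t * deriv \<phi> t \<partial>L01)"
    by (simp add: A)
  let ?I = "\<integral>x. \<phi> (x 0) *\<^sub>R (cnj (u x) * D x) \<partial>cubeM N"
  have C: "(\<integral>x. (\<phi> (x 0) *\<^sub>R D x) * cnj (u x) \<partial>cubeM N) = ?I"
    by (rule Bochner_Integration.integral_cong) (auto simp: mult.commute)
  have "(\<integral>x. (\<phi> (x 0) *\<^sub>R u x) * cnj (D x) \<partial>cubeM N) = (\<integral>x. cnj (\<phi> (x 0) *\<^sub>R (cnj (u x) * D x)) \<partial>cubeM N)"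
    by (rule Bochner_Integration.integral_cong) (auto simp: mult.commute)
  also have "\<dots> = cnj ?I" by (rule Bochner_Integration.integral_cnj)
  finally have D: "(\<integral>x. (\<phi> (x 0) *\<^sub>R u x) * cnj (D x) \<partial>cubeM N) = cnj ?I" .
  have "(\<integral>t. msq N u t * deriv \<phi> t \<partial>L01) = - 2 * Re ?I"
    unfolding B[symmetric] wd_product[OF j s s w w \<phi>] C D by simp
  also have "Re ?I = (\<integral>t. Re (\<phi> t *\<^sub>R marg N (\<lambda>x. cnj (u x) * D x) t) \<partial>L01)"
  proof -
    have eq: "marg N (\<lambda>x. \<phi> (x 0) *\<^sub>R (cnj (u x) * D x)) = (\<lambda>t. \<phi> t *\<^sub>R marg N (\<lambda>x. cnj (u x) * D x) t)"
      by (rule ext) (rule marg_mult[OF N])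
    show ?thesis
      using marg_integral(2,3)[OF N i2] unfolding eq by (simp only: integral_Re)
  qed
  also have "- 2 * \<dots> = - (\<integral>t. 2 * Re (\<phi> t *\<^sub>R marg N (\<lambda>x. cnj (u x) * D x) t) \<partial>L01)"
    by simp
  also have "(\<integral>t. 2 * Re (\<phi> t *\<^sub>R marg N (\<lambda>x. cnj (u x) * D x) t) \<partial>L01) = (\<integral>t. jd N u D t * \<phi> t \<partial>L01)"
    by (rule Bochner_Integration.integral_cong) (auto simp: jd_def)
  finally show "(\<integral>t. msq N u t * deriv \<phi> t \<partial>L01) = - (\<integral>t. jd N u D t * \<phi> t \<partial>L01)" .
qed

text \<open>The one-dimensional Sobolev bound for the marginal density of u.\<close>

definition mbound :: "nat \<Rightarrow> ((nat \<Rightarrow> real) \<Rightarrow> complex) \<Rightarrow> ((nat \<Rightarrow> real) \<Rightarrow> complex) \<Rightarrow> real" where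
  "mbound N u D = l2 (cubeM N) u + 2 * (sqrt (l2 (cubeM N) u) * sqrt (l2 (cubeM N) D))"

lemma mbound_nonneg [simp]: "0 \<le> mbound N u D"
  by (simp add: mbound_def)

lemma msq_le:
  assumes "N \<ge> 1" "sqint (cubeM N) u" "sqint (cubeM N) D" "wd N 0 u D"
  shows "AE t in L01. msq N u t \<le> mbound N u D"
  using wderivT_sup[OF msq_integral(1)[OF assms(1,2)] jd_integral(1)[OF assms(1-3)] wderivT_msq[OF assms]]
  unfolding mbound_def msq_integral(2)[OF assms(1,2)]
  by eventually_elim (use jd_integral(2)[OF assms(1-3)] in linarith)

text \<open>The weight is only square integrable, so the product is controlled through Fubini:
  integrating out the other coordinates first leaves the square of \<open>g\<close> against the
  marginal density, which the Sobolev bound caps.\<close>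

lemma weighted_sqint:
  assumes N: "N \<ge> 1" and s: "sqint (cubeM N) u" "sqint (cubeM N) D" and w: "wd N 0 u D" and g: "sqint L01 (g :: real \<Rightarrow> real)"
  shows "sqint (cubeM N) (\<lambda>x. g (x 0) *\<^sub>R u x)" "l2 (cubeM N) (\<lambda>x. g (x 0) *\<^sub>R u x) \<le> mbound N u D * l2 L01 g"
proof -
  let ?R = "PiM {1..<N} (\<lambda>_::nat. L01)"
  have N0: "0 < N" using N by simp
  have m: "(\<lambda>x. g (x 0) *\<^sub>R u x) \<in> borel_measurable (cubeM N)"
    using measurable_cubeM_comp[OF N0 sqint_measurable[OF g]] s by (auto simp: sqint_measurable)
  have "(\<integral>\<^sup>+x. ennreal ((norm (g (x 0) *\<^sub>R u x))\<^sup>2) \<partial>cubeM N) = (\<integral>\<^sup>+t. \<integral>\<^sup>+y. ennreal ((norm (g t *\<^sub>R u (y(0 := t))))\<^sup>2) \<partial>?R \<partial>L01)"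
  proof -
    have "(\<lambda>x. ennreal ((norm (g (x 0) *\<^sub>R u x))\<^sup>2)) \<in> borel_measurable (cubeM N)"
      by (intro measurable_compose[OF _ measurable_ennreal] borel_measurable_power measurable_compose[OF m borel_measurable_norm])
    from marg_nn_integral[OF N this] show ?thesis by simp
  qed
  also have "\<dots> \<le> (\<integral>\<^sup>+t. ennreal (mbound N u D * (norm (g t))\<^sup>2) \<partial>L01)"
  proof (rule nn_integral_mono_AE)
    show "AE t in L01. (\<integral>\<^sup>+y. ennreal ((norm (g t *\<^sub>R u (y(0 := t))))\<^sup>2) \<partial>?R) \<le> ennreal (mbound N u D * (norm (g t))\<^sup>2)"
      using marg_integral(1)[OF N sqint_integrable[OF s(1)]] msq_le[OF N s w]
    proof eventually_elim
      case (elim t)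
      have "(\<integral>\<^sup>+y. ennreal ((norm (g t *\<^sub>R u (y(0 := t))))\<^sup>2) \<partial>?R) = (\<integral>\<^sup>+y. ennreal ((norm (g t))\<^sup>2 * (norm (u (y(0 := t))))\<^sup>2) \<partial>?R)"
        by (simp add: power_mult_distrib)
      also have "\<dots> = ennreal ((norm (g t))\<^sup>2 * msq N u t)"
        using elim(1) unfolding msq_def marg_def by (subst nn_integral_eq_integral) auto
      also have "\<dots> \<le> ennreal (mbound N u D * (norm (g t))\<^sup>2)"
        using elim(2) by (intro ennreal_leI) (simp add: mult.commute mult_right_mono)
      finally show ?case .
    qed
  qed
  also have "\<dots> = ennreal (mbound N u D * l2 L01 g)"
    using g unfolding l2_def sqint_def by (subst nn_integral_eq_integral) auto
  finally have le: "(\<integral>\<^sup>+x. ennreal ((norm (g (x 0) *\<^sub>R u x))\<^sup>2) \<partial>cubeM N) \<le> ennreal (mbound N u D * l2 L01 g)" .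
  have i: "integrable (cubeM N) (\<lambda>x. (norm (g (x 0) *\<^sub>R u x))\<^sup>2)"
  proof (rule integrableI_bounded)
    show "(\<lambda>x. (norm (g (x 0) *\<^sub>R u x))\<^sup>2) \<in> borel_measurable (cubeM N)"
      by (intro borel_measurable_power measurable_compose[OF m borel_measurable_norm])
  qed (use le in \<open>auto intro: le_less_trans\<close>)
  then show "sqint (cubeM N) (\<lambda>x. g (x 0) *\<^sub>R u x)" using m by (simp add: sqint_def)
  have "ennreal (l2 (cubeM N) (\<lambda>x. g (x 0) *\<^sub>R u x)) \<le> ennreal (mbound N u D * l2 L01 g)"
    using le unfolding l2_def[of "cubeM N"] by (subst (asm) nn_integral_eq_integral[OF i]) auto
  then show "l2 (cubeM N) (\<lambda>x. g (x 0) *\<^sub>R u x) \<le> mbound N u D * l2 L01 g"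
    by (simp add: ennreal_le_iff)
qed

text \<open>Cauchy-Schwarz on each slice bounds the square by 4 times the product of the marginals
  of \<open>u\<close> and \<open>D\<close>; the first is bounded and the second integrable. Square
  integrability is what allows pairing with an L2 function \<open>g\<close>.\<close>

lemma jd_sqint:
  assumes N: "N \<ge> 1" and s: "sqint (cubeM N) u" "sqint (cubeM N) D" and w: "wd N 0 u D"
  shows "sqint L01 (jd N u D)"
proof -
  let ?R = "PiM {1..<N} (\<lambda>_::nat. L01)"
  have jm: "jd N u D \<in> borel_measurable L01" using jd_integral(1)[OF N s] by simp
  have "integrable L01 (\<lambda>t. (norm (jd N u D t))\<^sup>2)"
  proof (rule Bochner_Integration.integrable_bound)
    show "integrable L01 (\<lambda>t. 4 * (mbound N u D * msq N D t))"
      using msq_integral(1)[OF N s(2)] by simp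
    show "AE t in L01. norm ((norm (jd N u D t))\<^sup>2) \<le> norm (4 * (mbound N u D * msq N D t))"
      using marg_integral(1)[OF N sqint_integrable[OF s(1)]] marg_integral(1)[OF N sqint_integrable[OF s(2)]]
        msq_le[OF N s w] AE_space
    proof eventually_elim
      case (elim t)
      have t: "t \<in> {0..1}" using elim(4) by simp
      have su: "sqint ?R (\<lambda>y. u (y(0 := t)))" "sqint ?R (\<lambda>y. D (y(0 := t)))"
        using elim(1,2) measurable_slice[OF N t sqint_measurable[OF s(1)]] measurable_slice[OF N t sqint_measurable[OF s(2)]]
        by (simp_all add: sqint_def)
      have "\<bar>Re (marg N (\<lambda>x. cnj (u x) * D x) t)\<bar> \<le> norm (marg N (\<lambda>x. cnj (u x) * D x) t)" by (rule abs_Re_le_cmod)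
      also have "\<dots> \<le> sqrt (l2 ?R (\<lambda>y. cnj (u (y(0 := t))))) * sqrt (l2 ?R (\<lambda>y. D (y(0 := t))))"
        unfolding marg_def by (rule norm_integral_mult_sqint[OF sqint_cnj[OF su(1)] su(2)])
      also have "\<dots> = sqrt (msq N u t) * sqrt (msq N D t)" by (simp add: msq_def marg_def l2_def)
      finally have "\<bar>jd N u D t\<bar> \<le> 2 * (sqrt (msq N u t) * sqrt (msq N D t))" by (simp add: jd_def abs_mult)
      then have "\<bar>jd N u D t\<bar>\<^sup>2 \<le> (2 * (sqrt (msq N u t) * sqrt (msq N D t)))\<^sup>2" by (rule power_mono) simp
      also have "\<dots> = 4 * (msq N u t * msq N D t)"
        by (simp add: power_mult_distrib msq_def marg_def)
      also have "\<dots> \<le> 4 * (mbound N u D * msq N D t)"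
        using elim(3) by (intro mult_left_mono mult_right_mono) (auto simp: msq_def marg_def)
      finally show ?case by simp
    qed
  qed (use jm in auto)
  then show ?thesis using jm by (simp add: sqint_def)
qed

text \<open>Fubini moves the pairing from the density to the cube, where the dependence on the wave
  function becomes a sesquilinear expression.\<close>

lemma integral_jd:
  assumes N: "N \<ge> 1" and s: "sqint (cubeM N) u" "sqint (cubeM N) D" and w: "wd N 0 u D" and g: "sqint L01 g"
  shows "(\<integral>t. g t * jd N u D t \<partial>L01) = 2 * Re (\<integral>x. cnj (g (x 0) *\<^sub>R u x) * D x \<partial>cubeM N)"
proof -
  let ?F = "\<lambda>x. g (x 0) *\<^sub>R (cnj (u x) * D x)"
  have i: "integrable (cubeM N) ?F"
    using integrable_cnj_mult[OF weighted_sqint(1)[OF N s w g] s(2)] by simp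
  have eq: "marg N ?F = (\<lambda>t. g t *\<^sub>R marg N (\<lambda>x. cnj (u x) * D x) t)" by (rule ext) (rule marg_mult[OF N])
  have ig: "integrable L01 (\<lambda>t. g t *\<^sub>R marg N (\<lambda>x. cnj (u x) * D x) t)"
    and vg: "(\<integral>t. g t *\<^sub>R marg N (\<lambda>x. cnj (u x) * D x) t \<partial>L01) = (\<integral>x. ?F x \<partial>cubeM N)"
    using marg_integral(2,3)[OF N i] unfolding eq by auto
  have "2 * Re (\<integral>x. cnj (g (x 0) *\<^sub>R u x) * D x \<partial>cubeM N) = 2 * Re (\<integral>x. ?F x \<partial>cubeM N)" by simp
  also have "\<dots> = 2 * (\<integral>t. Re (g t *\<^sub>R marg N (\<lambda>x. cnj (u x) * D x) t) \<partial>L01)"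
    unfolding vg[symmetric] using ig by (simp only: integral_Re)
  also have "\<dots> = (\<integral>t. 2 * Re (g t *\<^sub>R marg N (\<lambda>x. cnj (u x) * D x) t) \<partial>L01)" by simp
  also have "\<dots> = (\<integral>t. g t * jd N u D t \<partial>L01)"
    by (rule Bochner_Integration.integral_cong) (auto simp: jd_def)
  finally show ?thesis by simp
qed

section \<open>Hermitian forms on the form domain\<close>

lemma finite_spins [simp]: "finite (spins N)"
  by (simp add: spins_def finite_PiE)

lemma L2wf_iff: "L2wf N \<Psi> \<longleftrightarrow> (\<forall>\<sigma>\<in>spins N. sqint (cubeM N) (\<lambda>x. \<Psi> x \<sigma>))"
  by (simp add: L2wf_def sqint_def)

lemma L2wfD: "L2wf N \<Psi> \<Longrightarrow> \<sigma> \<in> spins N \<Longrightarrow> sqint (cubeM N) (\<lambda>x. \<Psi> x \<sigma>)"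
  by (simp add: L2wf_iff)

lemma nrm2_eq: "nrm2 N \<Psi> = (\<Sum>\<sigma>\<in>spins N. l2 (cubeM N) (\<lambda>x. \<Psi> x \<sigma>))"
  by (simp add: nrm2_def l2_def)

lemma nrm2_nonneg [simp]: "0 \<le> nrm2 N \<Psi>"
  by (simp add: nrm2_eq sum_nonneg)

lemma Tkin_nonneg [simp]: "0 \<le> Tkin N \<Psi>"
  by (simp add: Tkin_def sum_nonneg)

lemma inner_wf_self: "inner_wf N \<Psi> \<Psi> = of_real (nrm2 N \<Psi>)"
proof -
  have "(\<integral>x. cnj (\<Psi> x \<sigma>) * \<Psi> x \<sigma> \<partial>cubeM N) = of_real (\<integral>x. (cmod (\<Psi> x \<sigma>))\<^sup>2 \<partial>cubeM N)" for \<sigma>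
    unfolding integral_complex_of_real[symmetric]
    by (rule Bochner_Integration.integral_cong) (simp_all only: complex_norm_square mult.commute)
  then show ?thesis by (simp add: inner_wf_def nrm2_def)
qed

text \<open>The combination has exactly the shape of the linearity clause in
  \<open>interaction\<close>, so \<open>herm_W\<close> needs only unfolding.\<close>

definition vlin :: "complex \<Rightarrow> wf \<Rightarrow> wf \<Rightarrow> wf" where
  "vlin a \<Phi> \<Psi> = (\<lambda>x \<sigma>. a * \<Phi> x \<sigma> + \<Psi> x \<sigma>)"

lemma L2wf_vlin: "L2wf N \<Phi> \<Longrightarrow> L2wf N \<Psi> \<Longrightarrow> L2wf N (vlin a \<Phi> \<Psi>)"
  unfolding L2wf_iff vlin_def by (auto intro!: sqint_add sqint_mult_left)

lemma wderiv_wf_vlin: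
  assumes "j < N" "L2wf N \<Phi>" "L2wf N \<Psi>" "L2wf N D" "L2wf N E" "wderiv_wf N j \<Phi> D" "wderiv_wf N j \<Psi> E"
  shows "wderiv_wf N j (vlin a \<Phi> \<Psi>) (vlin a D E)"
  using assms unfolding wderiv_wf_iff vlin_def by (auto intro!: wd_linear L2wfD)

lemma fdom_L2wf: "fdom N \<Psi> \<Longrightarrow> L2wf N \<Psi>" and fdom_antisym: "fdom N \<Psi> \<Longrightarrow> antisym_wf N \<Psi>"
  by (simp_all add: fdom_def)

lemma spins_tsw:
  assumes "j < N" "k < N" "\<sigma> \<in> spins N" shows "\<sigma> \<circ> tsw j k \<in> spins N"
  using assms by (auto simp: spins_def PiE_iff extensional_def tsw_def)

lemma fdom_vlin:
  assumes "fdom N \<Phi>" "fdom N \<Psi>" shows "fdom N (vlin a \<Phi> \<Psi>)"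
  unfolding fdom_def
proof (intro conjI allI impI)
  show "L2wf N (vlin a \<Phi> \<Psi>)" using assms by (intro L2wf_vlin fdom_L2wf)
  show "antisym_wf N (vlin a \<Phi> \<Psi>)"
    unfolding antisym_wf_def
  proof (intro allI impI ballI)
    fix j k \<sigma> assume "j < N" "k < N" "j \<noteq> k" "\<sigma> \<in> spins N"
    then have "AE x in cubeM N. \<Phi> (x \<circ> tsw j k) (\<sigma> \<circ> tsw j k) = - \<Phi> x \<sigma>"
      "AE x in cubeM N. \<Psi> (x \<circ> tsw j k) (\<sigma> \<circ> tsw j k) = - \<Psi> x \<sigma>"
      using fdom_antisym[OF assms(1)] fdom_antisym[OF assms(2)] unfolding antisym_wf_def by blast+
    then show "AE x in cubeM N. vlin a \<Phi> \<Psi> (x \<circ> tsw j k) (\<sigma> \<circ> tsw j k) = - vlin a \<Phi> \<Psi> x \<sigma>"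
      by eventually_elim (simp add: vlin_def)
  qed
  fix j assume j: "j < N"
  then obtain D E where "L2wf N D" "wderiv_wf N j \<Phi> D" "L2wf N E" "wderiv_wf N j \<Psi> E"
    using assms unfolding fdom_def by blast
  then show "\<exists>D. L2wf N D \<and> wderiv_wf N j (vlin a \<Phi> \<Psi>) D"
    using wderiv_wf_vlin[OF j fdom_L2wf[OF assms(1)] fdom_L2wf[OF assms(2)]] L2wf_vlin by blast
qed

lemma grad_props:
  assumes "fdom N \<Psi>" "j < N"
  shows "L2wf N (grad N j \<Psi>)" "wderiv_wf N j \<Psi> (grad N j \<Psi>)"
proof -
  have "\<exists>D. L2wf N D \<and> wderiv_wf N j \<Psi> D" using assms by (simp add: fdom_def)
  from someI_ex[OF this] have "L2wf N (grad N j \<Psi>) \<and> wderiv_wf N j \<Psi> (grad N j \<Psi>)"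
    unfolding grad_def .
  then show "L2wf N (grad N j \<Psi>)" "wderiv_wf N j \<Psi> (grad N j \<Psi>)" by auto
qed

lemma wderiv_wf_unique:
  assumes "j < N" "wderiv_wf N j \<Psi> D" "wderiv_wf N j \<Psi> E" "L2wf N D" "L2wf N E" "\<sigma> \<in> spins N"
  shows "AE x in cubeM N. D x \<sigma> = E x \<sigma>"
  by (rule wd_unique[OF assms(1)]) (use assms in \<open>auto simp: wderiv_wf_iff L2wf_iff\<close>)

lemma grad_AE:
  assumes "fdom N \<Psi>" "j < N" "L2wf N D" "wderiv_wf N j \<Psi> D" "\<sigma> \<in> spins N"
  shows "AE x in cubeM N. grad N j \<Psi> x \<sigma> = D x \<sigma>"
  by (rule wderiv_wf_unique[OF assms(2) grad_props(2)]) (use assms grad_props in auto)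

lemma grad_vlin:
  assumes "fdom N \<Phi>" "fdom N \<Psi>" "j < N" "\<sigma> \<in> spins N"
  shows "AE x in cubeM N. grad N j (vlin a \<Phi> \<Psi>) x \<sigma> = a * grad N j \<Phi> x \<sigma> + grad N j \<Psi> x \<sigma>"
  using grad_AE[OF fdom_vlin[OF assms(1,2)] assms(3) L2wf_vlin wderiv_wf_vlin assms(4)]
    grad_props[OF assms(1,3)] grad_props[OF assms(2,3)] fdom_L2wf assms
  by (simp add: vlin_def)

lemma grad_sqint: "fdom N \<Psi> \<Longrightarrow> j < N \<Longrightarrow> \<sigma> \<in> spins N \<Longrightarrow> sqint (cubeM N) (\<lambda>x. grad N j \<Psi> x \<sigma>)"
  using grad_props(1) L2wfD by blast

lemma grad_wd: "fdom N \<Psi> \<Longrightarrow> j < N \<Longrightarrow> \<sigma> \<in> spins N \<Longrightarrow> wd N j (\<lambda>x. \<Psi> x \<sigma>) (\<lambda>x. grad N j \<Psi> x \<sigma>)"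
  using grad_props(2) wderiv_wf_iff by blast

lemma fdom_sqint: "fdom N \<Psi> \<Longrightarrow> \<sigma> \<in> spins N \<Longrightarrow> sqint (cubeM N) (\<lambda>x. \<Psi> x \<sigma>)"
  using fdom_L2wf L2wfD by blast

text \<open>The conditions are confined to the form domain, outside of which the chosen gradients
  carry no information. Antilinearity in the first argument follows from symmetry and is derived in
  \<open>herm_left\<close>.\<close>

definition herm :: "nat \<Rightarrow> (wf \<Rightarrow> wf \<Rightarrow> complex) \<Rightarrow> bool" where
  "herm N B \<longleftrightarrow> (\<forall>\<Phi> \<Psi>. fdom N \<Phi> \<longrightarrow> fdom N \<Psi> \<longrightarrow> B \<Phi> \<Psi> = cnj (B \<Psi> \<Phi>)) \<and>
    (\<forall>\<Phi> \<Psi>1 \<Psi>2 a. fdom N \<Phi> \<longrightarrow> fdom N \<Psi>1 \<longrightarrow> fdom N \<Psi>2 \<longrightarrow>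
      B \<Phi> (vlin a \<Psi>1 \<Psi>2) = a * B \<Phi> \<Psi>1 + B \<Phi> \<Psi>2)"

lemma hermD:
  assumes "herm N B"
  shows "fdom N \<Phi> \<Longrightarrow> fdom N \<Psi> \<Longrightarrow> B \<Phi> \<Psi> = cnj (B \<Psi> \<Phi>)"
    "fdom N \<Phi> \<Longrightarrow> fdom N \<Psi>1 \<Longrightarrow> fdom N \<Psi>2 \<Longrightarrow> B \<Phi> (vlin a \<Psi>1 \<Psi>2) = a * B \<Phi> \<Psi>1 + B \<Phi> \<Psi>2"
  using assms unfolding herm_def by blast+

lemma herm_left:
  assumes "herm N B" "fdom N \<Phi>1" "fdom N \<Phi>2" "fdom N \<Psi>"
  shows "B (vlin a \<Phi>1 \<Phi>2) \<Psi> = cnj a * B \<Phi>1 \<Psi> + B \<Phi>2 \<Psi>"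
proof -
  have "B (vlin a \<Phi>1 \<Phi>2) \<Psi> = cnj (B \<Psi> (vlin a \<Phi>1 \<Phi>2))"
    by (rule hermD(1)[OF assms(1)]) (use assms fdom_vlin in auto)
  also have "\<dots> = cnj (a * B \<Psi> \<Phi>1 + B \<Psi> \<Phi>2)" by (simp add: hermD(2)[OF assms(1)] assms)
  also have "\<dots> = cnj a * B \<Phi>1 \<Psi> + B \<Phi>2 \<Psi>"
    using hermD(1)[OF assms(1) assms(2,4)] hermD(1)[OF assms(1) assms(3,4)] by simp
  finally show ?thesis .
qed

lemma herm_expand_c:
  assumes "herm N B" "fdom N \<Phi>" "fdom N \<Psi>"
  shows "B (vlin a \<Phi> \<Psi>) (vlin a \<Phi> \<Psi>) = of_real ((cmod a)\<^sup>2) * B \<Phi> \<Phi> + B \<Psi> \<Psi> + (a * B \<Psi> \<Phi> + cnj (a * B \<Psi> \<Phi>))"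
proof -
  have "B (vlin a \<Phi> \<Psi>) (vlin a \<Phi> \<Psi>) = cnj a * (a * B \<Phi> \<Phi> + B \<Phi> \<Psi>) + (a * B \<Psi> \<Phi> + B \<Psi> \<Psi>)"
    by (simp add: herm_left[OF assms(1)] hermD(2)[OF assms(1)] assms fdom_vlin algebra_simps)
  also have "B \<Phi> \<Psi> = cnj (B \<Psi> \<Phi>)" by (rule hermD(1)[OF assms])
  finally show ?thesis unfolding complex_norm_square complex_cnj_mult by algebra
qed

lemma herm_expand:
  assumes "herm N B" "fdom N \<Phi>" "fdom N \<Psi>"
  shows "Re (B (vlin a \<Phi> \<Psi>) (vlin a \<Phi> \<Psi>)) = (cmod a)\<^sup>2 * Re (B \<Phi> \<Phi>) + Re (B \<Psi> \<Psi>) + 2 * Re (a * B \<Psi> \<Phi>)"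
  unfolding herm_expand_c[OF assms] by (simp add: Re_complex_of_real del: of_real_power)

lemma hermI:
  assumes "\<And>\<Phi> \<Psi>. fdom N \<Phi> \<Longrightarrow> fdom N \<Psi> \<Longrightarrow> B \<Phi> \<Psi> = cnj (B \<Psi> \<Phi>)"
    "\<And>\<Phi> \<Psi>1 \<Psi>2 a. fdom N \<Phi> \<Longrightarrow> fdom N \<Psi>1 \<Longrightarrow> fdom N \<Psi>2 \<Longrightarrow>
      B \<Phi> (vlin a \<Psi>1 \<Psi>2) = a * B \<Phi> \<Psi>1 + B \<Phi> \<Psi>2"
  shows "herm N B"
  using assms unfolding herm_def by blast

lemma herm_add:
  assumes B: "herm N B" and C: "herm N C" shows "herm N (\<lambda>\<Phi> \<Psi>. B \<Phi> \<Psi> + C \<Phi> \<Psi>)"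
proof (rule hermI)
  fix \<Phi> \<Psi> assume f: "fdom N \<Phi>" "fdom N \<Psi>"
  show "B \<Phi> \<Psi> + C \<Phi> \<Psi> = cnj (B \<Psi> \<Phi> + C \<Psi> \<Phi>)"
    using hermD(1)[OF B f] hermD(1)[OF C f] by simp
next
  fix \<Phi> \<Psi>1 \<Psi>2 a assume f: "fdom N \<Phi>" "fdom N \<Psi>1" "fdom N \<Psi>2"
  show "B \<Phi> (vlin a \<Psi>1 \<Psi>2) + C \<Phi> (vlin a \<Psi>1 \<Psi>2) = a * (B \<Phi> \<Psi>1 + C \<Phi> \<Psi>1) + (B \<Phi> \<Psi>2 + C \<Phi> \<Psi>2)"
    unfolding hermD(2)[OF B f] hermD(2)[OF C f] by (simp add: algebra_simps)
qed

lemma herm_scale: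
  assumes B: "herm N B" shows "herm N (\<lambda>\<Phi> \<Psi>. of_real c * B \<Phi> \<Psi>)"
proof (rule hermI)
  fix \<Phi> \<Psi> assume f: "fdom N \<Phi>" "fdom N \<Psi>"
  show "of_real c * B \<Phi> \<Psi> = cnj (of_real c * B \<Psi> \<Phi>)"
    using hermD(1)[OF B f] by simp
next
  fix \<Phi> \<Psi>1 \<Psi>2 a assume f: "fdom N \<Phi>" "fdom N \<Psi>1" "fdom N \<Psi>2"
  show "of_real c * B \<Phi> (vlin a \<Psi>1 \<Psi>2) = a * (of_real c * B \<Phi> \<Psi>1) + of_real c * B \<Phi> \<Psi>2"
    unfolding hermD(2)[OF B f] by (simp add: algebra_simps)
qed

lemma herm_sum:
  assumes "\<And>i. i \<in> A \<Longrightarrow> herm N (B i)" shows "herm N (\<lambda>\<Phi> \<Psi>. \<Sum>i\<in>A. B i \<Phi> \<Psi>)"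
  using assms
proof (induction A rule: infinite_finite_induct)
  case (insert i A)
  then show ?case using herm_add[of N "B i" "\<lambda>\<Phi> \<Psi>. \<Sum>i\<in>A. B i \<Phi> \<Psi>"] by simp
qed (auto intro: hermI)

lemma cnj_integral_swap: "(\<integral>x. cnj (u x) * v x \<partial>M) = cnj (\<integral>x. cnj (v x) * u x \<partial>M)"
proof -
  have "(\<integral>x. cnj (u x) * v x \<partial>M) = (\<integral>x. cnj (cnj (v x) * u x) \<partial>M)"
    by (rule Bochner_Integration.integral_cong) (auto simp: mult.commute)
  then show ?thesis by (simp only: Bochner_Integration.integral_cnj)
qed

lemma integral_cnj_mult_linear:
  assumes "sqint M u" "sqint M v" "sqint M w" "h \<in> borel_measurable M" "AE x in M. h x = a * v x + w x"
  shows "(\<integral>x. cnj (u x) * h x \<partial>M) = a * (\<integral>x. cnj (u x) * v x \<partial>M) + (\<integral>x. cnj (u x) * w x \<partial>M)"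
proof -
  note i = integrable_cnj_mult[OF assms(1,2)] integrable_cnj_mult[OF assms(1,3)]
  have "(\<integral>x. cnj (u x) * h x \<partial>M) = (\<integral>x. a * (cnj (u x) * v x) + cnj (u x) * w x \<partial>M)"
  proof (rule integral_cong_AE)
    show "(\<lambda>x. cnj (u x) * h x) \<in> borel_measurable M"
      using sqint_measurable[OF sqint_cnj[OF assms(1)]] assms(4) by simp
    show "(\<lambda>x. a * (cnj (u x) * v x) + cnj (u x) * w x) \<in> borel_measurable M"
      using i by simp
    show "AE x in M. cnj (u x) * h x = a * (cnj (u x) * v x) + cnj (u x) * w x"
      using assms(5) by eventually_elim (simp add: algebra_simps)
  qed
  then show ?thesis using i by simp
qed

lemma herm_inner: "herm N (inner_wf N)"
  unfolding herm_def inner_wf_def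
proof (intro conjI allI impI)
  fix \<Phi> \<Psi>
  show "(\<Sum>\<sigma>\<in>spins N. \<integral>x. cnj (\<Phi> x \<sigma>) * \<Psi> x \<sigma> \<partial>cubeM N) = cnj (\<Sum>\<sigma>\<in>spins N. \<integral>x. cnj (\<Psi> x \<sigma>) * \<Phi> x \<sigma> \<partial>cubeM N)"
    by (subst cnj_integral_swap) simp
next
  fix \<Phi> \<Psi>1 \<Psi>2 a assume f: "fdom N \<Phi>" "fdom N \<Psi>1" "fdom N \<Psi>2"
  have "(\<integral>x. cnj (\<Phi> x \<sigma>) * vlin a \<Psi>1 \<Psi>2 x \<sigma> \<partial>cubeM N) =
    a * (\<integral>x. cnj (\<Phi> x \<sigma>) * \<Psi>1 x \<sigma> \<partial>cubeM N) + (\<integral>x. cnj (\<Phi> x \<sigma>) * \<Psi>2 x \<sigma> \<partial>cubeM N)" if "\<sigma> \<in> spins N" for \<sigma>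
    using fdom_sqint[OF f(1) that] fdom_sqint[OF f(2) that] fdom_sqint[OF f(3) that] fdom_sqint[OF fdom_vlin[OF f(2,3)] that]
    by (intro integral_cnj_mult_linear) (auto simp: vlin_def sqint_measurable)
  then show "(\<Sum>\<sigma>\<in>spins N. \<integral>x. cnj (\<Phi> x \<sigma>) * vlin a \<Psi>1 \<Psi>2 x \<sigma> \<partial>cubeM N) =
    a * (\<Sum>\<sigma>\<in>spins N. \<integral>x. cnj (\<Phi> x \<sigma>) * \<Psi>1 x \<sigma> \<partial>cubeM N) + (\<Sum>\<sigma>\<in>spins N. \<integral>x. cnj (\<Phi> x \<sigma>) * \<Psi>2 x \<sigma> \<partial>cubeM N)"
    by (simp add: sum_distrib_left sum.distrib)
qed

lemma herm_grad: "j < N \<Longrightarrow> herm N (\<lambda>\<Phi> \<Psi>. inner_wf N (grad N j \<Phi>) (grad N j \<Psi>))"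
  unfolding herm_def inner_wf_def
proof (intro conjI allI impI)
  fix \<Phi> \<Psi>
  show "(\<Sum>\<sigma>\<in>spins N. \<integral>x. cnj (grad N j \<Phi> x \<sigma>) * grad N j \<Psi> x \<sigma> \<partial>cubeM N) = cnj (\<Sum>\<sigma>\<in>spins N. \<integral>x. cnj (grad N j \<Psi> x \<sigma>) * grad N j \<Phi> x \<sigma> \<partial>cubeM N)"
    by (subst cnj_integral_swap) simp
next
  fix \<Phi> \<Psi>1 \<Psi>2 a assume f: "fdom N \<Phi>" "fdom N \<Psi>1" "fdom N \<Psi>2" and j: "j < N"
  have "(\<integral>x. cnj (grad N j \<Phi> x \<sigma>) * grad N j (vlin a \<Psi>1 \<Psi>2) x \<sigma> \<partial>cubeM N) =
    a * (\<integral>x. cnj (grad N j \<Phi> x \<sigma>) * grad N j \<Psi>1 x \<sigma> \<partial>cubeM N) + (\<integral>x. cnj (grad N j \<Phi> x \<sigma>) * grad N j \<Psi>2 x \<sigma> \<partial>cubeM N)" if "\<sigma> \<in> spins N" for \<sigma>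
    using grad_sqint[OF f(1) j that] grad_sqint[OF f(2) j that] grad_sqint[OF f(3) j that] grad_sqint[OF fdom_vlin[OF f(2,3)] j that]
      grad_vlin[OF f(2,3) j that]
    by (intro integral_cnj_mult_linear) (auto simp: sqint_measurable)
  then show "(\<Sum>\<sigma>\<in>spins N. \<integral>x. cnj (grad N j \<Phi> x \<sigma>) * grad N j (vlin a \<Psi>1 \<Psi>2) x \<sigma> \<partial>cubeM N) =
    a * (\<Sum>\<sigma>\<in>spins N. \<integral>x. cnj (grad N j \<Phi> x \<sigma>) * grad N j \<Psi>1 x \<sigma> \<partial>cubeM N) + (\<Sum>\<sigma>\<in>spins N. \<integral>x. cnj (grad N j \<Phi> x \<sigma>) * grad N j \<Psi>2 x \<sigma> \<partial>cubeM N)"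
    by (simp add: sum_distrib_left sum.distrib)
qed

definition kf :: "nat \<Rightarrow> wf \<Rightarrow> wf \<Rightarrow> complex" where
  "kf N \<Phi> \<Psi> = of_real (1/2) * (\<Sum>j<N. inner_wf N (grad N j \<Phi>) (grad N j \<Psi>))"

lemma herm_kf: "herm N (kf N)"
  unfolding kf_def[abs_def] by (intro herm_scale herm_sum herm_grad) auto

lemma kf_self: "kf N \<Psi> \<Psi> = of_real (Tkin N \<Psi>)"
  by (simp add: kf_def Tkin_def inner_wf_self)

lemma herm_W: "interaction N W \<Longrightarrow> herm N W"
  unfolding interaction_def herm_def vlin_def by blast

section \<open>The potential form, density derivatives, and the relative bound\<close>

text \<open>The potential form of v = nabla g, with the derivative moved onto the wave function, so that sesquilinearity is visible.\<close>

definition pf :: "nat \<Rightarrow> (real \<Rightarrow> real) \<Rightarrow> wf \<Rightarrow> wf \<Rightarrow> complex" where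
  "pf N g \<Phi> \<Psi> = of_real (- real N) * (\<Sum>\<sigma>\<in>spins N. (\<integral>x. cnj (g (x 0) *\<^sub>R \<Phi> x \<sigma>) * grad N 0 \<Psi> x \<sigma> \<partial>cubeM N)
     + cnj (\<integral>x. cnj (g (x 0) *\<^sub>R \<Psi> x \<sigma>) * grad N 0 \<Phi> x \<sigma> \<partial>cubeM N))"

lemma fdom_weighted_sqint:
  assumes "N \<ge> 1" "fdom N \<Psi>" "L2T g" "\<sigma> \<in> spins N"
  shows "sqint (cubeM N) (\<lambda>x. g (x 0) *\<^sub>R \<Psi> x \<sigma>)"
proof -
  have j: "0 < N" using assms(1) by simp
  show ?thesis
    by (rule weighted_sqint(1)[OF assms(1) fdom_sqint[OF assms(2,4)] grad_sqint[OF assms(2) j assms(4)]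
      grad_wd[OF assms(2) j assms(4)] assms(3)[unfolded L2T_iff]])
qed

lemma herm_pf:
  assumes N: "N \<ge> 1" and g: "L2T g" shows "herm N (pf N g)"
  unfolding pf_def[abs_def]
proof (intro herm_scale herm_sum)
  fix \<sigma> assume \<sigma>: "\<sigma> \<in> spins N"
  have j: "0 < N" using N by simp
  show "herm N (\<lambda>\<Phi> \<Psi>. (\<integral>x. cnj (g (x 0) *\<^sub>R \<Phi> x \<sigma>) * grad N 0 \<Psi> x \<sigma> \<partial>cubeM N)
     + cnj (\<integral>x. cnj (g (x 0) *\<^sub>R \<Psi> x \<sigma>) * grad N 0 \<Phi> x \<sigma> \<partial>cubeM N))"
    unfolding herm_def
  proof (intro conjI allI impI)
    fix \<Phi> \<Psi>1 \<Psi>2 a assume f: "fdom N \<Phi>" "fdom N \<Psi>1" "fdom N \<Psi>2"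
    note f12 = fdom_vlin[OF f(2,3), of a]
    note w = fdom_weighted_sqint[OF N _ g \<sigma>]
    have 1: "(\<integral>x. cnj (g (x 0) *\<^sub>R \<Phi> x \<sigma>) * grad N 0 (vlin a \<Psi>1 \<Psi>2) x \<sigma> \<partial>cubeM N) =
      a * (\<integral>x. cnj (g (x 0) *\<^sub>R \<Phi> x \<sigma>) * grad N 0 \<Psi>1 x \<sigma> \<partial>cubeM N) + (\<integral>x. cnj (g (x 0) *\<^sub>R \<Phi> x \<sigma>) * grad N 0 \<Psi>2 x \<sigma> \<partial>cubeM N)"
      using w[OF f(1)] grad_sqint[OF f(2) j \<sigma>] grad_sqint[OF f(3) j \<sigma>] grad_sqint[OF f12 j \<sigma>] grad_vlin[OF f(2,3) j \<sigma>]
      by (intro integral_cnj_mult_linear) (auto simp: sqint_measurable)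
    have 2: "(\<integral>x. cnj (grad N 0 \<Phi> x \<sigma>) * (g (x 0) *\<^sub>R vlin a \<Psi>1 \<Psi>2 x \<sigma>) \<partial>cubeM N) =
      a * (\<integral>x. cnj (grad N 0 \<Phi> x \<sigma>) * (g (x 0) *\<^sub>R \<Psi>1 x \<sigma>) \<partial>cubeM N) + (\<integral>x. cnj (grad N 0 \<Phi> x \<sigma>) * (g (x 0) *\<^sub>R \<Psi>2 x \<sigma>) \<partial>cubeM N)"
      using w[OF f(2)] w[OF f(3)] grad_sqint[OF f(1) j \<sigma>]  sqint_measurable[OF w[OF f12]]
      by (intro integral_cnj_mult_linear) (auto simp: vlin_def algebra_simps)
    show "(\<integral>x. cnj (g (x 0) *\<^sub>R \<Phi> x \<sigma>) * grad N 0 (vlin a \<Psi>1 \<Psi>2) x \<sigma> \<partial>cubeM N)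
      + cnj (\<integral>x. cnj (g (x 0) *\<^sub>R vlin a \<Psi>1 \<Psi>2 x \<sigma>) * grad N 0 \<Phi> x \<sigma> \<partial>cubeM N)
      = a * ((\<integral>x. cnj (g (x 0) *\<^sub>R \<Phi> x \<sigma>) * grad N 0 \<Psi>1 x \<sigma> \<partial>cubeM N) + cnj (\<integral>x. cnj (g (x 0) *\<^sub>R \<Psi>1 x \<sigma>) * grad N 0 \<Phi> x \<sigma> \<partial>cubeM N))
      + ((\<integral>x. cnj (g (x 0) *\<^sub>R \<Phi> x \<sigma>) * grad N 0 \<Psi>2 x \<sigma> \<partial>cubeM N) + cnj (\<integral>x. cnj (g (x 0) *\<^sub>R \<Psi>2 x \<sigma>) * grad N 0 \<Phi> x \<sigma> \<partial>cubeM N))"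
      unfolding 1 cnj_integral_swap[symmetric] 2 by (simp add: algebra_simps)
  qed simp
qed

definition Jd :: "nat \<Rightarrow> wf \<Rightarrow> real \<Rightarrow> real" where
  "Jd N \<Psi> = gradT (dens N \<Psi>)"

lemma dens_eq: "dens N \<Psi> t = real N * (\<Sum>\<sigma>\<in>spins N. msq N (\<lambda>x. \<Psi> x \<sigma>) t)"
  by (simp add: dens_def msq_def marg_def)

lemma dens_props:
  assumes N: "N \<ge> 1" and f: "fdom N \<Psi>"
  shows "integrable L01 (dens N \<Psi>)" "(\<integral>t. dens N \<Psi> t \<partial>L01) = real N * nrm2 N \<Psi>"
    "L2T (Jd N \<Psi>)" "wderivT (dens N \<Psi>) (Jd N \<Psi>)"
    "AE t in L01. Jd N \<Psi> t = real N * (\<Sum>\<sigma>\<in>spins N. jd N (\<lambda>x. \<Psi> x \<sigma>) (\<lambda>x. grad N 0 \<Psi> x \<sigma>) t)"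
proof -
  have j: "0 < N" using N by simp
  note s = fdom_sqint[OF f] grad_sqint[OF f j] grad_wd[OF f j]
  let ?m = "\<lambda>\<sigma>. msq N (\<lambda>x. \<Psi> x \<sigma>)" and ?d = "\<lambda>\<sigma>. jd N (\<lambda>x. \<Psi> x \<sigma>) (\<lambda>x. grad N 0 \<Psi> x \<sigma>)"
  show i: "integrable L01 (dens N \<Psi>)" "(\<integral>t. dens N \<Psi> t \<partial>L01) = real N * nrm2 N \<Psi>"
    unfolding dens_eq[abs_def] nrm2_eq using msq_integral[OF N s(1)] by simp_all
  have sq: "sqint L01 (\<lambda>t. real N * (\<Sum>\<sigma>\<in>spins N. ?d \<sigma> t))"
    by (intro sqint_mult_left sqint_sum jd_sqint[OF N] s)
  have w: "wderivT (\<lambda>t. \<Sum>\<sigma>\<in>A. ?m \<sigma> t) (\<lambda>t. \<Sum>\<sigma>\<in>A. ?d \<sigma> t)" if "A \<subseteq> spins N" for A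
    using finite_subset[OF that finite_spins] that
  proof (induction A rule: finite_induct)
    case empty then show ?case by (simp add: wderivT_def)
  next
    case (insert \<sigma> A)
    then have \<sigma>: "\<sigma> \<in> spins N" and A: "A \<subseteq> spins N" by auto
    have i: "integrable L01 (\<lambda>t. \<Sum>\<sigma>\<in>A. ?m \<sigma> t)" "integrable L01 (\<lambda>t. \<Sum>\<sigma>\<in>A. ?d \<sigma> t)"
      using A by (auto intro!: Bochner_Integration.integrable_sum msq_integral[OF N] jd_integral[OF N] s)
    from wderivT_linear[OF msq_integral(1)[OF N s(1)[OF \<sigma>]] i(1) jd_integral(1)[OF N s(1)[OF \<sigma>] s(2)[OF \<sigma>]] i(2)
        wderivT_msq[OF N s(1)[OF \<sigma>] s(2)[OF \<sigma>] s(3)[OF \<sigma>]] insert.IH[OF A], of 1 1]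
    show ?case using insert(1,2) by simp
  qed
  have i2: "integrable L01 (\<lambda>t. \<Sum>\<sigma>\<in>spins N. ?m \<sigma> t)" "integrable L01 (\<lambda>t. \<Sum>\<sigma>\<in>spins N. ?d \<sigma> t)"
    by (auto intro!: Bochner_Integration.integrable_sum msq_integral[OF N] jd_integral[OF N] s)
  have "wderivT (dens N \<Psi>) (\<lambda>t. real N * (\<Sum>\<sigma>\<in>spins N. ?d \<sigma> t))"
    using wderivT_linear[OF i2(1) i2(1) i2(2) i2(2) w[OF order_refl] w[OF order_refl], of "real N" 0]
    by (simp add: dens_eq[abs_def])
  from gradT_AE[OF _ this] sq
  show "L2T (Jd N \<Psi>)" "wderivT (dens N \<Psi>) (Jd N \<Psi>)"
    "AE t in L01. Jd N \<Psi> t = real N * (\<Sum>\<sigma>\<in>spins N. ?d \<sigma> t)"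
    by (simp_all add: Jd_def L2T_iff)
qed

lemma pf_self:
  assumes N: "N \<ge> 1" and f: "fdom N \<Psi>" and g: "L2T g"
  shows "Re (pf N g \<Psi> \<Psi>) = - (\<integral>t. g t * Jd N \<Psi> t \<partial>L01)"
proof -
  have j: "0 < N" using N by simp
  note s = fdom_sqint[OF f] grad_sqint[OF f j] grad_wd[OF f j]
  have g': "sqint L01 g" using g by (simp add: L2T_iff)
  let ?d = "\<lambda>\<sigma>. jd N (\<lambda>x. \<Psi> x \<sigma>) (\<lambda>x. grad N 0 \<Psi> x \<sigma>)"
  have sd: "sqint L01 (?d \<sigma>)" if "\<sigma> \<in> spins N" for \<sigma> by (rule jd_sqint[OF N s(1)[OF that] s(2)[OF that] s(3)[OF that]])
  have sJ: "sqint L01 (\<lambda>t. real N * (\<Sum>\<sigma>\<in>spins N. ?d \<sigma> t))"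
    by (intro sqint_mult_left sqint_sum sd)
  have "(\<integral>t. g t * Jd N \<Psi> t \<partial>L01) = (\<integral>t. g t * (real N * (\<Sum>\<sigma>\<in>spins N. ?d \<sigma> t)) \<partial>L01)"
  proof (rule integral_cong_AE)
    show "AE t in L01. g t * Jd N \<Psi> t = g t * (real N * (\<Sum>\<sigma>\<in>spins N. ?d \<sigma> t))"
      using dens_props(5)[OF N f] by eventually_elim simp
    show "(\<lambda>t. g t * Jd N \<Psi> t) \<in> borel_measurable L01"
      using dens_props(3)[OF N f] g' by (auto simp: L2T_iff sqint_measurable)
    show "(\<lambda>t. g t * (real N * (\<Sum>\<sigma>\<in>spins N. ?d \<sigma> t))) \<in> borel_measurable L01"
      using sqint_measurable[OF sJ] sqint_measurable[OF g'] by simp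
  qed
  also have "\<dots> = (\<integral>t. real N * (\<Sum>\<sigma>\<in>spins N. g t * ?d \<sigma> t) \<partial>L01)"
    by (simp add: sum_distrib_left mult.left_commute)
  also have "\<dots> = real N * (\<Sum>\<sigma>\<in>spins N. \<integral>t. g t * ?d \<sigma> t \<partial>L01)"
    using integrable_mult_sqint(1)[OF g' sd] by simp
  also have "\<dots> = real N * (\<Sum>\<sigma>\<in>spins N. 2 * Re (\<integral>x. cnj (g (x 0) *\<^sub>R \<Psi> x \<sigma>) * grad N 0 \<Psi> x \<sigma> \<partial>cubeM N))"
    using integral_jd[OF N s(1) s(2) s(3) g'] by simp
  finally show ?thesis by (simp add: pf_def)
qed

text \<open>Two uses with d as the first factor leave d squared over 4, which is the share of the
  gradient norm that half the kinetic energy can absorb.\<close>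

lemma young_8: "x * y \<le> x\<^sup>2 / 8 + 2 * y\<^sup>2" for x y :: real
proof -
  have "0 \<le> (x - 4 * y)\<^sup>2 / 8" by simp
  then show ?thesis by (simp add: power2_diff field_simps)
qed

text \<open>With n and d the norms of a component and of its gradient, the weighted component has
  squared norm at most (n^2 + 2nd) G, so the potential costs at most a multiple of d sqrt(n^2 +
  2nd); Young's inequality trades this for kinetic energy. The constant depends on \<open>g\<close>
  only through the bound G, as needed when the potential is perturbed.\<close>

lemma pf_bound:
  assumes N: "N \<ge> 1"
  shows "\<exists>C\<ge>0. \<forall>g \<Psi>. L2T g \<longrightarrow> l2 L01 g \<le> G \<longrightarrow> fdom N \<Psi> \<longrightarrow> \<bar>Re (pf N g \<Psi> \<Psi>)\<bar> \<le> Tkin N \<Psi> / 2 + C * nrm2 N \<Psi>"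
proof (intro exI conjI allI impI)
  define A where "A = 2 * real N * sqrt (max 0 G)"
  have A0: "A \<ge> 0" by (simp add: A_def)
  show "0 \<le> 2 * A\<^sup>2 + 2 * (4 * A\<^sup>2)\<^sup>2" by simp
  fix g \<Psi> assume g: "L2T g" "l2 L01 g \<le> G" and f: "fdom N \<Psi>"
  have j: "0 < N" using N by simp
  note s = fdom_sqint[OF f] grad_sqint[OF f j] grad_wd[OF f j]
  have g': "sqint L01 g" using g by (simp add: L2T_iff)
  have summand: "real N * \<bar>2 * Re (\<integral>x. cnj (g (x 0) *\<^sub>R \<Psi> x \<sigma>) * grad N 0 \<Psi> x \<sigma> \<partial>cubeM N)\<bar>
     \<le> l2 (cubeM N) (\<lambda>x. grad N 0 \<Psi> x \<sigma>) / 4 + (2 * A\<^sup>2 + 2 * (4 * A\<^sup>2)\<^sup>2) * l2 (cubeM N) (\<lambda>x. \<Psi> x \<sigma>)" if \<sigma>: "\<sigma> \<in> spins N" for \<sigma>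
  proof -
    define n where "n = sqrt (l2 (cubeM N) (\<lambda>x. \<Psi> x \<sigma>))"
    define d where "d = sqrt (l2 (cubeM N) (\<lambda>x. grad N 0 \<Psi> x \<sigma>))"
    have nd: "n \<ge> 0" "d \<ge> 0" "n\<^sup>2 = l2 (cubeM N) (\<lambda>x. \<Psi> x \<sigma>)" "d\<^sup>2 = l2 (cubeM N) (\<lambda>x. grad N 0 \<Psi> x \<sigma>)"
      by (simp_all add: n_def d_def)
    have w: "sqint (cubeM N) (\<lambda>x. g (x 0) *\<^sub>R \<Psi> x \<sigma>)" by (rule fdom_weighted_sqint[OF N f g(1) \<sigma>])
    have "l2 (cubeM N) (\<lambda>x. g (x 0) *\<^sub>R \<Psi> x \<sigma>) \<le> mbound N (\<lambda>x. \<Psi> x \<sigma>) (\<lambda>x. grad N 0 \<Psi> x \<sigma>) * l2 L01 g"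
      by (rule weighted_sqint(2)[OF N s(1)[OF \<sigma>] s(2)[OF \<sigma>] s(3)[OF \<sigma>] g'])
    also have "\<dots> \<le> (n\<^sup>2 + 2 * (n * d)) * max 0 G"
      using g(2) by (intro mult_mono) (auto simp: mbound_def n_def d_def)
    finally have l: "sqrt (l2 (cubeM N) (\<lambda>x. g (x 0) *\<^sub>R \<Psi> x \<sigma>)) \<le> sqrt (n\<^sup>2 + 2 * (n * d)) * sqrt (max 0 G)"
      by (metis real_sqrt_le_mono real_sqrt_mult)
    have "\<bar>Re (\<integral>x. cnj (g (x 0) *\<^sub>R \<Psi> x \<sigma>) * grad N 0 \<Psi> x \<sigma> \<partial>cubeM N)\<bar> \<le> norm (\<integral>x. cnj (g (x 0) *\<^sub>R \<Psi> x \<sigma>) * grad N 0 \<Psi> x \<sigma> \<partial>cubeM N)"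
      by (rule abs_Re_le_cmod)
    also have "\<dots> \<le> sqrt (l2 (cubeM N) (\<lambda>x. cnj (g (x 0) *\<^sub>R \<Psi> x \<sigma>))) * d"
      unfolding d_def by (rule norm_integral_mult_sqint[OF sqint_cnj[OF w] s(2)[OF \<sigma>]])
    also have "l2 (cubeM N) (\<lambda>x. cnj (g (x 0) *\<^sub>R \<Psi> x \<sigma>)) = l2 (cubeM N) (\<lambda>x. g (x 0) *\<^sub>R \<Psi> x \<sigma>)"
      by (simp add: l2_def)
    also have "sqrt \<dots> * d \<le> (sqrt (n\<^sup>2 + 2 * (n * d)) * sqrt (max 0 G)) * d"
      using l nd by (intro mult_right_mono)
    finally have "real N * \<bar>2 * Re (\<integral>x. cnj (g (x 0) *\<^sub>R \<Psi> x \<sigma>) * grad N 0 \<Psi> x \<sigma> \<partial>cubeM N)\<bar>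
       \<le> (real N * 2) * ((sqrt (n\<^sup>2 + 2 * (n * d)) * sqrt (max 0 G)) * d)"
      using N by (simp add: abs_mult mult.assoc mult_left_mono)
    also have "\<dots> = d * (A * sqrt (n\<^sup>2 + 2 * (n * d)))" by (simp add: A_def mult_ac)
    also have "\<dots> \<le> d\<^sup>2 / 8 + 2 * (A * sqrt (n\<^sup>2 + 2 * (n * d)))\<^sup>2" by (rule young_8)
    also have "(A * sqrt (n\<^sup>2 + 2 * (n * d)))\<^sup>2 = A\<^sup>2 * (n\<^sup>2 + 2 * (n * d))"
      using nd by (simp add: power_mult_distrib)
    also have "2 * (A\<^sup>2 * (n\<^sup>2 + 2 * (n * d))) = 2 * A\<^sup>2 * n\<^sup>2 + d * (4 * A\<^sup>2 * n)" by (simp add: algebra_simps)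
    also have "d * (4 * A\<^sup>2 * n) \<le> d\<^sup>2 / 8 + 2 * (4 * A\<^sup>2 * n)\<^sup>2" by (rule young_8)
    finally show ?thesis unfolding nd(3,4)[symmetric] by (simp add: power_mult_distrib algebra_simps)
  qed
  have "\<bar>Re (pf N g \<Psi> \<Psi>)\<bar> = real N * \<bar>\<Sum>\<sigma>\<in>spins N. 2 * Re (\<integral>x. cnj (g (x 0) *\<^sub>R \<Psi> x \<sigma>) * grad N 0 \<Psi> x \<sigma> \<partial>cubeM N)\<bar>"
    by (simp add: pf_def abs_mult)
  also have "\<dots> \<le> real N * (\<Sum>\<sigma>\<in>spins N. \<bar>2 * Re (\<integral>x. cnj (g (x 0) *\<^sub>R \<Psi> x \<sigma>) * grad N 0 \<Psi> x \<sigma> \<partial>cubeM N)\<bar>)"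
    by (intro mult_left_mono sum_abs) simp
  also have "\<dots> = (\<Sum>\<sigma>\<in>spins N. real N * \<bar>2 * Re (\<integral>x. cnj (g (x 0) *\<^sub>R \<Psi> x \<sigma>) * grad N 0 \<Psi> x \<sigma> \<partial>cubeM N)\<bar>)"
    by (rule sum_distrib_left)
  also have "\<dots> \<le> (\<Sum>\<sigma>\<in>spins N. l2 (cubeM N) (\<lambda>x. grad N 0 \<Psi> x \<sigma>) / 4 + (2 * A\<^sup>2 + 2 * (4 * A\<^sup>2)\<^sup>2) * l2 (cubeM N) (\<lambda>x. \<Psi> x \<sigma>))"
    by (rule sum_mono[OF summand])
  also have "\<dots> = nrm2 N (grad N 0 \<Psi>) / 4 + (2 * A\<^sup>2 + 2 * (4 * A\<^sup>2)\<^sup>2) * nrm2 N \<Psi>"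
    by (simp add: nrm2_eq sum.distrib sum_divide_distrib sum_distrib_left)
  also have "nrm2 N (grad N 0 \<Psi>) / 4 \<le> Tkin N \<Psi> / 2"
  proof -
    have "nrm2 N (grad N 0 \<Psi>) \<le> (\<Sum>j<N. nrm2 N (grad N j \<Psi>))" using j by (intro member_le_sum) auto
    then show ?thesis by (simp add: Tkin_def)
  qed
  finally show "\<bar>Re (pf N g \<Psi> \<Psi>)\<bar> \<le> Tkin N \<Psi> / 2 + (2 * A\<^sup>2 + 2 * (4 * A\<^sup>2)\<^sup>2) * nrm2 N \<Psi>" by simp
qed

section \<open>Completeness and compactness\<close>

lemma measurable_tsw:
  assumes "j < N" "k < N"
  shows "(\<lambda>x. x \<circ> tsw j k) \<in> measurable (cubeM N) (cubeM N)"
proof -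
  have "(\<lambda>x. \<lambda>i\<in>{..<N}. x (tsw j k i)) \<in> measurable (cubeM N) (PiM {..<N} (\<lambda>_. L01))"
    using assms by (intro measurable_restrict measurable_cubeM_component) (auto simp: tsw_def)
  moreover have "(\<lambda>i\<in>{..<N}. x (tsw j k i)) = x \<circ> tsw j k" if "x \<in> space (cubeM N)" for x
    using that assms by (auto simp: space_cubeM PiE_iff extensional_def restrict_def tsw_def fun_eq_iff)
  ultimately show ?thesis unfolding cubeM_def[symmetric] by (subst measurable_cong[symmetric]) auto
qed

lemma tsw_tsw [simp]: "tsw j k (tsw j k i) = i"
  by (auto simp: tsw_def)

lemma tsw_less: "j < N \<Longrightarrow> k < N \<Longrightarrow> tsw j k i < N \<longleftrightarrow> i < N"
  by (auto simp: tsw_def)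

text \<open>Compared on boxes, where a swap permutes the factors of the volume. Invariance of the
  measure lets antisymmetry survive L2 limits.\<close>

lemma distr_tsw:
  assumes "j < N" "k < N"
  shows "distr (cubeM N) (cubeM N) (\<lambda>x. x \<circ> tsw j k) = cubeM N"
proof -
  note m = measurable_tsw[OF assms]
  have "distr (cubeM N) (cubeM N) (\<lambda>x. x \<circ> tsw j k) = PiM {..<N} (\<lambda>_. L01)"
  proof (rule L01P.PiM_eqI)
    fix A :: "nat \<Rightarrow> real set" assume A: "\<And>i. i \<in> {..<N} \<Longrightarrow> A i \<in> sets L01"
    have A': "PiE {..<N} A \<in> sets (cubeM N)"
      unfolding cubeM_def using A by (intro sets_PiM_I_finite) auto
    have sub: "A i \<subseteq> {0..1}" if "i < N" for i using A[of i, THEN sets.sets_into_space] that by simp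
    have "(\<lambda>x. x \<circ> tsw j k) -` PiE {..<N} A \<inter> space (cubeM N) = PiE {..<N} (A \<circ> tsw j k)"
    proof (intro set_eqI iffI)
      fix x assume x: "x \<in> (\<lambda>x. x \<circ> tsw j k) -` PiE {..<N} A \<inter> space (cubeM N)"
      have "x i \<in> A (tsw j k i)" if "i < N" for i
      proof -
        have 1: "tsw j k i \<in> {..<N}" using that tsw_less[OF assms] by simp
        have 2: "x \<circ> tsw j k \<in> PiE {..<N} A" using x by blast
        from PiE_mem[OF 2 1] show ?thesis by simp
      qed
      then show "x \<in> PiE {..<N} (A \<circ> tsw j k)" using x by (simp add: PiE_iff space_cubeM)
    next
      fix x assume x: "x \<in> PiE {..<N} (A \<circ> tsw j k)"
      have 1: "x i \<in> {0..1}" if "i < N" for i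
      proof -
        have "tsw j k i < N" using that tsw_less[OF assms] by simp
        then show ?thesis using x sub[of "tsw j k i"] that by (auto simp: PiE_iff)
      qed
      have 2: "x (tsw j k i) \<in> A i" if "i < N" for i
      proof -
        have "tsw j k i < N" using that tsw_less[OF assms] by simp
        then have "x (tsw j k i) \<in> (A \<circ> tsw j k) (tsw j k i)" using x by (simp only: PiE_iff lessThan_iff)
        then show ?thesis by simp
      qed
      have 3: "x \<circ> tsw j k \<in> extensional {..<N}"
        using x tsw_less[OF assms] by (auto simp: PiE_iff extensional_def)
      show "x \<in> (\<lambda>x. x \<circ> tsw j k) -` PiE {..<N} A \<inter> space (cubeM N)"
        using 1 2 3 x by (simp add: PiE_iff space_cubeM)
    qed
    then have "emeasure (distr (cubeM N) (cubeM N) (\<lambda>x. x \<circ> tsw j k)) (PiE {..<N} A) = emeasure (cubeM N) (PiE {..<N} (A \<circ> tsw j k))"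
      using A' by (subst emeasure_distr[OF m]) auto
    also have "\<dots> = (\<Prod>i<N. emeasure L01 (A (tsw j k i)))"
      unfolding cubeM_def using A tsw_less[OF assms] by (subst L01P.emeasure_PiM) auto
    also have "\<dots> = (\<Prod>i<N. emeasure L01 (A i))"
      by (rule prod.reindex_bij_witness[of _ "tsw j k" "tsw j k"]) (auto simp: tsw_less[OF assms])
    finally show "emeasure (distr (cubeM N) (cubeM N) (\<lambda>x. x \<circ> tsw j k)) (PiE {..<N} A) = (\<Prod>i<N. emeasure L01 (A i))" .
  qed (simp_all add: cubeM_def)
  then show ?thesis by (simp add: cubeM_def)
qed

lemma sqint_tsw:
  assumes "j < N" "k < N" "sqint (cubeM N) u"
  shows "sqint (cubeM N) (\<lambda>x. u (x \<circ> tsw j k))" "l2 (cubeM N) (\<lambda>x. u (x \<circ> tsw j k)) = l2 (cubeM N) u"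
proof -
  note m = measurable_tsw[OF assms(1,2)]
  have sm: "(\<lambda>x. (norm (u x))\<^sup>2) \<in> borel_measurable (cubeM N)" using sqint_measurable[OF assms(3)] by simp
  have "integrable (cubeM N) (\<lambda>x. (norm (u (x \<circ> tsw j k)))\<^sup>2)"
    using integrable_distr_eq[OF m sm] sqint_integrable[OF assms(3)] unfolding distr_tsw[OF assms(1,2)] by simp
  moreover have "(\<lambda>x. u (x \<circ> tsw j k)) \<in> borel_measurable (cubeM N)"
    by (rule measurable_compose[OF m sqint_measurable[OF assms(3)]])
  ultimately show "sqint (cubeM N) (\<lambda>x. u (x \<circ> tsw j k))" by (simp add: sqint_def)
  show "l2 (cubeM N) (\<lambda>x. u (x \<circ> tsw j k)) = l2 (cubeM N) u"
    using integral_distr[OF m sm] unfolding distr_tsw[OF assms(1,2)] by (simp add: l2_def)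
qed

abbreviation wsub :: "wf \<Rightarrow> wf \<Rightarrow> wf" where "wsub \<Psi> \<Phi> \<equiv> vlin (-1) \<Phi> \<Psi>"

text \<open>A squared Sobolev norm up to constants; the gradients carry the weight 1/2 of the
  kinetic energy so that this is the diagonal of the Hermitian form \<open>h1f\<close>.\<close>

definition h1n :: "nat \<Rightarrow> wf \<Rightarrow> real" where
  "h1n N \<Psi> = nrm2 N \<Psi> + Tkin N \<Psi>"

lemma h1n_nonneg [simp]: "0 \<le> h1n N \<Psi>"
  by (simp add: h1n_def)

lemma nrm2_le_h1n: "nrm2 N \<Psi> \<le> h1n N \<Psi>" and Tkin_le_h1n: "Tkin N \<Psi> \<le> h1n N \<Psi>"
  by (simp_all add: h1n_def)

lemma l2_le_nrm2: "\<sigma> \<in> spins N \<Longrightarrow> l2 (cubeM N) (\<lambda>x. \<Psi> x \<sigma>) \<le> nrm2 N \<Psi>"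
  unfolding nrm2_eq by (rule member_le_sum) auto

lemma l2_grad_le_Tkin: "j < N \<Longrightarrow> \<sigma> \<in> spins N \<Longrightarrow> l2 (cubeM N) (\<lambda>x. grad N j \<Psi> x \<sigma>) \<le> 2 * Tkin N \<Psi>"
proof -
  assume a: "j < N" "\<sigma> \<in> spins N"
  have "l2 (cubeM N) (\<lambda>x. grad N j \<Psi> x \<sigma>) \<le> nrm2 N (grad N j \<Psi>)" by (rule l2_le_nrm2[OF a(2)])
  also have "\<dots> \<le> (\<Sum>j<N. nrm2 N (grad N j \<Psi>))" using a(1) by (intro member_le_sum) auto
  finally show ?thesis by (simp add: Tkin_def)
qed

lemma l2_grad_wsub:
  assumes "fdom N \<Phi>" "fdom N \<Psi>" "j < N" "\<sigma> \<in> spins N"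
  shows "l2 (cubeM N) (\<lambda>x. grad N j (wsub \<Psi> \<Phi>) x \<sigma>) = l2 (cubeM N) (\<lambda>x. grad N j \<Psi> x \<sigma> - grad N j \<Phi> x \<sigma>)"
proof (rule l2_cong_AE)
  show "AE x in cubeM N. grad N j (wsub \<Psi> \<Phi>) x \<sigma> = grad N j \<Psi> x \<sigma> - grad N j \<Phi> x \<sigma>"
    using grad_vlin[OF assms, of "-1"] by eventually_elim simp
qed (use grad_sqint[OF assms(1,3,4)] grad_sqint[OF assms(2,3,4)] grad_sqint[OF fdom_vlin[OF assms(1,2)] assms(3,4)]
    in \<open>auto simp: sqint_measurable\<close>)

text \<open>Components and partial gradients converge separately in L2. The limits are matched by
  closedness of the weak derivative, and antisymmetry passes over because swapping two coordinates
  is an L2 isometry.\<close>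

lemma h1_complete:
  assumes f: "\<And>n. fdom N (\<Psi> n)"
    and cauchy: "\<And>e. e > 0 \<Longrightarrow> \<exists>n0. \<forall>m\<ge>n0. \<forall>n\<ge>n0. h1n N (wsub (\<Psi> m) (\<Psi> n)) < e"
  obtains \<Phi> where "fdom N \<Phi>" "(\<lambda>n. h1n N (wsub (\<Psi> n) \<Phi>)) \<longlonglongrightarrow> 0"
proof -
  have "\<exists>u. \<sigma> \<in> spins N \<longrightarrow> sqint (cubeM N) u \<and> (\<lambda>n. l2 (cubeM N) (\<lambda>x. \<Psi> n x \<sigma> - u x)) \<longlonglongrightarrow> 0" for \<sigma>
  proof (cases "\<sigma> \<in> spins N")
    case True
    have "\<exists>n0. \<forall>m\<ge>n0. \<forall>n\<ge>n0. l2 (cubeM N) (\<lambda>x. \<Psi> m x \<sigma> - \<Psi> n x \<sigma>) < e" if "e > 0" for e :: real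
    proof -
      have "l2 (cubeM N) (\<lambda>x. \<Psi> m x \<sigma> - \<Psi> n x \<sigma>) \<le> h1n N (wsub (\<Psi> m) (\<Psi> n))" for m n
        using l2_le_nrm2[OF True, of "wsub (\<Psi> m) (\<Psi> n)"] nrm2_le_h1n[of N "wsub (\<Psi> m) (\<Psi> n)"] by (simp add: vlin_def)
      then show ?thesis using cauchy[OF that] by (meson le_less_trans)
    qed
    from cube.l2_complete[OF fdom_sqint[OF f True] this] show ?thesis by blast
  qed auto
  then have "\<forall>\<sigma>. \<exists>u. \<sigma> \<in> spins N \<longrightarrow> sqint (cubeM N) u \<and> (\<lambda>n. l2 (cubeM N) (\<lambda>x. \<Psi> n x \<sigma> - u x)) \<longlonglongrightarrow> 0" by blast
  from choice[OF this] obtain U where U: "\<And>\<sigma>. \<sigma> \<in> spins N \<Longrightarrow> sqint (cubeM N) (U \<sigma>)"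
    "\<And>\<sigma>. \<sigma> \<in> spins N \<Longrightarrow> (\<lambda>n. l2 (cubeM N) (\<lambda>x. \<Psi> n x \<sigma> - U \<sigma> x)) \<longlonglongrightarrow> 0" by blast
  have "\<exists>u. j < N \<and> \<sigma> \<in> spins N \<longrightarrow> sqint (cubeM N) u \<and> (\<lambda>n. l2 (cubeM N) (\<lambda>x. grad N j (\<Psi> n) x \<sigma> - u x)) \<longlonglongrightarrow> 0" for j \<sigma>
  proof (cases "j < N \<and> \<sigma> \<in> spins N")
    case True
    then have j: "j < N" and \<sigma>: "\<sigma> \<in> spins N" by auto
    have "\<exists>n0. \<forall>m\<ge>n0. \<forall>n\<ge>n0. l2 (cubeM N) (\<lambda>x. grad N j (\<Psi> m) x \<sigma> - grad N j (\<Psi> n) x \<sigma>) < e" if "e > 0" for e :: real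
    proof -
      have "l2 (cubeM N) (\<lambda>x. grad N j (\<Psi> m) x \<sigma> - grad N j (\<Psi> n) x \<sigma>) \<le> 2 * h1n N (wsub (\<Psi> m) (\<Psi> n))" for m n
        using l2_grad_le_Tkin[OF j \<sigma>, of "wsub (\<Psi> m) (\<Psi> n)"] Tkin_le_h1n[of N "wsub (\<Psi> m) (\<Psi> n)"]
          l2_grad_wsub[OF f f j \<sigma>, of n m] by linarith
      moreover have "e / 2 > 0" using that by simp
      from cauchy[OF this] obtain n0 where "\<forall>m\<ge>n0. \<forall>n\<ge>n0. h1n N (wsub (\<Psi> m) (\<Psi> n)) < e / 2" by blast
      ultimately have "\<forall>m\<ge>n0. \<forall>n\<ge>n0. l2 (cubeM N) (\<lambda>x. grad N j (\<Psi> m) x \<sigma> - grad N j (\<Psi> n) x \<sigma>) < e"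
        by (smt (verit) field_sum_of_halves)
      then show ?thesis by blast
    qed
    from cube.l2_complete[OF grad_sqint[OF f j \<sigma>] this] show ?thesis by blast
  qed auto
  then have "\<forall>j. \<forall>\<sigma>. \<exists>u. j < N \<and> \<sigma> \<in> spins N \<longrightarrow> sqint (cubeM N) u \<and> (\<lambda>n. l2 (cubeM N) (\<lambda>x. grad N j (\<Psi> n) x \<sigma> - u x)) \<longlonglongrightarrow> 0" by blast
  then have "\<forall>j. \<exists>V. \<forall>\<sigma>. j < N \<and> \<sigma> \<in> spins N \<longrightarrow> sqint (cubeM N) (V \<sigma>) \<and> (\<lambda>n. l2 (cubeM N) (\<lambda>x. grad N j (\<Psi> n) x \<sigma> - V \<sigma> x)) \<longlonglongrightarrow> 0"
    by (intro allI choice) blast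
  from choice[OF this] obtain V where V: "\<And>j \<sigma>. j < N \<Longrightarrow> \<sigma> \<in> spins N \<Longrightarrow> sqint (cubeM N) (V j \<sigma>)"
    "\<And>j \<sigma>. j < N \<Longrightarrow> \<sigma> \<in> spins N \<Longrightarrow> (\<lambda>n. l2 (cubeM N) (\<lambda>x. grad N j (\<Psi> n) x \<sigma> - V j \<sigma> x)) \<longlonglongrightarrow> 0" by blast
  define \<Phi> :: wf where "\<Phi> = (\<lambda>x \<sigma>. U \<sigma> x)"
  have fd: "fdom N \<Phi>"
    unfolding fdom_def
  proof (intro conjI allI impI)
    show "L2wf N \<Phi>" using U(1) by (simp add: L2wf_iff \<Phi>_def)
    show "antisym_wf N \<Phi>"
      unfolding antisym_wf_def
    proof (intro allI impI ballI)
      fix j k \<sigma> assume jk: "j < N" "k < N" "j \<noteq> k" and \<sigma>: "\<sigma> \<in> spins N"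
      note \<sigma>' = spins_tsw[OF jk(1,2) \<sigma>]
      let ?\<sigma> = "\<sigma> \<circ> tsw j k"
      have s: "sqint (cubeM N) (\<lambda>x. U ?\<sigma> (x \<circ> tsw j k))" by (rule sqint_tsw(1)[OF jk(1,2) U(1)[OF \<sigma>']])
      \<comment> \<open>The antisymmetry defect of the limit equals, up to sign and almost
        everywhere, a sum of two approximation errors, because the approximants have no
        defect.\<close>
      have b: "l2 (cubeM N) (\<lambda>x. U ?\<sigma> (x \<circ> tsw j k) + U \<sigma> x) \<le>
         2 * l2 (cubeM N) (\<lambda>x. \<Psi> n x ?\<sigma> - U ?\<sigma> x) + 2 * l2 (cubeM N) (\<lambda>x. \<Psi> n x \<sigma> - U \<sigma> x)" for n
      proof -
        have d1: "sqint (cubeM N) (\<lambda>x. \<Psi> n x ?\<sigma> - U ?\<sigma> x)" "sqint (cubeM N) (\<lambda>x. \<Psi> n x \<sigma> - U \<sigma> x)"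
          using fdom_sqint[OF f] U(1) \<sigma> \<sigma>' by (auto intro: sqint_diff)
        note d2 = sqint_tsw[OF jk(1,2) d1(1)]
        have "l2 (cubeM N) (\<lambda>x. U ?\<sigma> (x \<circ> tsw j k) + U \<sigma> x) =
          l2 (cubeM N) (\<lambda>x. (\<Psi> n (x \<circ> tsw j k) ?\<sigma> - U ?\<sigma> (x \<circ> tsw j k)) + (\<Psi> n x \<sigma> - U \<sigma> x))"
        proof (rule trans[OF l2_minus[symmetric] l2_cong_AE])
          have "AE x in cubeM N. \<Psi> n (x \<circ> tsw j k) ?\<sigma> = - \<Psi> n x \<sigma>"
            using fdom_antisym[OF f[of n]] jk \<sigma> unfolding antisym_wf_def by blast
          then show "AE x in cubeM N. - (U ?\<sigma> (x \<circ> tsw j k) + U \<sigma> x) = (\<Psi> n (x \<circ> tsw j k) ?\<sigma> - U ?\<sigma> (x \<circ> tsw j k)) + (\<Psi> n x \<sigma> - U \<sigma> x)"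
            by eventually_elim simp
          show "(\<lambda>x. - (U ?\<sigma> (x \<circ> tsw j k) + U \<sigma> x)) \<in> borel_measurable (cubeM N)"
            by (rule sqint_measurable) (intro sqint_minus sqint_add s U(1) \<sigma>)
          show "(\<lambda>x. \<Psi> n (x \<circ> tsw j k) ?\<sigma> - U ?\<sigma> (x \<circ> tsw j k) + (\<Psi> n x \<sigma> - U \<sigma> x)) \<in> borel_measurable (cubeM N)"
            by (rule sqint_measurable) (rule sqint_add(1)[OF d2(1) d1(2)])
        qed
        also have "\<dots> \<le> 2 * l2 (cubeM N) (\<lambda>x. \<Psi> n (x \<circ> tsw j k) ?\<sigma> - U ?\<sigma> (x \<circ> tsw j k)) + 2 * l2 (cubeM N) (\<lambda>x. \<Psi> n x \<sigma> - U \<sigma> x)"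
          by (rule sqint_add(2)[OF d2(1) d1(2)])
        finally show ?thesis using d2(2) by simp
      qed
      have "(\<lambda>n. 2 * l2 (cubeM N) (\<lambda>x. \<Psi> n x ?\<sigma> - U ?\<sigma> x) + 2 * l2 (cubeM N) (\<lambda>x. \<Psi> n x \<sigma> - U \<sigma> x)) \<longlonglongrightarrow> 2 * 0 + 2 * 0"
        by (intro tendsto_intros U(2) \<sigma> \<sigma>')
      then have "l2 (cubeM N) (\<lambda>x. U ?\<sigma> (x \<circ> tsw j k) + U \<sigma> x) \<le> 0"
        by (intro LIMSEQ_le_const[of "\<lambda>n. 2 * l2 (cubeM N) (\<lambda>x. \<Psi> n x ?\<sigma> - U ?\<sigma> x) + 2 * l2 (cubeM N) (\<lambda>x. \<Psi> n x \<sigma> - U \<sigma> x)"]) (use b in auto)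
      then have "l2 (cubeM N) (\<lambda>x. U ?\<sigma> (x \<circ> tsw j k) + U \<sigma> x) = 0"
        by (meson antisym l2_nonneg)
      then have "AE x in cubeM N. U ?\<sigma> (x \<circ> tsw j k) + U \<sigma> x = 0"
        using l2_eq_0_iff[OF sqint_add(1)[OF s U(1)[OF \<sigma>]]] by simp
      then show "AE x in cubeM N. \<Phi> (x \<circ> tsw j k) ?\<sigma> = - \<Phi> x \<sigma>"
        by eventually_elim (simp add: \<Phi>_def eq_neg_iff_add_eq_0)
    qed
    fix j assume j: "j < N"
    have "L2wf N (\<lambda>x \<sigma>. V j \<sigma> x)" using V(1)[OF j] by (simp add: L2wf_iff)
    moreover have "wderiv_wf N j \<Phi> (\<lambda>x \<sigma>. V j \<sigma> x)"
      unfolding wderiv_wf_iff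
    proof
      fix \<sigma> assume \<sigma>: "\<sigma> \<in> spins N"
      show "wd N j (\<lambda>x. \<Phi> x \<sigma>) (\<lambda>x. V j \<sigma> x)"
        unfolding \<Phi>_def
        by (rule wd_limit[OF j U(1)[OF \<sigma>] V(1)[OF j \<sigma>] fdom_sqint[OF f \<sigma>] grad_sqint[OF f j \<sigma>] U(2)[OF \<sigma>] V(2)[OF j \<sigma>] grad_wd[OF f j \<sigma>]])
    qed
    ultimately show "\<exists>D. L2wf N D \<and> wderiv_wf N j \<Phi> D" by blast
  qed
  have gl: "(\<lambda>n. l2 (cubeM N) (\<lambda>x. grad N j (\<Psi> n) x \<sigma> - grad N j \<Phi> x \<sigma>)) \<longlonglongrightarrow> 0" if j: "j < N" and \<sigma>: "\<sigma> \<in> spins N" for j \<sigma>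
  proof -
    have wdV: "wd N j (\<lambda>x. \<Phi> x \<sigma>) (V j \<sigma>)"
      unfolding \<Phi>_def
      by (rule wd_limit[OF j U(1)[OF \<sigma>] V(1)[OF j \<sigma>] fdom_sqint[OF f \<sigma>] grad_sqint[OF f j \<sigma>] U(2)[OF \<sigma>] V(2)[OF j \<sigma>] grad_wd[OF f j \<sigma>]])
    have ae: "AE x in cubeM N. grad N j \<Phi> x \<sigma> = V j \<sigma> x"
      by (rule wd_unique[OF j grad_wd[OF fd j \<sigma>] wdV grad_sqint[OF fd j \<sigma>] V(1)[OF j \<sigma>]])
    have "l2 (cubeM N) (\<lambda>x. grad N j (\<Psi> n) x \<sigma> - grad N j \<Phi> x \<sigma>) = l2 (cubeM N) (\<lambda>x. grad N j (\<Psi> n) x \<sigma> - V j \<sigma> x)" for n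
      by (rule l2_cong_AE)
        (use ae grad_sqint[OF f j \<sigma>, of n] grad_sqint[OF fd j \<sigma>] V(1)[OF j \<sigma>] in \<open>auto simp: sqint_measurable elim: eventually_mono\<close>)
    then show ?thesis using V(2)[OF j \<sigma>] by simp
  qed
  have "(\<lambda>n. h1n N (wsub (\<Psi> n) \<Phi>)) \<longlonglongrightarrow> 0"
  proof -
    have eq: "h1n N (wsub (\<Psi> n) \<Phi>) = (\<Sum>\<sigma>\<in>spins N. l2 (cubeM N) (\<lambda>x. \<Psi> n x \<sigma> - U \<sigma> x)) +
       (1/2) * (\<Sum>j<N. \<Sum>\<sigma>\<in>spins N. l2 (cubeM N) (\<lambda>x. grad N j (\<Psi> n) x \<sigma> - grad N j \<Phi> x \<sigma>))" for n
      unfolding h1n_def Tkin_def nrm2_eq using l2_grad_wsub[OF fd f[of n]]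
      by (simp add: vlin_def \<Phi>_def)
    have "(\<lambda>n. h1n N (wsub (\<Psi> n) \<Phi>)) \<longlonglongrightarrow> (\<Sum>\<sigma>\<in>spins N. 0) + (1/2) * (\<Sum>j<N. \<Sum>\<sigma>\<in>spins N. 0)"
      unfolding eq by (intro tendsto_intros U(2) gl) auto
    then show ?thesis by simp
  qed
  with fd show ?thesis by (rule that)
qed

text \<open>The cross terms cancel. For a nonnegative form this single identity gives both closure
  of its null space under linear combinations and control of differences by the diagonal.\<close>

lemma herm_parallelogram:
  assumes "herm N B" "fdom N \<Phi>" "fdom N \<Psi>"
  shows "Re (B (vlin (-a) \<Phi> \<Psi>) (vlin (-a) \<Phi> \<Psi>)) + Re (B (vlin a \<Phi> \<Psi>) (vlin a \<Phi> \<Psi>)) = 2 * (cmod a)\<^sup>2 * Re (B \<Phi> \<Phi>) + 2 * Re (B \<Psi> \<Psi>)"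
  by (simp add: herm_expand[OF assms] del: Re_complex_of_real)

lemma nrm2_Re: "nrm2 N \<Psi> = Re (inner_wf N \<Psi> \<Psi>)" and Tkin_Re: "Tkin N \<Psi> = Re (kf N \<Psi> \<Psi>)"
  by (simp_all add: inner_wf_self kf_self)

definition h1f :: "nat \<Rightarrow> wf \<Rightarrow> wf \<Rightarrow> complex" where
  "h1f N \<Phi> \<Psi> = inner_wf N \<Phi> \<Psi> + kf N \<Phi> \<Psi>"

lemma herm_h1f: "herm N (h1f N)"
  unfolding h1f_def[abs_def] by (intro herm_add herm_inner herm_kf)

lemma h1n_Re: "h1n N \<Psi> = Re (h1f N \<Psi> \<Psi>)"
  by (simp add: h1n_def h1f_def nrm2_Re Tkin_Re)

lemma wsub_le:
  assumes "herm N B" "fdom N \<Phi>" "fdom N \<Psi>" "\<And>\<Psi>. fdom N \<Psi> \<Longrightarrow> 0 \<le> Re (B \<Psi> \<Psi>)"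
  shows "Re (B (wsub \<Psi> \<Phi>) (wsub \<Psi> \<Phi>)) \<le> 2 * Re (B \<Phi> \<Phi>) + 2 * Re (B \<Psi> \<Psi>)"
  using herm_parallelogram[OF assms(1-3), of 1] assms(4)[OF fdom_vlin[OF assms(2,3), of 1]] by simp

text \<open>There are countably many pairs of a spin and a mode, so a diagonal subsequence makes all
  Fourier coefficients converge. Finitely many low modes are then Cauchy, and the kinetic energy
  makes the remaining modes uniformly small.\<close>

lemma rellich:
  assumes f: "\<And>n. fdom N (\<Psi> n)" and C: "\<And>n. h1n N (\<Psi> n) \<le> C"
  obtains s where "strict_mono (s :: nat \<Rightarrow> nat)"
    "\<And>e. e > 0 \<Longrightarrow> \<exists>n0. \<forall>m\<ge>n0. \<forall>n\<ge>n0. nrm2 N (wsub (\<Psi> (s m)) (\<Psi> (s n))) < e"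
proof -
  define c where "c n p = cube.coef N (\<lambda>x. \<Psi> n x (fst p)) (snd p)" for n p
  have cnt: "countable (spins N \<times> idx N)"
    by (rule countable_SIGMA) (auto simp: idx_def intro: countable_finite countable_PiE)
  have C0: "C \<ge> 0" using C[of 0] h1n_nonneg[of N "\<Psi> 0"] by linarith
  have bnd: "norm (c n p) \<le> sqrt C" if "p \<in> spins N \<times> idx N" for n p
  proof -
    have p: "fst p \<in> spins N" "snd p \<in> idx N" using that by auto
    have "norm (c n p) \<le> sqrt (l2 (cubeM N) (\<lambda>x. \<Psi> n x (fst p)))"
      unfolding c_def by (rule cube.coef_norm_le[OF fdom_sqint[OF f p(1)] p(2)])
    also have "l2 (cubeM N) (\<lambda>x. \<Psi> n x (fst p)) \<le> C"
      using l2_le_nrm2[OF p(1), of "\<Psi> n"] nrm2_le_h1n[of N "\<Psi> n"] C[of n] by linarith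
    finally show ?thesis by simp
  qed
  obtain s where s: "strict_mono (s :: nat \<Rightarrow> nat)" "\<And>p. p \<in> spins N \<times> idx N \<Longrightarrow> \<exists>l. (\<lambda>n. c (s n) p) \<longlonglongrightarrow> l"
    using function_convergent_subsequence[OF cnt, of c "sqrt C"] bnd by blast
  then obtain l where l: "\<And>p. p \<in> spins N \<times> idx N \<Longrightarrow> (\<lambda>n. c (s n) p) \<longlonglongrightarrow> l p" by metis
  show ?thesis
  proof (rule that[OF s(1)])
    fix e :: real assume e: "e > 0"
    \<comment> \<open>Differences have kinetic energy at most 4C, so the high modes contribute at
      most 8C divided by the square of K + 1; this K makes that at most e/2.\<close>
    obtain K :: nat where K: "16 * C / e < real K" using reals_Archimedean2 by blast
    define a where "a n = (\<Sum>\<sigma>\<in>spins N. \<Sum>k\<in>ibox N K. (norm (c (s n) (\<sigma>, k) - l (\<sigma>, k)))\<^sup>2)" for n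
    have "a \<longlonglongrightarrow> (\<Sum>\<sigma>\<in>spins N. \<Sum>k\<in>ibox N K. (norm (l (\<sigma>, k) - l (\<sigma>, k)))\<^sup>2)"
      unfolding a_def using cube.F_subset[of N K] by (intro tendsto_intros l) auto
    then have "a \<longlonglongrightarrow> 0" by simp
    moreover have "e / 16 > 0" using e by simp
    ultimately obtain n0 where n0: "\<And>n. n \<ge> n0 \<Longrightarrow> \<bar>a n\<bar> < e / 16"
      by (metis (no_types) LIMSEQ_D diff_zero real_norm_def)
    have "nrm2 N (wsub (\<Psi> (s m)) (\<Psi> (s n))) < e" if mn: "m \<ge> n0" "n \<ge> n0" for m n
    proof -
      let ?d = "wsub (\<Psi> (s m)) (\<Psi> (s n))"
      have fd: "fdom N ?d" by (intro fdom_vlin f)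
      have T: "Tkin N ?d \<le> 4 * C"
        using wsub_le[OF herm_kf f f, of "s n" "s m"] C[of "s n"] C[of "s m"] Tkin_le_h1n[of N "\<Psi> (s n)"] Tkin_le_h1n[of N "\<Psi> (s m)"]
        by (simp add: Tkin_Re[symmetric])
      have "nrm2 N ?d \<le> (\<Sum>\<sigma>\<in>spins N. (\<Sum>k\<in>ibox N K. (norm (cube.coef N (\<lambda>x. ?d x \<sigma>) k))\<^sup>2)
          + (\<Sum>j<N. l2 (cubeM N) (\<lambda>x. grad N j ?d x \<sigma>)) / (real (Suc K))\<^sup>2)"
        unfolding nrm2_eq
        by (intro sum_mono l2_le_low_modes fdom_sqint[OF fd] grad_sqint[OF fd] grad_wd[OF fd])
      also have "\<dots> = (\<Sum>\<sigma>\<in>spins N. \<Sum>k\<in>ibox N K. (norm (cube.coef N (\<lambda>x. ?d x \<sigma>) k))\<^sup>2) + 2 * Tkin N ?d / (real (Suc K))\<^sup>2"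
      proof -
        have "(\<Sum>\<sigma>\<in>spins N. \<Sum>j<N. l2 (cubeM N) (\<lambda>x. grad N j ?d x \<sigma>)) = 2 * Tkin N ?d"
          unfolding Tkin_def nrm2_eq by (subst sum.swap) simp
        then show ?thesis unfolding sum.distrib sum_divide_distrib[symmetric] by simp
      qed
      also have "(\<Sum>\<sigma>\<in>spins N. \<Sum>k\<in>ibox N K. (norm (cube.coef N (\<lambda>x. ?d x \<sigma>) k))\<^sup>2) \<le> 2 * a m + 2 * a n"
        unfolding a_def sum_distrib_left sum.distrib[symmetric]
      proof (intro sum_mono)
        fix \<sigma> k assume \<sigma>: "\<sigma> \<in> spins N" and k: "k \<in> ibox N K"
        have "cube.coef N (\<lambda>x. ?d x \<sigma>) k = c (s m) (\<sigma>, k) - c (s n) (\<sigma>, k)"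
          unfolding c_def using cube.coef_diff[OF fdom_sqint[OF f \<sigma>] fdom_sqint[OF f \<sigma>]] by (simp add: vlin_def)
        also have "\<dots> = (c (s m) (\<sigma>, k) - l (\<sigma>, k)) + (l (\<sigma>, k) - c (s n) (\<sigma>, k))" by simp
        finally show "(norm (cube.coef N (\<lambda>x. ?d x \<sigma>) k))\<^sup>2 \<le> 2 * (norm (c (s m) (\<sigma>, k) - l (\<sigma>, k)))\<^sup>2 + 2 * (norm (c (s n) (\<sigma>, k) - l (\<sigma>, k)))\<^sup>2"
          using norm_add_sq_le by (metis norm_minus_commute)
      qed
      also have "2 * Tkin N ?d / (real (Suc K))\<^sup>2 \<le> e / 2"
      proof -
        have "real (Suc K) * 1 \<le> real (Suc K) * real (Suc K)" by (intro mult_left_mono) auto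
        moreover have "16 * C < e * real K" using K e by (simp add: field_simps)
        moreover have "e * real K \<le> e * real (Suc K)" using e by (intro mult_left_mono) auto
        moreover have "e * real (Suc K) \<le> e * (real (Suc K) * real (Suc K))" using e calculation(1) by (intro mult_left_mono) auto
        ultimately have "16 * C \<le> e * (real (Suc K))\<^sup>2" unfolding power2_eq_square by linarith
        then have "2 * Tkin N ?d \<le> (e / 2) * (real (Suc K))\<^sup>2" using T by linarith
        then show ?thesis by (subst pos_divide_le_eq) simp_all
      qed
      finally show ?thesis using n0[OF mn(1)] n0[OF mn(2)] e by linarith
    qed
    then show "\<exists>n0. \<forall>m\<ge>n0. \<forall>n\<ge>n0. nrm2 N (wsub (\<Psi> (s m)) (\<Psi> (s n))) < e" by blast
  qed
qed

lemma herm_cross_bound: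
  assumes B: "herm N B" and C: "\<And>\<Psi>. fdom N \<Psi> \<Longrightarrow> \<bar>Re (B \<Psi> \<Psi>)\<bar> \<le> C * h1n N \<Psi>"
    and f: "fdom N \<Phi>" "fdom N \<delta>" and s: "s > 0" and C0: "C \<ge> 0"
  shows "\<bar>2 * Re (B \<Phi> \<delta>)\<bar> \<le> C * (s * h1n N \<delta> + h1n N \<Phi> / s)"
proof -
  let ?p = "vlin (of_real s) \<delta> \<Phi>" and ?q = "vlin (- of_real s) \<delta> \<Phi>"
  have e: "Re (B ?p ?p) - Re (B ?q ?q) = 4 * s * Re (B \<Phi> \<delta>)"
    unfolding herm_expand[OF B f(2,1)] by simp
  have "h1n N ?q + h1n N ?p = 2 * s\<^sup>2 * h1n N \<delta> + 2 * h1n N \<Phi>"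
    using herm_parallelogram[OF herm_h1f f(2,1), of "of_real s"] by (simp add: h1n_Re)
  then have sum: "C * h1n N ?q + C * h1n N ?p = C * (2 * s\<^sup>2 * h1n N \<delta> + 2 * h1n N \<Phi>)"
    by (simp add: distrib_left[symmetric])
  have "\<bar>4 * s * Re (B \<Phi> \<delta>)\<bar> \<le> C * h1n N ?q + C * h1n N ?p"
    using C[OF fdom_vlin[OF f(2,1)], of "of_real s"] C[OF fdom_vlin[OF f(2,1)], of "- of_real s"] e by linarith
  then have "\<bar>4 * s * Re (B \<Phi> \<delta>)\<bar> / (2 * s) \<le> C * (2 * s\<^sup>2 * h1n N \<delta> + 2 * h1n N \<Phi>) / (2 * s)"
    unfolding sum using s by (intro divide_right_mono) auto
  moreover have "\<bar>4 * s * Re (B \<Phi> \<delta>)\<bar> / (2 * s) = \<bar>2 * Re (B \<Phi> \<delta>)\<bar>"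
    using s by (simp add: abs_mult)
  moreover have "C * (2 * s\<^sup>2 * h1n N \<delta> + 2 * h1n N \<Phi>) / (2 * s) = C * (s * h1n N \<delta> + h1n N \<Phi> / s)"
    using s by (simp add: field_simps power2_eq_square)
  ultimately show ?thesis by linarith
qed

text \<open>Expanding around the limit leaves a small diagonal term and a cross term, which the
  preceding bound makes small with s equal to 1 / sqrt h.\<close>

lemma herm_tendsto:
  assumes B: "herm N B" and C: "\<And>\<Psi>. fdom N \<Psi> \<Longrightarrow> \<bar>Re (B \<Psi> \<Psi>)\<bar> \<le> C * h1n N \<Psi>" and C0: "C \<ge> 0"
    and f: "fdom N \<Phi>" "\<And>n. fdom N (\<Psi> n)" and lim: "(\<lambda>n. h1n N (wsub (\<Psi> n) \<Phi>)) \<longlonglongrightarrow> 0"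
  shows "(\<lambda>n. Re (B (\<Psi> n) (\<Psi> n))) \<longlonglongrightarrow> Re (B \<Phi> \<Phi>)"
proof -
  \<comment> \<open>The extra 1/(n+1) keeps \<open>h n\<close> positive, so that the scale 1 / sqrt
    (h n) makes sense even when the distance is zero.\<close>
  define h where "h n = h1n N (wsub (\<Psi> n) \<Phi>) + 1 / real (Suc n)" for n
  have hpos: "h n > 0" for n unfolding h_def by (intro add_nonneg_pos) auto
  have hle: "h1n N (wsub (\<Psi> n) \<Phi>) \<le> h n" for n by (simp add: h_def)
  have "(\<lambda>n. 1 / real (Suc n)) \<longlonglongrightarrow> 0" using LIMSEQ_inverse_real_of_nat by (simp add: inverse_eq_divide)
  from tendsto_add[OF lim this] have h0: "h \<longlonglongrightarrow> 0" by (simp add: h_def[abs_def])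
  have b: "norm (Re (B (\<Psi> n) (\<Psi> n)) - Re (B \<Phi> \<Phi>)) \<le> C * h n + C * (sqrt (h n) + h1n N \<Phi> * sqrt (h n))" for n
  proof -
    let ?d = "wsub (\<Psi> n) \<Phi>"
    have fd: "fdom N ?d" by (intro fdom_vlin f)
    have eq: "\<Psi> n = vlin 1 ?d \<Phi>" by (simp add: vlin_def fun_eq_iff)
    have e: "Re (B (\<Psi> n) (\<Psi> n)) = Re (B ?d ?d) + Re (B \<Phi> \<Phi>) + 2 * Re (B \<Phi> ?d)"
      using herm_expand[OF B fd f(1), of 1] unfolding eq[symmetric] by simp
    have sp: "1 / sqrt (h n) > 0" using hpos[of n] by simp
    have "\<bar>2 * Re (B \<Phi> ?d)\<bar> \<le> C * (1 / sqrt (h n) * h1n N ?d + h1n N \<Phi> / (1 / sqrt (h n)))"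
      by (rule herm_cross_bound[OF B C f(1) fd sp C0])
    also have "\<dots> \<le> C * (1 / sqrt (h n) * h n + h1n N \<Phi> / (1 / sqrt (h n)))"
      using sp hle[of n] C0 by (intro mult_left_mono add_right_mono) auto
    also have "1 / sqrt (h n) * h n = sqrt (h n)" using hpos[of n] by (simp add: real_div_sqrt)
    finally have "\<bar>2 * Re (B \<Phi> ?d)\<bar> \<le> C * (sqrt (h n) + h1n N \<Phi> * sqrt (h n))" by simp
    moreover have "\<bar>Re (B ?d ?d)\<bar> \<le> C * h n"
      using C[OF fd] mult_left_mono[OF hle[of n] C0] by linarith
    ultimately show ?thesis unfolding real_norm_def using e by linarith
  qed
  have "(\<lambda>n. C * h n + C * (sqrt (h n) + h1n N \<Phi> * sqrt (h n))) \<longlonglongrightarrow> C * 0 + C * (sqrt 0 + h1n N \<Phi> * sqrt 0)"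
    by (intro tendsto_intros h0)
  then have "(\<lambda>n. C * h n + C * (sqrt (h n) + h1n N \<Phi> * sqrt (h n))) \<longlonglongrightarrow> 0" by simp
  then have "(\<lambda>n. Re (B (\<Psi> n) (\<Psi> n)) - Re (B \<Phi> \<Phi>)) \<longlonglongrightarrow> 0"
    by (rule tendsto_0_le[where K=1]) (intro always_eventually allI order_trans[OF b], simp)
  then show ?thesis by (rule LIM_zero_cancel)
qed

section \<open>Ground states\<close>

definition smul :: "complex \<Rightarrow> wf \<Rightarrow> wf" where
  "smul c \<Psi> = (\<lambda>x \<sigma>. c * \<Psi> x \<sigma>)"

lemma smul_vlin: "smul c \<Psi> = vlin (c - 1) \<Psi> \<Psi>"
  by (simp add: smul_def vlin_def fun_eq_iff algebra_simps)

lemma fdom_smul: "fdom N \<Psi> \<Longrightarrow> fdom N (smul c \<Psi>)"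
  unfolding smul_vlin by (rule fdom_vlin)

lemma herm_smul:
  assumes "herm N B" "fdom N \<Phi>" "fdom N \<Psi>"
  shows "B \<Phi> (smul c \<Psi>) = c * B \<Phi> \<Psi>" "B (smul c \<Phi>) \<Psi> = cnj c * B \<Phi> \<Psi>"
  unfolding smul_vlin using hermD(2)[OF assms(1,2,3,3)] herm_left[OF assms(1,2,2,3)]
  by (simp_all add: algebra_simps)

lemma herm_smul_Re:
  assumes "herm N B" "fdom N \<Psi>"
  shows "Re (B (smul c \<Psi>) (smul c \<Psi>)) = (cmod c)\<^sup>2 * Re (B \<Psi> \<Psi>)"
proof -
  have "B (smul c \<Psi>) (smul c \<Psi>) = (c * cnj c) * B \<Psi> \<Psi>"
    by (simp add: herm_smul[OF assms(1)] assms(2) fdom_smul mult_ac)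
  then show ?thesis unfolding complex_norm_square[symmetric] by (simp del: of_real_power)
qed

lemma nrm2_smul: "nrm2 N (smul c \<Psi>) = (cmod c)\<^sup>2 * nrm2 N \<Psi>"
  by (simp add: nrm2_def smul_def norm_mult power_mult_distrib sum_distrib_left)

lemma dens_smul: "dens N (smul c \<Psi>) t = (cmod c)\<^sup>2 * dens N \<Psi> t"
  by (simp add: dens_def smul_def norm_mult power_mult_distrib sum_distrib_left mult_ac)

lemma WsetD: "\<Psi> \<in> Wset N \<Longrightarrow> fdom N \<Psi>" "\<Psi> \<in> Wset N \<Longrightarrow> nrm2 N \<Psi> = 1"
  by (simp_all add: Wset_def)

lemma normalize_Wset:
  assumes "fdom N \<Psi>" "nrm2 N \<Psi> > 0"
  shows "smul (of_real (1 / sqrt (nrm2 N \<Psi>))) \<Psi> \<in> Wset N"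
proof -
  have "(cmod (of_real (1 / sqrt (nrm2 N \<Psi>))))\<^sup>2 = 1 / nrm2 N \<Psi>"
    unfolding norm_of_real using assms(2) by (simp add: power_divide)
  then have "nrm2 N (smul (of_real (1 / sqrt (nrm2 N \<Psi>))) \<Psi>) = 1 / nrm2 N \<Psi> * nrm2 N \<Psi>"
    unfolding nrm2_smul by (simp only:)
  then show ?thesis using assms fdom_smul by (simp add: Wset_def)
qed

lemma L2T_lin: "L2T f \<Longrightarrow> L2T g \<Longrightarrow> L2T (\<lambda>t. a * f t + b * g t)"
  unfolding L2T_iff by (intro sqint_add sqint_mult_left)

lemma L2T_diff: "L2T f \<Longrightarrow> L2T g \<Longrightarrow> L2T (\<lambda>t. f t - g t)"
  unfolding L2T_iff by (rule sqint_diff)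

lemma L2T_int: "L2T f \<Longrightarrow> L2T g \<Longrightarrow> integrable L01 (\<lambda>t. f t * g t)"
  unfolding L2T_iff by (rule integrable_mult_sqint)

lemma L2T_int_lin:
  assumes "L2T f" "L2T g" "L2T h"
  shows "(\<integral>t. (a * f t + b * g t) * h t \<partial>L01) = a * (\<integral>t. f t * h t \<partial>L01) + b * (\<integral>t. g t * h t \<partial>L01)"
proof -
  have "(\<integral>t. (a * f t + b * g t) * h t \<partial>L01) = (\<integral>t. a * (f t * h t) + b * (g t * h t) \<partial>L01)"
    by (rule Bochner_Integration.integral_cong) (auto simp: algebra_simps)
  then show ?thesis using L2T_int assms by simp
qed

lemma L2T_int_diff:
  assumes "L2T f" "L2T g" "L2T h"
  shows "(\<integral>t. h t * (f t - g t) \<partial>L01) = (\<integral>t. h t * f t \<partial>L01) - (\<integral>t. h t * g t \<partial>L01)"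
  using L2T_int[OF assms(3,1)] L2T_int[OF assms(3,2)] by (simp add: right_diff_distrib)

locale qsys =
  fixes N :: nat and W :: "wf \<Rightarrow> wf \<Rightarrow> complex"
  assumes N: "N \<ge> 1" and W: "interaction N W" and Wset_ne: "Wset N \<noteq> {}"
begin

definition hg :: "(real \<Rightarrow> real) \<Rightarrow> wf \<Rightarrow> wf \<Rightarrow> complex" where
  "hg g \<Phi> \<Psi> = kf N \<Phi> \<Psi> + W \<Phi> \<Psi> + pf N g \<Phi> \<Psi>"

definition q :: "(real \<Rightarrow> real) \<Rightarrow> wf \<Rightarrow> real" where
  "q g \<Psi> = Re (hg g \<Psi> \<Psi>)"

lemma herm_hg: "L2T g \<Longrightarrow> herm N (hg g)"
  unfolding hg_def[abs_def] by (intro herm_add herm_kf herm_W W herm_pf N)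

lemma q_eq:
  assumes "L2T g" "fdom N \<Psi>"
  shows "q g \<Psi> = Tkin N \<Psi> + Re (W \<Psi> \<Psi>) - (\<integral>t. g t * Jd N \<Psi> t \<partial>L01)"
  by (simp add: q_def hg_def kf_self pf_self[OF N assms(2,1)])

lemma hq_eq:
  assumes "L2T g" "fdom N \<Psi>"
  shows "hq N W (\<lambda>_. 0) g \<Psi> = q g \<Psi>"
  by (simp add: hq_def pot_def q_eq[OF assms] Jd_def)

definition E :: "(real \<Rightarrow> real) \<Rightarrow> real" where
  "E g = Inf (q g ` Wset N)"

lemma E0_eq: "L2T g \<Longrightarrow> E0 N W (\<lambda>_. 0) g = E g"
  unfolding E0_def E_def by (rule arg_cong[where f=Inf], rule image_cong) (auto simp: hq_eq Wset_def)

lemma W_nonneg: "fdom N \<Psi> \<Longrightarrow> 0 \<le> Re (W \<Psi> \<Psi>)"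
proof -
  have "\<forall>\<Psi>. fdom N \<Psi> \<longrightarrow> Re (W \<Psi> \<Psi>) \<ge> 0" using W unfolding interaction_def by (elim conjE)
  then show "fdom N \<Psi> \<Longrightarrow> 0 \<le> Re (W \<Psi> \<Psi>)" by blast
qed

text \<open>A vector of norm zero cannot be normalised, so the bound on unit vectors says nothing
  about it. It agrees almost everywhere with a difference of equal vectors, and linearity then
  cancels the interaction.\<close>

lemma W_null:
  assumes f: "fdom N \<Psi>" and 0: "nrm2 N \<Psi> = 0"
  shows "W \<Psi> \<Psi> = 0"
proof -
  have ae: "AE x in cubeM N. \<Psi> x \<sigma> = vlin (-1) \<Psi> \<Psi> x \<sigma>" if "\<sigma> \<in> spins N" for \<sigma>
  proof -
    have "l2 (cubeM N) (\<lambda>x. \<Psi> x \<sigma>) = 0"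
      using l2_le_nrm2[OF that, of \<Psi>] 0 l2_nonneg[of "cubeM N" "\<lambda>x. \<Psi> x \<sigma>"] by linarith
    then have "AE x in cubeM N. \<Psi> x \<sigma> = 0" using l2_eq_0_iff[OF fdom_sqint[OF f that]] by simp
    then show ?thesis by eventually_elim (simp add: vlin_def)
  qed
  have cong: "\<forall>\<Phi> \<Psi>1 \<Psi>2. fdom N \<Phi> \<longrightarrow> fdom N \<Psi>1 \<longrightarrow> fdom N \<Psi>2 \<longrightarrow>
        (\<forall>\<sigma>\<in>spins N. AE x in cubeM N. \<Psi>1 x \<sigma> = \<Psi>2 x \<sigma>) \<longrightarrow> W \<Phi> \<Psi>1 = W \<Phi> \<Psi>2"
    using W unfolding interaction_def by (elim conjE)
  \<comment> \<open>\<open>vlin (-1) \<Psi> \<Psi>\<close> is the zero function, written in the form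
    to which linearity applies.\<close>
  have "W \<Psi> \<Psi> = W \<Psi> (vlin (-1) \<Psi> \<Psi>)"
    by (rule cong[rule_format, OF f f fdom_vlin[OF f f]]) (rule ae)
  also have "\<dots> = -1 * W \<Psi> \<Psi> + W \<Psi> \<Psi>" by (rule hermD(2)[OF herm_W[OF W] f f f])
  finally show ?thesis by simp
qed

text \<open>Normalising a vector turns the bound on unit vectors into a homogeneous inequality valid
  on the whole form domain.\<close>

lemma W_bound: "\<exists>b\<ge>0. \<forall>\<Psi>. fdom N \<Psi> \<longrightarrow> Re (W \<Psi> \<Psi>) \<le> Tkin N \<Psi> + b * nrm2 N \<Psi>"
proof -
  have "\<exists>a b. 0 \<le> a \<and> a < 1 \<and> 0 \<le> b \<and> (\<forall>\<Psi>\<in>Wset N. cmod (W \<Psi> \<Psi>) \<le> a * Tkin N \<Psi> + b)"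
    using W unfolding interaction_def by (elim conjE)
  then obtain a b where ab: "0 \<le> a" "a < 1" "0 \<le> b" "\<And>\<Psi>. \<Psi> \<in> Wset N \<Longrightarrow> cmod (W \<Psi> \<Psi>) \<le> a * Tkin N \<Psi> + b"
    by blast
  have "Re (W \<Psi> \<Psi>) \<le> Tkin N \<Psi> + b * nrm2 N \<Psi>" if f: "fdom N \<Psi>" for \<Psi>
  proof (cases "nrm2 N \<Psi> = 0")
    case True
    then show ?thesis by (simp add: W_null[OF f])
  next
    case False
    then have pos: "nrm2 N \<Psi> > 0" using nrm2_nonneg[of N \<Psi>] by linarith
    let ?c = "of_real (1 / sqrt (nrm2 N \<Psi>)) :: complex"
    have c: "(cmod ?c)\<^sup>2 = 1 / nrm2 N \<Psi>" unfolding norm_of_real using pos by (simp add: power_divide)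
    have "Re (W (smul ?c \<Psi>) (smul ?c \<Psi>)) \<le> a * Tkin N (smul ?c \<Psi>) + b"
      using ab(4)[OF normalize_Wset[OF f pos]] complex_Re_le_cmod order_trans by blast
    also have "a * Tkin N (smul ?c \<Psi>) \<le> 1 * Tkin N (smul ?c \<Psi>)" using ab by (intro mult_right_mono) auto
    finally have "1 / nrm2 N \<Psi> * Re (W \<Psi> \<Psi>) \<le> 1 / nrm2 N \<Psi> * Tkin N \<Psi> + b"
      unfolding Tkin_Re herm_smul_Re[OF herm_kf f] herm_smul_Re[OF herm_W[OF W] f] c by simp
    then have "nrm2 N \<Psi> * (1 / nrm2 N \<Psi> * Re (W \<Psi> \<Psi>)) \<le> nrm2 N \<Psi> * (1 / nrm2 N \<Psi> * Tkin N \<Psi> + b)"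
      using pos by (intro mult_left_mono) auto
    moreover have "nrm2 N \<Psi> * (1 / nrm2 N \<Psi> * x) = x" for x using pos by simp
    ultimately show ?thesis unfolding distrib_left by (simp only: mult.commute)
  qed
  then show ?thesis using ab(3) by blast
qed

text \<open>The interaction is nonnegative and half of the kinetic energy pays for the potential.
  Uniformity over L2 balls of potentials carries over from \<open>pf_bound\<close>.\<close>

lemma q_lower: "\<exists>C\<ge>0. \<forall>g \<Psi>. L2T g \<longrightarrow> l2 L01 g \<le> G \<longrightarrow> fdom N \<Psi> \<longrightarrow> Tkin N \<Psi> / 2 - C * nrm2 N \<Psi> \<le> q g \<Psi>"
proof -
  obtain C where C: "C \<ge> 0" "\<And>g \<Psi>. L2T g \<Longrightarrow> l2 L01 g \<le> G \<Longrightarrow> fdom N \<Psi> \<Longrightarrow> \<bar>Re (pf N g \<Psi> \<Psi>)\<bar> \<le> Tkin N \<Psi> / 2 + C * nrm2 N \<Psi>"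
    using pf_bound[OF N, of G] by blast
  have "Tkin N \<Psi> / 2 - C * nrm2 N \<Psi> \<le> q g \<Psi>" if "L2T g" "l2 L01 g \<le> G" "fdom N \<Psi>" for g \<Psi>
    using C(2)[OF that] W_nonneg[OF that(3)] unfolding q_def hg_def by (simp add: kf_self)
  then show ?thesis using C(1) by blast
qed

lemma pf_h1: "\<exists>C\<ge>0. \<forall>\<Psi>. fdom N \<Psi> \<longrightarrow> \<bar>Re (pf N g \<Psi> \<Psi>)\<bar> \<le> C * h1n N \<Psi>" if g: "L2T g"
proof -
  obtain C where C: "C \<ge> 0" "\<And>\<Psi>. fdom N \<Psi> \<Longrightarrow> \<bar>Re (pf N g \<Psi> \<Psi>)\<bar> \<le> Tkin N \<Psi> / 2 + C * nrm2 N \<Psi>"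
    using pf_bound[OF N, of "l2 L01 g"] g by blast
  have "\<bar>Re (pf N g \<Psi> \<Psi>)\<bar> \<le> (C + 1) * h1n N \<Psi>" if "fdom N \<Psi>" for \<Psi>
  proof -
    have "C * nrm2 N \<Psi> \<le> C * h1n N \<Psi>" using C(1) nrm2_le_h1n by (intro mult_left_mono)
    then show ?thesis using C(2)[OF that] Tkin_le_h1n[of N \<Psi>] Tkin_nonneg[of N \<Psi>]
      unfolding distrib_right by linarith
  qed
  then show ?thesis using C(1) by (intro exI[of _ "C + 1"]) auto
qed

lemma q_h1: "\<exists>C\<ge>0. \<forall>\<Psi>. fdom N \<Psi> \<longrightarrow> \<bar>q g \<Psi>\<bar> \<le> C * h1n N \<Psi>" if g: "L2T g"
proof -
  obtain C where C: "C \<ge> 0" "\<And>\<Psi>. fdom N \<Psi> \<Longrightarrow> \<bar>Re (pf N g \<Psi> \<Psi>)\<bar> \<le> C * h1n N \<Psi>"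
    using pf_h1[OF g] by blast
  obtain b where b: "b \<ge> 0" "\<And>\<Psi>. fdom N \<Psi> \<Longrightarrow> Re (W \<Psi> \<Psi>) \<le> Tkin N \<Psi> + b * nrm2 N \<Psi>"
    using W_bound by blast
  have "\<bar>q g \<Psi>\<bar> \<le> (C + 2 + b) * h1n N \<Psi>" if f: "fdom N \<Psi>" for \<Psi>
  proof -
    have "b * nrm2 N \<Psi> \<le> b * h1n N \<Psi>" using b(1) nrm2_le_h1n by (intro mult_left_mono)
    then show ?thesis
      using C(2)[OF f] b(2)[OF f] W_nonneg[OF f] Tkin_le_h1n[of N \<Psi>] Tkin_nonneg[of N \<Psi>]
      unfolding q_def hg_def kf_self distrib_right plus_complex.sel Re_complex_of_real by linarith
  qed
  then show ?thesis using C(1) b(1) by (intro exI[of _ "C + 2 + b"]) auto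
qed

lemma bdd_q: "L2T g \<Longrightarrow> bdd_below (q g ` Wset N)"
proof -
  assume g: "L2T g"
  obtain C where C: "\<And>\<Psi>. fdom N \<Psi> \<Longrightarrow> Tkin N \<Psi> / 2 - C * nrm2 N \<Psi> \<le> q g \<Psi>"
    using q_lower[of "l2 L01 g"] g by blast
  show ?thesis
  proof (rule bdd_belowI2[where m="- C"])
    fix \<Psi> assume "\<Psi> \<in> Wset N"
    then have "Tkin N \<Psi> / 2 - C * 1 \<le> q g \<Psi>" using C[of \<Psi>] WsetD[of \<Psi> N] by simp
    then show "- C \<le> q g \<Psi>" using Tkin_nonneg[of N \<Psi>] by linarith
  qed
qed

lemma E_le: "L2T g \<Longrightarrow> \<Psi> \<in> Wset N \<Longrightarrow> E g \<le> q g \<Psi>"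
  unfolding E_def using bdd_q by (intro cInf_lower) auto

lemma E_ge: "(\<And>\<Psi>. \<Psi> \<in> Wset N \<Longrightarrow> c \<le> q g \<Psi>) \<Longrightarrow> c \<le> E g"
  unfolding E_def using Wset_ne by (intro cInf_greatest) auto

lemma E_approx: "L2T g \<Longrightarrow> e > 0 \<Longrightarrow> \<exists>\<Psi>\<in>Wset N. q g \<Psi> < E g + e"
  using cInf_lessD[of "q g ` Wset N" "E g + e"] Wset_ne unfolding E_def by auto

definition rf :: "(real \<Rightarrow> real) \<Rightarrow> wf \<Rightarrow> wf \<Rightarrow> complex" where
  "rf g \<Phi> \<Psi> = hg g \<Phi> \<Psi> + of_real (- E g) * inner_wf N \<Phi> \<Psi>"

text \<open>The excess energy above the ground state energy, a nonnegative quadratic form whose null space is the ground space.\<close>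

definition rr :: "(real \<Rightarrow> real) \<Rightarrow> wf \<Rightarrow> real" where
  "rr g \<Psi> = Re (rf g \<Psi> \<Psi>)"

lemma herm_rf: "L2T g \<Longrightarrow> herm N (rf g)"
  unfolding rf_def[abs_def] by (intro herm_add herm_hg herm_scale herm_inner)

lemma rr_eq: "rr g \<Psi> = q g \<Psi> - E g * nrm2 N \<Psi>"
  by (simp add: rr_def rf_def q_def inner_wf_self)

lemma rr_nonneg:
  assumes g: "L2T g" and f: "fdom N \<Psi>" shows "0 \<le> rr g \<Psi>"
proof (cases "nrm2 N \<Psi> = 0")
  case True
  obtain C where "\<And>\<Psi>. fdom N \<Psi> \<Longrightarrow> Tkin N \<Psi> / 2 - C * nrm2 N \<Psi> \<le> q g \<Psi>"
    using q_lower[of "l2 L01 g"] g by blast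
  from this[OF f] have "Tkin N \<Psi> / 2 \<le> q g \<Psi>" using True by simp
  then have "0 \<le> q g \<Psi>" using Tkin_nonneg[of N \<Psi>] by linarith
  then show ?thesis using True by (simp add: rr_eq)
next
  case False
  then have pos: "nrm2 N \<Psi> > 0" using nrm2_nonneg[of N \<Psi>] by linarith
  let ?c = "of_real (1 / sqrt (nrm2 N \<Psi>)) :: complex"
  have c: "(cmod ?c)\<^sup>2 = 1 / nrm2 N \<Psi>" unfolding norm_of_real using pos by (simp add: power_divide)
  have "E g \<le> q g (smul ?c \<Psi>)" by (rule E_le[OF g normalize_Wset[OF f pos]])
  then have "E g \<le> 1 / nrm2 N \<Psi> * q g \<Psi>" unfolding q_def herm_smul_Re[OF herm_hg[OF g] f] c .
  then have "E g * nrm2 N \<Psi> \<le> 1 / nrm2 N \<Psi> * q g \<Psi> * nrm2 N \<Psi>" using pos by (intro mult_right_mono) auto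
  then show ?thesis using pos by (simp add: rr_eq)
qed

lemma tendsto_q:
  assumes "L2T g" "fdom N \<Phi>" "\<And>n. fdom N (\<Psi> n)" "(\<lambda>n. h1n N (wsub (\<Psi> n) \<Phi>)) \<longlonglongrightarrow> 0"
  shows "(\<lambda>n. q g (\<Psi> n)) \<longlonglongrightarrow> q g \<Phi>"
proof -
  obtain C where C: "C \<ge> 0" "\<And>\<Psi>. fdom N \<Psi> \<Longrightarrow> \<bar>q g \<Psi>\<bar> \<le> C * h1n N \<Psi>" using q_h1[OF assms(1)] by blast
  show ?thesis unfolding q_def
    by (rule herm_tendsto[OF herm_hg[OF assms(1)] _ C(1) assms(2-4)]) (use C(2) in \<open>simp add: q_def\<close>)
qed

lemma tendsto_nrm2:
  assumes "fdom N \<Phi>" "\<And>n. fdom N (\<Psi> n)" "(\<lambda>n. h1n N (wsub (\<Psi> n) \<Phi>)) \<longlonglongrightarrow> 0"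
  shows "(\<lambda>n. nrm2 N (\<Psi> n)) \<longlonglongrightarrow> nrm2 N \<Phi>"
  unfolding nrm2_Re
  by (rule herm_tendsto[OF herm_inner _ _ assms, of 1]) (simp_all add: nrm2_Re[symmetric] nrm2_le_h1n)

lemma tendsto_J:
  assumes "L2T g" "fdom N \<Phi>" "\<And>n. fdom N (\<Psi> n)" "(\<lambda>n. h1n N (wsub (\<Psi> n) \<Phi>)) \<longlonglongrightarrow> 0"
  shows "(\<lambda>n. \<integral>t. g t * Jd N (\<Psi> n) t \<partial>L01) \<longlonglongrightarrow> (\<integral>t. g t * Jd N \<Phi> t \<partial>L01)"
proof -
  obtain C where C: "C \<ge> 0" "\<And>\<Psi>. fdom N \<Psi> \<Longrightarrow> \<bar>Re (pf N g \<Psi> \<Psi>)\<bar> \<le> C * h1n N \<Psi>" using pf_h1[OF assms(1)] by blast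
  have "(\<lambda>n. Re (pf N g (\<Psi> n) (\<Psi> n))) \<longlonglongrightarrow> Re (pf N g \<Phi> \<Phi>)"
    by (rule herm_tendsto[OF herm_pf[OF N assms(1)] C(2) C(1) assms(2-4)])
  from tendsto_minus[OF this] show ?thesis
    by (simp add: pf_self[OF N assms(2,1)] pf_self[OF N assms(3,1)])
qed

text \<open>Small excess energy bounds the kinetic energy, so Rellich gives a subsequence that is
  Cauchy in L2. The excess of a difference is at most twice the sum of the excesses, which upgrades
  the convergence to the Sobolev norm, and continuity of the forms puts the limit in the ground
  space.\<close>

lemma gs_compact:
  assumes g: "L2T g" and f: "\<And>n. fdom N (\<Psi> n)" and b: "\<And>n. nrm2 N (\<Psi> n) \<le> 1" and r0: "(\<lambda>n. rr g (\<Psi> n)) \<longlonglongrightarrow> 0"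
  obtains s \<Phi> where "strict_mono (s :: nat \<Rightarrow> nat)" "fdom N \<Phi>" "rr g \<Phi> = 0" "(\<lambda>n. h1n N (wsub (\<Psi> (s n)) \<Phi>)) \<longlonglongrightarrow> 0"
proof -
  obtain C where C: "C \<ge> 0" "\<And>\<Psi>. fdom N \<Psi> \<Longrightarrow> Tkin N \<Psi> / 2 - C * nrm2 N \<Psi> \<le> q g \<Psi>"
    using q_lower[of "l2 L01 g"] g by blast
  \<comment> \<open>The lower bound on the energy read backwards: kinetic energy is at most twice
    the excess plus a multiple of the squared norm.\<close>
  have h: "h1n N \<Psi> \<le> 2 * rr g \<Psi> + (1 + 2 * \<bar>E g\<bar> + 2 * C) * nrm2 N \<Psi>" if "fdom N \<Psi>" for \<Psi>
  proof -
    have "E g * nrm2 N \<Psi> \<le> \<bar>E g\<bar> * nrm2 N \<Psi>" by (intro mult_right_mono) auto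
    then show ?thesis using C(2)[OF that] unfolding rr_eq h1n_def by (simp add: algebra_simps)
  qed
  obtain R where R: "\<And>n. \<bar>rr g (\<Psi> n)\<bar> \<le> R"
    using convergent_imp_Bseq[OF convergentI[OF r0]] unfolding Bseq_def by auto
  define D where "D = 1 + 2 * \<bar>E g\<bar> + 2 * C"
  have D: "D \<ge> 1" using C(1) by (simp add: D_def)
  have "h1n N (\<Psi> n) \<le> 2 * R + D" for n
  proof -
    have "D * nrm2 N (\<Psi> n) \<le> D * 1" using D b[of n] by (intro mult_left_mono) auto
    then show ?thesis using h[OF f[of n]] R[of n] unfolding D_def[symmetric] by linarith
  qed
  with f have "\<exists>s. strict_mono (s :: nat \<Rightarrow> nat) \<and>
      (\<forall>e>0. \<exists>n0. \<forall>m\<ge>n0. \<forall>n\<ge>n0. nrm2 N (wsub (\<Psi> (s m)) (\<Psi> (s n))) < e)"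
    by (rule rellich[of N \<Psi>]) (rule exI, rule conjI, assumption, blast)
  then obtain s where s: "strict_mono (s :: nat \<Rightarrow> nat)"
    "\<And>e. e > 0 \<Longrightarrow> \<exists>n0. \<forall>m\<ge>n0. \<forall>n\<ge>n0. nrm2 N (wsub (\<Psi> (s m)) (\<Psi> (s n))) < e" by blast
  have rs: "(\<lambda>n. rr g (\<Psi> (s n))) \<longlonglongrightarrow> 0" using LIMSEQ_subseq_LIMSEQ[OF r0 s(1)] by (simp add: comp_def)
  have "\<exists>n0. \<forall>m\<ge>n0. \<forall>n\<ge>n0. h1n N (wsub (\<Psi> (s m)) (\<Psi> (s n))) < e" if e: "e > 0" for e :: real
  proof -
    have "e / (2 * D) > 0" using e D by simp
    from s(2)[OF this] obtain n1 where n1: "\<forall>m\<ge>n1. \<forall>n\<ge>n1. nrm2 N (wsub (\<Psi> (s m)) (\<Psi> (s n))) < e / (2 * D)" by blast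
    have "e / 16 > 0" using e by simp
    from LIMSEQ_D[OF rs this] obtain n2 where n2: "\<forall>n\<ge>n2. norm (rr g (\<Psi> (s n)) - 0) < e / 16" by blast
    have "h1n N (wsub (\<Psi> (s m)) (\<Psi> (s n))) < e" if mn: "m \<ge> max n1 n2" "n \<ge> max n1 n2" for m n
    proof -
      let ?d = "wsub (\<Psi> (s m)) (\<Psi> (s n))"
      have "h1n N ?d \<le> 2 * rr g ?d + D * nrm2 N ?d" unfolding D_def by (intro h fdom_vlin f)
      moreover have "rr g ?d \<le> 2 * rr g (\<Psi> (s n)) + 2 * rr g (\<Psi> (s m))"
        unfolding rr_def by (rule wsub_le[OF herm_rf[OF g] f f]) (use rr_nonneg[OF g] in \<open>simp add: rr_def\<close>)
      moreover have "D * nrm2 N ?d < D * (e / (2 * D))" using n1 mn D by (intro mult_strict_left_mono) auto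
      moreover have "D * (e / (2 * D)) = e / 2" using D by simp
      moreover have "norm (rr g (\<Psi> (s n)) - 0) < e / 16" "norm (rr g (\<Psi> (s m)) - 0) < e / 16" using n2 mn by auto
      ultimately show ?thesis using e unfolding real_norm_def by linarith
    qed
    then show ?thesis by blast
  qed
  from f this obtain \<Phi> where \<Phi>: "fdom N \<Phi>" "(\<lambda>n. h1n N (wsub (\<Psi> (s n)) \<Phi>)) \<longlonglongrightarrow> 0" by (rule h1_complete[of N "\<lambda>n. \<Psi> (s n)"])
  have "(\<lambda>n. rr g (\<Psi> (s n))) \<longlonglongrightarrow> rr g \<Phi>"
    unfolding rr_eq by (intro tendsto_intros tendsto_q tendsto_nrm2 g \<Phi> f)
  from LIMSEQ_unique[OF this rs] have "rr g \<Phi> = 0" by simp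
  with s(1) \<Phi> show ?thesis by (intro that)
qed

definition gsp :: "(real \<Rightarrow> real) \<Rightarrow> wf set" where
  "gsp g = {\<Psi>. fdom N \<Psi> \<and> rr g \<Psi> = 0}"

lemma gspD: "\<Psi> \<in> gsp g \<Longrightarrow> fdom N \<Psi>" "\<Psi> \<in> gsp g \<Longrightarrow> rr g \<Psi> = 0"
  by (simp_all add: gsp_def)

text \<open>By the parallelogram identity two nonnegative excesses add up to zero, so both
  vanish.\<close>

lemma gsp_vlin:
  assumes g: "L2T g" and f: "\<Phi> \<in> gsp g" "\<Psi> \<in> gsp g" shows "vlin a \<Phi> \<Psi> \<in> gsp g"
proof -
  note fd = gspD(1)[OF f(1)] gspD(1)[OF f(2)]
  have "rr g (vlin (-a) \<Phi> \<Psi>) + rr g (vlin a \<Phi> \<Psi>) = 0"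
    using herm_parallelogram[OF herm_rf[OF g] fd, of a] gspD(2)[OF f(1)] gspD(2)[OF f(2)] by (simp add: rr_def)
  moreover have "rr g (vlin (-a) \<Phi> \<Psi>) \<ge> 0" "rr g (vlin a \<Phi> \<Psi>) \<ge> 0"
    by (intro rr_nonneg g fdom_vlin fd)+
  ultimately show ?thesis using fdom_vlin[OF fd] by (simp add: gsp_def)
qed

lemma gsp_smul: "L2T g \<Longrightarrow> \<Psi> \<in> gsp g \<Longrightarrow> smul c \<Psi> \<in> gsp g"
  unfolding smul_vlin by (rule gsp_vlin)

text \<open>A null vector of a nonnegative form is orthogonal to everything: otherwise moving along
  it with the right phase would make the form negative. This yields the weak eigenvalue
  equation.\<close>

lemma gsp_orthogonal:
  assumes g: "L2T g" and \<Psi>: "\<Psi> \<in> gsp g" and \<Phi>: "fdom N \<Phi>"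
  shows "rf g \<Phi> \<Psi> = 0"
proof (rule ccontr)
  assume "rf g \<Phi> \<Psi> \<noteq> 0"
  define z where "z = rf g \<Phi> \<Psi>"
  have z: "(cmod z)\<^sup>2 > 0" using \<open>rf g \<Phi> \<Psi> \<noteq> 0\<close> by (simp add: z_def)
  have ge: "0 \<le> rr g \<Phi> - 2 * t * (cmod z)\<^sup>2" for t
  proof -
    \<comment> \<open>The coefficient contains \<open>cnj z\<close> so that the cross term becomes
      real and equal to -2 t |z|^2.\<close>
    have "0 \<le> rr g (vlin (- of_real t * cnj z) \<Psi> \<Phi>)" by (intro rr_nonneg g fdom_vlin \<Phi> gspD(1)[OF \<Psi>])
    also have "\<dots> = rr g \<Phi> + 2 * Re (- of_real t * cnj z * z)"
      unfolding rr_def herm_expand[OF herm_rf[OF g] gspD(1)[OF \<Psi>] \<Phi>] z_def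
      using gspD(2)[OF \<Psi>] by (simp add: rr_def)
    also have "- of_real t * cnj z * z = - of_real (t * (cmod z)\<^sup>2)"
      unfolding of_real_mult complex_norm_square by (simp add: mult_ac)
    finally show ?thesis by simp
  qed
  show False using ge[of "(rr g \<Phi> + 1) / (cmod z)\<^sup>2"] z rr_nonneg[OF g \<Phi>] by simp
qed

text \<open>In the expansion of the quadratic form at \<Psi> + a \<Phi>, summing over the four
  powers of the imaginary unit keeps only the part of the cross term that is antilinear in \<Phi>,
  namely \<open>cnj (hg g \<Psi> \<Phi>)\<close>.\<close>

lemma hform_eq:
  assumes g: "L2T g" and f: "fdom N \<Phi>" "fdom N \<Psi>"
  shows "hform N W (\<lambda>_. 0) g \<Phi> \<Psi> = hg g \<Phi> \<Psi>"
proof -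
  let ?z = "hg g \<Psi> \<Phi>"
  have 1: "hq N W (\<lambda>_. 0) g (\<lambda>x \<sigma>. \<Psi> x \<sigma> + a * \<Phi> x \<sigma>) = (cmod a)\<^sup>2 * q g \<Phi> + q g \<Psi> + 2 * Re (a * ?z)" for a
  proof -
    have "(\<lambda>x \<sigma>. \<Psi> x \<sigma> + a * \<Phi> x \<sigma>) = vlin a \<Phi> \<Psi>" by (simp add: vlin_def fun_eq_iff)
    then show ?thesis using hq_eq[OF g fdom_vlin[OF f]] herm_expand[OF herm_hg[OF g] f] by (simp add: q_def)
  qed
  have 4: "(\<Sum>k<4::nat. h k) = h 0 + h 1 + h 2 + h 3" for h :: "nat \<Rightarrow> complex"
    by (simp add: eval_nat_numeral)
  have "hform N W (\<lambda>_. 0) g \<Phi> \<Psi> = cnj ?z"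
    unfolding hform_def 4 1 by (simp add: complex_eq_iff power2_eq_square power3_eq_cube)
  then show ?thesis using hermD(1)[OF herm_hg[OF g] f] by simp
qed

lemma gsp_eigen:
  assumes g: "L2T g" and \<Psi>: "\<Psi> \<in> gsp g" "nrm2 N \<Psi> = 1"
  shows "hq N W (\<lambda>_. 0) g \<Psi> = E0 N W (\<lambda>_. 0) g"
    and "fdom N \<Phi> \<Longrightarrow> hform N W (\<lambda>_. 0) g \<Phi> \<Psi> = of_real (E0 N W (\<lambda>_. 0) g) * inner_wf N \<Phi> \<Psi>"
proof -
  show "hq N W (\<lambda>_. 0) g \<Psi> = E0 N W (\<lambda>_. 0) g"
    using gspD[OF \<Psi>(1)] \<Psi>(2) by (simp add: hq_eq[OF g] E0_eq[OF g] rr_eq)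
  show "fdom N \<Phi> \<Longrightarrow> hform N W (\<lambda>_. 0) g \<Phi> \<Psi> = of_real (E0 N W (\<lambda>_. 0) g) * inner_wf N \<Phi> \<Psi>"
    using gsp_orthogonal[OF g \<Psi>(1)] hform_eq[OF g _ gspD(1)[OF \<Psi>(1)]] by (simp add: E0_eq[OF g] rf_def)
qed

end

section \<open>The dual problem\<close>

text \<open>Coercivity is an assumption here, so that the dual argument is independent of how trial
  states are built; the trial state may depend on \<open>g\<close>, while the constants may
  not.\<close>

locale qrep = qsys +
  fixes r :: "real \<Rightarrow> real" and \<epsilon> C :: real
  assumes r: "L2T r" and r_mean: "(\<integral>t. r t \<partial>L01) = 0" and \<epsilon>: "\<epsilon> > 0"
    and coercive: "\<And>g. L2T g \<Longrightarrow> (\<integral>t. g t \<partial>L01) = 0 \<Longrightarrow>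
      \<exists>\<Psi>\<in>Wset N. q g \<Psi> + (\<integral>t. g t * r t \<partial>L01) \<le> C - \<epsilon> * sqrt (l2 L01 g)"
begin

definition Xs :: "(real \<Rightarrow> real) set" where
  "Xs = {g. L2T g \<and> (\<integral>t. g t \<partial>L01) = 0}"

lemma XsD: "g \<in> Xs \<Longrightarrow> L2T g" "g \<in> Xs \<Longrightarrow> (\<integral>t. g t \<partial>L01) = 0"
  by (simp_all add: Xs_def)

lemma Xs_lin: "f \<in> Xs \<Longrightarrow> g \<in> Xs \<Longrightarrow> (\<lambda>t. a * f t + b * g t) \<in> Xs"
  using L2T_lin[of f g a b] by (auto simp: Xs_def L2T_iff sqint_L01_integrable)

definition Dd :: "(real \<Rightarrow> real) \<Rightarrow> real" where
  "Dd g = E g + (\<integral>t. g t * r t \<partial>L01)"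

lemma q_lin:
  assumes "L2T f" "L2T g" "fdom N \<Psi>"
  shows "q (\<lambda>t. a * f t + b * g t) \<Psi> = Tkin N \<Psi> + Re (W \<Psi> \<Psi>) - a * (\<integral>t. f t * Jd N \<Psi> t \<partial>L01) - b * (\<integral>t. g t * Jd N \<Psi> t \<partial>L01)"
  using q_eq[OF L2T_lin[OF assms(1,2)] assms(3), of a b] L2T_int_lin[OF assms(1,2) dens_props(3)[OF N assms(3)], of a b]
  by simp

lemma Dd_upper:
  assumes "g \<in> Xs" shows "Dd g \<le> C - \<epsilon> * sqrt (l2 L01 g)"
proof -
  obtain \<Psi> where "\<Psi> \<in> Wset N" "q g \<Psi> + (\<integral>t. g t * r t \<partial>L01) \<le> C - \<epsilon> * sqrt (l2 L01 g)"
    using coercive[OF XsD[OF assms]] by blast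
  then show ?thesis using E_le[OF XsD(1)[OF assms], of \<Psi>] unfolding Dd_def by linarith
qed

text \<open>For each fixed state the energy is affine in the potential, and an infimum of affine
  functions is concave; the midpoint case is all that is used.\<close>

lemma Dd_avg:
  assumes f: "f \<in> Xs" and g: "g \<in> Xs"
  shows "(Dd f + Dd g) / 2 \<le> Dd (\<lambda>t. (1/2) * f t + (1/2) * g t)"
proof -
  note fl = XsD(1)[OF f] and gl = XsD(1)[OF g]
  have "(E f + E g) / 2 \<le> E (\<lambda>t. (1/2) * f t + (1/2) * g t)"
  proof (rule E_ge)
    fix \<Psi> assume \<Psi>: "\<Psi> \<in> Wset N"
    note fd = WsetD(1)[OF \<Psi>]
    have "q (\<lambda>t. (1/2) * f t + (1/2) * g t) \<Psi> = (q f \<Psi> + q g \<Psi>) / 2"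
      unfolding q_lin[OF fl gl fd] q_eq[OF fl fd] q_eq[OF gl fd] by (simp add: field_simps)
    then show "(E f + E g) / 2 \<le> q (\<lambda>t. (1/2) * f t + (1/2) * g t) \<Psi>"
      using E_le[OF fl \<Psi>] E_le[OF gl \<Psi>] by simp
  qed
  then show ?thesis unfolding Dd_def L2T_int_lin[OF fl gl r] by simp
qed

text \<open>An infimum of functionals that are continuous in \<open>g\<close> is upper
  semicontinuous. The bounds \<open>c n\<close> stand in for the values \<open>Dd (gs n)\<close>,
  whose convergence is not assumed.\<close>

lemma Dd_usc:
  assumes g: "g \<in> Xs" and gs: "\<And>n. gs n \<in> Xs" and lim: "(\<lambda>n. l2 L01 (\<lambda>t. gs n t - g t)) \<longlonglongrightarrow> 0"
    and c: "(\<lambda>n. c n) \<longlonglongrightarrow> c0" "\<And>n. c n \<le> Dd (gs n)"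
  shows "c0 \<le> Dd g"
proof -
  have s: "sqint L01 g" "\<And>n. sqint L01 (gs n)" using g gs by (auto simp: Xs_def L2T_iff)
  have z: "(\<lambda>n::nat. l2 L01 (\<lambda>x. h x - h x)) \<longlonglongrightarrow> 0" for h :: "real \<Rightarrow> real" by (simp add: l2_def)
  have li: "(\<lambda>n. \<integral>t. gs n t * h t \<partial>L01) \<longlonglongrightarrow> (\<integral>t. g t * h t \<partial>L01)" if "sqint L01 h" for h :: "real \<Rightarrow> real"
    by (rule l2_tendsto_bilinear[OF bounded_bilinear_mult s that that lim z])
  have "c0 - (\<integral>t. g t * r t \<partial>L01) \<le> E g"
  proof (rule E_ge)
    fix \<Psi> assume \<Psi>: "\<Psi> \<in> Wset N"
    note fd = WsetD(1)[OF \<Psi>]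
    have sJ: "sqint L01 (Jd N \<Psi>)" using dens_props(3)[OF N fd] by (simp add: L2T_iff)
    have qn: "q (gs n) \<Psi> = Tkin N \<Psi> + Re (W \<Psi> \<Psi>) - (\<integral>t. gs n t * Jd N \<Psi> t \<partial>L01)" for n
      by (rule q_eq[OF XsD(1)[OF gs] fd])
    have lim: "(\<lambda>n. q (gs n) \<Psi> + (\<integral>t. gs n t * r t \<partial>L01)) \<longlonglongrightarrow> q g \<Psi> + (\<integral>t. g t * r t \<partial>L01)"
      unfolding qn q_eq[OF XsD(1)[OF g] fd] by (intro tendsto_intros li sJ) (use r in \<open>simp add: L2T_iff\<close>)
    have "c0 \<le> q g \<Psi> + (\<integral>t. g t * r t \<partial>L01)"
    proof (rule LIMSEQ_le[OF c(1) lim])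
      show "\<exists>N. \<forall>n\<ge>N. c n \<le> q (gs n) \<Psi> + (\<integral>t. gs n t * r t \<partial>L01)"
        using c(2) E_le[OF XsD(1)[OF gs] \<Psi>] unfolding Dd_def by (meson add_right_mono order_trans)
    qed
    then show "c0 - (\<integral>t. g t * r t \<partial>L01) \<le> q g \<Psi>" by simp
  qed
  then show ?thesis by (simp add: Dd_def)
qed

text \<open>Near-minimal-norm elements of the superlevel sets of the concave dual function form a Cauchy sequence
  by the parallelogram law; this replaces weak compactness.\<close>

lemma dual_max: "\<exists>g\<in>Xs. \<forall>f\<in>Xs. Dd f \<le> Dd g"
proof -
  have ne: "Xs \<noteq> {}" using L2T_iff[of "\<lambda>_. 0"] by (auto simp: Xs_def intro!: exI[of _ "\<lambda>_. 0"])
  have bdd: "bdd_above (Dd ` Xs)"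
  proof (rule bdd_aboveI2)
    fix g assume g: "g \<in> Xs"
    have "0 \<le> \<epsilon> * sqrt (l2 L01 g)" using \<epsilon> by simp
    then show "Dd g \<le> C" using Dd_upper[OF g] by linarith
  qed
  define S where "S = Sup (Dd ` Xs)"
  have le_S: "Dd g \<le> S" if "g \<in> Xs" for g unfolding S_def using that bdd by (intro cSup_upper) auto
  \<comment> \<open>The superlevel sets decrease with n, so the infima of the squared norms
    increase; coercivity keeps them bounded and hence convergent.\<close>
  define L where "L n = {g \<in> Xs. Dd g \<ge> S - 1 / real (Suc n)}" for n
  define \<mu> where "\<mu> n = Inf (l2 L01 ` L n)" for n
  have L_ne: "L n \<noteq> {}" for n
  proof -
    have "S - 1 / real (Suc n) < S" by simp
    then obtain y where "y \<in> Dd ` Xs" "S - 1 / real (Suc n) < y"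
      unfolding S_def using less_cSupD[of "Dd ` Xs"] ne by blast
    then show ?thesis by (auto simp: L_def intro: less_imp_le)
  qed
  have bb: "bdd_below (l2 L01 ` L n)" for n by (rule bdd_belowI2[of _ 0]) simp
  have \<mu>_le: "\<mu> n \<le> l2 L01 g" if "g \<in> L n" for n g unfolding \<mu>_def using that bb by (intro cInf_lower) auto
  have mono_L: "L m \<subseteq> L n" if "n \<le> m" for m n
  proof -
    have "1 / real (Suc m) \<le> 1 / real (Suc n)" using that by (intro divide_left_mono) auto
    then show ?thesis by (auto simp: L_def)
  qed
  have inc: "incseq \<mu>"
    unfolding incseq_def \<mu>_def using mono_L L_ne bb by (auto intro!: cInf_superset_mono)
  have "\<exists>g. g \<in> L n \<and> l2 L01 g < \<mu> n + 1 / real (Suc n)" for n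
  proof -
    have "Inf (l2 L01 ` L n) < \<mu> n + 1 / real (Suc n)" unfolding \<mu>_def[symmetric] by simp
    then show ?thesis using cInf_lessD[of "l2 L01 ` L n"] L_ne by blast
  qed
  then obtain gs where gs: "\<And>n. gs n \<in> L n" "\<And>n. l2 L01 (gs n) < \<mu> n + 1 / real (Suc n)" by metis
  have gX: "gs n \<in> Xs" for n using gs(1) by (simp add: L_def)
  have gq: "sqint L01 (gs n)" for n using gX by (simp add: Xs_def L2T_iff)
  have \<mu>b: "\<mu> n \<le> ((C - S + 1) / \<epsilon>)\<^sup>2" for n
  proof -
    have "S - 1 / real (Suc n) \<le> Dd (gs n)" using gs(1) by (simp add: L_def)
    moreover have "1 / real (Suc n) \<le> 1" by simp
    ultimately have "\<epsilon> * sqrt (l2 L01 (gs n)) \<le> C - S + 1" using Dd_upper[OF gX[of n]] by linarith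
    then have "sqrt (l2 L01 (gs n)) \<le> (C - S + 1) / \<epsilon>" using \<epsilon> by (simp add: field_simps)
    then have "(sqrt (l2 L01 (gs n)))\<^sup>2 \<le> ((C - S + 1) / \<epsilon>)\<^sup>2" by (rule power_mono) simp
    then show ?thesis using \<mu>_le[OF gs(1)[of n]] by simp
  qed
  have "bdd_above (range \<mu>)" using \<mu>b by (intro bdd_aboveI2)
  from LIMSEQ_incseq_SUP[OF this inc] obtain M where M: "\<mu> \<longlonglongrightarrow> M" by blast
  have M_ge: "\<mu> n \<le> M" for n by (rule incseq_le[OF inc M])
  have par: "l2 L01 (\<lambda>t. gs m t - gs n t) \<le> 4 * (M - \<mu> n) + 4 / real (Suc n)" if "n \<le> m" for m n
  proof -
    let ?a = "\<lambda>t. (1/2) * gs m t + (1/2) * gs n t"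
    have gm: "gs m \<in> L n" using gs(1) mono_L[OF that] by blast
    \<comment> \<open>Concavity keeps midpoints inside the superlevel set, so a midpoint cannot have
      squared norm below \<open>\<mu> n\<close>; the parallelogram identity then limits how far
      apart the two endpoints are.\<close>
    have "?a \<in> L n"
      using Dd_avg[OF gX gX, of m n] gm gs(1)[of n] Xs_lin[OF gX gX, of "1/2" m "1/2" n] by (simp add: L_def)
    then have A: "\<mu> n \<le> l2 L01 ?a" by (rule \<mu>_le)
    define A where "A = l2 L01 ?a"
    have "A = (1/4) * l2 L01 (\<lambda>t. gs m t + gs n t)" unfolding A_def
      using l2_mult_left[of L01 "1/2" "\<lambda>t. gs m t + gs n t"] by (simp add: distrib_left power2_eq_square)
    moreover have "l2 L01 (\<lambda>t. gs m t + gs n t) + l2 L01 (\<lambda>t. gs m t - gs n t) = 2 * l2 L01 (gs m) + 2 * l2 L01 (gs n)"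
      using l2_add_eq[OF gq gq, of m n] l2_add_eq[OF gq sqint_minus[OF gq], of m n] by (simp add: l2_minus)
    moreover define i k where "i = 1 / real (Suc m)" and "k = 1 / real (Suc n)"
    moreover have "i \<le> k" unfolding i_def k_def using that by (intro divide_left_mono) auto
    moreover have "4 / real (Suc n) = 4 * k" by (simp add: k_def)
    moreover note gs(2)[of m, folded i_def] gs(2)[of n, folded k_def]
    ultimately show ?thesis using A[folded A_def] M_ge[of m] M_ge[of n] by argo
  qed
  have lim0: "(\<lambda>n. 4 * (M - \<mu> n) + 4 / real (Suc n)) \<longlonglongrightarrow> 0"
  proof -
    have "(\<lambda>n. 4 * (M - \<mu> n) + 4 * inverse (real (Suc n))) \<longlonglongrightarrow> 4 * (M - M) + 4 * 0"
      by (intro tendsto_intros M LIMSEQ_inverse_real_of_nat)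
    then show ?thesis by (simp add: field_class.field_divide_inverse)
  qed
  have "\<exists>n0. \<forall>m\<ge>n0. \<forall>n\<ge>n0. l2 L01 (\<lambda>t. gs m t - gs n t) < e" if e: "e > 0" for e :: real
  proof -
    from LIMSEQ_D[OF lim0 e] obtain n0 where n0: "\<And>n. n \<ge> n0 \<Longrightarrow> 4 * (M - \<mu> n) + 4 / real (Suc n) < e"
      by (auto simp: abs_less_iff)
    have "l2 L01 (\<lambda>t. gs m t - gs n t) < e" if "m \<ge> n0" "n \<ge> n0" for m n
    proof (cases "n \<le> m")
      case True
      then show ?thesis using par[OF True] n0[of n] that by linarith
    next
      case False
      then have "m \<le> n" by simp
      then show ?thesis using par[OF \<open>m \<le> n\<close>] n0[of m] that l2_minus_commute[of L01 "gs m" "gs n"] by linarith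
    qed
    then show ?thesis by blast
  qed
  from L01.l2_complete[OF gq this] obtain g where g: "sqint L01 g" "(\<lambda>n. l2 L01 (\<lambda>t. gs n t - g t)) \<longlonglongrightarrow> 0" by blast
  have "(\<integral>t. g t \<partial>L01) = 0"
  proof -
    have one: "sqint L01 (\<lambda>_. 1::real)" by (rule L01.sqint_bounded[of _ 1]) auto
    have "(\<lambda>n. \<integral>t. gs n t * 1 \<partial>L01) \<longlonglongrightarrow> (\<integral>t. g t * 1 \<partial>L01)"
      by (rule l2_tendsto_bilinear[OF bounded_bilinear_mult g(1) gq one one g(2)]) (simp add: l2_def)
    then show ?thesis using XsD(2)[OF gX] by (simp add: LIMSEQ_const_iff)
  qed
  then have gXs: "g \<in> Xs" using g(1) by (simp add: Xs_def L2T_iff)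
  have "S \<le> Dd g"
  proof (rule Dd_usc[OF gXs gX g(2)])
    show "S - inverse (real (Suc n)) \<le> Dd (gs n)" for n using gs(1)[of n] by (simp add: L_def inverse_eq_divide)
    show "(\<lambda>n. S - inverse (real (Suc n))) \<longlonglongrightarrow> S"
      using tendsto_diff[OF tendsto_const LIMSEQ_inverse_real_of_nat, of S] by simp
  qed
  then show ?thesis using gXs le_S by (meson order_trans)
qed

text \<open>One-sided differentiation of the ground state energy along w. Near-minimisers for g +
  \<tau> w are also near-minimisers for g, and maximality of g forces their pairing with w to be
  almost nonnegative; compactness yields a genuine ground state in the limit.\<close>

lemma optimality:
  assumes g: "g \<in> Xs" and max: "\<And>f. f \<in> Xs \<Longrightarrow> Dd f \<le> Dd g" and w: "w \<in> Xs"
  shows "\<exists>\<Psi>\<in>gsp g. nrm2 N \<Psi> = 1 \<and> 0 \<le> (\<integral>t. w t * (Jd N \<Psi> t - r t) \<partial>L01)"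
proof -
  note gl = XsD(1)[OF g] and wl = XsD(1)[OF w]
  define \<tau> where "\<tau> n = 1 / real (Suc n)" for n
  have \<tau>: "0 < \<tau> n" "\<tau> n \<le> 1" for n by (simp_all add: \<tau>_def)
  have \<tau>0: "\<tau> \<longlonglongrightarrow> 0" unfolding \<tau>_def using LIMSEQ_inverse_real_of_nat by (simp add: inverse_eq_divide)
  define gw where "gw n = (\<lambda>t. 1 * g t + \<tau> n * w t)" for n
  have gwX: "gw n \<in> Xs" for n unfolding gw_def by (rule Xs_lin[OF g w])
  note gwl = XsD(1)[OF gwX]
  \<comment> \<open>The slack is quadratic in \<tau> so that it still tends to zero after division
    by \<tau>, the size of the perturbation.\<close>
  have "\<exists>\<Psi>\<in>Wset N. q (gw n) \<Psi> < E (gw n) + (\<tau> n)\<^sup>2" for n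
    by (rule E_approx[OF gwl]) (use \<tau>(1)[of n] in simp)
  then obtain \<Psi> where \<Psi>: "\<And>n. \<Psi> n \<in> Wset N" "\<And>n. q (gw n) (\<Psi> n) < E (gw n) + (\<tau> n)\<^sup>2" by metis
  note fd = WsetD(1)[OF \<Psi>(1)]
  define J where "J n = (\<integral>t. w t * Jd N (\<Psi> n) t \<partial>L01)" for n
  define R where "R = (\<integral>t. w t * r t \<partial>L01)"
  have qg: "q (gw n) (\<Psi> n) = q g (\<Psi> n) - \<tau> n * J n" for n
    unfolding gw_def q_lin[OF gl wl fd] q_eq[OF gl fd] J_def by simp
  have Eg: "E (gw n) \<le> E g - \<tau> n * R" for n
    using max[OF gwX[of n]] L2T_int_lin[OF gl wl r, of 1 "\<tau> n"] unfolding Dd_def R_def gw_def by simp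
  have up: "q g (\<Psi> n) \<le> E g + \<tau> n * (J n - R) + (\<tau> n)\<^sup>2" for n
    using \<Psi>(2)[of n] Eg[of n] qg[of n] by (simp add: algebra_simps)
  have lo: "E g \<le> q g (\<Psi> n)" for n by (rule E_le[OF gl \<Psi>(1)])
  have JR: "- \<tau> n \<le> J n - R" for n
  proof -
    have "0 \<le> \<tau> n * ((J n - R) + \<tau> n)" using up[of n] lo[of n] by (simp add: algebra_simps power2_eq_square)
    then show ?thesis using \<tau>(1)[of n] by (simp add: zero_le_mult_iff)
  qed
  \<comment> \<open>Since \<tau> is at most 1, all perturbed potentials lie in one L2 ball of this
    size, which gives a single energy bound for the whole sequence.\<close>
  obtain c where c: "c \<ge> 0" "\<And>f \<Psi>. L2T f \<Longrightarrow> l2 L01 f \<le> 2 * l2 L01 g + 2 * l2 L01 w \<Longrightarrow> fdom N \<Psi> \<Longrightarrow> Tkin N \<Psi> / 2 - c * nrm2 N \<Psi> \<le> q f \<Psi>"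
    using q_lower[of "2 * l2 L01 g + 2 * l2 L01 w"] by blast
  obtain d where d: "d \<ge> 0" "\<And>\<Psi>. fdom N \<Psi> \<Longrightarrow> \<bar>Re (pf N w \<Psi> \<Psi>)\<bar> \<le> d * h1n N \<Psi>"
    using pf_h1[OF wl] by blast
  define T where "T = 2 * (E g + \<bar>R\<bar> + 1 + c)"
  have Tb: "Tkin N (\<Psi> n) \<le> T" for n
  proof -
    have s: "sqint L01 g" "sqint L01 (\<lambda>t. \<tau> n * w t)" using gl wl by (auto simp: L2T_iff intro: sqint_mult_left)
    have "l2 L01 (gw n) \<le> 2 * l2 L01 g + 2 * l2 L01 (\<lambda>t. \<tau> n * w t)"
      unfolding gw_def using sqint_add(2)[OF s] by simp
    also have "l2 L01 (\<lambda>t. \<tau> n * w t) \<le> 1 * l2 L01 w"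
      unfolding l2_mult_left using \<tau>[of n] by (intro mult_right_mono) (auto simp: power_le_one_iff abs_if)
    finally have "Tkin N (\<Psi> n) / 2 - c * nrm2 N (\<Psi> n) \<le> q (gw n) (\<Psi> n)" by (intro c(2) gwl fd) simp
    moreover have "(\<tau> n)\<^sup>2 \<le> 1" using \<tau>[of n] by (simp add: power_le_one_iff)
    moreover have "- (\<tau> n * R) \<le> \<bar>R\<bar>"
    proof -
      have "- (\<tau> n * R) \<le> \<tau> n * \<bar>R\<bar>" using \<tau>(1)[of n] by (metis abs_ge_minus_self abs_mult abs_of_pos)
      also have "\<dots> \<le> 1 * \<bar>R\<bar>" using \<tau>(2)[of n] by (intro mult_right_mono) auto
      finally show ?thesis by simp
    qed
    ultimately show ?thesis using \<Psi>(2)[of n] Eg[of n] WsetD(2)[OF \<Psi>(1)[of n]] unfolding T_def by simp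
  qed
  have Jb: "\<bar>J n\<bar> \<le> d * (1 + T)" for n
  proof -
    have "\<bar>J n\<bar> = \<bar>Re (pf N w (\<Psi> n) (\<Psi> n))\<bar>" unfolding J_def pf_self[OF N fd wl] by simp
    also have "\<dots> \<le> d * h1n N (\<Psi> n)" by (rule d(2)[OF fd])
    also have "\<dots> \<le> d * (1 + T)"
      using d(1) Tb[of n] WsetD(2)[OF \<Psi>(1)[of n]] by (intro mult_left_mono) (auto simp: h1n_def)
    finally show ?thesis .
  qed
  have r0: "(\<lambda>n. rr g (\<Psi> n)) \<longlonglongrightarrow> 0"
  proof (rule tendsto_sandwich)
    show "eventually (\<lambda>n. 0 \<le> rr g (\<Psi> n)) sequentially" using rr_nonneg[OF gl fd] by simp
    show "eventually (\<lambda>n. rr g (\<Psi> n) \<le> \<tau> n * (d * (1 + T) + \<bar>R\<bar>) + (\<tau> n)\<^sup>2) sequentially"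
    proof (intro always_eventually allI)
      fix n
      have "\<tau> n * (J n - R) \<le> \<tau> n * (d * (1 + T) + \<bar>R\<bar>)"
        using Jb[of n] \<tau>(1)[of n] by (intro mult_left_mono) linarith+
      then show "rr g (\<Psi> n) \<le> \<tau> n * (d * (1 + T) + \<bar>R\<bar>) + (\<tau> n)\<^sup>2"
        using up[of n] WsetD(2)[OF \<Psi>(1)[of n]] by (simp add: rr_eq)
    qed
    have "(\<lambda>n. \<tau> n * (d * (1 + T) + \<bar>R\<bar>) + (\<tau> n)\<^sup>2) \<longlonglongrightarrow> 0 * (d * (1 + T) + \<bar>R\<bar>) + 0\<^sup>2"
      by (intro tendsto_intros \<tau>0)
    then show "(\<lambda>n. \<tau> n * (d * (1 + T) + \<bar>R\<bar>) + (\<tau> n)\<^sup>2) \<longlonglongrightarrow> 0" by simp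
  qed simp
  have b1: "nrm2 N (\<Psi> n) \<le> 1" for n using WsetD(2)[OF \<Psi>(1)[of n]] by simp
  obtain s \<Phi> where s: "strict_mono (s :: nat \<Rightarrow> nat)" and \<Phi>: "fdom N \<Phi>" "rr g \<Phi> = 0"
    "(\<lambda>n. h1n N (wsub (\<Psi> (s n)) \<Phi>)) \<longlonglongrightarrow> 0"
    using gs_compact[OF gl fd b1 r0] by blast
  have "(\<lambda>n. nrm2 N (\<Psi> (s n))) \<longlonglongrightarrow> nrm2 N \<Phi>" by (rule tendsto_nrm2[OF \<Phi>(1) fd \<Phi>(3)])
  then have n1: "nrm2 N \<Phi> = 1" using WsetD(2)[OF \<Psi>(1)] by (simp add: LIMSEQ_const_iff)
  have "(\<lambda>n. J (s n)) \<longlonglongrightarrow> (\<integral>t. w t * Jd N \<Phi> t \<partial>L01)" unfolding J_def by (rule tendsto_J[OF wl \<Phi>(1) fd \<Phi>(3)])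
  then have "(\<lambda>n. J (s n) - R) \<longlonglongrightarrow> (\<integral>t. w t * Jd N \<Phi> t \<partial>L01) - R" by (intro tendsto_intros)
  moreover have "(\<lambda>n. - \<tau> (s n)) \<longlonglongrightarrow> 0"
    using tendsto_minus[OF LIMSEQ_subseq_LIMSEQ[OF \<tau>0 s]] by (simp add: comp_def)
  ultimately have "0 \<le> (\<integral>t. w t * Jd N \<Phi> t \<partial>L01) - R"
    using JR by (intro LIMSEQ_le[where X="\<lambda>n. - \<tau> (s n)" and Y="\<lambda>n. J (s n) - R"]) auto
  then have "0 \<le> (\<integral>t. w t * (Jd N \<Phi> t - r t) \<partial>L01)"
    unfolding R_def using L2T_int_diff[OF dens_props(3)[OF N \<Phi>(1)] r wl] by simp
  then show ?thesis using \<Phi> n1 by (auto simp: gsp_def)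
qed

end

section \<open>Finite-dimensional ground spaces\<close>

definition ons :: "nat \<Rightarrow> wf set \<Rightarrow> nat \<Rightarrow> (nat \<Rightarrow> wf) \<Rightarrow> bool" where
  "ons N V d e \<longleftrightarrow> (\<forall>i<d. e i \<in> V \<and> nrm2 N (e i) = 1) \<and>
    (\<forall>i<d. \<forall>j<d. i \<noteq> j \<longrightarrow> inner_wf N (e i) (e j) = 0)"

text \<open>Gram-Schmidt residual of v.\<close>

primrec resid :: "nat \<Rightarrow> (nat \<Rightarrow> wf) \<Rightarrow> nat \<Rightarrow> wf \<Rightarrow> wf" where
  "resid N e 0 v = v"
| "resid N e (Suc n) v = vlin (- inner_wf N (e n) v) (e n) (resid N e n v)"

text \<open>Used for the ground space, where orthonormal families have bounded length, and for the
  whole form domain, where they can be extended without end.\<close>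

locale wf_subspace =
  fixes N :: nat and V :: "wf set"
  assumes V_fdom: "\<And>\<Psi>. \<Psi> \<in> V \<Longrightarrow> fdom N \<Psi>"
    and V_vlin: "\<And>a \<Phi> \<Psi>. \<Phi> \<in> V \<Longrightarrow> \<Psi> \<in> V \<Longrightarrow> vlin a \<Phi> \<Psi> \<in> V"
begin

lemma V_smul: "\<Psi> \<in> V \<Longrightarrow> smul c \<Psi> \<in> V"
  unfolding smul_vlin by (rule V_vlin)

lemma resid_props:
  assumes e: "ons N V d e" and v: "v \<in> V" and n: "n \<le> d"
  shows "resid N e n v \<in> V"
    and "\<And>i. i < d \<Longrightarrow> inner_wf N (e i) (resid N e n v) = (if i < n then 0 else inner_wf N (e i) v)"
    and "nrm2 N (resid N e n v) = nrm2 N v - (\<Sum>i<n. (cmod (inner_wf N (e i) v))\<^sup>2)"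
proof -
  have "resid N e n v \<in> V \<and> (\<forall>i<d. inner_wf N (e i) (resid N e n v) = (if i < n then 0 else inner_wf N (e i) v)) \<and>
    nrm2 N (resid N e n v) = nrm2 N v - (\<Sum>i<n. (cmod (inner_wf N (e i) v))\<^sup>2)"
    using n
  proof (induction n)
    case 0
    then show ?case using v by simp
  next
    case (Suc n)
    then have IH: "resid N e n v \<in> V" "\<And>i. i < d \<Longrightarrow> inner_wf N (e i) (resid N e n v) = (if i < n then 0 else inner_wf N (e i) v)"
      "nrm2 N (resid N e n v) = nrm2 N v - (\<Sum>i<n. (cmod (inner_wf N (e i) v))\<^sup>2)" by auto
    let ?w = "resid N e n v" and ?z = "inner_wf N (e n) v"
    have nd: "n < d" using Suc.prems by simp
    have eV: "e i \<in> V" "nrm2 N (e i) = 1" if "i < d" for i using e that by (auto simp: ons_def)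
    note fe = V_fdom[OF eV(1)] and fw = V_fdom[OF IH(1)]
    have "inner_wf N (e i) (vlin (- ?z) (e n) ?w) = (if i < Suc n then 0 else inner_wf N (e i) v)" if i: "i < d" for i
    proof -
      have "inner_wf N (e i) (vlin (- ?z) (e n) ?w) = - ?z * inner_wf N (e i) (e n) + inner_wf N (e i) ?w"
        by (rule hermD(2)[OF herm_inner fe[OF i] fe[OF nd] fw])
      moreover have "inner_wf N (e i) (e n) = (if i = n then 1 else 0)"
        using e i nd eV(2)[OF nd] by (auto simp: ons_def inner_wf_self)
      ultimately show ?thesis using IH(2)[OF i] by (cases "i = n") auto
    qed
    moreover have "nrm2 N (vlin (- ?z) (e n) ?w) = nrm2 N v - (\<Sum>i<Suc n. (cmod (inner_wf N (e i) v))\<^sup>2)"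
    proof -
      have "inner_wf N ?w (e n) = cnj (inner_wf N (e n) ?w)" by (rule hermD(1)[OF herm_inner fw fe[OF nd]])
      also have "\<dots> = cnj ?z" using IH(2)[OF nd] by simp
      finally have 1: "inner_wf N ?w (e n) = cnj ?z" .
      have "nrm2 N (vlin (- ?z) (e n) ?w) = (cmod ?z)\<^sup>2 * nrm2 N (e n) + nrm2 N ?w + 2 * Re (- (?z * cnj ?z))"
        unfolding nrm2_Re herm_expand[OF herm_inner fe[OF nd] fw] 1 by simp
      also have "?z * cnj ?z = of_real ((cmod ?z)\<^sup>2)" by (simp add: complex_norm_square del: of_real_power)
      finally show ?thesis using IH(3) eV(2)[OF nd] by (simp del: of_real_power)
    qed
    ultimately show ?case using V_vlin[OF eV(1)[OF nd] IH(1)] by simp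
  qed
  then show "resid N e n v \<in> V"
    "\<And>i. i < d \<Longrightarrow> inner_wf N (e i) (resid N e n v) = (if i < n then 0 else inner_wf N (e i) v)"
    "nrm2 N (resid N e n v) = nrm2 N v - (\<Sum>i<n. (cmod (inner_wf N (e i) v))\<^sup>2)" by auto
qed

text \<open>Double counting in place of a dimension theory. If no residual of the longer family
  could be added, each of its d + 1 members would have projection norm 1 on the shorter family, for
  a total of d + 1; Bessel for the longer family bounds the same double sum by d.\<close>

lemma ons_extend:
  assumes e: "ons N V d e" and f: "ons N V (Suc d) f"
  shows "\<exists>v. ons N V (Suc d) (e(d := v))"
proof (rule ccontr)
  assume no: "\<nexists>v. ons N V (Suc d) (e(d := v))"
  have eV: "e i \<in> V" "nrm2 N (e i) = 1" if "i < d" for i using e that by (auto simp: ons_def)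
  have fV: "f i \<in> V" "nrm2 N (f i) = 1" if "i < Suc d" for i using f that by (auto simp: ons_def)
  have one: "(\<Sum>i<d. (cmod (inner_wf N (e i) (f j)))\<^sup>2) = 1" if j: "j < Suc d" for j
  proof (rule ccontr)
    assume ne: "(\<Sum>i<d. (cmod (inner_wf N (e i) (f j)))\<^sup>2) \<noteq> 1"
    let ?w = "resid N e d (f j)"
    note R = resid_props[OF e fV(1)[OF j] order_refl]
    have "nrm2 N ?w \<noteq> 0" using R(3) ne fV(2)[OF j] by simp
    then have pos: "nrm2 N ?w > 0" using nrm2_nonneg[of N ?w] by linarith
    define v where "v = smul (of_real (1 / sqrt (nrm2 N ?w))) ?w"
    have vW: "v \<in> V" "nrm2 N v = 1"
      using V_smul[OF R(1)] WsetD(2)[OF normalize_Wset[OF V_fdom[OF R(1)] pos]] by (simp_all add: v_def)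
    have o1: "inner_wf N (e i) v = 0" if i: "i < d" for i
      unfolding v_def herm_smul(1)[OF herm_inner V_fdom[OF eV(1)[OF i]] V_fdom[OF R(1)]] using R(2)[OF i] i by simp
    have o2: "inner_wf N v (e i) = 0" if i: "i < d" for i
      using hermD(1)[OF herm_inner V_fdom[OF vW(1)] V_fdom[OF eV(1)[OF i]]] o1[OF i] by simp
    have "ons N V (Suc d) (e(d := v))"
      using e vW o1 o2 unfolding ons_def by (auto simp: less_Suc_eq)
    with no show False by blast
  qed
  have bes: "(\<Sum>j<Suc d. (cmod (inner_wf N (f j) (e i)))\<^sup>2) \<le> 1" if i: "i < d" for i
    using resid_props(3)[OF f eV(1)[OF i] order_refl] nrm2_nonneg[of N "resid N f (Suc d) (e i)"] eV(2)[OF i] by simp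
  have sw: "cmod (inner_wf N (f j) (e i)) = cmod (inner_wf N (e i) (f j))" if "i < d" "j < Suc d" for i j
    using hermD(1)[OF herm_inner V_fdom[OF fV(1)[OF that(2)]] V_fdom[OF eV(1)[OF that(1)]]] by simp
  have "real (Suc d) = (\<Sum>j<Suc d. \<Sum>i<d. (cmod (inner_wf N (e i) (f j)))\<^sup>2)" using one by simp
  also have "\<dots> = (\<Sum>i<d. \<Sum>j<Suc d. (cmod (inner_wf N (f j) (e i)))\<^sup>2)"
    by (subst sum.swap) (intro sum.cong refl, simp add: sw)
  also have "\<dots> \<le> (\<Sum>i<d. 1)" by (intro sum_mono bes) auto
  finally show False by simp
qed

text \<open>\<open>gs_density\<close> asks for an infinite orthonormal sequence, so a finite one has
  to be prolonged. One-step extensions are iterated by choice; each step leaves the earlier members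
  alone, so the sequence can be read off diagonally.\<close>

lemma ons_infinite:
  assumes e: "ons N V d e" and all: "\<And>n. \<exists>f. ons N V n f"
  shows "\<exists>F. (\<forall>i<d. F i = e i) \<and> (\<forall>n. ons N V n F)"
proof -
  have "\<exists>v. ons N V n e \<longrightarrow> ons N V (Suc n) (e(n := v))" for n e
    using ons_extend all by meson
  then have "\<forall>p. \<exists>v. ons N V (fst p) (snd p) \<longrightarrow> ons N V (Suc (fst p)) ((snd p)(fst p := v))" by blast
  from choice[OF this] obtain nxt where nxt: "\<And>n e. ons N V n e \<Longrightarrow> ons N V (Suc n) (e(n := nxt (n, e)))" by auto
  define G where "G = rec_nat e (\<lambda>n f. f(d + n := nxt (d + n, f)))"
  have G0: "G 0 = e" and GS: "G (Suc n) = (G n)(d + n := nxt (d + n, G n))" for n by (simp_all add: G_def)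
  have Go: "ons N V (d + n) (G n)" for n
  proof (induction n)
    case 0
    then show ?case using e by (simp add: G0)
  next
    case (Suc n)
    from nxt[OF this] show ?case by (simp only: GS add_Suc_right)
  qed
  have stable: "G (n + k) i = G n i" if "i < d + n" for n k i
    by (induction k) (use that in \<open>auto simp: GS\<close>)
  define F where "F i = G (Suc i) i" for i
  have FG: "F i = G n i" if "i < d + n" for i n
  proof (cases "n \<le> Suc i")
    case True
    then show ?thesis using stable[OF that, of "Suc i - n"] by (simp add: F_def)
  next
    case False
    then show ?thesis using stable[of i "Suc i" "n - Suc i"] by (simp add: F_def)
  qed
  have "ons N V n F" for n
  proof -
    have "F i = G n i" if "i < n" for i using that by (intro FG) simp
    then show ?thesis using Go[of n] unfolding ons_def by auto
  qed
  moreover have "F i = e i" if "i < d" for i using FG[of i 0] that by (simp add: G0)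
  ultimately show ?thesis by blast
qed

end

text \<open>The squared norm is the supremum of these expressions over w, attained at w = a. This
  presents the distance to the target as a supremum of functionals affine in the density, the source
  of its lower semicontinuity.\<close>

lemma l2_ge_dual:
  assumes "sqint M a" "sqint M (w :: _ \<Rightarrow> real)"
  shows "2 * (\<integral>t. w t * a t \<partial>M) - l2 M w \<le> l2 M a"
proof -
  have "0 \<le> l2 M (\<lambda>t. a t + - w t)" by simp
  also have "\<dots> = l2 M a - 2 * (\<integral>t. w t * a t \<partial>M) + l2 M w"
    unfolding l2_add_eq[OF assms(1) sqint_minus[OF assms(2)]] by (simp add: l2_minus mult.commute)
  finally show ?thesis by simp
qed

lemma l2_eq_dual: "2 * (\<integral>t. a t * a t \<partial>M) - l2 M a = l2 M (a :: _ \<Rightarrow> real)"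
  by (simp add: l2_def power2_eq_square)

lemma inf_attained:
  fixes f :: "'a \<Rightarrow> real"
  assumes "S \<noteq> {}" "\<And>x. x \<in> S \<Longrightarrow> b \<le> f x"
    and lsc: "\<And>X c. (\<And>n. X n \<in> S) \<Longrightarrow> (\<lambda>n. f (X n)) \<longlonglongrightarrow> c \<Longrightarrow> \<exists>x\<in>S. f x \<le> c"
  shows "\<exists>x\<in>S. \<forall>y\<in>S. f x \<le> f y"
proof -
  let ?c = "Inf (f ` S)"
  have bdd: "bdd_below (f ` S)" using assms(2) by (intro bdd_belowI2)
  have "\<exists>x. x \<in> S \<and> f x < ?c + inverse (real (Suc n))" for n
    using cInf_lessD[of "f ` S" "?c + inverse (real (Suc n))"] assms(1) by auto
  then obtain X where X: "\<And>n. X n \<in> S" "\<And>n. f (X n) < ?c + inverse (real (Suc n))" by metis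
  have lo: "?c \<le> f y" if "y \<in> S" for y using that bdd by (intro cInf_lower) auto
  have "(\<lambda>n. f (X n)) \<longlonglongrightarrow> ?c"
  proof (rule tendsto_sandwich[of "\<lambda>_. ?c" _ _ "\<lambda>n. ?c + inverse (real (Suc n))"])
    show "(\<lambda>n. ?c + inverse (real (Suc n))) \<longlonglongrightarrow> ?c"
      using tendsto_add[OF tendsto_const LIMSEQ_inverse_real_of_nat, of ?c] by simp
    show "eventually (\<lambda>n. f (X n) \<le> ?c + inverse (real (Suc n))) sequentially"
      using X(2) by (intro always_eventually allI less_imp_le)
    show "eventually (\<lambda>n. ?c \<le> f (X n)) sequentially"
      by (intro always_eventually allI lo X(1))
  qed simp
  from lsc[OF X(1) this] show ?thesis using lo by (meson order_trans)
qed

lemma sum_split_two: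
  fixes h :: "nat \<Rightarrow> real"
  assumes "i < m" "j < m" "i \<noteq> j"
  shows "(\<Sum>k<m. h k) = h i + h j + (\<Sum>k\<in>{..<m}-{i,j}. h k)"
proof -
  have "(\<Sum>k<m. h k) = h i + (\<Sum>k\<in>{..<m}-{i}. h k)" using assms by (intro sum.remove) auto
  also have "(\<Sum>k\<in>{..<m}-{i}. h k) = h j + (\<Sum>k\<in>{..<m}-{i}-{j}. h k)" using assms by (intro sum.remove) auto
  also have "{..<m}-{i}-{j} = {..<m}-{i,j}" by auto
  finally show ?thesis by simp
qed

text \<open>The two new vectors arise from the old ones by a unitary 2 by 2 matrix, and the trace of
  a Hermitian form over a pair is unitarily invariant. Applied to the norm and to the potential
  form, it shows that mass and density are unchanged by the rotation.\<close>

lemma herm_rotate: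
  assumes B: "herm N B" and f: "fdom N \<Phi>" "fdom N \<Psi>" and c: "c = 1 / sqrt (1 + (cmod \<zeta>)\<^sup>2)"
  shows "Re (B (smul (of_real c) (vlin \<zeta> \<Psi> \<Phi>)) (smul (of_real c) (vlin \<zeta> \<Psi> \<Phi>)))
     + Re (B (smul (of_real c) (vlin (- cnj \<zeta>) \<Phi> \<Psi>)) (smul (of_real c) (vlin (- cnj \<zeta>) \<Phi> \<Psi>)))
     = Re (B \<Phi> \<Phi>) + Re (B \<Psi> \<Psi>)"
proof -
  have pos: "1 + (cmod \<zeta>)\<^sup>2 > 0" by (simp add: add_pos_nonneg)
  then have c2: "(cmod (of_real c))\<^sup>2 = 1 / (1 + (cmod \<zeta>)\<^sup>2)" unfolding norm_of_real c by (simp add: power_divide)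
  have "Re (\<zeta> * B \<Phi> \<Psi>) + Re (- cnj \<zeta> * B \<Psi> \<Phi>) = 0"
    unfolding hermD(1)[OF B f] by simp
  then have "Re (B (vlin \<zeta> \<Psi> \<Phi>) (vlin \<zeta> \<Psi> \<Phi>)) + Re (B (vlin (- cnj \<zeta>) \<Phi> \<Psi>) (vlin (- cnj \<zeta>) \<Phi> \<Psi>))
     = (1 + (cmod \<zeta>)\<^sup>2) * (Re (B \<Phi> \<Phi>) + Re (B \<Psi> \<Psi>))"
    unfolding herm_expand[OF B f(2,1)] herm_expand[OF B f] norm_minus_cancel complex_mod_cnj distrib_right distrib_left
    by linarith
  then show ?thesis
    unfolding herm_smul_Re[OF B fdom_vlin[OF f]] herm_smul_Re[OF B fdom_vlin[OF f(2,1)]] c2 distrib_left[symmetric]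
    using pos by simp
qed

context qrep
begin

lemma subspace_gsp: "L2T g \<Longrightarrow> wf_subspace N (gsp g)"
  by unfold_locales (auto intro: gspD gsp_vlin)

text \<open>Otherwise the ground space would contain an infinite orthonormal sequence. Compactness
  would give it a convergent subsequence, although distinct members are at squared distance
  2.\<close>

lemma gsp_finite_dim:
  assumes g: "L2T g"
  shows "\<exists>m. \<nexists>f. ons N (gsp g) m f"
proof (rule ccontr)
  assume "\<not> ?thesis"
  then have all: "\<exists>f. ons N (gsp g) n f" for n by blast
  interpret wf_subspace N "gsp g" by (rule subspace_gsp[OF g])
  have "ons N (gsp g) 0 (\<lambda>_. undefined)" by (simp add: ons_def)
  from ons_infinite[OF this all] obtain F where F: "\<And>n. ons N (gsp g) n F" by blast
  have FV: "F i \<in> gsp g" "nrm2 N (F i) = 1" for i using F[of "Suc i"] by (auto simp: ons_def)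
  have Fo: "inner_wf N (F i) (F j) = 0" if "i \<noteq> j" for i j
    using F[of "Suc (max i j)"] that by (auto simp: ons_def less_Suc_eq_le)
  have "nrm2 N (F i) \<le> 1" "(\<lambda>n. rr g (F n)) \<longlonglongrightarrow> 0" for i using FV gspD(2)[OF FV(1)] by simp_all
  then obtain s \<Phi> where s: "strict_mono (s :: nat \<Rightarrow> nat)" and \<Phi>: "fdom N \<Phi>" "(\<lambda>n. h1n N (wsub (F (s n)) \<Phi>)) \<longlonglongrightarrow> 0"
    using gs_compact[where \<Psi>=F, OF g gspD(1)[OF FV(1)]] by blast
  \<comment> \<open>Two members within squared distance 1/4 of the limit are within squared distance
    1 of each other, which contradicts 2.\<close>
  have "(0::real) < 1 / 4" by simp
  from LIMSEQ_D[OF \<Phi>(2) this] obtain n where n: "\<And>k. k \<ge> n \<Longrightarrow> norm (h1n N (wsub (F (s k)) \<Phi>) - 0) < 1 / 4" by blast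
  define i j where "i = s n" and "j = s (Suc n)"
  have ij: "i \<noteq> j" using strict_monoD[OF s, of n "Suc n"] by (simp add: i_def j_def)
  have b: "nrm2 N (wsub (F i) \<Phi>) < 1 / 4" "nrm2 N (wsub (F j) \<Phi>) < 1 / 4"
    using n[of n] n[of "Suc n"] nrm2_le_h1n[of N "wsub (F i) \<Phi>"] nrm2_le_h1n[of N "wsub (F j) \<Phi>"]
    by (simp_all add: i_def j_def)
  note fd = fdom_vlin[OF \<Phi>(1) gspD(1)[OF FV(1)], of "-1"]
  have "wsub (F i) (F j) = wsub (wsub (F i) \<Phi>) (wsub (F j) \<Phi>)" by (simp add: vlin_def fun_eq_iff)
  then have "nrm2 N (wsub (F i) (F j)) \<le> 2 * nrm2 N (wsub (F j) \<Phi>) + 2 * nrm2 N (wsub (F i) \<Phi>)"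
    using wsub_le[OF herm_inner fd fd, of j i] by (simp add: nrm2_Re[symmetric])
  moreover have "nrm2 N (wsub (F i) (F j)) = 2"
    unfolding nrm2_Re herm_expand[OF herm_inner gspD(1)[OF FV(1)] gspD(1)[OF FV(1)]]
    using FV(2)[of i] FV(2)[of j] Fo[OF ij] by (simp add: inner_wf_self)
  ultimately show False using b by linarith
qed

section \<open>Ensembles of ground states and their distance from the prescribed derivative\<close>

text \<open>A mixed ground state as a tuple of unnormalised members: the weights are the squared norms.\<close>

definition Tup :: "(real \<Rightarrow> real) \<Rightarrow> nat \<Rightarrow> (nat \<Rightarrow> wf) set" where
  "Tup g m = {x. (\<forall>i<m. x i \<in> gsp g) \<and> (\<Sum>i<m. nrm2 N (x i)) = 1}"

definition Jt :: "nat \<Rightarrow> (nat \<Rightarrow> wf) \<Rightarrow> real \<Rightarrow> real" where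
  "Jt m x t = (\<Sum>i<m. Jd N (x i) t)"

definition F1 :: "nat \<Rightarrow> (nat \<Rightarrow> wf) \<Rightarrow> real" where
  "F1 m x = l2 L01 (\<lambda>t. Jt m x t - r t)"

lemma TupD: "x \<in> Tup g m \<Longrightarrow> i < m \<Longrightarrow> x i \<in> gsp g" "x \<in> Tup g m \<Longrightarrow> (\<Sum>i<m. nrm2 N (x i)) = 1"
  by (simp_all add: Tup_def)

lemma TupI: "(\<And>i. i < m \<Longrightarrow> x i \<in> gsp g) \<Longrightarrow> (\<Sum>i<m. nrm2 N (x i)) = 1 \<Longrightarrow> x \<in> Tup g m"
  by (simp add: Tup_def)

lemma L2T_Jd: "\<Psi> \<in> gsp g \<Longrightarrow> L2T (Jd N \<Psi>)"
  by (intro dens_props(3) N gspD)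

lemma L2T_Jt: "x \<in> Tup g m \<Longrightarrow> L2T (Jt m x)"
  unfolding Jt_def[abs_def] L2T_iff by (intro sqint_sum) (auto simp: L2T_iff[symmetric] intro: L2T_Jd TupD)

lemma int_Jt:
  assumes "x \<in> Tup g m" "L2T w"
  shows "(\<integral>t. w t * Jt m x t \<partial>L01) = (\<Sum>i<m. \<integral>t. w t * Jd N (x i) t \<partial>L01)"
  unfolding Jt_def sum_distrib_left
  by (rule Bochner_Integration.integral_sum) (use assms L2T_Jd TupD(1) L2T_int in blast)

lemma int_Jt_r:
  assumes "x \<in> Tup g m" "L2T w"
  shows "(\<integral>t. w t * (Jt m x t - r t) \<partial>L01) = (\<Sum>i<m. \<integral>t. w t * Jd N (x i) t \<partial>L01) - (\<integral>t. w t * r t \<partial>L01)"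
  using L2T_int_diff[OF L2T_Jt[OF assms(1)] r assms(2)] int_Jt[OF assms] by simp

lemma F1_ge:
  assumes "x \<in> Tup g m" "L2T w"
  shows "2 * ((\<Sum>i<m. \<integral>t. w t * Jd N (x i) t \<partial>L01) - (\<integral>t. w t * r t \<partial>L01)) - l2 L01 w \<le> F1 m x"
  unfolding int_Jt_r[OF assms, symmetric] F1_def
  by (rule l2_ge_dual) (use L2T_diff[OF L2T_Jt[OF assms(1)] r] assms(2) in \<open>simp_all add: L2T_iff\<close>)

lemma F1_eq:
  assumes "x \<in> Tup g m" "w = (\<lambda>t. Jt m x t - r t)"
  shows "F1 m x = 2 * ((\<Sum>i<m. \<integral>t. w t * Jd N (x i) t \<partial>L01) - (\<integral>t. w t * r t \<partial>L01)) - l2 L01 w" "L2T w"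
proof -
  show w: "L2T w" unfolding assms(2) by (rule L2T_diff[OF L2T_Jt[OF assms(1)] r])
  show "F1 m x = 2 * ((\<Sum>i<m. \<integral>t. w t * Jd N (x i) t \<partial>L01) - (\<integral>t. w t * r t \<partial>L01)) - l2 L01 w"
    unfolding int_Jt_r[OF assms(1) w, symmetric] F1_def using l2_eq_dual[of L01 w] by (simp add: assms(2))
qed

lemma F1_mono:
  assumes "x \<in> Tup g m" "y \<in> Tup g m"
    and "\<And>w. L2T w \<Longrightarrow> (\<Sum>i<m. \<integral>t. w t * Jd N (y i) t \<partial>L01) = (\<Sum>i<m. \<integral>t. w t * Jd N (x i) t \<partial>L01)"
  shows "F1 m y \<le> F1 m x"
proof -
  define w where "w = (\<lambda>t. Jt m y t - r t)"
  note Fy = F1_eq[OF assms(2) w_def]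
  show ?thesis using F1_ge[OF assms(1) Fy(2)] unfolding Fy(1) assms(3)[OF Fy(2)] .
qed

text \<open>The members are treated one after another, refining the subsequence each time; the
  normalisation survives because squared norms converge.\<close>

lemma Tup_compact:
  assumes g: "L2T g" and X: "\<And>n. X n \<in> Tup g m"
  shows "\<exists>s x. strict_mono (s :: nat \<Rightarrow> nat) \<and> x \<in> Tup g m \<and> (\<forall>i<m. (\<lambda>n. h1n N (wsub (X (s n) i) (x i))) \<longlonglongrightarrow> 0)"
proof -
  have "k \<le> m \<Longrightarrow> \<exists>s x. strict_mono (s :: nat \<Rightarrow> nat) \<and> (\<forall>i<k. x i \<in> gsp g \<and> (\<lambda>n. h1n N (wsub (X (s n) i) (x i))) \<longlonglongrightarrow> 0)" for k
  proof (induction k)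
    case 0
    show ?case using strict_mono_id by (auto intro!: exI[of _ id])
  next
    case (Suc k)
    then obtain s x where s: "strict_mono (s :: nat \<Rightarrow> nat)"
      and x: "\<And>i. i < k \<Longrightarrow> x i \<in> gsp g \<and> (\<lambda>n. h1n N (wsub (X (s n) i) (x i))) \<longlonglongrightarrow> 0" by auto
    have k: "k < m" using Suc.prems by simp
    have f: "X (s n) k \<in> gsp g" for n by (rule TupD(1)[OF X k])
    have "nrm2 N (X (s n) k) \<le> 1" for n
    proof -
      have "nrm2 N (X (s n) k) \<le> (\<Sum>i<m. nrm2 N (X (s n) i))" using k by (intro member_le_sum) auto
      then show ?thesis using TupD(2)[OF X] by simp
    qed
    moreover have "(\<lambda>n. rr g (X (s n) k)) \<longlonglongrightarrow> 0" using gspD(2)[OF f] by simp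
    ultimately obtain s' \<Phi> where s': "strict_mono (s' :: nat \<Rightarrow> nat)" and \<Phi>: "fdom N \<Phi>" "rr g \<Phi> = 0" "(\<lambda>n. h1n N (wsub (X (s (s' n)) k) \<Phi>)) \<longlonglongrightarrow> 0"
      using gs_compact[where \<Psi>="\<lambda>n. X (s n) k", OF g gspD(1)[OF f]] by blast
    have "(x(k := \<Phi>)) i \<in> gsp g \<and> (\<lambda>n. h1n N (wsub (X ((s \<circ> s') n) i) ((x(k := \<Phi>)) i))) \<longlonglongrightarrow> 0" if i: "i < Suc k" for i
    proof (cases "i = k")
      case True
      then show ?thesis using \<Phi> by (simp add: gsp_def)
    next
      case False
      then have "i < k" using i by simp
      from x[OF this] LIMSEQ_subseq_LIMSEQ[OF _ s', of "\<lambda>n. h1n N (wsub (X (s n) i) (x i))" 0] False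
      show ?thesis by (simp add: comp_def)
    qed
    then show ?case using strict_mono_o[OF s s'] by blast
  qed
  from this[OF order_refl] obtain s x where s: "strict_mono (s :: nat \<Rightarrow> nat)"
    and x: "\<And>i. i < m \<Longrightarrow> x i \<in> gsp g" "\<And>i. i < m \<Longrightarrow> (\<lambda>n. h1n N (wsub (X (s n) i) (x i))) \<longlonglongrightarrow> 0" by blast
  have "(\<lambda>n. \<Sum>i<m. nrm2 N (X (s n) i)) \<longlonglongrightarrow> (\<Sum>i<m. nrm2 N (x i))"
    by (intro tendsto_sum tendsto_nrm2 gspD(1)[OF x(1)] gspD(1)[OF TupD(1)[OF X]] x(2)) auto
  then have "(\<Sum>i<m. nrm2 N (x i)) = 1" using TupD(2)[OF X] by (simp add: LIMSEQ_const_iff)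
  then show ?thesis using s x by (blast intro: TupI)
qed

lemma Tup_lim:
  assumes "\<And>n. X n \<in> Tup g m" "x \<in> Tup g m" "\<And>i. i < m \<Longrightarrow> (\<lambda>n. h1n N (wsub (X n i) (x i))) \<longlonglongrightarrow> 0"
  shows "L2T w \<Longrightarrow> (\<lambda>n. \<Sum>i<m. \<integral>t. w t * Jd N (X n i) t \<partial>L01) \<longlonglongrightarrow> (\<Sum>i<m. \<integral>t. w t * Jd N (x i) t \<partial>L01)"
    and "(\<lambda>n. \<Sum>i<m. real i * nrm2 N (X n i)) \<longlonglongrightarrow> (\<Sum>i<m. real i * nrm2 N (x i))"
  using assms by (auto intro!: tendsto_sum tendsto_mult_left tendsto_J tendsto_nrm2 gspD(1) TupD(1))

text \<open>The affine lower bound of \<open>F1_ge\<close> is used with the one w that is sharp at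
  the limit tuple. The subsequence is part of the conclusion so that a second functional can be
  followed along it.\<close>

lemma F1_lsc:
  assumes g: "L2T g" and X: "\<And>n. X n \<in> Tup g m" and c: "(\<lambda>n. F1 m (X n)) \<longlonglongrightarrow> c"
  shows "\<exists>s x. strict_mono (s :: nat \<Rightarrow> nat) \<and> x \<in> Tup g m \<and> F1 m x \<le> c \<and> (\<forall>i<m. (\<lambda>n. h1n N (wsub (X (s n) i) (x i))) \<longlonglongrightarrow> 0)"
proof -
  obtain s x where s: "strict_mono (s :: nat \<Rightarrow> nat)" and x: "x \<in> Tup g m" "\<And>i. i < m \<Longrightarrow> (\<lambda>n. h1n N (wsub (X (s n) i) (x i))) \<longlonglongrightarrow> 0"
    using Tup_compact[where X=X and m=m, OF g X] by blast
  define w where "w = (\<lambda>t. Jt m x t - r t)"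
  note Fx = F1_eq[OF x(1) w_def]
  have "(\<lambda>n. 2 * ((\<Sum>i<m. \<integral>t. w t * Jd N (X (s n) i) t \<partial>L01) - (\<integral>t. w t * r t \<partial>L01)) - l2 L01 w) \<longlonglongrightarrow> F1 m x"
    unfolding Fx(1) by (intro tendsto_intros Tup_lim(1)[where X="\<lambda>n. X (s n)", OF X x Fx(2)])
  moreover have "(\<lambda>n. F1 m (X (s n))) \<longlonglongrightarrow> c" using LIMSEQ_subseq_LIMSEQ[OF c s] by (simp add: comp_def)
  ultimately have "F1 m x \<le> c"
    by (rule LIMSEQ_le) (use F1_ge[OF X Fx(2)] in blast)
  then show ?thesis using s x by blast
qed

text \<open>Among the minimisers of the distance to r, maximising a weighted sum of the squared norms
  forces orthogonality, because a plane rotation of two members leaves the density unchanged.\<close>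

lemma orthogonal_minimiser:
  assumes g: "L2T g" and ne: "Tup g m \<noteq> {}"
  shows "\<exists>x\<in>Tup g m. (\<forall>y\<in>Tup g m. F1 m x \<le> F1 m y) \<and> (\<forall>i<m. \<forall>j<m. i \<noteq> j \<longrightarrow> inner_wf N (x i) (x j) = 0)"
proof -
  have "\<exists>x\<in>Tup g m. \<forall>y\<in>Tup g m. F1 m x \<le> F1 m y"
  proof (rule inf_attained[OF ne])
    show "0 \<le> F1 m x" for x by (simp add: F1_def)
    show "\<exists>x\<in>Tup g m. F1 m x \<le> c" if "\<And>n. X n \<in> Tup g m" "(\<lambda>n. F1 m (X n)) \<longlonglongrightarrow> c" for X c
      using F1_lsc[where X=X and m=m, OF g that] by blast
  qed
  then obtain x0 where x0: "x0 \<in> Tup g m" "\<And>y. y \<in> Tup g m \<Longrightarrow> F1 m x0 \<le> F1 m y" by blast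
  define S where "S = {x \<in> Tup g m. F1 m x \<le> F1 m x0}"
  \<comment> \<open>The weights are strictly increasing in the index, so shifting mass from a lower
    to a higher member strictly improves the functional.\<close>
  define f where "f x = - (\<Sum>i<m. real i * nrm2 N (x i))" for x
  have "\<exists>x\<in>S. \<forall>y\<in>S. f x \<le> f y"
  proof (rule inf_attained)
    show "S \<noteq> {}" using x0(1) by (auto simp: S_def)
    show "- real m \<le> f x" if "x \<in> S" for x
    proof -
      have "(\<Sum>i<m. real i * nrm2 N (x i)) \<le> (\<Sum>i<m. real m * nrm2 N (x i))" by (intro sum_mono mult_right_mono) auto
      also have "\<dots> = real m" using that TupD(2)[of x g m] by (simp add: S_def sum_distrib_left[symmetric])
      finally show ?thesis by (simp add: f_def)
    qed
    fix X c assume X: "\<And>n. X n \<in> S" and c: "(\<lambda>n. f (X n)) \<longlonglongrightarrow> c"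
    have XT: "X n \<in> Tup g m" "F1 m (X n) = F1 m x0" for n using X[of n] x0(2)[of "X n"] by (auto simp: S_def)
    have "(\<lambda>n. F1 m (X n)) \<longlonglongrightarrow> F1 m x0" using XT(2) by simp
    from F1_lsc[where X=X and m=m, OF g XT(1) this] obtain s x where s: "strict_mono (s :: nat \<Rightarrow> nat)"
      and x: "x \<in> Tup g m" "F1 m x \<le> F1 m x0" "\<And>i. i < m \<Longrightarrow> (\<lambda>n. h1n N (wsub (X (s n) i) (x i))) \<longlonglongrightarrow> 0" by blast
    have "(\<lambda>n. f (X (s n))) \<longlonglongrightarrow> f x"
      unfolding f_def by (intro tendsto_minus Tup_lim(2)[where X="\<lambda>n. X (s n)", OF XT(1) x(1,3)])
    moreover have "(\<lambda>n. f (X (s n))) \<longlonglongrightarrow> c" using LIMSEQ_subseq_LIMSEQ[OF c s] by (simp add: comp_def)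
    ultimately have "f x = c" by (rule LIMSEQ_unique)
    then show "\<exists>x\<in>S. f x \<le> c" using x by (auto simp: S_def)
  qed
  then obtain x where x: "x \<in> S" "\<And>y. y \<in> S \<Longrightarrow> f x \<le> f y" by blast
  have xT: "x \<in> Tup g m" and xF: "F1 m x \<le> F1 m x0" using x(1) by (auto simp: S_def)
  have "inner_wf N (x i) (x j) = 0" if ij: "i < m" "j < m" "j < i" for i j
  proof (rule ccontr)
    assume z0: "inner_wf N (x i) (x j) \<noteq> 0"
    define z where "z = inner_wf N (x i) (x j)"
    define a b where "a = nrm2 N (x i)" and "b = nrm2 N (x j)"
    \<comment> \<open>This step size gives t * a at most 1, whereas the inequality derived below
      would need t * a to be at least 2.\<close>
    define t where "t = 1 / (a + 1)"
    have a0: "a \<ge> 0" "b \<ge> 0" by (simp_all add: a_def b_def)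
    have t: "t > 0" using a0 by (simp add: t_def)
    \<comment> \<open>The phase makes \<zeta> * z real and positive, so that the rotation moves mass
      to the member with the larger index.\<close>
    define \<zeta> where "\<zeta> = of_real t * cnj z"
    define c where "c = 1 / sqrt (1 + (cmod \<zeta>)\<^sup>2)"
    define y where "y = x(i := smul (of_real c) (vlin \<zeta> (x j) (x i)), j := smul (of_real c) (vlin (- cnj \<zeta>) (x i) (x j)))"
    have ne: "i \<noteq> j" using ij by simp
    note G = TupD(1)[OF xT ij(1)] TupD(1)[OF xT ij(2)]
    note fd = gspD(1)[OF G(1)] gspD(1)[OF G(2)]
    have yi: "y i = smul (of_real c) (vlin \<zeta> (x j) (x i))" "y j = smul (of_real c) (vlin (- cnj \<zeta>) (x i) (x j))"
      and yk: "\<And>k. k \<noteq> i \<Longrightarrow> k \<noteq> j \<Longrightarrow> y k = x k" using ne by (auto simp: y_def)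
    have Gy: "y k \<in> gsp g" if "k < m" for k
      using TupD(1)[OF xT that] gsp_smul[OF g gsp_vlin[OF g G(2,1)]] gsp_smul[OF g gsp_vlin[OF g G]]
      by (auto simp: y_def)
    have inv: "Re (B (y i) (y i)) + Re (B (y j) (y j)) = Re (B (x i) (x i)) + Re (B (x j) (x j))" if "herm N B" for B
      unfolding yi by (rule herm_rotate[OF that fd c_def])
    have rest: "(\<Sum>k\<in>{..<m}-{i,j}. h (y k) k) = (\<Sum>k\<in>{..<m}-{i,j}. h (x k) k)" for h :: "wf \<Rightarrow> nat \<Rightarrow> real"
      by (rule sum.cong) (auto simp: yk)
    have nsum: "nrm2 N (y i) + nrm2 N (y j) = a + b"
      using inv[OF herm_inner] by (simp add: nrm2_Re a_def b_def)
    have yT: "y \<in> Tup g m"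
    proof (rule TupI[OF Gy])
      show "(\<Sum>k<m. nrm2 N (y k)) = 1"
        using TupD(2)[OF xT] nsum rest[of "\<lambda>v k. nrm2 N v"]
        unfolding sum_split_two[OF ij(1,2) ne] a_def b_def by linarith
    qed
    have "F1 m y \<le> F1 m x"
    proof (rule F1_mono[OF xT yT])
      fix w assume w: "L2T w"
      have J: "(\<integral>t. w t * Jd N (v k) t \<partial>L01) = - Re (pf N w (v k) (v k))" if "v k \<in> gsp g" for v and k :: nat
        using pf_self[OF N gspD(1)[OF that] w] by simp
      show "(\<Sum>k<m. \<integral>t. w t * Jd N (y k) t \<partial>L01) = (\<Sum>k<m. \<integral>t. w t * Jd N (x k) t \<partial>L01)"
        unfolding sum_split_two[OF ij(1,2) ne] rest[of "\<lambda>v k. \<integral>t. w t * Jd N v t \<partial>L01"]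
        using inv[OF herm_pf[OF N w]] J[of y i] J[of y j] J[of x i] J[of x j] Gy[OF ij(1)] Gy[OF ij(2)] G by simp
    qed
    then have "y \<in> S" using yT xF by (auto simp: S_def)
    from x(2)[OF this] have "(\<Sum>k<m. real k * nrm2 N (y k)) \<le> (\<Sum>k<m. real k * nrm2 N (x k))" by (simp add: f_def)
    then have le: "real i * nrm2 N (y i) + real j * nrm2 N (y j) \<le> real i * a + real j * b"
      unfolding sum_split_two[OF ij(1,2) ne] a_def b_def using rest[of "\<lambda>v k. real k * nrm2 N v"] by linarith
    have "nrm2 N (y j) = a + b - nrm2 N (y i)" using nsum by simp
    with le have "(real i - real j) * nrm2 N (y i) \<le> (real i - real j) * a" by (simp add: algebra_simps)
    then have le2: "nrm2 N (y i) \<le> a" using ij(3) by simp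
    have pos: "1 + (cmod \<zeta>)\<^sup>2 > 0" by (simp add: add_pos_nonneg)
    then have c2: "(cmod (of_real c))\<^sup>2 = 1 / (1 + (cmod \<zeta>)\<^sup>2)" unfolding norm_of_real c_def by (simp add: power_divide)
    have "nrm2 N (y i) = ((cmod \<zeta>)\<^sup>2 * b + a + 2 * Re (\<zeta> * z)) / (1 + (cmod \<zeta>)\<^sup>2)"
      unfolding yi nrm2_Re herm_smul_Re[OF herm_inner fdom_vlin[OF fd(2,1)]] c2 herm_expand[OF herm_inner fd(2,1)]
      by (simp add: a_def b_def z_def nrm2_Re)
    then have "(cmod \<zeta>)\<^sup>2 * b + a + 2 * Re (\<zeta> * z) \<le> a * (1 + (cmod \<zeta>)\<^sup>2)"
      using le2 pos by (simp add: pos_divide_le_eq)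
    moreover have "\<zeta> * z = of_real (t * (cmod z)\<^sup>2)"
      unfolding \<zeta>_def of_real_mult complex_norm_square by (simp add: mult_ac)
    moreover have "(cmod \<zeta>)\<^sup>2 = t * (t * (cmod z)\<^sup>2)"
      unfolding \<zeta>_def by (simp add: norm_mult power2_eq_square)
    ultimately have "t * (cmod z)\<^sup>2 * (t * b + 2) \<le> t * (cmod z)\<^sup>2 * (t * a)" by (simp add: algebra_simps)
    moreover have "t * (cmod z)\<^sup>2 > 0" using t z0 by (simp add: z_def)
    ultimately have "t * b + 2 \<le> t * a" by (simp only: mult_le_cancel_left_pos)
    moreover have "t * a \<le> 1" using a0 by (simp add: t_def)
    moreover have "0 \<le> t * b" using t a0 by simp
    ultimately show False by linarith
  qed
  then have orth: "inner_wf N (x i) (x j) = 0" if "i < m" "j < m" "i \<noteq> j" for i j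
    using that hermD(1)[OF herm_inner gspD(1)[OF TupD(1)[OF xT that(1)]] gspD(1)[OF TupD(1)[OF xT that(2)]]]
    by (cases "j < i") auto
  show ?thesis
    using xT orth xF x0(2) by (meson order_trans)
qed

end

lemma L2T_weak_eq:
  assumes "L2T u" "L2T v" "\<And>w. L2T w \<Longrightarrow> (\<integral>t. w t * u t \<partial>L01) = (\<integral>t. w t * v t \<partial>L01)"
  shows "AE t in L01. u t = v t"
proof -
  let ?w = "\<lambda>t. u t - v t"
  have w: "L2T ?w" by (rule L2T_diff[OF assms(1,2)])
  have "l2 L01 ?w = (\<integral>t. ?w t * (u t - v t) \<partial>L01)" by (simp add: l2_def power2_eq_square)
  also have "\<dots> = 0" using L2T_int_diff[OF assms(1,2) w] assms(3)[OF w] by simp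
  finally have "AE t in L01. ?w t = 0" using l2_eq_0_iff[of L01 ?w] w by (simp add: L2T_iff)
  then show ?thesis by eventually_elim simp
qed

text \<open>First-order condition at an endpoint: for small s the quadratic term cannot compensate a
  negative slope.\<close>

lemma ex_small_step:
  fixes p c :: real
  assumes "\<And>s. 0 < s \<Longrightarrow> s < 1 \<Longrightarrow> 0 \<le> 2 * s * p + s\<^sup>2 * c" "c \<ge> 0"
  shows "0 \<le> p"
proof (rule ccontr)
  assume "\<not> 0 \<le> p"
  then have p: "p < 0" by simp
  define s where "s = min (1/2) (- p / (c + 1))"
  have s: "0 < s" "s < 1" using p assms(2) by (auto simp: s_def divide_neg_pos)
  have "s * c \<le> (- p / (c + 1)) * c" using assms(2) by (intro mult_right_mono) (auto simp: s_def)
  also have "\<dots> \<le> - p" using p assms(2) by (simp add: field_simps)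
  finally have "2 * p + s * c < 0" using p by linarith
  then have "s * (2 * p + s * c) < 0" using s(1) by (simp add: mult_pos_neg)
  then show False using assms(1)[OF s] by (simp add: algebra_simps power2_eq_square)
qed

context qrep
begin

lemma int_smul_Jd:
  assumes "fdom N \<Psi>" "L2T w"
  shows "(\<integral>t. w t * Jd N (smul c \<Psi>) t \<partial>L01) = (cmod c)\<^sup>2 * (\<integral>t. w t * Jd N \<Psi> t \<partial>L01)"
proof -
  have "(\<integral>t. w t * Jd N (smul c \<Psi>) t \<partial>L01) = - Re (pf N w (smul c \<Psi>) (smul c \<Psi>))"
    using pf_self[OF N fdom_smul[OF assms(1)] assms(2)] by simp
  also have "\<dots> = - ((cmod c)\<^sup>2 * Re (pf N w \<Psi> \<Psi>))" by (simp add: herm_smul_Re[OF herm_pf[OF N assms(2)] assms(1)])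
  finally show ?thesis using pf_self[OF N assms] by simp
qed

lemma null_gsp_Jd:
  assumes g: "L2T g" and \<Psi>: "\<Psi> \<in> gsp g" "nrm2 N \<Psi> = 0" and w: "L2T w"
  shows "(\<integral>t. w t * Jd N \<Psi> t \<partial>L01) = 0"
proof -
  note fd = gspD(1)[OF \<Psi>(1)]
  obtain c where c: "\<And>\<Psi>. fdom N \<Psi> \<Longrightarrow> Tkin N \<Psi> / 2 - c * nrm2 N \<Psi> \<le> q g \<Psi>"
    using q_lower[of "l2 L01 g"] g by blast
  have "q g \<Psi> = 0" using gspD(2)[OF \<Psi>(1)] \<Psi>(2) by (simp add: rr_eq)
  then have "Tkin N \<Psi> \<le> 0" using c[OF fd] \<Psi>(2) by simp
  then have h: "h1n N \<Psi> = 0" using \<Psi>(2) Tkin_nonneg[of N \<Psi>] by (simp add: h1n_def)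
  obtain d where "\<And>\<Psi>. fdom N \<Psi> \<Longrightarrow> \<bar>Re (pf N w \<Psi> \<Psi>)\<bar> \<le> d * h1n N \<Psi>" using pf_h1[OF w] by blast
  from this[OF fd] h show ?thesis using pf_self[OF N fd w] by simp
qed

text \<open>With a = \<open>Jt m x\<close> - r, optimality in direction -a gives a ground state
  whose pairing with a is at most that of r. Minimality of the distance gives that mixing in this
  state cannot lower the pairing of the tuple. Together the squared norm of a is at most 0.\<close>

lemma representable:
  "\<exists>g x m. g \<in> Xs \<and> x \<in> Tup g m \<and> (\<forall>i<m. \<forall>j<m. i \<noteq> j \<longrightarrow> inner_wf N (x i) (x j) = 0) \<and> (AE t in L01. Jt m x t = r t)"
proof -
  obtain g where gX: "g \<in> Xs" and gmax: "\<And>f. f \<in> Xs \<Longrightarrow> Dd f \<le> Dd g" using dual_max by blast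
  note g = XsD(1)[OF gX]
  interpret V: wf_subspace N "gsp g" by (rule subspace_gsp[OF g])
  obtain m where m: "\<nexists>f. ons N (gsp g) m f" using gsp_finite_dim[OF g] by blast
  have m0: "0 < m" using m by (cases m) (auto simp: ons_def)
  have z: "(\<lambda>_. 0) \<in> Xs" by (auto simp: Xs_def L2T_iff)
  obtain \<Psi>0 where \<Psi>0: "\<Psi>0 \<in> gsp g" "nrm2 N \<Psi>0 = 1" using optimality[OF gX gmax z] by blast
  have "(\<lambda>i. if i = 0 then \<Psi>0 else smul 0 \<Psi>0) \<in> Tup g m"
  proof (rule TupI)
    have "(\<Sum>i<m. nrm2 N (if i = 0 then \<Psi>0 else smul 0 \<Psi>0)) = (\<Sum>i<m. if i = 0 then 1 else 0)"
      by (intro sum.cong refl) (simp add: \<Psi>0 nrm2_smul)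
    then show "(\<Sum>i<m. nrm2 N (if i = 0 then \<Psi>0 else smul 0 \<Psi>0)) = 1" using m0 by simp
  qed (use \<Psi>0 V.V_smul in auto)
  then obtain x where x: "x \<in> Tup g m" and xmin: "\<And>y. y \<in> Tup g m \<Longrightarrow> F1 m x \<le> F1 m y"
    and orth: "\<And>i j. i < m \<Longrightarrow> j < m \<Longrightarrow> i \<noteq> j \<Longrightarrow> inner_wf N (x i) (x j) = 0"
    using orthogonal_minimiser[OF g, of m] by blast
  note xg = TupD(1)[OF x] and fd = gspD(1)[OF TupD(1)[OF x]]
  \<comment> \<open>There is no orthonormal family of length m in the ground space, so the m
    orthogonal members cannot all be nonzero; the null one is the slot for a new state.\<close>
  obtain l where l: "l < m" "nrm2 N (x l) = 0"
  proof -
    have "\<exists>l<m. nrm2 N (x l) = 0"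
    proof (rule ccontr)
      assume "\<not> ?thesis"
      then have pos: "nrm2 N (x i) > 0" if "i < m" for i using that nrm2_nonneg[of N "x i"] by (metis less_eq_real_def)
      let ?e = "\<lambda>i. smul (of_real (1 / sqrt (nrm2 N (x i)))) (x i)"
      have "ons N (gsp g) m ?e"
        unfolding ons_def
      proof (intro conjI allI impI)
        fix i assume i: "i < m"
        show "?e i \<in> gsp g" by (rule V.V_smul[OF xg[OF i]])
        show "nrm2 N (?e i) = 1" by (rule WsetD(2)[OF normalize_Wset[OF fd[OF i] pos[OF i]]])
        fix j assume j: "j < m" "i \<noteq> j"
        show "inner_wf N (?e i) (?e j) = 0"
          using orth[OF i j] by (simp add: herm_smul[OF herm_inner] fdom_smul fd i j)
      qed
      with m show False by blast
    qed
    with that show ?thesis by blast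
  qed
  define a where "a = (\<lambda>t. Jt m x t - r t)"
  have aL: "L2T a" unfolding a_def by (rule L2T_diff[OF L2T_Jt[OF x] r])
  have "(\<integral>t. a t \<partial>L01) = 0"
  proof -
    have i: "integrable L01 (Jd N (x i))" "(\<integral>t. Jd N (x i) t \<partial>L01) = 0" if "i < m" for i
      using L2T_Jd[OF xg[OF that]] integral_wderivT_0[OF dens_props(4)[OF N fd[OF that]]]
      by (auto simp: L2T_iff sqint_L01_integrable)
    have "(\<integral>t. a t \<partial>L01) = (\<integral>t. Jt m x t \<partial>L01) - (\<integral>t. r t \<partial>L01)"
      unfolding a_def using L2T_Jt[OF x] r by (intro Bochner_Integration.integral_diff sqint_L01_integrable) (auto simp: L2T_iff)
    also have "(\<integral>t. Jt m x t \<partial>L01) = (\<Sum>i<m. \<integral>t. Jd N (x i) t \<partial>L01)"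
      unfolding Jt_def by (rule Bochner_Integration.integral_sum) (use i in auto)
    finally show ?thesis using i(2) r_mean by simp
  qed
  then have "a \<in> Xs" using aL by (simp add: Xs_def)
  then have maX: "(\<lambda>t. (-1) * a t + 0 * a t) \<in> Xs" by (intro Xs_lin)
  obtain \<Psi> where \<Psi>: "\<Psi> \<in> gsp g" "nrm2 N \<Psi> = 1" and opt: "0 \<le> (\<integral>t. ((-1) * a t + 0 * a t) * (Jd N \<Psi> t - r t) \<partial>L01)"
    using optimality[OF gX gmax maX] by blast
  have J\<Psi>: "L2T (Jd N \<Psi>)" by (rule L2T_Jd[OF \<Psi>(1)])
  have opt': "(\<integral>t. a t * Jd N \<Psi> t \<partial>L01) \<le> (\<integral>t. a t * r t \<partial>L01)"
    using opt L2T_int_lin[OF aL aL L2T_diff[OF J\<Psi> r], of "-1" 0] L2T_int_diff[OF J\<Psi> r aL] by simp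
  define b where "b = (\<lambda>t. Jd N \<Psi> t - Jt m x t)"
  have bL: "L2T b" unfolding b_def by (rule L2T_diff[OF J\<Psi> L2T_Jt[OF x]])
  have "0 \<le> (\<integral>t. a t * b t \<partial>L01)"
  proof (rule ex_small_step)
    show "0 \<le> l2 L01 b" by simp
    fix s :: real assume s: "0 < s" "s < 1"
    \<comment> \<open>Slot l carries no mass, so overwriting it loses nothing; the square roots make
      the weights s and 1 - s, and the density derivative becomes a convex combination.\<close>
    define y where "y i = (if i = l then smul (of_real (sqrt s)) \<Psi> else smul (of_real (sqrt (1 - s))) (x i))" for i
    have c1: "(cmod (of_real (sqrt s)))\<^sup>2 = s" "(cmod (of_real (sqrt (1 - s))))\<^sup>2 = 1 - s"
      unfolding norm_of_real using s by simp_all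
    have split: "(\<Sum>i<m. h (y i)) = h (y l) + (\<Sum>i\<in>{..<m}-{l}. h (y i))" "(\<Sum>i<m. h (x i)) = h (x l) + (\<Sum>i\<in>{..<m}-{l}. h (x i))"
      for h :: "wf \<Rightarrow> real" using l(1) by (auto intro!: sum.remove)
    have yT: "y \<in> Tup g m"
    proof (rule TupI)
      show "y i \<in> gsp g" if "i < m" for i using V.V_smul \<Psi>(1) xg[OF that] by (simp add: y_def)
      have "(\<Sum>i\<in>{..<m}-{l}. nrm2 N (y i)) = (\<Sum>i\<in>{..<m}-{l}. (1 - s) * nrm2 N (x i))"
        by (intro sum.cong refl) (simp add: y_def nrm2_smul c1 del: norm_of_real)
      also have "\<dots> = (1 - s) * (\<Sum>i\<in>{..<m}-{l}. nrm2 N (x i))" by (rule sum_distrib_left[symmetric])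
      also have "(\<Sum>i\<in>{..<m}-{l}. nrm2 N (x i)) = 1" using split(2)[of "nrm2 N"] l(2) TupD(2)[OF x] by simp
      finally have "(\<Sum>i\<in>{..<m}-{l}. nrm2 N (y i)) = 1 - s" by simp
      moreover have "nrm2 N (y l) = s" by (simp add: y_def nrm2_smul c1 \<Psi>(2) del: norm_of_real)
      ultimately show "(\<Sum>i<m. nrm2 N (y i)) = 1" unfolding split(1)[of "nrm2 N"] by simp
    qed
    have ab: "L2T (\<lambda>t. 1 * a t + s * b t)" by (rule L2T_lin[OF aL bL])
    have yr: "L2T (\<lambda>t. Jt m y t - r t)" by (rule L2T_diff[OF L2T_Jt[OF yT] r])
    have "AE t in L01. Jt m y t - r t = 1 * a t + s * b t"
    proof (rule L2T_weak_eq[OF yr ab])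
      fix w assume w: "L2T w"
      let ?I = "\<lambda>v. \<integral>t. w t * Jd N v t \<partial>L01"
      have "(\<Sum>i\<in>{..<m}-{l}. ?I (y i)) = (\<Sum>i\<in>{..<m}-{l}. (1 - s) * ?I (x i))"
      proof (intro sum.cong refl)
        fix i assume i: "i \<in> {..<m}-{l}"
        then have "y i = smul (of_real (sqrt (1 - s))) (x i)" "fdom N (x i)" using fd by (auto simp: y_def)
        then show "?I (y i) = (1 - s) * ?I (x i)" using int_smul_Jd[OF _ w] c1(2) by metis
      qed
      also have "\<dots> = (1 - s) * (\<Sum>i\<in>{..<m}-{l}. ?I (x i))" by (rule sum_distrib_left[symmetric])
      also have "(\<Sum>i\<in>{..<m}-{l}. ?I (x i)) = (\<Sum>i<m. ?I (x i))"
        using split(2)[of ?I] null_gsp_Jd[OF g xg[OF l(1)] l(2) w] by simp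
      finally have "(\<Sum>i<m. ?I (y i)) = ?I (y l) + (1 - s) * (\<Sum>i<m. ?I (x i))" unfolding split(1)[of ?I] by simp
      moreover have "?I (y l) = s * ?I \<Psi>"
      proof -
        have "y l = smul (of_real (sqrt s)) \<Psi>" by (simp add: y_def)
        then show ?thesis using int_smul_Jd[OF gspD(1)[OF \<Psi>(1)] w] c1(1) by metis
      qed
      ultimately have A: "(\<integral>t. w t * (Jt m y t - r t) \<partial>L01) = s * ?I \<Psi> + (1 - s) * (\<Sum>i<m. ?I (x i)) - (\<integral>t. w t * r t \<partial>L01)"
        unfolding int_Jt_r[OF yT w] by simp
      have wa: "(\<integral>t. w t * a t \<partial>L01) = (\<Sum>i<m. ?I (x i)) - (\<integral>t. w t * r t \<partial>L01)"
        unfolding a_def by (rule int_Jt_r[OF x w])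
      have wb: "(\<integral>t. w t * b t \<partial>L01) = ?I \<Psi> - (\<Sum>i<m. ?I (x i))"
        unfolding b_def L2T_int_diff[OF J\<Psi> L2T_Jt[OF x] w] int_Jt[OF x w] ..
      have "(\<integral>t. w t * (1 * a t + s * b t) \<partial>L01) = 1 * (\<integral>t. w t * a t \<partial>L01) + s * (\<integral>t. w t * b t \<partial>L01)"
        using L2T_int_lin[OF aL bL w, of 1 s] by (simp add: mult.commute)
      then show "(\<integral>t. w t * (Jt m y t - r t) \<partial>L01) = (\<integral>t. w t * (1 * a t + s * b t) \<partial>L01)"
        unfolding A wa wb by (simp add: algebra_simps)
    qed
    then have "F1 m y = l2 L01 (\<lambda>t. 1 * a t + s * b t)"
      unfolding F1_def by (rule l2_cong_AE) (use yr ab in \<open>auto simp: L2T_iff sqint_measurable\<close>)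
    also have "\<dots> = l2 L01 a + 2 * (\<integral>t. a t \<bullet> (s * b t) \<partial>L01) + l2 L01 (\<lambda>t. s * b t)"
      using l2_add_eq[of L01 a "\<lambda>t. s * b t"] aL bL by (simp add: L2T_iff sqint_mult_left)
    also have "\<dots> = l2 L01 a + 2 * s * (\<integral>t. a t * b t \<partial>L01) + s\<^sup>2 * l2 L01 b"
      unfolding l2_mult_left by (simp add: mult.left_commute)
    finally show "0 \<le> 2 * s * (\<integral>t. a t * b t \<partial>L01) + s\<^sup>2 * l2 L01 b"
      using xmin[OF yT] unfolding F1_def[of m x] a_def[symmetric] by simp
  qed
  then have "(\<integral>t. a t * Jt m x t \<partial>L01) \<le> (\<integral>t. a t * Jd N \<Psi> t \<partial>L01)"
    unfolding b_def L2T_int_diff[OF J\<Psi> L2T_Jt[OF x] aL] by simp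
  with opt' have "(\<integral>t. a t * (Jt m x t - r t) \<partial>L01) \<le> 0"
    unfolding L2T_int_diff[OF L2T_Jt[OF x] r aL] by simp
  then have "l2 L01 a \<le> 0" by (simp add: a_def l2_def power2_eq_square)
  then have "l2 L01 a = 0" using l2_nonneg[of L01 a] by linarith
  then have "AE t in L01. a t = 0" using l2_eq_0_iff[of L01 a] aL by (simp add: L2T_iff)
  then have "AE t in L01. Jt m x t = r t" by eventually_elim (simp add: a_def)
  then show ?thesis using gX x orth by blast
qed

text \<open>Equal derivatives and equal total mass make the densities agree almost everywhere. Null
  members are dropped, the others normalised with their squared norms as weights, and the family is
  continued to an infinite orthonormal sequence by states of weight zero.\<close>

lemma gs_density_of_inf:
  assumes inf: "\<And>n. \<exists>f. ons N {\<Psi>. fdom N \<Psi>} n f"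
    and \<rho>: "integrable L01 \<rho>" "wderivT \<rho> r" "(\<integral>t. \<rho> t \<partial>L01) = real N"
  shows "\<exists>g. L2T g \<and> gs_density N W (\<lambda>_. 0) g \<rho>"
proof -
  obtain g x m where gX: "g \<in> Xs" and x: "x \<in> Tup g m"
    and orth: "\<And>i j. i < m \<Longrightarrow> j < m \<Longrightarrow> i \<noteq> j \<Longrightarrow> inner_wf N (x i) (x j) = 0"
    and Jr: "AE t in L01. Jt m x t = r t" using representable by blast
  note g = XsD(1)[OF gX] and xg = TupD(1)[OF x] and fd = gspD(1)[OF TupD(1)[OF x]]
  define D where "D k t = (\<Sum>i<k. dens N (x i) t)" for k t
  have D: "k \<le> m \<Longrightarrow> integrable L01 (D k) \<and> wderivT (D k) (Jt k x)" for k
  proof (induction k)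
    case 0
    then show ?case by (simp add: D_def Jt_def wderivT_def)
  next
    case (Suc k)
    then have k: "k < m" and IH: "integrable L01 (D k)" "wderivT (D k) (Jt k x)" by auto
    note p = dens_props[OF N fd[OF k]]
    have i: "integrable L01 (Jt k x)" "integrable L01 (Jd N (x k))"
      unfolding Jt_def[abs_def] using k L2T_Jd[OF xg]
      by (auto intro!: Bochner_Integration.integrable_sum sqint_L01_integrable sqint_sum simp: L2T_iff)
    from wderivT_linear[OF IH(1) p(1) i IH(2) p(4), of 1 1] p(1) IH(1)
    show ?case by (simp add: D_def[abs_def] Jt_def[abs_def])
  qed
  have Dm: "integrable L01 (D m)" "wderivT (D m) (Jt m x)" using D by auto
  have JL: "integrable L01 (Jt m x)" "integrable L01 r"
    using L2T_Jt[OF x] r by (auto simp: L2T_iff sqint_L01_integrable)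
  have intD: "(\<integral>t. D m t \<partial>L01) = real N"
  proof -
    have "(\<integral>t. D m t \<partial>L01) = (\<Sum>i<m. real N * nrm2 N (x i))"
      unfolding D_def using dens_props(1,2)[OF N fd] by (subst Bochner_Integration.integral_sum) auto
    also have "\<dots> = real N" using TupD(2)[OF x] by (simp add: sum_distrib_left[symmetric])
    finally show ?thesis .
  qed
  have "wderivT (\<lambda>t. 1 * D m t + (-1) * \<rho> t) (\<lambda>t. 1 * Jt m x t + (-1) * r t)"
    by (rule wderivT_linear[OF Dm(1) \<rho>(1) JL Dm(2) \<rho>(2)])
  then have wu: "wderivT (\<lambda>t. D m t - \<rho> t) (\<lambda>t. Jt m x t - r t)" by simp
  have "(\<integral>t. \<bar>Jt m x t - r t\<bar> \<partial>L01) = (\<integral>t. 0 \<partial>L01)"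
  proof (rule integral_cong_AE)
    show "AE t in L01. \<bar>Jt m x t - r t\<bar> = 0" using Jr by eventually_elim simp
  qed (use JL in auto)
  moreover have "AE t in L01. \<bar>D m t - \<rho> t\<bar> \<le> (\<integral>t. \<bar>Jt m x t - r t\<bar> \<partial>L01)"
    by (rule wderivT_abs_le[OF _ _ wu]) (use Dm(1) \<rho>(1,3) JL intD in simp_all)
  ultimately have D\<rho>: "AE t in L01. D m t = \<rho> t" by simp
  define I where "I = {i. i < m \<and> nrm2 N (x i) > 0}"
  have fI: "finite I" by (simp add: I_def)
  define d where "d = card I"
  obtain h where h: "bij_betw h {..<d} I"
    using ex_bij_betw_nat_finite[OF fI] by (auto simp: d_def lessThan_atLeast0)
  have hI: "h k < m" "nrm2 N (x (h k)) > 0" if "k < d" for k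
    using bij_betw_apply[OF h, of k] that by (auto simp: I_def)
  let ?c = "\<lambda>k. of_real (1 / sqrt (nrm2 N (x (h k)))) :: complex"
  define e where "e k = smul (?c k) (x (h k))" for k
  have cc: "(cmod (?c k))\<^sup>2 = 1 / nrm2 N (x (h k))" if "k < d" for k
    unfolding norm_of_real using hI(2)[OF that] by (simp add: power_divide)
  interpret V: wf_subspace N "{\<Psi>. fdom N \<Psi>}" by unfold_locales (auto intro: fdom_vlin)
  interpret G: wf_subspace N "gsp g" by (rule subspace_gsp[OF g])
  have oe: "ons N {\<Psi>. fdom N \<Psi>} d e"
    unfolding ons_def
  proof (intro conjI allI impI)
    fix i assume i: "i < d"
    show "e i \<in> {\<Psi>. fdom N \<Psi>}" unfolding e_def using fdom_smul fd hI(1)[OF i] by simp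
    show "nrm2 N (e i) = 1" unfolding e_def by (rule WsetD(2)[OF normalize_Wset[OF fd[OF hI(1)[OF i]] hI(2)[OF i]]])
    fix j assume j: "j < d" "i \<noteq> j"
    have "h i \<noteq> h j" using h i j unfolding bij_betw_def inj_on_def by auto
    from orth[OF hI(1)[OF i] hI(1)[OF j(1)] this] show "inner_wf N (e i) (e j) = 0"
      unfolding e_def by (simp add: herm_smul[OF herm_inner] fdom_smul fd hI i j)
  qed
  \<comment> \<open>The continuation takes place in the whole form domain, since the ground space is
    finite-dimensional; the eigenvalue conditions are asked only of states with positive
    weight.\<close>
  from V.ons_infinite[OF this inf] obtain F where F: "\<And>i. i < d \<Longrightarrow> F i = e i" "\<And>n. ons N {\<Psi>. fdom N \<Psi>} n F" by blast
  define wts where "wts k = (if k < d then nrm2 N (x (h k)) else 0)" for k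
  have "gs_density N W (\<lambda>_. 0) g \<rho>"
    unfolding gs_density_def
  proof (intro exI conjI allI impI)
    show "F k \<in> Wset N" for k using F(2)[of "Suc k"] by (auto simp: ons_def Wset_def)
    show "inner_wf N (F k) (F l) = 0" if "k \<noteq> l" for k l
      using F(2)[of "Suc (max k l)"] that by (auto simp: ons_def less_Suc_eq_le)
    show "0 \<le> wts k" for k by (simp add: wts_def)
    have sumI: "(\<Sum>k<d. v (h k)) = (\<Sum>i\<in>I. v i)" for v :: "nat \<Rightarrow> real"
      by (rule sum.reindex_bij_betw[OF h])
    have "wts sums (\<Sum>k<d. wts k)" by (rule sums_finite) (auto simp: wts_def)
    also have "(\<Sum>k<d. wts k) = (\<Sum>k<d. nrm2 N (x (h k)))" by (rule sum.cong) (auto simp: wts_def)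
    also have "\<dots> = (\<Sum>i\<in>I. nrm2 N (x i))" by (rule sumI)
    also have "\<dots> = (\<Sum>i<m. nrm2 N (x i))"
    proof (rule sum.mono_neutral_left)
      show "\<forall>i\<in>{..<m} - I. nrm2 N (x i) = 0"
      proof
        fix i assume "i \<in> {..<m} - I"
        then show "nrm2 N (x i) = 0" using nrm2_nonneg[of N "x i"] by (auto simp: I_def not_less)
      qed
    qed (auto simp: I_def)
    finally show "wts sums 1" using TupD(2)[OF x] by simp
    show "hq N W (\<lambda>_. 0) g (F k) = E0 N W (\<lambda>_. 0) g" if "0 < wts k" for k
    proof -
      have k: "k < d" using that by (auto simp: wts_def split: if_splits)
      have "F k \<in> gsp g" unfolding F(1)[OF k] e_def by (rule G.V_smul[OF xg[OF hI(1)[OF k]]])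
      then show ?thesis using F(2)[of "Suc k"] by (intro gsp_eigen(1)[OF g]) (auto simp: ons_def)
    qed
    show "hform N W (\<lambda>_. 0) g \<Phi> (F k) = complex_of_real (E0 N W (\<lambda>_. 0) g) * inner_wf N \<Phi> (F k)" if "0 < wts k" "fdom N \<Phi>" for k \<Phi>
    proof -
      have k: "k < d" using that by (auto simp: wts_def split: if_splits)
      have "F k \<in> gsp g" unfolding F(1)[OF k] e_def by (rule G.V_smul[OF xg[OF hI(1)[OF k]]])
      then show ?thesis using F(2)[of "Suc k"] that(2) by (intro gsp_eigen(2)[OF g]) (auto simp: ons_def)
    qed
    have dn: "0 \<le> dens N \<Psi> t" for \<Psi> t
      by (simp add: dens_def sum_nonneg)
    \<comment> \<open>A dropped member contributes nothing to the density: its density is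
      nonnegative with integral zero.\<close>
    have z: "AE t in L01. \<forall>i\<in>{..<m} - I. dens N (x i) t = 0"
    proof (rule AE_finite_allI)
      fix i assume i: "i \<in> {..<m} - I"
      then have im: "i < m" and n0: "nrm2 N (x i) = 0" using nrm2_nonneg[of N "x i"] by (auto simp: I_def not_less)
      note p = dens_props[OF N fd[OF im]]
      show "AE t in L01. dens N (x i) t = 0"
        using integral_nonneg_eq_0_iff_AE[OF p(1)] dn p(2) n0 by simp
    qed simp
    show "AE t in L01. (\<lambda>k. wts k * dens N (F k) t) sums \<rho> t"
      using z D\<rho>
    proof eventually_elim
      case (elim t)
      have "(\<lambda>k. wts k * dens N (F k) t) sums (\<Sum>k<d. wts k * dens N (F k) t)" by (rule sums_finite) (auto simp: wts_def)
      also have "(\<Sum>k<d. wts k * dens N (F k) t) = (\<Sum>k<d. dens N (x (h k)) t)"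
      proof (intro sum.cong refl)
        fix k assume k: "k \<in> {..<d}"
        then have k': "k < d" by simp
        show "wts k * dens N (F k) t = dens N (x (h k)) t"
          unfolding F(1)[OF k'] e_def dens_smul cc[OF k'] using hI(2)[OF k'] k' by (simp add: wts_def)
      qed
      also have "\<dots> = (\<Sum>i\<in>I. dens N (x i) t)" by (rule sumI)
      also have "\<dots> = (\<Sum>i<m. dens N (x i) t)"
        by (rule sum.mono_neutral_left) (use elim(1) in \<open>auto simp: I_def\<close>)
      also have "\<dots> = \<rho> t" using elim(2) by (simp add: D_def)
      finally show ?case .
    qed
  qed
  then show ?thesis using g by blast
qed

end

section \<open>Slater determinants\<close>

lemma tsw_eq_transpose: "tsw j k = Transposition.transpose j k"
  by (auto simp: tsw_def Transposition.transpose_def fun_eq_iff)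

lemma sqint_prod_continuous:
  fixes h :: "nat \<Rightarrow> real \<Rightarrow> complex"
  assumes "\<And>i. i < N \<Longrightarrow> continuous_on {0..1} (h i)"
  shows "sqint (cubeM N) (\<lambda>x. \<Prod>i<N. h i (x i))"
    and "l2 (cubeM N) (\<lambda>x. \<Prod>i<N. h i (x i)) = (\<Prod>i<N. l2 L01 (h i))"
proof -
  have s: "sqint L01 (h i)" if "i < N" for i
  proof -
    have "bounded (h i ` {0..1})" using assms[OF that] by (intro compact_imp_bounded compact_continuous_image) auto
    then obtain B where "\<forall>t\<in>{0..1}. norm (h i t) \<le> B" unfolding bounded_iff by blast
    then show ?thesis using continuous_measurable_L01[OF assms[OF that]] by (intro L01.sqint_bounded[of _ B]) auto
  qed
  have eq: "(norm (\<Prod>i<N. h i (x i)))\<^sup>2 = (\<Prod>i<N. (norm (h i (x i)))\<^sup>2)" for x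
    by (simp add: prod_norm[symmetric] prod_power_distrib)
  have i: "\<And>i. i < N \<Longrightarrow> integrable L01 (\<lambda>t. (norm (h i t))\<^sup>2)" using s by (simp add: sqint_def)
  show "sqint (cubeM N) (\<lambda>x. \<Prod>i<N. h i (x i))"
    unfolding sqint_def eq
    using integral_cubeM_prod(1)[OF i] prod_measurable_cubeM[of N h] s by (auto simp: sqint_measurable)
  show "l2 (cubeM N) (\<lambda>x. \<Prod>i<N. h i (x i)) = (\<Prod>i<N. l2 L01 (h i))"
    unfolding l2_def eq by (rule integral_cubeM_prod(2)[OF i])
qed

lemma continuous_sqint_L01: "continuous_on {0..1} (h :: real \<Rightarrow> complex) \<Longrightarrow> sqint L01 h"
proof -
  assume c: "continuous_on {0..1} h"
  have "bounded (h ` {0..1})" using c by (intro compact_imp_bounded compact_continuous_image) auto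
  then obtain B where "\<forall>t\<in>{0..1}. norm (h t) \<le> B" unfolding bounded_iff by blast
  then show ?thesis using continuous_measurable_L01[OF c] by (intro L01.sqint_bounded[of _ B]) auto
qed

lemma wd_sum:
  assumes j: "j < N" and A: "finite A" and "\<And>p. p \<in> A \<Longrightarrow> sqint (cubeM N) (u p)" "\<And>p. p \<in> A \<Longrightarrow> sqint (cubeM N) (D p)"
    "\<And>p. p \<in> A \<Longrightarrow> wd N j (u p) (D p)"
  shows "wd N j (\<lambda>x. \<Sum>p\<in>A. c p * u p x) (\<lambda>x. \<Sum>p\<in>A. c p * D p x)"
  using A assms(3-)
proof (induction A rule: finite_induct)
  case empty
  show ?case by (simp add: wd_def)
next
  case (insert p A)
  have "wd N j (\<lambda>x. c p * u p x + (\<Sum>p\<in>A. c p * u p x)) (\<lambda>x. c p * D p x + (\<Sum>p\<in>A. c p * D p x))"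
    by (rule wd_linear[OF j]) (use insert in \<open>auto intro!: sqint_sum sqint_mult_left\<close>)
  then show ?case using insert(1,2) by simp
qed

lemma integral_by_parts_L01:
  fixes h h' :: "real \<Rightarrow> 'b::euclidean_space"
  assumes d: "\<And>t. t \<in> {0..1} \<Longrightarrow> (h has_vector_derivative h' t) (at t)" and c: "continuous_on {0..1} h'"
    and per: "h 0 = h 1" and f: "ptest f"
  shows "(\<integral>t. deriv f t *\<^sub>R h t \<partial>L01) = - (\<integral>t. f t *\<^sub>R h' t \<partial>L01)"
proof -
  have hc: "continuous_on {0..1} h"
    using d by (intro continuous_on_vector_derivative) (auto intro: has_vector_derivative_at_within)
  have "((\<lambda>t. f t *\<^sub>R h t) has_vector_derivative (f t *\<^sub>R h' t + deriv f t *\<^sub>R h t)) (at t)" if "t \<in> {0..1}" for t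
    by (rule has_vector_derivative_scaleR[OF ptestD(2)[OF f] d[OF that]])
  then have "(\<integral>t. f t *\<^sub>R h' t + deriv f t *\<^sub>R h t \<partial>L01) = f 1 *\<^sub>R h 1 - f 0 *\<^sub>R h 0"
    by (rule integral_L01_FTC) (assumption, intro continuous_intros ptestD[OF f] c hc)
  also have "\<dots> = 0" using per ptestD(1)[OF f, of 0] by simp
  finally have "(\<integral>t. f t *\<^sub>R h' t \<partial>L01) + (\<integral>t. deriv f t *\<^sub>R h t \<partial>L01) = 0"
    by (subst (asm) Bochner_Integration.integral_add)
      (auto intro!: continuous_imp_integrable_real continuous_intros ptestD[OF f] c hc)
  then show ?thesis by (simp add: eq_neg_iff_add_eq_0 add.commute)
qed

text \<open>Both integrals factor over the coordinates; only the factor in coordinate j changes, by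
  periodic integration by parts.\<close>

lemma wd_prod:
  fixes h :: "nat \<Rightarrow> real \<Rightarrow> complex"
  assumes j: "j < N" and c: "\<And>i. i < N \<Longrightarrow> continuous_on {0..1} (h i)"
    and d: "\<And>t. t \<in> {0..1} \<Longrightarrow> (h j has_vector_derivative h' t) (at t)" and c': "continuous_on {0..1} h'" and per: "h j 0 = h j 1"
  shows "wd N j (\<lambda>x. \<Prod>i<N. h i (x i)) (\<lambda>x. \<Prod>i<N. (h(j := h')) i (x i))"
  unfolding wd_def
proof (intro allI impI)
  fix fs :: "nat \<Rightarrow> real \<Rightarrow> real" assume fs: "\<forall>i<N. ptest (fs i)"
  have int: "(\<integral>x. (\<Prod>i<N. a i (x i)) *\<^sub>R (\<Prod>i<N. b i (x i)) \<partial>cubeM N) = (\<Prod>i<N. \<integral>t. a i t *\<^sub>R b i t \<partial>L01)"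
    if "\<And>i. i < N \<Longrightarrow> continuous_on {0..1} (a i)" "\<And>i. i < N \<Longrightarrow> continuous_on {0..1} (b i)"
    for a :: "nat \<Rightarrow> real \<Rightarrow> real" and b :: "nat \<Rightarrow> real \<Rightarrow> complex"
  proof -
    have "(\<integral>x. (\<Prod>i<N. a i (x i)) *\<^sub>R (\<Prod>i<N. b i (x i)) \<partial>cubeM N) = (\<integral>x. (\<Prod>i<N. a i (x i) *\<^sub>R b i (x i)) \<partial>cubeM N)"
      by (simp add: scaleR_conv_of_real prod.distrib)
    also have "\<dots> = (\<Prod>i<N. \<integral>t. a i t *\<^sub>R b i t \<partial>L01)"
      using that by (intro integral_cubeM_prod(2)) (auto intro!: continuous_imp_integrable_real continuous_intros)
    finally show ?thesis .
  qed
  have "(\<integral>x. dtst N j fs x *\<^sub>R (\<Prod>i<N. h i (x i)) \<partial>cubeM N) = (\<Prod>i<N. \<integral>t. (fs(j := deriv (fs j))) i t *\<^sub>R h i t \<partial>L01)"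
    unfolding dtst_eq[OF j] by (rule int) (use fs c in \<open>auto intro: ptestD\<close>)
  also have "\<dots> = (\<integral>t. deriv (fs j) t *\<^sub>R h j t \<partial>L01) * (\<Prod>i\<in>{..<N}-{j}. \<integral>t. fs i t *\<^sub>R h i t \<partial>L01)"
    using j by (subst prod.remove[of _ j]) auto
  also have "(\<integral>t. deriv (fs j) t *\<^sub>R h j t \<partial>L01) = - (\<integral>t. fs j t *\<^sub>R h' t \<partial>L01)"
    by (rule integral_by_parts_L01[OF d c' per]) (use fs j in auto)
  also have "- (\<integral>t. fs j t *\<^sub>R h' t \<partial>L01) * (\<Prod>i\<in>{..<N}-{j}. \<integral>t. fs i t *\<^sub>R h i t \<partial>L01)
     = - (\<Prod>i<N. \<integral>t. fs i t *\<^sub>R (h(j := h')) i t \<partial>L01)"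
    using j by (subst prod.remove[of _ j "\<lambda>i. \<integral>t. fs i t *\<^sub>R (h(j := h')) i t \<partial>L01"]) auto
  also have "(\<Prod>i<N. \<integral>t. fs i t *\<^sub>R (h(j := h')) i t \<partial>L01) = (\<integral>x. tst N fs x *\<^sub>R (\<Prod>i<N. (h(j := h')) i (x i)) \<partial>cubeM N)"
    unfolding tst_def by (rule int[symmetric]) (use fs c c' in \<open>auto intro: ptestD\<close>)
  finally show "(\<integral>x. dtst N j fs x *\<^sub>R (\<Prod>i<N. h i (x i)) \<partial>cubeM N) = - (\<integral>x. tst N fs x *\<^sub>R (\<Prod>i<N. (h(j := h')) i (x i)) \<partial>cubeM N)" .
qed

section \<open>Determinants of orbitals: antisymmetry, orthonormality, density, kinetic
  energy\<close>

abbreviation perms :: "nat \<Rightarrow> (nat \<Rightarrow> nat) set" where "perms N \<equiv> {p. p permutes {..<N}}"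

lemma finite_perms: "finite (perms N)" by (rule finite_permutations) simp

lemma card_perms: "card (perms N) = fact N" by (rule card_permutations) auto

definition slf :: "nat \<Rightarrow> (nat \<Rightarrow> real \<Rightarrow> complex) \<Rightarrow> (nat \<Rightarrow> real) \<Rightarrow> complex" where
  "slf N \<phi> x = (\<Sum>p\<in>perms N. of_int (sign p) * (\<Prod>i<N. \<phi> (p i) (x i)))"

text \<open>Restricted to the particle indices so that it belongs to the extensional set
  \<open>spins N\<close>.\<close>

definition upspin :: "nat \<Rightarrow> nat \<Rightarrow> bool" where
  "upspin N = restrict (\<lambda>_. True) {..<N}"

text \<open>All particles have spin up, so antisymmetry in the joint variables reduces to that of
  the spatial determinant, written as a Leibniz sum of products that Fubini can integrate.\<close>

definition slater :: "nat \<Rightarrow> (nat \<Rightarrow> real \<Rightarrow> complex) \<Rightarrow> wf" where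
  "slater N \<phi> x \<sigma> = (if \<sigma> = upspin N then of_real (1 / sqrt (fact N)) * slf N \<phi> x else 0)"

lemma upspin_spins [simp]: "upspin N \<in> spins N"
  by (auto simp: upspin_def spins_def)

lemma upspin_tsw: "j < N \<Longrightarrow> k < N \<Longrightarrow> \<sigma> \<circ> tsw j k = upspin N \<longleftrightarrow> \<sigma> = upspin N"
proof -
  assume jk: "j < N" "k < N"
  have u: "upspin N \<circ> tsw j k = upspin N"
    using tsw_less[OF jk] by (auto simp: upspin_def fun_eq_iff restrict_def)
  have "\<sigma> \<circ> tsw j k \<circ> tsw j k = \<sigma>" by (simp add: fun_eq_iff)
  then show ?thesis using u by metis
qed

lemma sign_sq: "of_int (sign p) * of_int (sign p) = (1::complex)"
  by (simp add: sign_def)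

lemma slf_tsw:
  assumes "j < N" "k < N" "j \<noteq> k"
  shows "slf N \<phi> (x \<circ> tsw j k) = - slf N \<phi> x"
proof -
  let ?t = "tsw j k"
  have tp: "?t permutes {..<N}" unfolding tsw_eq_transpose using assms by (intro permutes_swap_id) auto
  have inv: "p \<circ> ?t \<circ> ?t = p" for p :: "nat \<Rightarrow> nat" by (simp add: fun_eq_iff)
  have "slf N \<phi> (x \<circ> ?t) = (\<Sum>p\<in>perms N. of_int (sign p) * (\<Prod>i<N. \<phi> (p i) (x (?t i))))"
    by (simp add: slf_def)
  also have "\<dots> = (\<Sum>p\<in>perms N. of_int (sign p) * (\<Prod>i<N. \<phi> (p (?t i)) (x i)))"
    by (intro sum.cong refl arg_cong2[where f="(*)"], rule prod.reindex_bij_witness[of _ ?t ?t])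
      (auto simp: tsw_less[OF assms(1,2)])
  also have "\<dots> = (\<Sum>p\<in>perms N. - (of_int (sign p) * (\<Prod>i<N. \<phi> (p i) (x i))))"
  proof (rule sum.reindex_bij_witness[of _ "\<lambda>p. p \<circ> ?t" "\<lambda>p. p \<circ> ?t"])
    fix p assume p: "p \<in> perms N"
    show "p \<circ> ?t \<circ> ?t = p" "p \<circ> ?t \<circ> ?t = p" by (rule inv)+
    show "p \<circ> ?t \<in> perms N" "p \<circ> ?t \<in> perms N" using permutes_compose[OF tp, of p] p by auto
    have "permutation p" using p permutation_permutes by blast
    then have "sign (p \<circ> ?t) = - sign p"
      unfolding tsw_eq_transpose by (simp add: sign_compose permutation_swap_id sign_swap_id assms(3))
    then show "- (of_int (sign (p \<circ> ?t)) * (\<Prod>i<N. \<phi> ((p \<circ> ?t) i) (x i))) = of_int (sign p) * (\<Prod>i<N. \<phi> (p (?t i)) (x i))"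
      by simp
  qed
  finally show ?thesis by (simp add: slf_def sum_negf)
qed

text \<open>The family is infinite although a determinant uses only N orbitals; the surplus supplies
  orthonormal families of determinants of any length.\<close>

locale orbitals =
  fixes N :: nat and \<phi> \<phi>' :: "nat \<Rightarrow> real \<Rightarrow> complex"
  assumes N: "N \<ge> 1"
    and deriv: "\<And>k t. t \<in> {0..1} \<Longrightarrow> (\<phi> k has_vector_derivative \<phi>' k t) (at t)"
    and cont': "\<And>k. continuous_on {0..1} (\<phi>' k)"
    and per: "\<And>k. \<phi> k 0 = \<phi> k 1"
    and orth: "\<And>k l. (\<integral>t. cnj (\<phi> k t) * \<phi> l t \<partial>L01) = (if k = l then 1 else 0)"
begin

lemma cont: "continuous_on {0..1} (\<phi> k)"
  using deriv by (intro continuous_on_vector_derivative) (auto intro: has_vector_derivative_at_within)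

definition sl :: "(nat \<Rightarrow> nat) \<Rightarrow> wf" where
  "sl \<kappa> = slater N (\<lambda>i. \<phi> (\<kappa> i))"

definition dsl :: "(nat \<Rightarrow> nat) \<Rightarrow> nat \<Rightarrow> wf" where
  "dsl \<kappa> j x \<sigma> = (if \<sigma> = upspin N then of_real (1 / sqrt (fact N)) *
     (\<Sum>p\<in>perms N. of_int (sign p) * (\<Prod>i<N. ((\<lambda>i. \<phi> (\<kappa> (p i)))(j := \<phi>' (\<kappa> (p j)))) i (x i))) else 0)"

lemma sqint_dprod: "sqint (cubeM N) (\<lambda>x. \<Prod>i<N. ((\<lambda>i. \<phi> (\<kappa> (p i)))(j := \<phi>' (\<kappa> (p j)))) i (x i))"
  by (rule sqint_prod_continuous(1)) (auto intro: cont cont')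

lemma sqint_pprod: "sqint (cubeM N) (\<lambda>x. \<Prod>i<N. \<phi> (\<kappa> (p i)) (x i))"
  by (rule sqint_prod_continuous(1)) (rule cont)

lemma L2wf_dsl: "L2wf N (dsl \<kappa> j)"
  unfolding L2wf_iff
proof
  fix \<sigma>
  show "sqint (cubeM N) (\<lambda>x. dsl \<kappa> j x \<sigma>)"
  proof (cases "\<sigma> = upspin N")
    case True
    show ?thesis unfolding dsl_def if_P[OF True]
      by (intro sqint_mult_left sqint_sum sqint_dprod finite_perms)
  next
    case False
    show ?thesis unfolding dsl_def if_not_P[OF False] by simp
  qed
qed

lemma wderiv_sl: "j < N \<Longrightarrow> wderiv_wf N j (sl \<kappa>) (dsl \<kappa> j)"
proof -
  assume j: "j < N"
  have "wd N j (\<lambda>x. of_real (1 / sqrt (fact N)) * slf N (\<lambda>i. \<phi> (\<kappa> i)) x)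
     (\<lambda>x. of_real (1 / sqrt (fact N)) * (\<Sum>p\<in>perms N. of_int (sign p) * (\<Prod>i<N. ((\<lambda>i. \<phi> (\<kappa> (p i)))(j := \<phi>' (\<kappa> (p j)))) i (x i))))"
  proof -
    have "wd N j (\<lambda>x. \<Sum>p\<in>perms N. (of_real (1 / sqrt (fact N)) * of_int (sign p)) * (\<Prod>i<N. \<phi> (\<kappa> (p i)) (x i)))
     (\<lambda>x. \<Sum>p\<in>perms N. (of_real (1 / sqrt (fact N)) * of_int (sign p)) * (\<Prod>i<N. ((\<lambda>i. \<phi> (\<kappa> (p i)))(j := \<phi>' (\<kappa> (p j)))) i (x i)))"
    proof (rule wd_sum[OF j finite_perms sqint_pprod sqint_dprod])
      fix p
      show "wd N j (\<lambda>x. \<Prod>i<N. \<phi> (\<kappa> (p i)) (x i)) (\<lambda>x. \<Prod>i<N. ((\<lambda>i. \<phi> (\<kappa> (p i)))(j := \<phi>' (\<kappa> (p j)))) i (x i))"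
        by (rule wd_prod[OF j]) (auto intro: cont cont' deriv per)
    qed
    then show ?thesis by (simp only: slf_def sum_distrib_left mult.assoc)
  qed
  moreover have "wd N j (\<lambda>x. 0) (\<lambda>x. 0)" by (simp add: wd_def)
  ultimately show ?thesis
    unfolding wderiv_wf_iff
    by (intro ballI, rename_tac \<sigma>, case_tac "\<sigma> = upspin N") (simp_all only: sl_def slater_def dsl_def if_True if_False simp_thms)
qed

lemma fdom_sl: "fdom N (sl \<kappa>)"
  unfolding fdom_def
proof (intro conjI allI impI)
  show "L2wf N (sl \<kappa>)"
    unfolding L2wf_iff
  proof
    fix \<sigma>
    show "sqint (cubeM N) (\<lambda>x. sl \<kappa> x \<sigma>)"
    proof (cases "\<sigma> = upspin N")
      case True
      show ?thesis unfolding sl_def slater_def slf_def if_P[OF True]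
        by (intro sqint_mult_left sqint_sum sqint_pprod finite_perms)
    next
      case False
      show ?thesis unfolding sl_def slater_def if_not_P[OF False] by simp
    qed
  qed
  show "antisym_wf N (sl \<kappa>)"
    unfolding antisym_wf_def
    by (auto intro!: AE_I2 simp: sl_def slater_def upspin_tsw slf_tsw)
  show "\<exists>D. L2wf N D \<and> wderiv_wf N j (sl \<kappa>) D" if "j < N" for j
    using wderiv_sl[OF that] L2wf_dsl by blast
qed

lemma orth_int: "integrable L01 (\<lambda>t. cnj (\<phi> k t) * \<phi> l t)"
  by (intro continuous_imp_integrable_real continuous_intros cont)

lemma sum_spins_upspin:
  assumes "\<And>\<sigma>. \<sigma> \<noteq> upspin N \<Longrightarrow> h \<sigma> = 0" shows "(\<Sum>\<sigma>\<in>spins N. h \<sigma>) = (h (upspin N) :: 'b::comm_monoid_add)"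
proof -
  have "(\<Sum>\<sigma>\<in>spins N. h \<sigma>) = (\<Sum>\<sigma>\<in>{upspin N}. h \<sigma>)"
    by (rule sum.mono_neutral_right) (use assms in auto)
  then show ?thesis by simp
qed

text \<open>Expanding both determinants and integrating coordinate by coordinate turns every term
  into a product of Kronecker deltas.\<close>

lemma inner_sl:
  "inner_wf N (sl \<kappa>) (sl \<mu>) = (1 / fact N) * (\<Sum>p\<in>perms N. \<Sum>q\<in>perms N. of_int (sign p * sign q) *
     (\<Prod>i<N. if \<kappa> (p i) = \<mu> (q i) then 1 else 0))"
proof -
  let ?c = "of_real (1 / sqrt (fact N)) :: complex"
  have cc: "?c * ?c = 1 / fact N"
    unfolding of_real_mult[symmetric] by (simp add: real_sqrt_mult[symmetric])
  have "inner_wf N (sl \<kappa>) (sl \<mu>) = (\<integral>x. cnj (?c * slf N (\<lambda>i. \<phi> (\<kappa> i)) x) * (?c * slf N (\<lambda>i. \<phi> (\<mu> i)) x) \<partial>cubeM N)"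
    unfolding inner_wf_def by (subst sum_spins_upspin) (auto simp: sl_def slater_def)
  also have "\<dots> = (\<integral>x. (1 / fact N) * (\<Sum>p\<in>perms N. \<Sum>q\<in>perms N. of_int (sign p * sign q) *
     (\<Prod>i<N. cnj (\<phi> (\<kappa> (p i)) (x i)) * \<phi> (\<mu> (q i)) (x i))) \<partial>cubeM N)"
  proof (rule Bochner_Integration.integral_cong[OF refl])
    fix x
    have "cnj (?c * slf N (\<lambda>i. \<phi> (\<kappa> i)) x) * (?c * slf N (\<lambda>i. \<phi> (\<mu> i)) x)
       = (?c * ?c) * (cnj (slf N (\<lambda>i. \<phi> (\<kappa> i)) x) * slf N (\<lambda>i. \<phi> (\<mu> i)) x)" by (simp add: mult_ac)
    also have "cnj (slf N (\<lambda>i. \<phi> (\<kappa> i)) x) * slf N (\<lambda>i. \<phi> (\<mu> i)) x = (\<Sum>p\<in>perms N. \<Sum>q\<in>perms N. of_int (sign p * sign q) *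
     (\<Prod>i<N. cnj (\<phi> (\<kappa> (p i)) (x i)) * \<phi> (\<mu> (q i)) (x i)))"
      unfolding slf_def cnj_sum sum_product by (intro sum.cong refl) (simp add: prod.distrib mult_ac)
    finally show "cnj (?c * slf N (\<lambda>i. \<phi> (\<kappa> i)) x) * (?c * slf N (\<lambda>i. \<phi> (\<mu> i)) x) = (1 / fact N) * (\<Sum>p\<in>perms N. \<Sum>q\<in>perms N. of_int (sign p * sign q) *
     (\<Prod>i<N. cnj (\<phi> (\<kappa> (p i)) (x i)) * \<phi> (\<mu> (q i)) (x i)))" unfolding cc .
  qed
  also have "\<dots> = (1 / fact N) * (\<Sum>p\<in>perms N. \<Sum>q\<in>perms N. of_int (sign p * sign q) *
     (\<integral>x. (\<Prod>i<N. cnj (\<phi> (\<kappa> (p i)) (x i)) * \<phi> (\<mu> (q i)) (x i)) \<partial>cubeM N))"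
  proof -
    have ii: "integrable (cubeM N) (\<lambda>x. \<Prod>i<N. cnj (\<phi> (\<kappa> (p i)) (x i)) * \<phi> (\<mu> (q i)) (x i))" for p q :: "nat \<Rightarrow> nat"
      by (rule integral_cubeM_prod(1)) (rule orth_int)
    have i1: "integrable (cubeM N) (\<lambda>x. of_int (sign p * sign q) * (\<Prod>i<N. cnj (\<phi> (\<kappa> (p i)) (x i)) * \<phi> (\<mu> (q i)) (x i)))" for p q :: "nat \<Rightarrow> nat"
      using ii[of p q] by (rule integrable_mult_right)
    show ?thesis
      unfolding integral_mult_right_zero
      by (subst Bochner_Integration.integral_sum, rule Bochner_Integration.integrable_sum, rule i1,
          subst Bochner_Integration.integral_sum, rule i1) (simp only: integral_mult_right_zero)
  qed
  also have "\<dots> = (1 / fact N) * (\<Sum>p\<in>perms N. \<Sum>q\<in>perms N. of_int (sign p * sign q) *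
     (\<Prod>i<N. if \<kappa> (p i) = \<mu> (q i) then 1 else 0))"
    by (subst integral_cubeM_prod(2)) (auto simp: orth_int orth)
  finally show ?thesis .
qed

lemma inner_sl_self:
  assumes \<kappa>: "inj_on \<kappa> {..<N}"
  shows "inner_wf N (sl \<kappa>) (sl \<kappa>) = 1"
proof -
  have "(\<Prod>i<N. if \<kappa> (p i) = \<kappa> (q i) then 1 else 0) = (if p = q then 1 else (0::complex))"
    if p: "p \<in> perms N" and q: "q \<in> perms N" for p q
  proof (cases "p = q")
    case False
    then obtain i where i: "p i \<noteq> q i" by blast
    have "i < N" using i p q by (metis lessThan_iff mem_Collect_eq permutes_not_in)
    moreover have "p i < N" "q i < N" using \<open>i < N\<close> p q permutes_in_image by (metis lessThan_iff mem_Collect_eq)+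
    then have "\<kappa> (p i) \<noteq> \<kappa> (q i)" using \<kappa> i by (auto simp: inj_on_def)
    ultimately have "(\<Prod>i<N. if \<kappa> (p i) = \<kappa> (q i) then 1 else (0::complex)) = 0" by (intro prod_zero) auto
    then show ?thesis using False by simp
  qed simp
  then have "inner_wf N (sl \<kappa>) (sl \<kappa>) = (1 / fact N) * (\<Sum>p\<in>perms N. \<Sum>q\<in>perms N. if p = q then of_int (sign p * sign q) else 0)"
    unfolding inner_sl by (intro arg_cong2[where f="(*)"] sum.cong refl) (auto simp: sign_sq)
  also have "\<dots> = (1 / fact N) * (\<Sum>p\<in>perms N. 1)"
    by (intro arg_cong2[where f="(*)"] sum.cong refl) (simp add: finite_perms sign_sq)
  also have "\<dots> = 1" by (simp add: card_perms)
  finally show ?thesis .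
qed

lemma sl_Wset: "inj_on \<kappa> {..<N} \<Longrightarrow> sl \<kappa> \<in> Wset N"
  using inner_sl_self[of \<kappa>] fdom_sl[of \<kappa>] by (simp add: Wset_def inner_wf_self)

text \<open>The orbital \<open>\<mu> l\<close> is missing from the first determinant. In each term
  of the expansion it sits at position \<open>inv q l\<close>, where the delta vanishes.\<close>

lemma inner_sl_0:
  assumes l: "l < N" "\<And>k. k < N \<Longrightarrow> \<kappa> k \<noteq> \<mu> l"
  shows "inner_wf N (sl \<kappa>) (sl \<mu>) = 0"
proof -
  have "(\<Prod>i<N. if \<kappa> (p i) = \<mu> (q i) then 1 else 0) = (0::complex)" if p: "p \<in> perms N" and q: "q \<in> perms N" for p q
  proof -
    have q': "q permutes {..<N}" and p': "p permutes {..<N}" using p q by auto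
    have "inv q l < N" using permutes_in_image[OF permutes_inv[OF q'], of l] l(1) by simp
    moreover have "q (inv q l) = l" using permutes_inverses(1)[OF q'] .
    moreover have "p (inv q l) < N" using permutes_in_image[OF p', of "inv q l"] calculation(1) by simp
    ultimately have "\<exists>i\<in>{..<N}. (if \<kappa> (p i) = \<mu> (q i) then 1 else 0) = (0::complex)"
      using l(2) by (intro bexI[of _ "inv q l"]) auto
    then show ?thesis by (intro prod_zero) auto
  qed
  then have "(\<Sum>p\<in>perms N. \<Sum>q\<in>perms N. of_int (sign p * sign q) * (\<Prod>i<N. if \<kappa> (p i) = \<mu> (q i) then 1 else 0)) = (0::complex)"
    by (intro sum.neutral ballI) (simp only: mult_zero_right)
  then show ?thesis unfolding inner_sl by (simp only: mult_zero_right)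
qed

lemma ons_sl: "\<exists>f. ons N {\<Psi>. fdom N \<Psi>} n f"
proof -
  \<comment> \<open>All determinants share the orbitals below N - 1 and differ only in the last one,
    which is moved up by a.\<close>
  define \<kappa> where "\<kappa> a i = (if i = N - 1 then N - 1 + a else i)" for a i :: nat
  have "inj_on (\<kappa> a) {..<N}" for a by (auto simp: \<kappa>_def inj_on_def)
  then have 1: "sl (\<kappa> a) \<in> Wset N" for a by (rule sl_Wset)
  have 2: "inner_wf N (sl (\<kappa> a)) (sl (\<kappa> b)) = 0" if "a \<noteq> b" for a b
  proof (cases "b = 0")
    case False
    show ?thesis by (rule inner_sl_0[of "N - 1"]) (use False that N in \<open>auto simp: \<kappa>_def\<close>)
  next
    case True
    then have "inner_wf N (sl (\<kappa> b)) (sl (\<kappa> a)) = 0"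
      by (intro inner_sl_0[of "N - 1"]) (use that N in \<open>auto simp: \<kappa>_def\<close>)
    then show ?thesis using hermD(1)[OF herm_inner fdom_sl[of "\<kappa> a"] fdom_sl[of "\<kappa> b"]] by simp
  qed
  show ?thesis
    by (rule exI[of _ "\<lambda>a. sl (\<kappa> a)"]) (use 1 2 WsetD in \<open>auto simp: ons_def\<close>)
qed

lemma perms_eq_off_0:
  assumes "p \<in> perms N" "q \<in> perms N" "\<And>i. i \<in> {1..<N} \<Longrightarrow> p i = q i"
  shows "p = q"
proof
  have pq: "p permutes {..<N}" "q permutes {..<N}" using assms by auto
  have ne: "p i = q i" if "i \<noteq> 0" for i
    using assms(3)[of i] that permutes_not_in[OF pq(1), of i] permutes_not_in[OF pq(2), of i] by (cases "i < N") auto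
  have "p 0 = q 0"
  proof (rule ccontr)
    assume n: "p 0 \<noteq> q 0"
    define j where "j = inv p (q 0)"
    have "p j = q 0" unfolding j_def by (rule permutes_inverses(1)[OF pq(1)])
    have "j \<noteq> 0" using n \<open>p j = q 0\<close> by metis
    then have "q j = q 0" using ne \<open>p j = q 0\<close> by metis
    then have "j = 0" using permutes_inj[OF pq(2)] by (metis injD)
    with \<open>j \<noteq> 0\<close> show False by blast
  qed
  then show "p i = q i" for i using ne by (cases "i = 0") auto
qed

text \<open>Integrating out all coordinates but the first leaves only pairs of permutations that
  agree away from 0, hence are equal. Each remaining term is the squared modulus of one orbital at
  t; equal moduli P / N make the average P / N and the density P.\<close>

lemma dens_sl:
  assumes mod: "\<And>k. (cmod (\<phi> k t))\<^sup>2 = P / real N"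
  shows "dens N (sl id) t = P"
proof -
  let ?R = "PiM {1..<N} (\<lambda>_::nat. L01)"
  let ?c = "of_real (1 / sqrt (fact N)) :: complex"
  have cc: "?c * ?c = 1 / fact N"
    unfolding of_real_mult[symmetric] by (simp add: real_sqrt_mult[symmetric])
  let ?F = "\<lambda>p q y. \<Prod>i\<in>{1..<N}. cnj (\<phi> (p i) (y i)) * \<phi> (q i) (y i)"
  let ?h = "\<lambda>p q. of_int (sign p * sign q) * (cnj (\<phi> (p 0) t) * \<phi> (q 0) t)"
  have pt: "of_real ((cmod (sl id (y(0 := t)) (upspin N)))\<^sup>2) = (1 / fact N) * (\<Sum>p\<in>perms N. \<Sum>q\<in>perms N. ?h p q * ?F p q y)" for y
  proof -
    have spl: "(\<Prod>i<N. \<phi> (p i) ((y(0 := t)) i)) = \<phi> (p 0) t * (\<Prod>i\<in>{1..<N}. \<phi> (p i) (y i))" for p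
      unfolding lessThan_eq_insert_0[OF N] by (subst prod.insert) auto
    have "of_real ((cmod (sl id (y(0 := t)) (upspin N)))\<^sup>2) = (?c * ?c) * (cnj (slf N \<phi> (y(0 := t))) * slf N \<phi> (y(0 := t)))"
      unfolding complex_norm_square by (simp add: sl_def slater_def mult_ac)
    also have "cnj (slf N \<phi> (y(0 := t))) * slf N \<phi> (y(0 := t)) = (\<Sum>p\<in>perms N. \<Sum>q\<in>perms N. ?h p q * ?F p q y)"
      unfolding slf_def cnj_sum sum_product spl by (intro sum.cong refl) (simp add: prod.distrib mult_ac)
    finally show ?thesis unfolding cc .
  qed
  have ii: "integrable ?R (?F p q)" for p q :: "nat \<Rightarrow> nat"
    by (rule L01P.product_integrable_prod) (auto simp: orth_int)
  have iF: "(\<integral>y. ?F p q y \<partial>?R) = (if p = q then 1 else 0)" if pq: "p \<in> perms N" "q \<in> perms N" for p q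
  proof -
    have "(\<integral>y. ?F p q y \<partial>?R) = (\<Prod>i\<in>{1..<N}. \<integral>t. cnj (\<phi> (p i) t) * \<phi> (q i) t \<partial>L01)"
      by (rule L01P.product_integral_prod) (auto simp: orth_int)
    also have "\<dots> = (\<Prod>i\<in>{1..<N}. if p i = q i then 1 else 0)" by (simp add: orth)
    also have "\<dots> = (if p = q then 1 else 0)"
    proof (cases "p = q")
      case False
      then obtain i where "i \<in> {1..<N}" "p i \<noteq> q i" using perms_eq_off_0[OF pq] by blast
      then have "\<exists>i\<in>{1..<N}. (if p i = q i then 1 else 0) = (0::complex)" by (intro bexI[of _ i]) auto
      then have "(\<Prod>i\<in>{1..<N}. if p i = q i then 1 else 0) = (0::complex)" by (intro prod_zero) auto
      then show ?thesis using False by simp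
    qed simp
    finally show ?thesis .
  qed
  have "of_real (\<integral>y. (cmod (sl id (y(0 := t)) (upspin N)))\<^sup>2 \<partial>?R) = (\<integral>y. (1 / fact N) * (\<Sum>p\<in>perms N. \<Sum>q\<in>perms N. ?h p q * ?F p q y) \<partial>?R)"
    unfolding integral_complex_of_real[symmetric] pt ..
  also have "\<dots> = (1 / fact N) * (\<Sum>p\<in>perms N. \<Sum>q\<in>perms N. ?h p q * (\<integral>y. ?F p q y \<partial>?R))"
    unfolding integral_mult_right_zero
    by (subst Bochner_Integration.integral_sum, rule Bochner_Integration.integrable_sum, rule integrable_mult_right, rule ii,
        subst Bochner_Integration.integral_sum, rule integrable_mult_right, rule ii) (simp only: integral_mult_right_zero)
  also have "\<dots> = (1 / fact N) * (\<Sum>p\<in>perms N. \<Sum>q\<in>perms N. if p = q then ?h p q else 0)"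
  proof (intro arg_cong2[where f="(*)"] sum.cong refl)
    fix p q assume "p \<in> perms N" "q \<in> perms N"
    show "?h p q * (\<integral>y. ?F p q y \<partial>?R) = (if p = q then ?h p q else 0)"
      unfolding iF[OF \<open>p \<in> perms N\<close> \<open>q \<in> perms N\<close>] by (cases "p = q") (simp_all only: if_True if_False mult_1_right mult_zero_right simp_thms)
  qed
  also have "\<dots> = (1 / fact N) * (\<Sum>p\<in>perms N. of_real (P / real N))"
  proof (intro arg_cong2[where f="(*)"] sum.cong refl)
    fix p assume "p \<in> perms N"
    then have "(\<Sum>q\<in>perms N. if p = q then ?h p q else 0) = ?h p p" by (simp add: finite_perms)
    also have "\<dots> = of_real ((cmod (\<phi> (p 0) t))\<^sup>2)"
      unfolding complex_norm_square by (simp add: of_int_mult[symmetric] mult.commute del: of_int_mult)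
    finally show "(\<Sum>q\<in>perms N. if p = q then ?h p q else 0) = of_real (P / real N)" unfolding mod .
  qed
  also have "\<dots> = of_real (P / real N)" by (simp add: card_perms)
  finally have "(\<integral>y. (cmod (sl id (y(0 := t)) (upspin N)))\<^sup>2 \<partial>?R) = P / real N" by (simp only: of_real_eq_iff)
  then show ?thesis
    unfolding dens_def using N by (subst sum_spins_upspin) (auto simp: sl_def slater_def)
qed

lemma norm_sign: "norm (of_int (sign p) :: complex) = 1"
  by (simp add: sign_def)

lemma norm_sum_sq_le: "finite A \<Longrightarrow> (norm (\<Sum>p\<in>A. v p :: complex))\<^sup>2 \<le> real (card A) * (\<Sum>p\<in>A. (norm (v p))\<^sup>2)"
proof -
  assume A: "finite A"
  have "(norm (\<Sum>p\<in>A. v p))\<^sup>2 \<le> (\<Sum>p\<in>A. norm (v p))\<^sup>2" by (intro power_mono norm_sum) auto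
  also have "\<dots> \<le> (\<Sum>p\<in>A. (norm (v p))\<^sup>2) * real (card A)"
    using sum_squared_le_sum_of_squares[of "\<lambda>p. norm (v p)" A] by simp
  finally show ?thesis by (simp add: mult.commute)
qed

text \<open>Cauchy-Schwarz over the permutations is wasteful by a factor N!, but only a bound
  independent of the potential is wanted, and this way no orthogonality of the differentiated
  orbitals is involved.\<close>

lemma Tkin_sl:
  assumes K: "\<And>k. k < N \<Longrightarrow> l2 L01 (\<phi>' k) \<le> K"
  shows "Tkin N (sl id) \<le> real N * fact N * K"
proof -
  have l1: "l2 L01 (\<phi> k) = 1" for k
  proof -
    have "of_real (l2 L01 (\<phi> k)) = (\<integral>t. cnj (\<phi> k t) * \<phi> k t \<partial>L01)"
      unfolding l2_def integral_complex_of_real[symmetric] complex_norm_square by (simp add: mult.commute)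
    then show ?thesis by (simp add: orth)
  qed
  have b: "nrm2 N (grad N j (sl id)) \<le> fact N * K" if j: "j < N" for j
  proof -
    have "nrm2 N (grad N j (sl id)) = nrm2 N (dsl id j)"
      unfolding nrm2_eq
      by (intro sum.cong refl l2_cong_AE grad_AE[OF fdom_sl j L2wf_dsl wderiv_sl[OF j]])
        (auto intro!: sqint_measurable grad_sqint[OF fdom_sl j] L2wfD[OF L2wf_dsl])
    also have "\<dots> = l2 (cubeM N) (\<lambda>x. dsl id j x (upspin N))"
      unfolding nrm2_eq by (rule sum_spins_upspin) (simp add: dsl_def l2_def)
    also have "\<dots> \<le> (\<Sum>p\<in>perms N. l2 (cubeM N) (\<lambda>x. \<Prod>i<N. ((\<lambda>i. \<phi> (p i))(j := \<phi>' (p j))) i (x i)))"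
    proof -
      let ?v = "\<lambda>p x. \<Prod>i<N. ((\<lambda>i. \<phi> (p i))(j := \<phi>' (p j))) i (x i)"
      have sv: "sqint (cubeM N) (?v p)" for p using sqint_dprod[where \<kappa>=id and p=p and j=j] by simp
      have "l2 (cubeM N) (\<lambda>x. dsl id j x (upspin N)) \<le> (\<integral>x. (\<Sum>p\<in>perms N. (norm (?v p x))\<^sup>2) \<partial>cubeM N)"
        unfolding l2_def
      proof (rule integral_mono)
        show "integrable (cubeM N) (\<lambda>x. (cmod (dsl id j x (upspin N)))\<^sup>2)"
          by (rule sqint_integrable[OF L2wfD[OF L2wf_dsl upspin_spins]])
        show "integrable (cubeM N) (\<lambda>x. \<Sum>p\<in>perms N. (norm (?v p x))\<^sup>2)"
          using sv by (auto simp: sqint_def)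
        fix x
        have "(cmod (dsl id j x (upspin N)))\<^sup>2 = (1 / fact N) * (norm (\<Sum>p\<in>perms N. of_int (sign p) * ?v p x))\<^sup>2"
          by (simp add: dsl_def norm_mult norm_divide power_mult_distrib power_divide)
        also have "\<dots> \<le> (1 / fact N) * (real (card (perms N)) * (\<Sum>p\<in>perms N. (norm (of_int (sign p) * ?v p x))\<^sup>2))"
          by (intro mult_left_mono norm_sum_sq_le finite_perms) simp
        also have "\<dots> = (\<Sum>p\<in>perms N. (norm (?v p x))\<^sup>2)"
          by (simp only: card_perms norm_mult norm_sign mult_1) simp
        finally show "(cmod (dsl id j x (upspin N)))\<^sup>2 \<le> (\<Sum>p\<in>perms N. (norm (?v p x))\<^sup>2)" .
      qed
      also have "\<dots> = (\<Sum>p\<in>perms N. l2 (cubeM N) (?v p))"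
        unfolding l2_def by (rule Bochner_Integration.integral_sum) (rule sqint_integrable[OF sv])
      finally show ?thesis .
    qed
    also have "\<dots> \<le> (\<Sum>p\<in>perms N. K)"
    proof (rule sum_mono)
      fix p assume p: "p \<in> perms N"
      have "p j < N" using p j permutes_in_image by (metis lessThan_iff mem_Collect_eq)
      have "l2 (cubeM N) (\<lambda>x. \<Prod>i<N. ((\<lambda>i. \<phi> (p i))(j := \<phi>' (p j))) i (x i)) = (\<Prod>i<N. l2 L01 (((\<lambda>i. \<phi> (p i))(j := \<phi>' (p j))) i))"
        by (rule sqint_prod_continuous(2)) (auto intro: cont cont')
      also have "\<dots> = l2 L01 (\<phi>' (p j)) * (\<Prod>i\<in>{..<N}-{j}. l2 L01 (((\<lambda>i. \<phi> (p i))(j := \<phi>' (p j))) i))"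
        using j by (subst prod.remove[of _ j]) auto
      also have "(\<Prod>i\<in>{..<N}-{j}. l2 L01 (((\<lambda>i. \<phi> (p i))(j := \<phi>' (p j))) i)) = 1"
        by (rule prod.neutral) (simp add: l1)
      finally show "l2 (cubeM N) (\<lambda>x. \<Prod>i<N. ((\<lambda>i. \<phi> (p i))(j := \<phi>' (p j))) i (x i)) \<le> K"
        using K[OF \<open>p j < N\<close>] by simp
    qed
    also have "\<dots> = fact N * K" by (simp add: card_perms)
    finally show ?thesis .
  qed
  have K0: "0 \<le> K" using K[of 0] N l2_nonneg[of L01 "\<phi>' 0"] by linarith
  have "(\<Sum>j<N. nrm2 N (grad N j (sl id))) \<le> (\<Sum>j<N. fact N * K)" by (intro sum_mono b) simp
  then have "Tkin N (sl id) \<le> (1/2) * (real N * (fact N * K))" unfolding Tkin_def by simp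
  also have "\<dots> \<le> 1 * (real N * (fact N * K))" using K0 by (intro mult_right_mono) auto
  finally show ?thesis by (simp add: mult_ac)
qed

end

section \<open>Coercivity\<close>

lemma AE_nonneg_continuous_L01:
  fixes f :: "real \<Rightarrow> real"
  assumes c: "continuous_on {0..1} f" and ae: "AE t in L01. 0 \<le> f t" and t: "t \<in> {0..1}"
  shows "0 \<le> f t"
proof -
  have c': "continuous_on {0..1} (\<lambda>t. max 0 (- f t))" by (intro continuous_intros c)
  have "(\<integral>t. max 0 (- f t) \<partial>L01) = (\<integral>t. 0 \<partial>L01)"
    by (rule integral_cong_AE) (use ae continuous_measurable_L01[OF c'] in \<open>auto elim: eventually_mono\<close>)
  then have "(\<integral>t. max 0 (- f t) \<partial>L01) = 0" by simp
  then have "max 0 (- f t) = 0" using integralL_eq_0_iff[OF c'] t by simp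
  then show ?thesis by (simp add: max_def split: if_splits)
qed

lemma integral_abs_le_L01:
  assumes "L2T f" shows "(\<integral>t. \<bar>f t\<bar> \<partial>L01) \<le> sqrt (l2 L01 f)"
proof -
  have s: "sqint L01 (\<lambda>_. 1::real)" by (rule L01.sqint_bounded[of _ 1]) auto
  have "l2 L01 (\<lambda>_. 1::real) = 1" by (simp add: l2_def)
  then show ?thesis using cauchy_schwarz_norm[OF assms[unfolded L2T_iff] s] by simp
qed

lemma integral_deriv_ptest:
  assumes "ptest f" shows "(\<integral>t. deriv f t \<partial>L01) = 0"
  using integral_L01_FTC[of f "deriv f"] ptestD[OF assms] ptestD(1)[OF assms, of 0]
  by (simp add: has_real_derivative_iff_has_vector_derivative[symmetric])

lemma trigp_L2T: "trigp p \<Longrightarrow> L2T p"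
proof -
  assume p: "trigp p"
  obtain B where "\<forall>t. \<bar>p t\<bar> \<le> B" using trigp_bounded[OF p] by blast
  then show ?thesis unfolding L2T_iff using trigp_measurable_L01[OF p] by (intro L01.sqint_bounded[of _ B]) auto
qed

lemma trigp_proj: "finite A \<Longrightarrow> trigp (L01.proj A (v :: real \<Rightarrow> real))"
proof (induction A rule: finite_induct)
  case empty
  show ?case using trigp_const[of 0] by (simp add: L01.proj_def[abs_def])
next
  case (insert i A)
  have "trigp (\<lambda>t. L01.coef v i * cas i t + L01.proj A v t)"
    by (intro trigp.add trigp.scale trigp.cas insert.IH)
  then show ?case using insert.hyps by (simp add: L01.proj_def[abs_def] mult.commute)
qed

lemma integral_proj:
  fixes v :: "real \<Rightarrow> real"
  assumes "finite A" "(\<integral>t. v t \<partial>L01) = 0"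
  shows "(\<integral>t. L01.proj A v t \<partial>L01) = 0"
proof -
  have "(\<integral>t. L01.proj A v t \<partial>L01) = (\<Sum>i\<in>A. (\<integral>t. cas i t \<partial>L01) * L01.coef v i)"
    unfolding L01.proj_def by (subst Bochner_Integration.integral_sum) (auto intro!: integrable_cas)
  also have "\<dots> = 0" by (rule sum.neutral) (auto simp: integral_cas L01.coef_def assms(2))
  finally show ?thesis .
qed

lemma trigp_with_derivative:
  assumes r: "trigp r" "(\<integral>t. r t \<partial>L01) = 0"
  obtains P where "trigp P" "\<And>t. (P has_real_derivative r t) (at t)" "P 0 = P 1" "(\<integral>t. P t \<partial>L01) = c" "wderivT P r"
proof -
  obtain \<phi> where \<phi>: "trigp \<phi>" "\<And>t. \<phi> (t + 1) = \<phi> t" "\<And>t. (\<phi> has_real_derivative r t) (at t)"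
    using trigp_primitive[OF r(1)] unfolding r(2) diff_zero by blast
  define P where "P t = \<phi> t + (c - (\<integral>t. \<phi> t \<partial>L01))" for t
  have P: "trigp P" unfolding P_def[abs_def] by (intro trigp.add trigp_const \<phi>(1))
  have d: "(P has_real_derivative r t) (at t)" for t
    unfolding P_def using \<phi>(3) by (auto intro!: derivative_eq_intros)
  have per: "P 0 = P 1" using \<phi>(2)[of 0] by (simp add: P_def)
  have "integrable L01 \<phi>" by (intro continuous_imp_integrable_real trigp_continuous \<phi>(1))
  then have i: "(\<integral>t. P t \<partial>L01) = c" unfolding P_def by simp
  have "wderivT P r"
    unfolding wderivT_def
  proof (intro allI impI)
    fix \<phi> assume "ptest \<phi>"
    have "(\<integral>t. deriv \<phi> t *\<^sub>R P t \<partial>L01) = - (\<integral>t. \<phi> t *\<^sub>R r t \<partial>L01)"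
      by (rule integral_by_parts_L01[OF _ trigp_continuous[OF r(1)] per \<open>ptest \<phi>\<close>])
        (use d in \<open>simp add: has_real_derivative_iff_has_vector_derivative\<close>)
    then show "(\<integral>t. P t * deriv \<phi> t \<partial>L01) = - (\<integral>t. r t * \<phi> t \<partial>L01)" by (simp add: mult.commute)
  qed
  then show ?thesis using that P d per i by blast
qed

section \<open>Harriman orbitals and trial states of prescribed density\<close>

definition horb :: "nat \<Rightarrow> (real \<Rightarrow> real) \<Rightarrow> (real \<Rightarrow> real) \<Rightarrow> nat \<Rightarrow> real \<Rightarrow> complex" where
  "horb N P \<theta> k t = of_real (sqrt (P t / real N)) * cis (2 * pi * real k * \<theta> t)"

text \<open>The derivative of \<open>horb\<close>: the first term differentiates the amplitude, the
  second the phase, where \<theta> has derivative P / N.\<close>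

definition horb' :: "nat \<Rightarrow> (real \<Rightarrow> real) \<Rightarrow> (real \<Rightarrow> real) \<Rightarrow> (real \<Rightarrow> real) \<Rightarrow> nat \<Rightarrow> real \<Rightarrow> complex" where
  "horb' N P r \<theta> k t = of_real (r t / (2 * real N * sqrt (P t / real N))) * cis (2 * pi * real k * \<theta> t) +
     of_real (sqrt (P t / real N) * (2 * pi * real k * (P t / real N))) * (\<i> * cis (2 * pi * real k * \<theta> t))"

lemma has_vector_derivative_cis:
  assumes "(f has_real_derivative f') (at t)"
  shows "((\<lambda>t. cis (f t)) has_vector_derivative of_real f' * (\<i> * cis (f t))) (at t)"
proof -
  have "((\<lambda>t. exp (\<i> * of_real (f t))) has_vector_derivative (\<i> * of_real f') * exp (\<i> * of_real (f t))) (at t)"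
    using field_vector_diff_chain_at[of "\<lambda>t. \<i> * of_real (f t)" "\<i> * of_real f'" t exp "exp (\<i> * of_real (f t))"]
      has_vector_derivative_mult_right[OF has_vector_derivative_of_real[OF assms], of \<i>]
      DERIV_exp[of "\<i> * of_real (f t)"]
    by (simp add: o_def)
  then show ?thesis by (simp add: cis_conv_exp mult_ac)
qed

text \<open>Harriman orbitals: the equidensity map \<theta> has derivative P / N, so that plane waves in \<theta> are orthogonal for the weight P / N.\<close>

locale harriman =
  fixes N :: nat and P r \<theta> :: "real \<Rightarrow> real"
  assumes N: "N \<ge> 1" and P: "trigp P" "\<And>t. (P has_real_derivative r t) (at t)" "P 0 = P 1"
    and pos: "\<And>t. t \<in> {0..1} \<Longrightarrow> 0 < P t" and r: "trigp r" and iP: "(\<integral>t. P t \<partial>L01) = real N"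
    and \<theta>: "\<And>t. (\<theta> has_real_derivative P t / real N) (at t)" "\<theta> 0 = 0" "\<theta> 1 = 1"
begin

lemma horb_deriv:
  assumes t: "t \<in> {0..1}"
  shows "(horb N P \<theta> k has_vector_derivative horb' N P r \<theta> k t) (at t)"
proof -
  have p: "0 < P t / real N" using pos[OF t] N by simp
  have "((\<lambda>t. sqrt (P t / real N)) has_real_derivative r t / (2 * real N * sqrt (P t / real N))) (at t)"
    using DERIV_chain2[OF DERIV_real_sqrt[OF p] DERIV_cdivide[OF P(2)]] by (simp add: field_simps)
  from has_vector_derivative_of_real[OF this]
  have 1: "((\<lambda>t. complex_of_real (sqrt (P t / real N))) has_vector_derivative of_real (r t / (2 * real N * sqrt (P t / real N)))) (at t)" .
  have "((\<lambda>t. 2 * pi * real k * \<theta> t) has_real_derivative 2 * pi * real k * (P t / real N)) (at t)"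
    using DERIV_cmult[OF \<theta>(1)[of t], of "2 * pi * real k"] .
  note 2 = has_vector_derivative_cis[OF this]
  show ?thesis
    unfolding horb_def[abs_def] horb'_def
    using has_vector_derivative_mult[OF 1 2] by (simp add: algebra_simps)
qed

lemma horb'_continuous: "continuous_on {0..1} (horb' N P r \<theta> k)"
proof -
  have c\<theta>: "continuous_on {0..1} \<theta>"
    using \<theta>(1) by (intro DERIV_continuous_on) (auto intro: DERIV_subset)
  have "sqrt (P t / real N) \<noteq> 0" if "t \<in> {0..1}" for t using pos[OF that] N by simp
  then show ?thesis
    unfolding horb'_def[abs_def] cis_conv_exp
    by (intro continuous_intros trigp_continuous[OF P(1)] trigp_continuous[OF r] c\<theta>) (use N in auto)
qed

lemma norm_horb: "t \<in> {0..1} \<Longrightarrow> (cmod (horb N P \<theta> k t))\<^sup>2 = P t / real N"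
  using pos[of t] by (simp add: horb_def norm_mult real_sqrt_pow2)

lemma horb_orth: "(\<integral>t. cnj (horb N P \<theta> k t) * horb N P \<theta> l t \<partial>L01) = (if k = l then 1 else 0)"
proof -
  define m where "m = real l - real k"
  have cP: "continuous_on {0..1} P" by (rule trigp_continuous[OF P(1)])
  have c\<theta>: "continuous_on {0..1} \<theta>"
    using \<theta>(1) by (intro DERIV_continuous_on) (auto intro: DERIV_subset)
  have "(\<integral>t. cnj (horb N P \<theta> k t) * horb N P \<theta> l t \<partial>L01) = (\<integral>t. of_real (P t / real N) * cis (2 * pi * m * \<theta> t) \<partial>L01)"
  proof (rule Bochner_Integration.integral_cong[OF refl])
    fix t assume "t \<in> space L01"
    then have t: "t \<in> {0..1}" by simp
    have a: "sqrt (P t / real N) * sqrt (P t / real N) = P t / real N" using pos[OF t] by simp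
    have b: "cis (- (2 * pi * real k * \<theta> t)) * cis (2 * pi * real l * \<theta> t) = cis (2 * pi * m * \<theta> t)"
      unfolding cis_mult m_def by (simp add: algebra_simps)
    have "cnj (horb N P \<theta> k t) * horb N P \<theta> l t = (of_real (sqrt (P t / real N)) * of_real (sqrt (P t / real N))) *
       (cis (- (2 * pi * real k * \<theta> t)) * cis (2 * pi * real l * \<theta> t))"
      unfolding horb_def complex_cnj_mult complex_cnj_complex_of_real cis_cnj by (simp only: mult_ac)
    then show "cnj (horb N P \<theta> k t) * horb N P \<theta> l t = of_real (P t / real N) * cis (2 * pi * m * \<theta> t)"
      unfolding b of_real_mult[symmetric] a .
  qed
  also have "\<dots> = (if k = l then 1 else 0)"
  proof (cases "k = l")
    case True
    then have "(\<integral>t. of_real (P t / real N) * cis (2 * pi * m * \<theta> t) \<partial>L01) = (\<integral>t. of_real (P t / real N) \<partial>L01)"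
      by (simp add: m_def)
    also have "\<dots> = of_real ((\<integral>t. P t \<partial>L01) / real N)" unfolding integral_complex_of_real by simp
    finally show ?thesis using True N iP by simp
  next
    case False
    then have m: "m \<noteq> 0" by (simp add: m_def)
    let ?F = "\<lambda>t. (1 / (2 * pi * \<i> * m)) * cis (2 * pi * m * \<theta> t)"
    have d: "(?F has_vector_derivative of_real (P t / real N) * cis (2 * pi * m * \<theta> t)) (at t)" for t
    proof -
      have "((\<lambda>t. 2 * pi * m * \<theta> t) has_real_derivative 2 * pi * m * (P t / real N)) (at t)"
        using DERIV_cmult[OF \<theta>(1)[of t], of "2 * pi * m"] .
      from has_vector_derivative_mult_right[OF has_vector_derivative_cis[OF this], of "1 / (2 * pi * \<i> * m)"]
      show ?thesis using m by (simp add: field_simps)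
    qed
    have "(\<integral>t. of_real (P t / real N) * cis (2 * pi * m * \<theta> t) \<partial>L01) = ?F 1 - ?F 0"
      by (rule integral_L01_FTC[OF d]) (unfold cis_conv_exp, intro continuous_intros cP c\<theta>, use N in auto)
    also have "\<dots> = 0"
    proof -
      have "m \<in> \<int>" by (simp add: m_def)
      then have "cis (2 * pi * m) = 1" by (rule cis_multiple_2pi)
      then show ?thesis by (simp add: \<theta>)
    qed
    finally show ?thesis using False by simp
  qed
  finally show ?thesis .
qed

sublocale orbitals N "horb N P \<theta>" "horb' N P r \<theta>"
proof
  show "horb N P \<theta> k 0 = horb N P \<theta> k 1" for k
    using cis_multiple_2pi[of "real k"] by (simp add: horb_def P(3) \<theta>)
qed (use N horb_deriv horb'_continuous horb_orth in auto)

text \<open>Twice the square of the amplitude term is r^2 / (2 N P), and twice the square of the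
  phase term is 8 pi^2 k^2 (P / N)^3; both constants arise from bounding P below and above. The
  lower bound on the density is essential in the first.\<close>

lemma l2_horb':
  assumes k: "k < N" and c0: "0 < c0" "\<And>t. t \<in> {0..1} \<Longrightarrow> c0 \<le> P t" and c1: "\<And>t. t \<in> {0..1} \<Longrightarrow> P t \<le> c1"
  shows "l2 L01 (horb' N P r \<theta> k) \<le> l2 L01 r / (2 * c0) + 8 * pi\<^sup>2 * (real N)\<^sup>2 * c1 ^ 3"
proof -
  let ?M = "8 * pi\<^sup>2 * (real N)\<^sup>2 * c1 ^ 3"
  have ri: "integrable L01 (\<lambda>t. (r t)\<^sup>2)" using trigp_L2T[OF r] by (simp add: L2T_def)
  have bd: "(norm (horb' N P r \<theta> k t))\<^sup>2 \<le> (r t)\<^sup>2 / (2 * c0) + ?M" if t: "t \<in> {0..1}" for t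
  proof -
    define s where "s = sqrt (P t / real N)"
    have Pt: "0 < P t" by (rule pos[OF t])
    have s2: "s\<^sup>2 = P t / real N" unfolding s_def using Pt by simp
    have sN: "P t / real N \<le> P t" using N Pt by (simp add: divide_le_eq)
    have "norm (horb' N P r \<theta> k t) \<le> \<bar>r t / (2 * real N * s)\<bar> + \<bar>s * (2 * pi * real k * (P t / real N))\<bar>"
      unfolding horb'_def s_def by (rule order_trans[OF norm_triangle_ineq]) (simp only: norm_mult norm_cis norm_of_real norm_ii mult_1_right mult_1 order_refl)
    then have "(norm (horb' N P r \<theta> k t))\<^sup>2 \<le> (\<bar>r t / (2 * real N * s)\<bar> + \<bar>s * (2 * pi * real k * (P t / real N))\<bar>)\<^sup>2"
      by (intro power_mono) auto
    also have "\<dots> \<le> 2 * (r t / (2 * real N * s))\<^sup>2 + 2 * (s * (2 * pi * real k * (P t / real N)))\<^sup>2"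
      using sum_squares_bound[of "\<bar>r t / (2 * real N * s)\<bar>" "\<bar>s * (2 * pi * real k * (P t / real N))\<bar>"]
      by (simp add: power2_sum del: abs_mult abs_divide)
    also have "2 * (r t / (2 * real N * s))\<^sup>2 = (r t)\<^sup>2 / (2 * real N * P t)"
      unfolding power_divide power_mult_distrib s2 using N by (simp add: power2_eq_square)
    also have "\<dots> \<le> (r t)\<^sup>2 / (2 * c0)"
    proof (rule divide_left_mono)
      have "1 * c0 \<le> real N * P t" by (intro mult_mono c0(2)[OF t]) (use N c0 in auto)
      then show "2 * c0 \<le> 2 * real N * P t" by simp
      show "0 < 2 * real N * P t * (2 * c0)" using N Pt c0 by simp
    qed simp
    also have "2 * (s * (2 * pi * real k * (P t / real N)))\<^sup>2 = 8 * pi\<^sup>2 * (real k)\<^sup>2 * (P t / real N) ^ 3"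
      unfolding power_mult_distrib s2 by (simp add: power2_eq_square power3_eq_cube mult_ac)
    also have "\<dots> \<le> ?M"
    proof (intro mult_mono order_refl power_mono)
      show "P t / real N \<le> c1" using sN c1[OF t] by linarith
    qed (use k Pt N in auto)
    finally show ?thesis by simp
  qed
  have "l2 L01 (horb' N P r \<theta> k) \<le> (\<integral>t. (r t)\<^sup>2 / (2 * c0) + ?M \<partial>L01)"
    unfolding l2_def
  proof (rule integral_mono)
    show "integrable L01 (\<lambda>t. (norm (horb' N P r \<theta> k t))\<^sup>2)"
      using continuous_sqint_L01[OF horb'_continuous] by (simp add: sqint_def)
  qed (use ri bd in auto)
  also have "\<dots> = l2 L01 r / (2 * c0) + ?M" using ri by (simp add: l2_def)
  finally show ?thesis .
qed

lemma dens_horb: "t \<in> {0..1} \<Longrightarrow> dens N (sl id) t = P t"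
  by (rule dens_sl) (rule norm_horb)

end

lemma harriman_exists:
  assumes "N \<ge> 1" "trigp r" "trigp P" "\<And>t. (P has_real_derivative r t) (at t)" "P 0 = P 1" "\<And>t. t \<in> {0..1} \<Longrightarrow> 0 < P t"
    "(\<integral>t. P t \<partial>L01) = real N"
  shows "\<exists>\<theta>. harriman N P r \<theta>"
proof -
  obtain \<psi> where \<psi>: "\<And>t. \<psi> (t + 1) = \<psi> t" "\<psi> 0 = 0" "\<And>t. (\<psi> has_real_derivative P t - real N) (at t)"
    using trigp_primitive[OF assms(3)] unfolding assms(7) by blast
  \<comment> \<open>The equidensity map is t plus a periodic correction with derivative P / N - 1;
    its vanishing at both ends gives \<theta> the values 0 and 1.\<close>
  have "harriman N P r (\<lambda>t. t + \<psi> t / real N)"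
  proof
    show "((\<lambda>t. t + \<psi> t / real N) has_real_derivative P t / real N) (at t)" for t
      using \<psi>(3)[of t] assms(1) by (auto intro!: derivative_eq_intros simp: field_simps)
    show "1 + \<psi> 1 / real N = 1" using \<psi>(1)[of 0] \<psi>(2) by simp
  qed (use assms \<psi>(2) in auto)
  then show ?thesis by blast
qed

text \<open>For constant density the Harriman construction gives determinants of normalised plane
  waves.\<close>

lemma Wset_large:
  assumes N: "N \<ge> 1" shows "Wset N \<noteq> {}" "\<exists>f. ons N {\<Psi>. fdom N \<Psi>} n f"
proof -
  have "\<exists>\<theta>. harriman N (\<lambda>_. real N) (\<lambda>_. 0) \<theta>"
    by (rule harriman_exists) (use N trigp_const in auto)
  then obtain \<theta> where "harriman N (\<lambda>_. real N) (\<lambda>_. 0) \<theta>" by blast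
  then interpret harriman N "\<lambda>_. real N" "\<lambda>_. 0" \<theta> .
  show "Wset N \<noteq> {}" using sl_Wset[of id] by auto
  show "\<exists>f. ons N {\<Psi>. fdom N \<Psi>} n f" by (rule ons_sl)
qed

text \<open>The kinetic bound depends on the density only through its extreme values and the norm of
  its derivative, which makes it uniform over the perturbed densities used for coercivity.\<close>

lemma trial_state:
  assumes "N \<ge> 1" "trigp r" "trigp P" "\<And>t. (P has_real_derivative r t) (at t)" "P 0 = P 1" "(\<integral>t. P t \<partial>L01) = real N"
    and w: "wderivT P r" and c0: "0 < c0" "\<And>t. t \<in> {0..1} \<Longrightarrow> c0 \<le> P t" and c1: "\<And>t. t \<in> {0..1} \<Longrightarrow> P t \<le> c1"
  shows "\<exists>\<Psi>\<in>Wset N. (AE t in L01. Jd N \<Psi> t = r t) \<and>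
    Tkin N \<Psi> \<le> real N * fact N * (l2 L01 r / (2 * c0) + 8 * pi\<^sup>2 * (real N)\<^sup>2 * c1 ^ 3)"
proof -
  have pos: "0 < P t" if "t \<in> {0..1}" for t using c0(1) c0(2)[OF that] by linarith
  obtain \<theta> where "harriman N P r \<theta>" using harriman_exists[OF assms(1-5) pos assms(6)] by blast
  then interpret harriman N P r \<theta> .
  have "wderivT (dens N (sl id)) r"
    unfolding wderivT_def
  proof (intro allI impI)
    fix \<phi> assume p: "ptest \<phi>"
    have "(\<integral>t. dens N (sl id) t * deriv \<phi> t \<partial>L01) = (\<integral>t. P t * deriv \<phi> t \<partial>L01)"
      by (rule Bochner_Integration.integral_cong) (auto simp: dens_horb)
    then show "(\<integral>t. dens N (sl id) t * deriv \<phi> t \<partial>L01) = - (\<integral>t. r t * \<phi> t \<partial>L01)"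
      using w p by (simp add: wderivT_def)
  qed
  from gradT_AE(3)[OF trigp_L2T[OF assms(2)] this] have "AE t in L01. Jd N (sl id) t = r t" by (simp add: Jd_def)
  moreover have "Tkin N (sl id) \<le> real N * fact N * (l2 L01 r / (2 * c0) + 8 * pi\<^sup>2 * (real N)\<^sup>2 * c1 ^ 3)"
    by (rule Tkin_sl) (rule l2_horb'[OF _ c0 c1])
  ultimately show ?thesis using sl_Wset[of id] by auto
qed

context qsys
begin

text \<open>The target derivative r is pushed by a vector of length e along g and then smoothed with
  error at most e/2. The pairing with g gains e times its norm and loses at most half of that, while
  the kinetic energy of the trial state stays below a bound independent of g.\<close>

lemma coercive:
  assumes \<rho>: "integrable L01 \<rho>" "wderivT \<rho> r" "L2T r" "(\<integral>t. \<rho> t \<partial>L01) = real N"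
    and e: "e > 0" "AE t in L01. 3 * e \<le> \<rho> t"
  shows "\<exists>C. \<forall>g. L2T g \<longrightarrow> (\<integral>t. g t \<partial>L01) = 0 \<longrightarrow>
    (\<exists>\<Psi>\<in>Wset N. q g \<Psi> + (\<integral>t. g t * r t \<partial>L01) \<le> C - e / 2 * sqrt (l2 L01 g))"
proof -
  obtain b where b: "\<And>\<Psi>. fdom N \<Psi> \<Longrightarrow> Re (W \<Psi> \<Psi>) \<le> Tkin N \<Psi> + b * nrm2 N \<Psi>" using W_bound by blast
  \<comment> \<open>A bound for the norm of the smoothed derivative: r itself, plus the push e and
    the smoothing error e/2.\<close>
  define R where "R = sqrt (l2 L01 r) + 3 * e / 2"
  define T where "T = real N * fact N * (R\<^sup>2 / (2 * (3 * e / 2)) + 8 * pi\<^sup>2 * (real N)\<^sup>2 * (real N + R) ^ 3)"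
  have rm: "(\<integral>t. r t \<partial>L01) = 0" by (rule integral_wderivT_0[OF \<rho>(2)])
  have "\<exists>\<Psi>\<in>Wset N. q g \<Psi> + (\<integral>t. g t * r t \<partial>L01) \<le> (2 * T + b) - e / 2 * sqrt (l2 L01 g)"
    if g: "L2T g" "(\<integral>t. g t \<partial>L01) = 0" for g
  proof -
    \<comment> \<open>For g of norm zero the quotient is 0 by convention; the asserted gain then
      vanishes as well.\<close>
    define a where "a = e / sqrt (l2 L01 g)"
    define v where "v t = 1 * r t + a * g t" for t
    have v: "L2T v" unfolding v_def[abs_def] by (rule L2T_lin[OF \<rho>(3) g(1)])
    have ir: "integrable L01 r" "integrable L01 g"
      using \<rho>(3) g(1) by (auto simp: L2T_iff intro: sqint_L01_integrable)
    have vm: "(\<integral>t. v t \<partial>L01) = 0" unfolding v_def using ir by (simp add: rm g(2))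
    have "\<forall>\<^sub>F K in sequentially. l2 L01 (\<lambda>t. v t - L01.proj {- int K..int K} v t) < (e/2)\<^sup>2"
      by (rule order_tendstoD(2)[OF L01.parseval(1)]) (use v e(1) in \<open>auto simp: L2T_iff\<close>)
    then obtain K where K: "l2 L01 (\<lambda>t. v t - L01.proj {- int K..int K} v t) < (e/2)\<^sup>2"
      unfolding eventually_sequentially by blast
    define r0 where "r0 = L01.proj {- int K..int K} v"
    have r0: "trigp r0" "(\<integral>t. r0 t \<partial>L01) = 0"
      unfolding r0_def by (auto intro: trigp_proj integral_proj vm)
    have r0L: "L2T r0" by (rule trigp_L2T[OF r0(1)])
    have vr0: "sqrt (l2 L01 (\<lambda>t. r0 t - v t)) \<le> e / 2"
      unfolding l2_minus_commute[of L01 r0]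
      by (rule real_le_lsqrt) (use K e(1) in \<open>auto simp: r0_def\<close>)
    have ag: "sqrt (l2 L01 (\<lambda>t. a * g t)) \<le> e"
    proof -
      have "sqrt (l2 L01 (\<lambda>t. a * g t)) = \<bar>a\<bar> * sqrt (l2 L01 g)"
        by (simp add: l2_mult_left real_sqrt_mult)
      also have "\<dots> \<le> e" using e(1) by (cases "l2 L01 g = 0") (auto simp: a_def)
      finally show ?thesis .
    qed
    have d: "sqrt (l2 L01 (\<lambda>t. r0 t - r t)) \<le> 3 * e / 2"
    proof -
      have "(\<lambda>t. r0 t - r t) = (\<lambda>t. (r0 t - v t) + a * g t)" by (simp add: v_def fun_eq_iff)
      moreover have "sqint L01 (\<lambda>t. r0 t - v t)" "sqint L01 (\<lambda>t. a * g t)"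
        using L2T_diff[OF r0L v] g(1) by (auto simp: L2T_iff intro: sqint_mult_left)
      ultimately show ?thesis using l2_triangle[of L01 "\<lambda>t. r0 t - v t" "\<lambda>t. a * g t"] vr0 ag by simp
    qed
    have r0R: "sqrt (l2 L01 r0) \<le> R"
      using l2_triangle[of L01 r "\<lambda>t. r0 t - r t"] L2T_diff[OF r0L \<rho>(3)] \<rho>(3) d by (simp add: L2T_iff R_def)
    obtain P where P: "trigp P" "\<And>t. (P has_real_derivative r0 t) (at t)" "P 0 = P 1" "(\<integral>t. P t \<partial>L01) = real N" "wderivT P r0"
      using trigp_with_derivative[OF r0, of "real N"] by blast
    have iP: "integrable L01 P" "integrable L01 r0"
      using trigp_L2T[OF P(1)] r0L by (auto simp: L2T_iff intro: sqint_L01_integrable)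
    have ae1: "AE t in L01. \<bar>P t - \<rho> t\<bar> \<le> (\<integral>t. \<bar>r0 t - r t\<bar> \<partial>L01)"
    proof (rule wderivT_abs_le)
      show "wderivT (\<lambda>t. P t - \<rho> t) (\<lambda>t. r0 t - r t)"
        using wderivT_linear[OF iP(1) \<rho>(1) iP(2) ir(1) P(5) \<rho>(2), of 1 "-1"] by simp
    qed (use iP ir \<rho> P(4) in auto)
    \<comment> \<open>The derivatives differ by at most 3e/2 in L2, hence in L1, and with equal
      masses the densities differ by no more almost everywhere; so at least 3e - 3e/2 of the lower
      bound survives.\<close>
    have b1: "(\<integral>t. \<bar>r0 t - r t\<bar> \<partial>L01) \<le> 3 * e / 2"
      using integral_abs_le_L01[OF L2T_diff[OF r0L \<rho>(3)]] d by linarith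
    have "AE t in L01. 0 \<le> P t - 3 * e / 2"
      using ae1 e(2) by eventually_elim (use b1 in linarith)
    \<comment> \<open>Bounds known almost everywhere hold everywhere because P is continuous; the
      orbitals need positivity at every point.\<close>
    then have lo: "3 * e / 2 \<le> P t" if "t \<in> {0..1}" for t
      using AE_nonneg_continuous_L01[of "\<lambda>t. P t - 3 * e / 2" t] that by (simp add: continuous_intros trigp_continuous[OF P(1)])
    have ae2: "AE t in L01. \<bar>P t - real N\<bar> \<le> (\<integral>t. \<bar>r0 t\<bar> \<partial>L01)"
    proof (rule wderivT_abs_le)
      have "wderivT (\<lambda>_. 1) (\<lambda>_. 0)"
        unfolding wderivT_def by (simp add: integral_deriv_ptest)
      from wderivT_linear[OF iP(1) _ iP(2) _ P(5) this, of 1 "- real N"]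
      show "wderivT (\<lambda>t. P t - real N) r0" by simp
    qed (use iP P(4) in auto)
    have b2: "(\<integral>t. \<bar>r0 t\<bar> \<partial>L01) \<le> R" using integral_abs_le_L01[OF r0L] r0R by linarith
    have "AE t in L01. 0 \<le> real N + R - P t" using ae2 by eventually_elim (use b2 in linarith)
    then have hi: "P t \<le> real N + R" if "t \<in> {0..1}" for t
      using AE_nonneg_continuous_L01[of "\<lambda>t. real N + R - P t" t] that by (simp add: continuous_intros trigp_continuous[OF P(1)])
    obtain \<Psi> where \<Psi>: "\<Psi> \<in> Wset N" "AE t in L01. Jd N \<Psi> t = r0 t"
      "Tkin N \<Psi> \<le> real N * fact N * (l2 L01 r0 / (2 * (3 * e / 2)) + 8 * pi\<^sup>2 * (real N)\<^sup>2 * (real N + R) ^ 3)"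
      using trial_state[OF N r0(1) P, of "3 * e / 2" "real N + R"] lo hi e(1) by auto
    have "l2 L01 r0 \<le> R\<^sup>2" using r0R by (rule sqrt_le_D)
    then have "Tkin N \<Psi> \<le> T"
      unfolding T_def using e(1) by (intro order_trans[OF \<Psi>(3)] mult_left_mono add_right_mono divide_right_mono) auto
    moreover have "Re (W \<Psi> \<Psi>) \<le> Tkin N \<Psi> + b" using b[of \<Psi>] WsetD[OF \<Psi>(1)] by simp
    moreover have "q g \<Psi> = Tkin N \<Psi> + Re (W \<Psi> \<Psi>) - (\<integral>t. g t * r0 t \<partial>L01)"
    proof -
      have "(\<integral>t. g t * Jd N \<Psi> t \<partial>L01) = (\<integral>t. g t * r0 t \<partial>L01)"
        using \<Psi>(2) g(1) r0L dens_props(3)[OF N WsetD(1)[OF \<Psi>(1)]]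
        by (intro integral_cong_AE) (auto simp: L2T_def)
      then show ?thesis by (simp add: q_eq[OF g(1) WsetD(1)[OF \<Psi>(1)]])
    qed
    moreover have "(\<integral>t. g t * r0 t \<partial>L01) - (\<integral>t. g t * r t \<partial>L01) \<ge> e / 2 * sqrt (l2 L01 g)"
    proof -
      have "(\<integral>t. g t * r0 t \<partial>L01) - (\<integral>t. g t * r t \<partial>L01) = (\<integral>t. g t * (r0 t - v t) \<partial>L01) + ((\<integral>t. g t * v t \<partial>L01) - (\<integral>t. g t * r t \<partial>L01))"
        by (simp add: L2T_int_diff[OF r0L v g(1)])
      also have "(\<integral>t. g t * v t \<partial>L01) - (\<integral>t. g t * r t \<partial>L01) = a * l2 L01 g"
        using L2T_int_lin[OF \<rho>(3) g(1) g(1), of 1 a] by (simp add: v_def mult.commute l2_def power2_eq_square)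
      also have "a * l2 L01 g = e * sqrt (l2 L01 g)"
      proof -
        have "l2 L01 g = sqrt (l2 L01 g) * sqrt (l2 L01 g)" by simp
        then show ?thesis unfolding a_def by (cases "l2 L01 g = 0") (auto simp: field_simps)
      qed
      finally have eq: "(\<integral>t. g t * r0 t \<partial>L01) - (\<integral>t. g t * r t \<partial>L01) = (\<integral>t. g t * (r0 t - v t) \<partial>L01) + e * sqrt (l2 L01 g)" .
      have "\<bar>\<integral>t. g t * (r0 t - v t) \<partial>L01\<bar> \<le> sqrt (l2 L01 g) * sqrt (l2 L01 (\<lambda>t. r0 t - v t))"
        using norm_integral_mult_sqint[of L01 g "\<lambda>t. r0 t - v t"] g(1) L2T_diff[OF r0L v] by (simp add: L2T_iff)
      also have "\<dots> \<le> sqrt (l2 L01 g) * (e / 2)" by (intro mult_left_mono vr0) simp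
      finally show ?thesis unfolding eq by (simp add: mult.commute)
    qed
    ultimately have "q g \<Psi> + (\<integral>t. g t * r t \<partial>L01) \<le> (2 * T + b) - e / 2 * sqrt (l2 L01 g)" by linarith
    then show ?thesis using \<Psi>(1) by blast
  qed
  then show ?thesis by blast
qed

end

theorem theorem1:
  fixes N :: nat and W :: "wf \<Rightarrow> wf \<Rightarrow> complex" and \<rho> :: "real \<Rightarrow> real"
  assumes "N \<ge> 1"
    and "interaction N W"
    and "H1T \<rho>"
    and "(\<integral>t. \<rho> t \<partial>lebesgue_on {0..1}) = real N"
    and "\<exists>r. continuous_on {0..1} r \<and> (AE t in lebesgue_on {0..1}. r t = \<rho> t) \<and>
              (\<forall>t\<in>{0..1}. r t > 0)"
  shows "\<exists>f g. L2T f \<and> L2T g \<and> gs_density N W f g \<rho>"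
proof -
  interpret qsys N W by unfold_locales (use assms(1,2) Wset_large in auto)
  obtain r where dr: "L2T r" "wderivT \<rho> r" using assms(3) by (auto simp: H1T_def)
  have \<rho>: "integrable L01 \<rho>" using assms(3) by (auto simp: H1T_def L2T_iff intro: sqint_L01_integrable)
  obtain R where R: "continuous_on {0..1} R" "AE t in L01. R t = \<rho> t" "\<And>t. t \<in> {0..1} \<Longrightarrow> R t > 0"
    using assms(5) by blast
  obtain t0 where t0: "t0 \<in> {0..1}" "\<And>t. t \<in> {0..1} \<Longrightarrow> R t0 \<le> R t"
    using continuous_attains_inf[OF _ _ R(1)] by auto
  \<comment> \<open>The continuous representative attains a positive minimum on the compact
    interval, and \<open>coercive\<close> expects a lower bound of the form 3e.\<close>
  define e where "e = R t0 / 3"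
  have e: "e > 0" using R(3)[OF t0(1)] by (simp add: e_def)
  have "AE t in L01. 3 * e \<le> \<rho> t"
    using R(2) AE_space[of L01]
  proof eventually_elim
    case (elim t)
    then show ?case using t0(2)[of t] by (simp add: e_def)
  qed
  from coercive[OF \<rho> dr(2,1) assms(4) e this] obtain C where
    C: "\<And>g. L2T g \<Longrightarrow> (\<integral>t. g t \<partial>L01) = 0 \<Longrightarrow> \<exists>\<Psi>\<in>Wset N. q g \<Psi> + (\<integral>t. g t * r t \<partial>L01) \<le> C - e / 2 * sqrt (l2 L01 g)"
    by blast
  interpret qrep N W r "e / 2" C
    by unfold_locales (use dr(1) integral_wderivT_0[OF dr(2)] e C in auto)
  have "L2T (\<lambda>_. 0)" by (simp add: L2T_def)
  then show ?thesis
    using gs_density_of_inf[OF Wset_large(2)[OF assms(1)] \<rho> dr(2) assms(4)] by blast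
qed

end
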